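(* Let $\mathcal{O}$ be a discrete valuation ring, let $A$ be a commutative noetherian local ring, and let $\lambda\colon A\to\mathcal{O}$ be a surjective ring map with kernel $\mathfrak{p}_A$ such that $\Phi_A=\mathfrak{p}_A/\mathfrak{p}_A^2$ has finite length as an $\mathcal{O}$-module. Suppose that the ring $A$ is Gorenstein and that $M$ is a finitely generated $A$-module with $\operatorname{depth}_AM\ge 1$. If \[ \delta_A(M)=(\operatorname{rank}_{\mathcal{O}}M[\mathfrak{p}_A])\cdot\delta_A(A) \] and $M$ has rank at most $\operatorname{rank}_{\mathcal{O}}M[\mathfrak{p}_A]$ at each generic point of $A$, then $M$ is a free $A$-module.
   Context: For an ideal $\mathfrak{a}\subseteq A$ and an $A$-module $M$, $M[\mathfrak{a}]=\{m\in M\mid \mathfrak{a}\cdot m=0\}$, and $I_A=A[\mathfrak{p}_A]$. For a finitely generated $A$-module $M$, the congruence module is $\Psi_A(M)=M/(M[\mathfrak{p}_A]+M[I_A])$; it is an $\mathcal{O}=A/\mathfrak{p}_A$-module, of finite length because $\Phi_A$ has finite length. Likewise $M[\mathfrak{p}_A]$ is an $\mathcal{O}$-module. The Wiles defect of $M$ is the integer \[ \delta_A(M)=(\operatorname{rank}_{\mathcal{O}}M[\mathfrak{p}_A])\cdot\operatorname{length}_{\mathcal{O}}\Phi_A-\operatorname{length}_{\mathcal{O}}\Psi_A(M). \] The zero module has depth $\infty$. The generic points of $A$ are its minimal primes; the rank of $M$ at a prime $\mathfrak{q}$ is $\dim_{\kappa(\mathfrak{q})}(M\otimes_A\kappa(\mathfrak{q}))$,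 where $\kappa(\mathfrak{q})$ is the residue field of $A_{\mathfrak{q}}$. *)

theory Defs
  imports
    "HOL-Algebra.Ring_Divisibility"
    "HOL-Algebra.Ideal_Product"
    "HOL-Library.Extended_Nat"
    "Jordan_Normal_Form.Missing_VectorSpace"
begin

section \<open>Rings\<close>

definition local_ring :: "('a, 'k) ring_scheme \<Rightarrow> bool" where
  "local_ring R \<longleftrightarrow> cring R \<and> (\<exists>!\<mm>. maximalideal \<mm> R)"

definition max_ideal :: "('a, 'k) ring_scheme \<Rightarrow> 'a set" where
  "max_ideal R = (THE \<mm>. maximalideal \<mm> R)"

definition residue_field :: "('a, 'k) ring_scheme \<Rightarrow> 'a set ring" where
  "residue_field R = R Quot (max_ideal R)"

definition discrete_valuation_ring :: "('a, 'k) ring_scheme \<Rightarrow> bool" where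
  "discrete_valuation_ring R \<longleftrightarrow> principal_domain R \<and> local_ring R \<and> \<not> field R"

definition minimal_prime :: "('a, 'k) ring_scheme \<Rightarrow> 'a set \<Rightarrow> bool" where
  "minimal_prime R \<qq> \<longleftrightarrow>
     primeideal \<qq> R \<and> (\<forall>\<pp>. primeideal \<pp> R \<and> \<pp> \<subseteq> \<qq> \<longrightarrow> \<pp> = \<qq>)"

text \<open>The fraction \<open>a / s\<close> as an equivalence class of pairs.\<close>

definition loc_frac :: "('a, 'k) ring_scheme \<Rightarrow> 'a set \<Rightarrow> 'a \<Rightarrow> 'a \<Rightarrow> ('a \<times> 'a) set" where
  "loc_frac R \<qq> a s =
     {(b, t). b \<in> carrier R \<and> t \<in> carrier R - \<qq> \<and>
        (\<exists>u \<in> carrier R - \<qq>. u \<otimes>\<^bsub>R\<^esub> (t \<otimes>\<^bsub>R\<^esub> a) = u \<otimes>\<^bsub>R\<^esub> (s \<otimes>\<^bsub>R\<^esub> b))}"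

text \<open>
  The localization \<open>R\<^sub>\<qq>\<close> at a prime \<open>\<qq>\<close>. In \<^term>\<open>mult\<close> and \<^term>\<open>add\<close> the unions run over all
  representatives; all the classes in them agree.
\<close>

definition localization_at :: "('a, 'k) ring_scheme \<Rightarrow> 'a set \<Rightarrow> ('a \<times> 'a) set ring" where
  "localization_at R \<qq> =
     \<lparr>carrier = {loc_frac R \<qq> a s | a s. a \<in> carrier R \<and> s \<in> carrier R - \<qq>},
      mult = (\<lambda>X Y. \<Union>{loc_frac R \<qq> (a \<otimes>\<^bsub>R\<^esub> b) (s \<otimes>\<^bsub>R\<^esub> t)
                       | a s b t. (a, s) \<in> X \<and> (b, t) \<in> Y}),
      one = loc_frac R \<qq> \<one>\<^bsub>R\<^esub> \<one>\<^bsub>R\<^esub>,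
      zero = loc_frac R \<qq> \<zero>\<^bsub>R\<^esub> \<one>\<^bsub>R\<^esub>,
      add = (\<lambda>X Y. \<Union>{loc_frac R \<qq> (a \<otimes>\<^bsub>R\<^esub> t \<oplus>\<^bsub>R\<^esub> b \<otimes>\<^bsub>R\<^esub> s) (s \<otimes>\<^bsub>R\<^esub> t)
                       | a s b t. (a, s) \<in> X \<and> (b, t) \<in> Y})\<rparr>"

definition kappa :: "('a, 'k) ring_scheme \<Rightarrow> 'a set \<Rightarrow> ('a \<times> 'a) set set ring" where
  "kappa R \<qq> = residue_field (localization_at R \<qq>)"

definition to_kappa :: "('a, 'k) ring_scheme \<Rightarrow> 'a set \<Rightarrow> 'a \<Rightarrow> ('a \<times> 'a) set set" where
  "to_kappa R \<qq> a =
     max_ideal (localization_at R \<qq>) +>\<^bsub>localization_at R \<qq>\<^esub> loc_frac R \<qq> a \<one>\<^bsub>R\<^esub>"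

section \<open>Modules\<close>

text \<open>
  The record type of modules extends that of rings; its fields \<^term>\<open>mult\<close> and \<^term>\<open>one\<close> play
  no role for modules and are left \<^term>\<open>undefined\<close> below.
\<close>

definition self_module :: "('a, 'k) ring_scheme \<Rightarrow> ('a, 'a) module" where
  "self_module R =
     \<lparr>carrier = carrier R, mult = undefined, one = undefined, zero = \<zero>\<^bsub>R\<^esub>, add = add R,
      smult = mult R\<rparr>"

definition quot_module :: "('a, 'm, 'k) module_scheme \<Rightarrow> 'm set \<Rightarrow> ('a, 'm set) module" where
  "quot_module M N =
     \<lparr>carrier = a_rcosets\<^bsub>M\<^esub> N, mult = undefined, one = undefined, zero = N, add = set_add M,
      smult = (\<lambda>a X. \<Union>x \<in> X. N +>\<^bsub>M\<^esub> (a \<odot>\<^bsub>M\<^esub> x))\<rparr>"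

definition fin_gen_module :: "('a, 'k) ring_scheme \<Rightarrow> ('a, 'm, 'l) module_scheme \<Rightarrow> bool" where
  "fin_gen_module R M \<longleftrightarrow>
     (\<exists>S. finite S \<and> S \<subseteq> carrier M \<and> module.span R M S = carrier M)"

definition free_module :: "('a, 'k) ring_scheme \<Rightarrow> ('a, 'm, 'l) module_scheme \<Rightarrow> bool" where
  "free_module R M \<longleftrightarrow>
     (\<exists>B \<subseteq> carrier M. \<not> module.lin_dep R M B \<and> module.span R M B = carrier M)"

text \<open>The length as the supremum of the lengths of strict chains of submodules.\<close>

definition module_length :: "('a, 'k) ring_scheme \<Rightarrow> ('a, 'm, 'l) module_scheme \<Rightarrow> enat" where
  "module_length R M =
     Sup {enat n | n. \<exists>N. (\<forall>i \<le> n. submodule R (N i) M) \<and> (\<forall>i < n. N i \<subset> N (Suc i))}"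

subsection \<open>Rank at a prime\<close>

text \<open>The free module on a set \<open>X\<close>: finitely supported functions.\<close>

definition free_on :: "('s, 'k) ring_scheme \<Rightarrow> 'x set \<Rightarrow> ('s, 'x \<Rightarrow> 's) module" where
  "free_on S X =
     \<lparr>carrier = {f. (\<forall>x. f x \<in> carrier S) \<and> (\<forall>x. x \<notin> X \<longrightarrow> f x = \<zero>\<^bsub>S\<^esub>) \<and> finite {x. f x \<noteq> \<zero>\<^bsub>S\<^esub>}},
      mult = undefined, one = undefined,
      zero = (\<lambda>_. \<zero>\<^bsub>S\<^esub>),
      add = (\<lambda>f g x. f x \<oplus>\<^bsub>S\<^esub> g x),
      smult = (\<lambda>c f x. c \<otimes>\<^bsub>S\<^esub> f x)\<rparr>"

definition free_gen :: "('s, 'k) ring_scheme \<Rightarrow> 'x \<Rightarrow> 'x \<Rightarrow> 's" where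
  "free_gen S x = (\<lambda>y. if y = x then \<one>\<^bsub>S\<^esub> else \<zero>\<^bsub>S\<^esub>)"

text \<open>
  The extension of scalars \<open>M \<otimes>\<^sub>R S\<close> along a ring homomorphism \<open>\<phi> : R \<rightarrow> S\<close>, as an \<open>S\<close>-module: the
  \<open>S\<close>-module generated by symbols \<open>x \<otimes> 1\<close> (\<open>x \<in> M\<close>) subject to additivity and
  \<open>(a x) \<otimes> 1 = \<phi>(a) (x \<otimes> 1)\<close>.
\<close>

definition tensor_relations ::
  "('a, 'k) ring_scheme \<Rightarrow> ('s, 'l) ring_scheme \<Rightarrow> ('a \<Rightarrow> 's) \<Rightarrow> ('a, 'm, 'n) module_scheme \<Rightarrow>
   ('m \<Rightarrow> 's) set" where
  "tensor_relations R S \<phi> M =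
     (let F = free_on S (carrier M); e = free_gen S in
        {e (x \<oplus>\<^bsub>M\<^esub> y) \<ominus>\<^bsub>F\<^esub> (e x \<oplus>\<^bsub>F\<^esub> e y) | x y. x \<in> carrier M \<and> y \<in> carrier M} \<union>
        {e (a \<odot>\<^bsub>M\<^esub> x) \<ominus>\<^bsub>F\<^esub> (\<phi> a \<odot>\<^bsub>F\<^esub> e x) | a x. a \<in> carrier R \<and> x \<in> carrier M})"

definition tensor_scalars ::
  "('a, 'k) ring_scheme \<Rightarrow> ('s, 'l) ring_scheme \<Rightarrow> ('a \<Rightarrow> 's) \<Rightarrow> ('a, 'm, 'n) module_scheme \<Rightarrow>
   ('s, ('m \<Rightarrow> 's) set) module" where
  "tensor_scalars R S \<phi> M =
     quot_module (free_on S (carrier M))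
       (module.span S (free_on S (carrier M)) (tensor_relations R S \<phi> M))"

definition rank_at ::
  "('a, 'k) ring_scheme \<Rightarrow> ('a, 'm, 'l) module_scheme \<Rightarrow> 'a set \<Rightarrow> nat" where
  "rank_at R M \<qq> =
     vectorspace.dim (kappa R \<qq>) (tensor_scalars R (kappa R \<qq>) (to_kappa R \<qq>) M)"

text \<open>Over a domain, the rank is the rank at its generic point, the zero ideal.\<close>

definition domain_rank :: "('a, 'k) ring_scheme \<Rightarrow> ('a, 'm, 'l) module_scheme \<Rightarrow> nat" where
  "domain_rank R M = rank_at R M {\<zero>\<^bsub>R\<^esub>}"

subsection \<open>Depth\<close>

definition ideal_smult ::
  "('a, 'k) ring_scheme \<Rightarrow> 'a set \<Rightarrow> ('a, 'm, 'l) module_scheme \<Rightarrow> 'm set" where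
  "ideal_smult R I M = module.span R M {a \<odot>\<^bsub>M\<^esub> x | a x. a \<in> I \<and> x \<in> carrier M}"

definition regular_sequence ::
  "('a, 'k) ring_scheme \<Rightarrow> ('a, 'm, 'l) module_scheme \<Rightarrow> 'a list \<Rightarrow> bool" where
  "regular_sequence R M xs \<longleftrightarrow>
     set xs \<subseteq> carrier R \<and>
     (\<forall>i < length xs. \<forall>y \<in> carrier M.
        xs ! i \<odot>\<^bsub>M\<^esub> y \<in> ideal_smult R (Idl\<^bsub>R\<^esub> (set (take i xs))) M \<longrightarrow>
        y \<in> ideal_smult R (Idl\<^bsub>R\<^esub> (set (take i xs))) M) \<and>
     ideal_smult R (Idl\<^bsub>R\<^esub> (set xs)) M \<noteq> carrier M"

text \<open>
  The depth over a local ring. The zero module has no regular sequence at all, so the convention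
  that its depth is \<open>\<infinity>\<close> has to be stated separately.
\<close>

definition depth :: "('a, 'k) ring_scheme \<Rightarrow> ('a, 'm, 'l) module_scheme \<Rightarrow> enat" where
  "depth R M =
     (if carrier M = {\<zero>\<^bsub>M\<^esub>} then \<infinity>
      else Sup {enat (length xs) | xs. set xs \<subseteq> max_ideal R \<and> regular_sequence R M xs})"

subsection \<open>Injective dimension and Gorenstein rings\<close>

text \<open>
  HOL cannot quantify over all \<open>R\<close>-modules inside a definition, so the modules \<open>P\<close> below, as well as
  the terms of the injective resolutions, have elements in \<^typ>\<open>(nat \<times> 'a) set\<close>, where
  \<^typ>\<open>'a\<close> is the type of ring elements. This is no restriction. The type contains a
  copy of the ring, so by Baer's criterion the extension property against modules of this type is
  the extension property against all modules. Over a noetherian ring, every term of the minimal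
  injective resolution of a finitely generated module has at most \<open>max(|R|, \<aleph>\<^sub>0)\<close> elements, so a
  resolution of minimal length exists on this type.
\<close>

definition injective_module :: "('a, 'k) ring_scheme \<Rightarrow> ('a, 'e, 'l) module_scheme \<Rightarrow> bool" where
  "injective_module R E \<longleftrightarrow>
     module R E \<and>
     (\<forall>(P :: ('a, (nat \<times> 'a) set) module) N f.
        module R P \<and> submodule R N P \<and> f \<in> module_hom R (P\<lparr>carrier := N\<rparr>) E \<longrightarrow>
        (\<exists>g \<in> module_hom R P E. \<forall>x \<in> N. g x = f x))"

text \<open>\<open>0 \<rightarrow> M \<rightarrow> I\<^sup>0 \<rightarrow> I\<^sup>1 \<rightarrow> \<dots>\<close> is exact with all \<open>I\<^sup>i\<close> injective.\<close>

definition injective_resolution ::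
  "('a, 'k) ring_scheme \<Rightarrow> ('a, 'm, 'l) module_scheme \<Rightarrow> ('m \<Rightarrow> 'e) \<Rightarrow>
   (nat \<Rightarrow> ('a, 'e) module) \<Rightarrow> (nat \<Rightarrow> 'e \<Rightarrow> 'e) \<Rightarrow> bool" where
  "injective_resolution R M \<epsilon> I d \<longleftrightarrow>
     (\<forall>i. injective_module R (I i)) \<and>
     \<epsilon> \<in> module_hom R M (I 0) \<and> inj_on \<epsilon> (carrier M) \<and>
     (\<forall>i. d i \<in> module_hom R (I i) (I (Suc i))) \<and>
     \<epsilon> ` carrier M = {x \<in> carrier (I 0). d 0 x = \<zero>\<^bsub>I 1\<^esub>} \<and>
     (\<forall>i. d i ` carrier (I i) = {x \<in> carrier (I (Suc i)). d (Suc i) x = \<zero>\<^bsub>I (Suc (Suc i))\<^esub>})"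

definition injective_dimension ::
  "('a, 'k) ring_scheme \<Rightarrow> ('a, 'm, 'l) module_scheme \<Rightarrow> enat" where
  "injective_dimension R M =
     Inf {enat n | n. \<exists>\<epsilon> (I :: nat \<Rightarrow> ('a, (nat \<times> 'a) set) module) d.
       injective_resolution R M \<epsilon> I d \<and> (\<forall>i > n. carrier (I i) = {\<zero>\<^bsub>I i\<^esub>})}"

definition gorenstein_local_ring :: "('a, 'k) ring_scheme \<Rightarrow> bool" where
  "gorenstein_local_ring R \<longleftrightarrow>
     local_ring R \<and> noetherian_ring R \<and> injective_dimension R (self_module R) < \<infinity>"

section \<open>Congruence modules and the Wiles defect\<close>

text \<open>\<open>M[I]\<close>\<close>

definition ann_part :: "('a, 'm, 'l) module_scheme \<Rightarrow> 'a set \<Rightarrow> 'm set" where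
  "ann_part M I = {x \<in> carrier M. \<forall>a \<in> I. a \<odot>\<^bsub>M\<^esub> x = \<zero>\<^bsub>M\<^esub>}"

text \<open>
  For a surjective ring map \<open>\<phi> : R \<rightarrow> S\<close> and an \<open>R\<close>-module \<open>M\<close> annihilated by its kernel, \<open>M\<close> regarded
  as an \<open>S\<close>-module. The action does not depend on the chosen preimages.
\<close>

definition descend_scalars ::
  "('a, 'k) ring_scheme \<Rightarrow> ('a \<Rightarrow> 's) \<Rightarrow> ('a, 'm, 'l) module_scheme \<Rightarrow> ('s, 'm) module" where
  "descend_scalars R \<phi> M =
     \<lparr>carrier = carrier M, mult = undefined, one = undefined, zero = \<zero>\<^bsub>M\<^esub>, add = add M,
      smult = (\<lambda>c x. inv_into (carrier R) \<phi> c \<odot>\<^bsub>M\<^esub> x)\<rparr>"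

text \<open>
  In the following, \<open>\<phi> : A \<rightarrow> \<O>\<close> is surjective and \<open>\<pp>\<^sub>A\<close> is its kernel. The modules \<open>M[\<pp>\<^sub>A]\<close>,
  \<open>\<Phi>\<^sub>A = \<pp>\<^sub>A / \<pp>\<^sub>A\<^sup>2\<close> and \<open>\<Psi>\<^sub>A(M) = M / (M[\<pp>\<^sub>A] + M[I\<^sub>A])\<close>, where \<open>I\<^sub>A = A[\<pp>\<^sub>A]\<close>, are taken as \<open>\<O>\<close>-modules.
\<close>

definition ann_module ::
  "('a, 'k) ring_scheme \<Rightarrow> ('o, 'l) ring_scheme \<Rightarrow> ('a \<Rightarrow> 'o) \<Rightarrow> ('a, 'm, 'n) module_scheme \<Rightarrow>
   ('o, 'm) module" where
  "ann_module A \<O> \<phi> M =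
     descend_scalars A \<phi> (M\<lparr>carrier := ann_part M (a_kernel A \<O> \<phi>)\<rparr>)"

definition cotangent_module ::
  "('a, 'k) ring_scheme \<Rightarrow> ('o, 'l) ring_scheme \<Rightarrow> ('a \<Rightarrow> 'o) \<Rightarrow> ('o, 'a set) module" where
  "cotangent_module A \<O> \<phi> =
     (let \<pp> = a_kernel A \<O> \<phi> in
        descend_scalars A \<phi> (quot_module ((self_module A)\<lparr>carrier := \<pp>\<rparr>) (\<pp> \<cdot>\<^bsub>A\<^esub> \<pp>)))"

definition congruence_module ::
  "('a, 'k) ring_scheme \<Rightarrow> ('o, 'l) ring_scheme \<Rightarrow> ('a \<Rightarrow> 'o) \<Rightarrow> ('a, 'm, 'n) module_scheme \<Rightarrow>
   ('o, 'm set) module" where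
  "congruence_module A \<O> \<phi> M =
     (let \<pp> = a_kernel A \<O> \<phi>; I = ann_part (self_module A) \<pp> in
        descend_scalars A \<phi> (quot_module M (ann_part M \<pp> <+>\<^bsub>M\<^esub> ann_part M I)))"

definition wiles_defect ::
  "('a, 'k) ring_scheme \<Rightarrow> ('o, 'l) ring_scheme \<Rightarrow> ('a \<Rightarrow> 'o) \<Rightarrow> ('a, 'm, 'n) module_scheme \<Rightarrow> int" where
  "wiles_defect A \<O> \<phi> M =
     int (domain_rank \<O> (ann_module A \<O> \<phi> M)) * int (the_enat (module_length \<O> (cotangent_module A \<O> \<phi>)))
     - int (the_enat (module_length \<O> (congruence_module A \<O> \<phi> M)))"

end

(*
  A Gorenstein local ring A in which Phi_A has finite length is one-dimensional, and it has a regular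
  element x outside p = ker phi for which A/x is self-injective; its socle is generated by t e, where e
  generates A[p] and x = t pi modulo p. Choose a minimal set X such that e X generates e M. Then
  card X = rank M[p], and Psi_A(M) has length at most card X * length Psi_A(A), with equality only if
  M[p] = e M. The equality of Wiles defects forces this, and comparing socles modulo x shows that a
  combination of X lies in xM only if its coefficients lie in xA. So X is linearly independent and x is
  regular on M / span X. If this quotient is nonzero, it has an associated prime Q not containing x;
  such a Q is minimal and an annihilator, so X is independent at Q, and the bound on the rank of M at Q
  makes X generate M at Q, a contradiction.
*)

theory Submission
  imports Defs
begin

\<comment> \<open>Being Gorenstein is given as a finite injective resolution of unknown length, so
  it must first be shown that the cosyzygy \<open>K 1\<close> is already injective. Starting from a
  cosyzygy that vanishes, injectivity descends one degree at a time (Bass's lemma) while Ext of the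
  residue field vanishes; in degrees above one it does, because the residue field embeds in A/x. The
  obstacle is Nakayama's lemma for Ext, which rests on finite generation: Ext is encoded by linear
  systems over the terms of the resolution, and the lemma is carried along by dimension shifting.
  Finite length of Phi_A makes A a field at p; hence A[p] meets p trivially and embeds as an ideal
  in the valuation ring, whence its generator \<open>e\<close>. The valuation \<open>n\<close> of
  \<open>e\<close> is the length of Psi_A(A), so the length of Phi_A cancels from the equality of
  defects, which becomes length Psi_A(M) = n rank M[p]. Ranks at generic points can be tested by
  annihilators, since every prime Q avoiding x is the annihilator of some w: multiplication by w
  kills QM and detects whether a coefficient lies in Q.\<close>
text \<open>\<open>x \<oplus>\<^sub>M y\<close> is short for \<open>x \<oplus>\<^bsub>M\<^esub> y\<close>.\<close>

syntax "_index" :: "logic \<Rightarrow> index" ("(\<open>unbreakable\<close>\<^sub>_)" [1000] 1000)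

section \<open>Submodules and ideals\<close>

context module
begin

text \<open>Sorting a sum by associativity and commutativity can leave other summands between a term
  and its negative, where \<open>M.r_neg1\<close> and \<open>M.r_neg2\<close> do not see the pair.
  These rules cancel across one or two intervening summands and so make \<open>msimps\<close> a
  usable normalizer for module identities.\<close>

lemma add_cancel_far2:
  assumes "x \<in> carrier M" "y \<in> carrier M"
  shows "x \<oplus>\<^sub>M (y \<oplus>\<^sub>M \<ominus>\<^sub>M x) = y" "\<ominus>\<^sub>M x \<oplus>\<^sub>M (y \<oplus>\<^sub>M x) = y"
  using assms by (simp_all add: M.a_lcomm[of x y] M.a_lcomm[of "\<ominus>\<^sub>M x" y] M.r_neg M.l_neg)

lemma add_cancel_far3:
  assumes "x \<in> carrier M" "y \<in> carrier M" "z \<in> carrier M"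
  shows "x \<oplus>\<^sub>M (y \<oplus>\<^sub>M (\<ominus>\<^sub>M x \<oplus>\<^sub>M z)) = y \<oplus>\<^sub>M z" "\<ominus>\<^sub>M x \<oplus>\<^sub>M (y \<oplus>\<^sub>M (x \<oplus>\<^sub>M z)) = y \<oplus>\<^sub>M z"
    "x \<oplus>\<^sub>M (y \<oplus>\<^sub>M (z \<oplus>\<^sub>M \<ominus>\<^sub>M x)) = y \<oplus>\<^sub>M z" "\<ominus>\<^sub>M x \<oplus>\<^sub>M (y \<oplus>\<^sub>M (z \<oplus>\<^sub>M x)) = y \<oplus>\<^sub>M z"
  using assms by (simp_all add: M.a_lcomm[of x y] M.a_lcomm[of x z] M.a_lcomm[of "\<ominus>\<^sub>M x" y] M.a_lcomm[of "\<ominus>\<^sub>M x" z] M.r_neg M.l_neg M.r_neg1 M.r_neg2)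

lemma add_cancel_far4:
  assumes "x \<in> carrier M" "y \<in> carrier M" "z \<in> carrier M" "w \<in> carrier M"
  shows "x \<oplus>\<^sub>M (y \<oplus>\<^sub>M (z \<oplus>\<^sub>M (\<ominus>\<^sub>M x \<oplus>\<^sub>M w))) = y \<oplus>\<^sub>M (z \<oplus>\<^sub>M w)"
    "\<ominus>\<^sub>M x \<oplus>\<^sub>M (y \<oplus>\<^sub>M (z \<oplus>\<^sub>M (x \<oplus>\<^sub>M w))) = y \<oplus>\<^sub>M (z \<oplus>\<^sub>M w)"
  using assms by (simp_all add: M.a_lcomm[of x y] M.a_lcomm[of x z] M.a_lcomm[of "\<ominus>\<^sub>M x" y] M.a_lcomm[of "\<ominus>\<^sub>M x" z] M.r_neg M.l_neg M.r_neg1 M.r_neg2)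

lemmas add_cancel_far = add_cancel_far2 add_cancel_far3 add_cancel_far4

lemmas msimps = a_minus_def smult_l_distr smult_r_distr smult_assoc_simp smult_l_minus
  smult_r_minus M.minus_add M.minus_minus M.a_ac M.r_neg M.r_neg1 M.r_neg2 M.l_neg add_cancel_far
  R.m_ac R.l_minus R.r_minus R.l_distr R.r_distr R.minus_add

lemma submodule_iff:
  "submodule R N M \<longleftrightarrow> N \<subseteq> carrier M \<and> \<zero>\<^sub>M \<in> N \<and> (\<forall>x\<in>N. \<forall>y\<in>N. x \<oplus>\<^sub>M y \<in> N) \<and>
     (\<forall>a\<in>carrier R. \<forall>x\<in>N. a \<odot>\<^sub>M x \<in> N)" using module_axioms by (auto simp: submodule_def)

lemma submoduleD:
  assumes "submodule R N M"
  shows "x \<in> N \<Longrightarrow> x \<in> carrier M" "\<zero>\<^sub>M \<in> N"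
    "x \<in> N \<Longrightarrow> y \<in> N \<Longrightarrow> x \<oplus>\<^sub>M y \<in> N"
    "a \<in> carrier R \<Longrightarrow> x \<in> N \<Longrightarrow> a \<odot>\<^sub>M x \<in> N" using assms by (auto simp: submodule_iff)

lemma submodule_minus:
  assumes "submodule R N M" "x \<in> N" "y \<in> N"
  shows "x \<ominus>\<^sub>M y \<in> N"
proof -
  have c: "x \<in> carrier M" "y \<in> carrier M" using assms submodule_iff by auto
  have "x \<oplus>\<^sub>M (\<ominus> \<one>) \<odot>\<^sub>M y \<in> N" using assms submodule_iff by auto
  thus ?thesis using c by (simp add: a_minus_def smult_minus_1)
qed

lemma submodule_add_cancel:
  assumes "submodule R N M" "x \<oplus>\<^sub>M y \<in> N" "y \<in> N" "x \<in> carrier M"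
  shows "x \<in> N"
proof -
  have c: "y \<in> carrier M" using assms submodule_iff by auto
  have "(x \<oplus>\<^sub>M y) \<ominus>\<^sub>M y \<in> N" using submodule_minus assms by blast
  thus ?thesis using c assms(4) by (simp add: msimps)
qed

lemma submodule_carrier: "submodule R (carrier M) M" by (auto simp: submodule_iff)

lemma submodule_zero: "submodule R {\<zero>\<^sub>M} M" by (auto simp: submodule_iff)

definition adjoin :: "'c set \<Rightarrow> 'c \<Rightarrow> 'c set" where
  "adjoin N x = {n \<oplus>\<^sub>M a \<odot>\<^sub>M x | n a. n \<in> N \<and> a \<in> carrier R}"

definition adjoin_mult :: "'c set \<Rightarrow> 'a set \<Rightarrow> 'c \<Rightarrow> 'c set" where
  "adjoin_mult N Q x = {n \<oplus>\<^sub>M a \<odot>\<^sub>M x | n a. n \<in> N \<and> a \<in> Q}"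

lemma submodule_adjoin_mult:
  assumes N: "submodule R N M" and Q: "ideal Q R" and x: "x \<in> carrier M"
  shows "submodule R (adjoin_mult N Q x) M"
proof -
  interpret Q: ideal Q R by fact
  have Nc: "n \<in> carrier M" if "n \<in> N" for n using N that submodule_iff by auto
  have Qc: "n \<in> carrier R" if "n \<in> Q" for n using Q.Icarr that by auto
  show ?thesis unfolding submodule_iff adjoin_mult_def
  proof (intro conjI ballI)
    show "{n \<oplus>\<^sub>M a \<odot>\<^sub>M x |n a. n \<in> N \<and> a \<in> Q} \<subseteq> carrier M" using Nc Qc x by auto
    have "\<zero>\<^sub>M = \<zero>\<^sub>M \<oplus>\<^sub>M \<zero> \<odot>\<^sub>M x" "\<zero>\<^sub>M \<in> N" using x N submodule_iff by auto
    thus "\<zero>\<^sub>M \<in> {n \<oplus>\<^sub>M a \<odot>\<^sub>M x |n a. n \<in> N \<and> a \<in> Q}" using Q.zero_closed by blast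
  next
    fix u v assume "u \<in> {n \<oplus>\<^sub>M a \<odot>\<^sub>M x |n a. n \<in> N \<and> a \<in> Q}"
      "v \<in> {n \<oplus>\<^sub>M a \<odot>\<^sub>M x |n a. n \<in> N \<and> a \<in> Q}"
    then obtain n a n' a' where h: "u = n \<oplus>\<^sub>M a \<odot>\<^sub>M x" "v = n' \<oplus>\<^sub>M a' \<odot>\<^sub>M x"
      "n \<in> N" "a \<in> Q" "n' \<in> N" "a' \<in> Q" by blast
    have "u \<oplus>\<^sub>M v = (n \<oplus>\<^sub>M n') \<oplus>\<^sub>M (a \<oplus> a') \<odot>\<^sub>M x" using h Nc Qc x by (simp add: msimps)
    moreover have "n \<oplus>\<^sub>M n' \<in> N" "a \<oplus> a' \<in> Q" using h N submodule_iff by auto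
    ultimately show "u \<oplus>\<^sub>M v \<in> {n \<oplus>\<^sub>M a \<odot>\<^sub>M x |n a. n \<in> N \<and> a \<in> Q}" by blast
  next
    fix c u assume "c \<in> carrier R" "u \<in> {n \<oplus>\<^sub>M a \<odot>\<^sub>M x |n a. n \<in> N \<and> a \<in> Q}"
    then obtain n a where h: "u = n \<oplus>\<^sub>M a \<odot>\<^sub>M x" "n \<in> N" "a \<in> Q" "c \<in> carrier R" by blast
    have "c \<odot>\<^sub>M u = c \<odot>\<^sub>M n \<oplus>\<^sub>M (c \<otimes> a) \<odot>\<^sub>M x" using h Nc Qc x by (simp add: msimps)
    moreover have "c \<odot>\<^sub>M n \<in> N" "c \<otimes> a \<in> Q" using h N submodule_iff Q.I_l_closed by auto
    ultimately show "c \<odot>\<^sub>M u \<in> {n \<oplus>\<^sub>M a \<odot>\<^sub>M x |n a. n \<in> N \<and> a \<in> Q}" by blast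
  qed
qed

lemma adjoin_eq: "adjoin N x = adjoin_mult N (carrier R) x" by (simp add: adjoin_def adjoin_mult_def)

lemma submodule_adjoin:
  "submodule R N M \<Longrightarrow> x \<in> carrier M \<Longrightarrow> submodule R (adjoin N x) M"
  by (simp add: adjoin_eq submodule_adjoin_mult R.oneideal)

lemma adjoin_superset:
  assumes "submodule R N M" "x \<in> carrier M"
  shows "N \<subseteq> adjoin N x" "x \<in> adjoin N x"
proof -
  have Nc: "N \<subseteq> carrier M" "\<zero>\<^sub>M \<in> N" using assms submodule_iff by auto
  show "N \<subseteq> adjoin N x"
  proof
    fix n assume n: "n \<in> N"
    hence "n = n \<oplus>\<^sub>M \<zero> \<odot>\<^sub>M x" using Nc assms by auto
    thus "n \<in> adjoin N x" unfolding adjoin_def using n R.zero_closed by blast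
  qed
  have "x = \<zero>\<^sub>M \<oplus>\<^sub>M \<one> \<odot>\<^sub>M x" using assms by auto
  thus "x \<in> adjoin N x" unfolding adjoin_def using Nc R.one_closed by blast
qed

lemma adjoin_least:
  assumes "submodule R L M" "N \<subseteq> L" "x \<in> L"
  shows "adjoin N x \<subseteq> L"
  using assms submodule_iff unfolding adjoin_def by auto

lemma lincomb_in_submodule:
  assumes "finite G" "submodule R N M" "G \<subseteq> carrier M" "a \<in> G \<rightarrow> carrier R"
    "\<And>g. g \<in> G \<Longrightarrow> a g \<odot>\<^sub>M g \<in> N"
  shows "lincomb a G \<in> N"
  using assms(1,3-)
proof (induction G)
  case empty
  thus ?case using assms(2) submodule_iff by (simp add: lincomb_def)
next
  case (insert g G)
  have "lincomb a (G \<union> {g}) = a g \<odot>\<^sub>M g \<oplus>\<^sub>M lincomb a G" using insert by (intro lincomb_insert) auto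
  thus ?case using insert assms(2) submodule_iff by auto
qed

lemma span_least:
  assumes "submodule R N M" "G \<subseteq> N"
  shows "span G \<subseteq> N"
  using span_is_subset[of G N] assms by auto

lemma ideal_colon:
  assumes "submodule R N M" "X \<subseteq> carrier M"
  shows "ideal {a \<in> carrier R. \<forall>x\<in>X. a \<odot>\<^sub>M x \<in> N} R"
proof (rule idealI)
  show "ring R" ..
  show "subgroup {a \<in> carrier R. \<forall>x\<in>X. a \<odot>\<^sub>M x \<in> N} (add_monoid R)"
  proof (rule R.add.subgroupI)
    have "\<zero> \<in> {a \<in> carrier R. \<forall>x\<in>X. a \<odot>\<^sub>M x \<in> N}" using assms submodule_iff by (auto simp: subset_iff)
    thus "{a \<in> carrier R. \<forall>x\<in>X. a \<odot>\<^sub>M x \<in> N} \<noteq> {}" by blast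
  next
    fix a assume a: "a \<in> {a \<in> carrier R. \<forall>x\<in>X. a \<odot>\<^sub>M x \<in> N}"
    have "(\<ominus> a) \<odot>\<^sub>M x \<in> N" if "x \<in> X" for x
    proof -
      have "(\<ominus> \<one>) \<odot>\<^sub>M (a \<odot>\<^sub>M x) \<in> N" using a that assms submodule_iff by auto
      moreover have "x \<in> carrier M" using that assms by auto
      ultimately show ?thesis using a by (simp add: msimps)
    qed
    thus "\<ominus> a \<in> {a \<in> carrier R. \<forall>x\<in>X. a \<odot>\<^sub>M x \<in> N}" using a by auto
  next
    fix a b assume "a \<in> {a \<in> carrier R. \<forall>x\<in>X. a \<odot>\<^sub>M x \<in> N}" "b \<in> {a \<in> carrier R. \<forall>x\<in>X. a \<odot>\<^sub>M x \<in> N}"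
    thus "a \<oplus> b \<in> {a \<in> carrier R. \<forall>x\<in>X. a \<odot>\<^sub>M x \<in> N}"
      using assms submodule_iff by (auto simp: smult_l_distr subset_iff)
  qed auto
next
  fix a b assume h: "a \<in> {a \<in> carrier R. \<forall>x\<in>X. a \<odot>\<^sub>M x \<in> N}" "b \<in> carrier R"
  thus "b \<otimes> a \<in> {a \<in> carrier R. \<forall>x\<in>X. a \<odot>\<^sub>M x \<in> N}"
    using assms submodule_iff by (auto simp: smult_assoc1 subset_iff)
  thus "a \<otimes> b \<in> {a \<in> carrier R. \<forall>x\<in>X. a \<odot>\<^sub>M x \<in> N}" using h by (auto simp: R.m_comm)
qed

lemma submodule_torsion:
  assumes "J \<subseteq> carrier R" "submodule R N M"
  shows "submodule R {x \<in> carrier M. \<forall>a\<in>J. a \<odot>\<^sub>M x \<in> N} M"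
  unfolding submodule_iff
proof (intro conjI ballI)
  fix c x assume h: "c \<in> carrier R" "x \<in> {x \<in> carrier M. \<forall>a\<in>J. a \<odot>\<^sub>M x \<in> N}"
  have "a \<odot>\<^sub>M (c \<odot>\<^sub>M x) \<in> N" if "a \<in> J" for a
  proof -
    have "c \<odot>\<^sub>M (a \<odot>\<^sub>M x) \<in> N" using h that assms submodule_iff by auto
    moreover have "a \<in> carrier R" using that assms by auto
    ultimately show ?thesis using h by (simp add: msimps)
  qed
  thus "c \<odot>\<^sub>M x \<in> {x \<in> carrier M. \<forall>a\<in>J. a \<odot>\<^sub>M x \<in> N}" using h by auto
next
  fix x y assume "x \<in> {x \<in> carrier M. \<forall>a\<in>J. a \<odot>\<^sub>M x \<in> N}" "y \<in> {x \<in> carrier M. \<forall>a\<in>J. a \<odot>\<^sub>M x \<in> N}"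
  thus "x \<oplus>\<^sub>M y \<in> {x \<in> carrier M. \<forall>a\<in>J. a \<odot>\<^sub>M x \<in> N}"
    using assms submodule_iff by (auto simp: smult_r_distr subset_iff)
qed (use assms submodule_iff in auto)

text \<open>The product of the multipliers of the single elements works, since \<open>Q\<close> is
  prime. It turns a statement at the localization at \<open>Q\<close> about finitely many elements
  into one with a single denominator.\<close>

lemma prime_common_multiplier:
  assumes Q: "primeideal Q R" and F: "submodule R F M" and "finite G" "G \<subseteq> carrier M"
    and "\<forall>g\<in>G. \<exists>s\<in>carrier R - Q. s \<odot>\<^sub>M g \<in> F"
  shows "\<exists>s\<in>carrier R - Q. \<forall>g\<in>G. s \<odot>\<^sub>M g \<in> F"
  using assms(3-)
proof (induction G)
  interpret Q: primeideal Q R by fact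
  case empty
  have "\<one> \<notin> Q" using Q.I_notcarr Q.one_imp_carrier by blast
  thus ?case using R.one_closed by blast
next
  interpret Q: primeideal Q R by fact
  case (insert g G)
  obtain s where s: "s \<in> carrier R - Q" "\<forall>g\<in>G. s \<odot>\<^sub>M g \<in> F" using insert by auto
  obtain t where t: "t \<in> carrier R - Q" "t \<odot>\<^sub>M g \<in> F" using insert by auto
  have "s \<otimes> t \<notin> Q" using Q.I_prime s t by blast
  moreover have "(s \<otimes> t) \<odot>\<^sub>M h \<in> F" if "h \<in> insert g G" for h
  proof (cases "h = g")
    case True
    thus ?thesis using s t insert.prems F submodule_iff by (auto simp: smult_assoc1)
  next
    case False
    hence h: "h \<in> G" "h \<in> carrier M" using that insert.prems by auto
    have "t \<odot>\<^sub>M (s \<odot>\<^sub>M h) \<in> F" using h s t F submodule_iff by auto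
    thus ?thesis using s t h by (simp add: msimps)
  qed
  ultimately show ?case using s t by blast
qed

text \<open>Nakayama's lemma over the localization at \<open>Q\<close>, written with denominators.
  Instead of a determinant, generators are eliminated one by one: \<open>g0\<close> is first put
  into the submodule, the induction hypothesis brings the others into \<open>F + R g0\<close>, and
  substituting them in the equation of \<open>g0\<close> frees \<open>g0\<close> as well. Hence
  \<open>F\<close> must vary in the induction.\<close>

lemma nakayama_at_prime:
  assumes "finite G" "G \<subseteq> carrier M" "submodule R F M" and Q: "primeideal Q R"
    and "\<forall>g\<in>G. \<exists>s\<in>carrier R - Q. \<exists>f\<in>F. \<exists>a\<in>G \<rightarrow> Q. s \<odot>\<^sub>M g = f \<oplus>\<^sub>M lincomb a G"
  shows "\<forall>g\<in>G. \<exists>s\<in>carrier R - Q. s \<odot>\<^sub>M g \<in> F"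
  using assms(1-3,5)
proof (induction G arbitrary: F)
  case empty
  thus ?case by auto
next
  interpret Q: primeideal Q R by fact
  have Qc: "q \<in> carrier R" if "q \<in> Q" for q using Q.Icarr that by auto
  case (insert g0 G)
  have g0: "g0 \<in> carrier M" and G: "G \<subseteq> carrier M" using insert.prems(1) by auto
  have Fc: "f \<in> carrier M" if "f \<in> F" for f using that insert.prems submodule_iff by auto
  have ins: "lincomb a (insert g0 G) = a g0 \<odot>\<^sub>M g0 \<oplus>\<^sub>M lincomb a G"
    if "a \<in> insert g0 G \<rightarrow> Q" for a
  proof -
    have "lincomb a (G \<union> {g0}) = a g0 \<odot>\<^sub>M g0 \<oplus>\<^sub>M lincomb a G"
      using insert.hyps g0 G that Qc by (intro lincomb_insert) (auto simp: Pi_iff)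
    thus ?thesis by simp
  qed
  have lc: "lincomb a G \<in> carrier M" if "a \<in> G \<rightarrow> Q" for a using that G by (intro lincomb_closed) (auto simp: Pi_iff Qc)
  have IH: "\<forall>g\<in>G. \<exists>s\<in>carrier R - Q. s \<odot>\<^sub>M g \<in> adjoin F g0"
  proof (rule insert.IH)
    show "submodule R (adjoin F g0) M" using submodule_adjoin insert.prems g0 by blast
    show "\<forall>g\<in>G. \<exists>s\<in>carrier R - Q. \<exists>f\<in>adjoin F g0. \<exists>a\<in>G \<rightarrow> Q. s \<odot>\<^sub>M g = f \<oplus>\<^sub>M lincomb a G"
    proof
      fix g assume "g \<in> G"
      then obtain s f a where h: "s \<in> carrier R - Q" "f \<in> F" "a \<in> insert g0 G \<rightarrow> Q"
        "s \<odot>\<^sub>M g = f \<oplus>\<^sub>M lincomb a (insert g0 G)" using insert.prems by blast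
      have "s \<odot>\<^sub>M g = (f \<oplus>\<^sub>M a g0 \<odot>\<^sub>M g0) \<oplus>\<^sub>M lincomb a G"
        using h ins[OF h(3)] g0 Fc Qc[of "a g0"] lc[of a] by (simp add: M.a_assoc Pi_iff)
      moreover have "f \<oplus>\<^sub>M a g0 \<odot>\<^sub>M g0 \<in> adjoin F g0"
        unfolding adjoin_def using h(2) h(3) Qc[of "a g0"] by (force simp: Pi_iff)
      ultimately show "\<exists>s\<in>carrier R - Q. \<exists>f\<in>adjoin F g0. \<exists>a\<in>G \<rightarrow> Q. s \<odot>\<^sub>M g = f \<oplus>\<^sub>M lincomb a G"
        using h(1,3) by (auto simp: Pi_iff)
    qed
  qed (use G in auto)
  then obtain t where t: "t \<in> carrier R - Q" "\<forall>g\<in>G. t \<odot>\<^sub>M g \<in> adjoin F g0"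
    using prime_common_multiplier[OF Q submodule_adjoin[OF insert.prems(2) g0] insert.hyps(1) G] by blast
  obtain s f a where h: "s \<in> carrier R - Q" "f \<in> F" "a \<in> insert g0 G \<rightarrow> Q"
        "s \<odot>\<^sub>M g0 = f \<oplus>\<^sub>M lincomb a (insert g0 G)" using insert.prems by blast
  have a0: "a g0 \<in> Q" "a g0 \<in> carrier R" using h Qc by auto
  have aG: "a g \<in> Q" "a g \<in> carrier R" if "g \<in> G" for g using h that Qc by (auto simp: Pi_iff)
  let ?W = "adjoin_mult F Q g0"
  have W: "submodule R ?W M" using submodule_adjoin_mult[OF insert.prems(2) Q.ideal_axioms g0] .
  have "lincomb (\<lambda>g. t \<otimes> a g) G \<in> ?W"
  proof (rule lincomb_in_submodule[OF insert.hyps(1) W G])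
    show "(\<lambda>g. t \<otimes> a g) \<in> G \<rightarrow> carrier R" using t aG by auto
    fix g assume g: "g \<in> G"
    then obtain f' c where f': "t \<odot>\<^sub>M g = f' \<oplus>\<^sub>M c \<odot>\<^sub>M g0" "f' \<in> F" "c \<in> carrier R"
      using t unfolding adjoin_def by blast
    have gc: "g \<in> carrier M" using g G by auto
    have "(t \<otimes> a g) \<odot>\<^sub>M g = a g \<odot>\<^sub>M (t \<odot>\<^sub>M g)" using gc t aG[OF g] by (simp add: msimps)
    also have "\<dots> = a g \<odot>\<^sub>M f' \<oplus>\<^sub>M (c \<otimes> a g) \<odot>\<^sub>M g0" unfolding f'(1) using f' Fc g0 aG[OF g] by (simp add: msimps)
    finally have "(t \<otimes> a g) \<odot>\<^sub>M g = a g \<odot>\<^sub>M f' \<oplus>\<^sub>M (c \<otimes> a g) \<odot>\<^sub>M g0" .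
    moreover have "a g \<odot>\<^sub>M f' \<in> F" using f' aG[OF g] insert.prems submodule_iff by auto
    moreover have "c \<otimes> a g \<in> Q" using aG[OF g] f' Q.I_l_closed by auto
    ultimately show "(t \<otimes> a g) \<odot>\<^sub>M g \<in> ?W" unfolding adjoin_mult_def by blast
  qed
  then obtain f1 q where f1: "lincomb (\<lambda>g. t \<otimes> a g) G = f1 \<oplus>\<^sub>M q \<odot>\<^sub>M g0" "f1 \<in> F" "q \<in> Q"
    unfolding adjoin_mult_def by blast
  have tl: "t \<odot>\<^sub>M lincomb a G = f1 \<oplus>\<^sub>M q \<odot>\<^sub>M g0" using lincomb_smult[of G a t] f1(1) G aG t by auto
  have lcG: "lincomb a G \<in> carrier M" using G aG by auto
  \<comment> \<open>The coefficient of \<open>g0\<close> after the substitution: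
    \<open>t \<otimes> s\<close> minus an element of \<open>Q\<close>. It lies outside
    \<open>Q\<close> because \<open>t\<close> and \<open>s\<close> do, and it multiplies
    \<open>g0\<close> into \<open>F\<close>.\<close>
  let ?u = "t \<otimes> s \<ominus> (t \<otimes> a g0 \<oplus> q)"
  note [simp] = Fc[OF h(2)] Fc[OF f1(2)] Qc[OF f1(3)] a0(2) g0
  have [simp]: "t \<in> carrier R" "s \<in> carrier R" using t h by auto
  have "?u \<odot>\<^sub>M g0 = t \<odot>\<^sub>M (s \<odot>\<^sub>M g0) \<ominus>\<^sub>M (t \<otimes> a g0 \<oplus> q) \<odot>\<^sub>M g0" by (simp add: msimps)
  also have "t \<odot>\<^sub>M (s \<odot>\<^sub>M g0) = t \<odot>\<^sub>M f \<oplus>\<^sub>M (t \<otimes> a g0) \<odot>\<^sub>M g0 \<oplus>\<^sub>M t \<odot>\<^sub>M lincomb a G"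
    unfolding h(4) ins[OF h(3)] using lcG by (simp add: msimps)
  also have "\<dots> \<ominus>\<^sub>M (t \<otimes> a g0 \<oplus> q) \<odot>\<^sub>M g0 = t \<odot>\<^sub>M f \<oplus>\<^sub>M f1" unfolding tl by (simp add: msimps)
  finally have u: "?u \<odot>\<^sub>M g0 \<in> F" using h f1 t insert.prems submodule_iff by auto
  have uQ: "?u \<notin> Q"
  proof
    assume "?u \<in> Q"
    moreover have "t \<otimes> a g0 \<oplus> q \<in> Q" using a0 f1 Q.I_l_closed by simp
    ultimately have "?u \<oplus> (t \<otimes> a g0 \<oplus> q) \<in> Q" by simp
    moreover have "?u \<oplus> (t \<otimes> a g0 \<oplus> q) = t \<otimes> s"
      using a0(2) Qc[OF f1(3)] \<open>t \<in> carrier R\<close> \<open>s \<in> carrier R\<close> by algebra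
    ultimately show False using Q.I_prime[of t s] t h(1) by auto
  qed
  show ?case
  proof
    fix g assume "g \<in> insert g0 G"
    then consider "g = g0" | "g \<in> G" by auto
    thus "\<exists>s\<in>carrier R - Q. s \<odot>\<^sub>M g \<in> F"
    proof cases
      case 1 thus ?thesis using u uQ by (intro bexI[of _ ?u]) auto
    next
      case 2
      then obtain f' c where f': "t \<odot>\<^sub>M g = f' \<oplus>\<^sub>M c \<odot>\<^sub>M g0" "f' \<in> F" "c \<in> carrier R"
        using t unfolding adjoin_def by blast
      have gc: "g \<in> carrier M" using 2 G by auto
      have "(?u \<otimes> t) \<odot>\<^sub>M g = ?u \<odot>\<^sub>M (t \<odot>\<^sub>M g)" using gc by (simp add: smult_assoc1)
      also have "\<dots> = ?u \<odot>\<^sub>M f' \<oplus>\<^sub>M c \<odot>\<^sub>M (?u \<odot>\<^sub>M g0)"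
        unfolding f'(1) using f' Fc by (simp add: smult_r_distr smult_assoc_simp R.m_comm)
      finally have "(?u \<otimes> t) \<odot>\<^sub>M g \<in> F" using u f' insert.prems submodule_iff by auto
      moreover have "?u \<otimes> t \<notin> Q" using Q.I_prime[of ?u t] uQ t by auto
      ultimately show ?thesis by (intro bexI[of _ "?u \<otimes> t"]) auto
    qed
  qed
qed

end


section \<open>The ring as a module over itself, ideals as submodules\<close>

lemma self_module_simps [simp]:
  "carrier (self_module R) = carrier R" "zero (self_module R) = zero R"
  "add (self_module R) = add R" "smult (self_module R) = mult R"
  "a_inv (self_module R) = a_inv R" "a_minus (self_module R) = a_minus R"
  by (auto simp: self_module_def a_inv_def a_minus_def m_inv_def fun_eq_iff)

context cring
begin

lemma self_module: "module R (self_module R)"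
proof (rule moduleI)
  show "abelian_group (self_module R)" by (rule abelian_groupI) (auto simp: a_ac intro: l_neg)
qed (auto simp: l_distr r_distr m_assoc is_cring)

sublocale self: module R "self_module R" by (rule self_module)

abbreviation (input) RM where "RM \<equiv> self_module R"

lemma ideal_iff_submodule: "ideal J R \<longleftrightarrow> submodule R J RM"
proof
  assume "ideal J R"
  then interpret J: ideal J R .
  show "submodule R J RM" unfolding self.submodule_iff using J.Icarr J.I_l_closed by auto
next
  assume h: "submodule R J RM"
  have "ideal {a \<in> carrier R. \<forall>x\<in>{\<one>}. a \<otimes> x \<in> J} R" using self.ideal_colon[OF h, of "{\<one>}"] by simp
  moreover have "{a \<in> carrier R. \<forall>x\<in>{\<one>}. a \<otimes> x \<in> J} = J" using self.submoduleD[OF h] by auto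
  ultimately show "ideal J R" by simp
qed

lemma ideal_iff:
  "ideal J R \<longleftrightarrow> J \<subseteq> carrier R \<and> \<zero> \<in> J \<and> (\<forall>x\<in>J. \<forall>y\<in>J. x \<oplus> y \<in> J) \<and> (\<forall>a\<in>carrier R. \<forall>x\<in>J. a \<otimes> x \<in> J)"
  unfolding ideal_iff_submodule self.submodule_iff by simp

lemma idealD:
  assumes "ideal J R"
  shows "x \<in> J \<Longrightarrow> x \<in> carrier R" "\<zero> \<in> J" "x \<in> J \<Longrightarrow> y \<in> J \<Longrightarrow> x \<oplus> y \<in> J"
    "a \<in> carrier R \<Longrightarrow> x \<in> J \<Longrightarrow> a \<otimes> x \<in> J" "J \<subseteq> carrier R" using assms by (auto simp: ideal_iff)

lemma genideal_eq_span:
  assumes "G \<subseteq> carrier R"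
  shows "Idl G = self.span G"
proof
  have "ideal (self.span G) R" using assms by (simp add: ideal_iff_submodule self.span_is_submodule)
  thus "Idl G \<subseteq> self.span G" using genideal_minimal[of "self.span G" G] self.in_own_span[of G] assms by auto
  have "submodule R (Idl G) RM" using genideal_ideal[OF assms] ideal_iff_submodule by auto
  thus "self.span G \<subseteq> Idl G" using self.span_least genideal_self[OF assms] by blast
qed

lemma ideal_adjoin: "ideal J R \<Longrightarrow> x \<in> carrier R \<Longrightarrow> ideal (self.adjoin J x) R"
  by (simp add: ideal_iff_submodule self.submodule_adjoin)

lemma adjoin_eq_self: "self.adjoin J x = {n \<oplus> a \<otimes> x | n a. n \<in> J \<and> a \<in> carrier R}"
  by (simp add: self.adjoin_def)

lemma ideal_minus: "ideal J R \<Longrightarrow> x \<in> J \<Longrightarrow> y \<in> J \<Longrightarrow> x \<ominus> y \<in> J"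
  using self.submodule_minus[of J x y] ideal_iff_submodule by simp

lemma ideal_add_cancel: "ideal J R \<Longrightarrow> x \<oplus> y \<in> J \<Longrightarrow> y \<in> J \<Longrightarrow> x \<in> carrier R \<Longrightarrow> x \<in> J"
  using self.submodule_add_cancel[of J x y] ideal_iff_submodule by simp

lemma primeideal_pow:
  assumes Q: "primeideal Q R" and "a \<in> carrier R" "a [^] (n::nat) \<in> Q"
  shows "a \<in> Q"
proof -
  interpret Q: primeideal Q R by fact
  show ?thesis using assms(3)
  proof (induction n)
    case 0
    thus ?case using Q.one_imp_carrier Q.I_notcarr by auto
  next
    case (Suc n)
    thus ?case using Q.I_prime[of "a [^] n" a] assms by auto
  qed
qed

lemma primeidealI':
  assumes "ideal Q R" "\<one> \<notin> Q"
    and "\<And>a b. a \<in> carrier R \<Longrightarrow> b \<in> carrier R \<Longrightarrow> a \<otimes> b \<in> Q \<Longrightarrow> a \<notin> Q \<Longrightarrow> b \<in> Q"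
  shows "primeideal Q R"
  by (rule primeidealI) (use assms is_cring one_closed in blast)+

end

section \<open>Noetherian rings\<close>

locale noeth_cring = cring R + noetherian_ring R for R (structure)
begin

lemma ideal_fg:
  assumes "ideal J R"
  obtains G where "finite G" "G \<subseteq> J" "J = self.span G"
proof -
  obtain G where G: "G \<subseteq> carrier R" "finite G" "J = Idl G" using finetely_gen[OF assms] by blast
  thus ?thesis using that[of G] genideal_eq_span[OF G(1)] genideal_self[OF G(1)] by simp
qed

lemma maximal_ideal_in_family:
  assumes "S \<noteq> {}" "\<And>J. J \<in> S \<Longrightarrow> ideal J R"
  shows "\<exists>J\<in>S. \<forall>J'\<in>S. J \<subseteq> J' \<longrightarrow> J' = J"
proof (rule subset_Zorn_nonempty[OF assms(1)])
    fix C assume C: "C \<noteq> {}" "subset.chain S C"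
    have "subset.chain {I. ideal I R} C" using C(2) assms(2) unfolding subset_chain_def by blast
    hence "\<Union>C \<in> C" using ideal_chain_is_trivial[OF C(1)] by blast
    thus "\<Union>C \<in> S" using C(2) unfolding subset_chain_def by blast
qed

text \<open>The hypothesis says that \<open>H\<close> lies in \<open>N + b H\<close> inside the
  localization at \<open>Q\<close>. Finite generation of \<open>H\<close> turns the multiple
  \<open>b h'\<close> into a combination with coefficients in \<open>Q\<close>, and one denominator
  serves all of \<open>H\<close>.\<close>

lemma nakayama_ideal:
  assumes Q: "primeideal Q R" and N: "ideal N R" and H: "ideal H R" and b: "b \<in> Q"
    and hyp: "\<And>h. h \<in> H \<Longrightarrow> \<exists>s\<in>carrier R - Q. \<exists>n\<in>N. \<exists>h'\<in>H. s \<otimes> h = n \<oplus> b \<otimes> h'"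
  shows "\<exists>s\<in>carrier R - Q. \<forall>h\<in>H. s \<otimes> h \<in> N"
proof -
  interpret Q: primeideal Q R by fact
  have bc: "b \<in> carrier R" using b Q.Icarr by auto
  obtain G where G: "finite G" "G \<subseteq> H" "H = self.span G" using ideal_fg[OF H] .
  have Hc: "H \<subseteq> carrier R" using idealD(5)[OF H] .
  have Gc: "G \<subseteq> carrier RM" using G Hc by auto
  have N': "submodule R N RM" using N ideal_iff_submodule by blast
  have "\<forall>g\<in>G. \<exists>s\<in>carrier R - Q. s \<odot>\<^bsub>RM\<^esub> g \<in> N"
  proof (rule self.nakayama_at_prime[OF G(1) Gc N' Q], rule)
    fix g assume g: "g \<in> G"
    then obtain s n h' where h: "s \<in> carrier R - Q" "n \<in> N" "h' \<in> H" "s \<otimes> g = n \<oplus> b \<otimes> h'" using hyp G by blast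
    obtain a where a: "a \<in> G \<rightarrow> carrier R" "h' = self.lincomb a G"
      using self.finite_span[OF G(1) Gc] h(3) G(3) by blast
    have "b \<otimes> h' = self.lincomb (\<lambda>g. b \<otimes> a g) G" using self.lincomb_smult[OF Gc a(1) bc] a(2) by simp
    moreover have "(\<lambda>g. b \<otimes> a g) \<in> G \<rightarrow> Q" using a b Q.I_r_closed by auto
    ultimately show "\<exists>s\<in>carrier R - Q. \<exists>f\<in>N. \<exists>a\<in>G \<rightarrow> Q.
        s \<odot>\<^bsub>RM\<^esub> g = f \<oplus>\<^bsub>RM\<^esub> self.lincomb a G" using h by auto
  qed
  then obtain s where s: "s \<in> carrier R - Q" "\<forall>g\<in>G. s \<otimes> g \<in> N"
    using self.prime_common_multiplier[OF Q N' G(1) Gc] by auto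
  have "ideal {a \<in> carrier R. \<forall>x\<in>{s}. a \<otimes> x \<in> N} R" using self.ideal_colon[OF N', of "{s}"] s by auto
  hence "submodule R {a \<in> carrier R. \<forall>x\<in>{s}. a \<otimes> x \<in> N} RM" using ideal_iff_submodule by blast
  moreover have "G \<subseteq> {a \<in> carrier R. \<forall>x\<in>{s}. a \<otimes> x \<in> N}" using s Gc m_comm[of s] by (auto simp: subset_iff)
  ultimately have "H \<subseteq> {a \<in> carrier R. \<forall>x\<in>{s}. a \<otimes> x \<in> N}" using self.span_least G(3) by blast
  thus ?thesis using s m_comm[of s] by (intro bexI[of _ s]) (auto simp: subset_iff)
qed

text \<open>Associated primes of an arbitrary module: annihilators maximal among those of the nonzero
  elements of a set stable under multiplication are prime.\<close>

lemma associated_prime: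
  assumes M: "module R M" and N: "submodule R N M" and v: "v \<in> carrier M" "v \<notin> N"
  obtains c Q where "c \<in> carrier R" "c \<odot>\<^sub>M v \<notin> N" "Q = {a \<in> carrier R. a \<odot>\<^sub>M (c \<odot>\<^sub>M v) \<in> N}"
    "primeideal Q R"
proof -
  interpret M: module R M by fact
  define ann where "ann c = {a \<in> carrier R. a \<odot>\<^sub>M (c \<odot>\<^sub>M v) \<in> N}" for c
  let ?S = "{ann c | c. c \<in> carrier R \<and> c \<odot>\<^sub>M v \<notin> N}"
  have id: "ideal (ann c) R" if "c \<in> carrier R" for c
    using M.ideal_colon[OF N, of "{c \<odot>\<^sub>M v}"] v that by (simp add: ann_def)
  have "ann \<one> \<in> ?S" using v by auto
  hence "?S \<noteq> {}" by blast
  moreover have "\<And>J. J \<in> ?S \<Longrightarrow> ideal J R" using id by auto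
  ultimately obtain J where J: "J \<in> ?S" "\<And>J'. J' \<in> ?S \<Longrightarrow> J \<subseteq> J' \<Longrightarrow> J' = J"
    using maximal_ideal_in_family[of ?S] by auto
  then obtain c where c: "J = ann c" "c \<in> carrier R" "c \<odot>\<^sub>M v \<notin> N" by blast
  have "primeideal J R"
  proof (rule primeidealI')
    show "ideal J R" using c id by auto
    show "\<one> \<notin> J" using c v by (auto simp: ann_def)
    fix a b assume ab: "a \<in> carrier R" "b \<in> carrier R" "a \<otimes> b \<in> J" "a \<notin> J"
    have "(a \<otimes> c) \<odot>\<^sub>M v \<notin> N" using ab c v by (auto simp: ann_def M.smult_assoc1)
    hence "ann (a \<otimes> c) \<in> ?S" using ab c by blast
    moreover have "J \<subseteq> ann (a \<otimes> c)"
    proof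
      fix d assume "d \<in> J"
      hence d: "d \<in> carrier R" "d \<odot>\<^sub>M (c \<odot>\<^sub>M v) \<in> N" using c by (auto simp: ann_def)
      hence "a \<odot>\<^sub>M (d \<odot>\<^sub>M (c \<odot>\<^sub>M v)) \<in> N" using M.submoduleD(4)[OF N] ab by blast
      thus "d \<in> ann (a \<otimes> c)" using d ab c v by (simp add: ann_def M.msimps)
    qed
    ultimately have "ann (a \<otimes> c) = J" using J by blast
    moreover have "b \<in> ann (a \<otimes> c)" using ab c v by (auto simp: ann_def M.msimps)
    ultimately show "b \<in> J" by simp
  qed
  thus ?thesis using that c by (auto simp: ann_def)
qed

end

section \<open>Noetherian local rings\<close>

locale noeth_local = noeth_cring +
  fixes \<mm>
  assumes m_ideal: "ideal \<mm> R" and m_proper: "\<one> \<notin> \<mm>"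
    and m_units: "\<And>a. a \<in> carrier R \<Longrightarrow> a \<notin> \<mm> \<Longrightarrow> a \<in> Units R"
begin

lemma m_carrier: "a \<in> \<mm> \<Longrightarrow> a \<in> carrier R" using idealD[OF m_ideal] by blast

lemma m_nonunit: "a \<in> \<mm> \<Longrightarrow> a \<notin> Units R"
proof
  assume a: "a \<in> \<mm>" "a \<in> Units R"
  hence "inv a \<otimes> a \<in> \<mm>" using idealD(4)[OF m_ideal] Units_inv_closed by blast
  thus False using a m_proper by simp
qed

lemma m_prime: "primeideal \<mm> R"
proof (rule primeidealI'[OF m_ideal m_proper])
  fix a b assume ab: "a \<in> carrier R" "b \<in> carrier R" "a \<otimes> b \<in> \<mm>" "a \<notin> \<mm>"
  hence u: "a \<in> Units R" using m_units by blast
  hence "inv a \<otimes> (a \<otimes> b) \<in> \<mm>" using ab idealD(4)[OF m_ideal] Units_inv_closed by blast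
  thus "b \<in> \<mm>" using ab u by (simp add: m_assoc[symmetric])
qed

lemma proper_ideal_le_m:
  assumes "ideal J R" "\<one> \<notin> J"
  shows "J \<subseteq> \<mm>"
proof
  fix a assume a: "a \<in> J"
  hence ac: "a \<in> carrier R" using idealD(1)[OF assms(1)] by blast
  show "a \<in> \<mm>"
  proof (rule ccontr)
    assume "a \<notin> \<mm>"
    hence u: "a \<in> Units R" using m_units ac by blast
    hence "inv a \<otimes> a \<in> J" using a idealD(4)[OF assms(1)] Units_inv_closed by blast
    thus False using u assms by simp
  qed
qed

lemma unit_smult_cancel:
  assumes "module R M" "submodule R N M" "s \<in> carrier R - \<mm>" "x \<in> carrier M" "s \<odot>\<^sub>M x \<in> N"
  shows "x \<in> N"
proof -
  interpret M: module R M by fact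
  have u: "s \<in> Units R" using assms m_units by blast
  hence "inv s \<odot>\<^sub>M (s \<odot>\<^sub>M x) \<in> N" using assms M.submoduleD(4)[OF assms(2)] Units_inv_closed by blast
  thus ?thesis using u assms by (simp add: M.smult_assoc1[symmetric])
qed

text \<open>Denominators outside \<open>\<mm>\<close> are units and cancel. Most vanishing results
  below come from this form: the elements of an annihilator are shown to be divisible by
  \<open>b\<close> inside that annihilator.\<close>

lemma nakayama_ideal_local:
  assumes N: "ideal N R" and H: "ideal H R" and b: "b \<in> \<mm>"
    and hyp: "\<And>h. h \<in> H \<Longrightarrow> \<exists>n\<in>N. \<exists>h'\<in>H. h = n \<oplus> b \<otimes> h'"
  shows "H \<subseteq> N"
proof -
  have Hc: "h \<in> carrier R" if "h \<in> H" for h using idealD(1)[OF H that] .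
  have "\<exists>s\<in>carrier R - \<mm>. \<forall>h\<in>H. s \<otimes> h \<in> N"
    using nakayama_ideal[OF m_prime N H b] hyp m_proper Hc by (metis DiffI l_one one_closed)
  thus ?thesis using unit_smult_cancel[OF self_module, of N] N ideal_iff_submodule Hc by auto
qed

end

section \<open>Finite linear combinations of tuples\<close>

text \<open>Sums over an initial segment of the naturals rather than over a finite set as in
  \<open>lincomb\<close>: rows of matrices may repeat, and such sums can be concatenated and
  exchanged.\<close>

primrec lcn :: "('a, 'm, 'x) module_scheme \<Rightarrow> nat \<Rightarrow> (nat \<Rightarrow> 'a) \<Rightarrow> (nat \<Rightarrow> 'm) \<Rightarrow> 'm" where
  "lcn M 0 a h = \<zero>\<^sub>M"
| "lcn M (Suc n) a h = lcn M n a h \<oplus>\<^sub>M a n \<odot>\<^sub>M h n"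

context module
begin

lemma lcn_closed [intro]:
  "(\<And>j. j < n \<Longrightarrow> a j \<in> carrier R) \<Longrightarrow> (\<And>j. j < n \<Longrightarrow> h j \<in> carrier M) \<Longrightarrow> lcn M n a h \<in> carrier M"
  by (induction n) auto

lemma lcn_submodule:
  "submodule R K M \<Longrightarrow> (\<And>j. j < n \<Longrightarrow> a j \<in> carrier R) \<Longrightarrow> (\<And>j. j < n \<Longrightarrow> h j \<in> K) \<Longrightarrow> lcn M n a h \<in> K"
  by (induction n) (auto dest: submoduleD)

lemma lcn_cong:
  "(\<And>j. j < n \<Longrightarrow> a j = a' j) \<Longrightarrow> (\<And>j. j < n \<Longrightarrow> h j = h' j) \<Longrightarrow> lcn M n a h = lcn M n a' h'" by (induction n) auto

lemma lcn_add_left: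
  assumes "\<And>j. j < n \<Longrightarrow> a j \<in> carrier R" "\<And>j. j < n \<Longrightarrow> b j \<in> carrier R" "\<And>j. j < n \<Longrightarrow> h j \<in> carrier M"
  shows "lcn M n (\<lambda>j. a j \<oplus> b j) h = lcn M n a h \<oplus>\<^sub>M lcn M n b h"
  using assms
proof (induction n)
  case (Suc n)
  have [simp]: "lcn M n a h \<in> carrier M" "lcn M n b h \<in> carrier M" using Suc.prems by auto
  show ?case using Suc by (simp add: msimps)
qed simp

lemma lcn_add_right:
  assumes "\<And>j. j < n \<Longrightarrow> a j \<in> carrier R" "\<And>j. j < n \<Longrightarrow> g j \<in> carrier M" "\<And>j. j < n \<Longrightarrow> h j \<in> carrier M"
  shows "lcn M n a (\<lambda>j. g j \<oplus>\<^sub>M h j) = lcn M n a g \<oplus>\<^sub>M lcn M n a h"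
  using assms
proof (induction n)
  case (Suc n)
  have [simp]: "lcn M n a h \<in> carrier M" "lcn M n a g \<in> carrier M" using Suc.prems by auto
  show ?case using Suc by (simp add: msimps)
qed simp

lemma lcn_smult_left:
  assumes "\<And>j. j < n \<Longrightarrow> a j \<in> carrier R" "\<And>j. j < n \<Longrightarrow> h j \<in> carrier M" "c \<in> carrier R"
  shows "lcn M n (\<lambda>j. c \<otimes> a j) h = c \<odot>\<^sub>M lcn M n a h"
  using assms
proof (induction n)
  case (Suc n)
  have [simp]: "lcn M n a h \<in> carrier M" using Suc.prems by auto
  show ?case using Suc by (simp add: msimps)
qed simp

lemma lcn_smult_right:
  assumes "\<And>j. j < n \<Longrightarrow> a j \<in> carrier R" "\<And>j. j < n \<Longrightarrow> h j \<in> carrier M" "c \<in> carrier R"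
  shows "lcn M n a (\<lambda>j. c \<odot>\<^sub>M h j) = c \<odot>\<^sub>M lcn M n a h"
  using assms
proof (induction n)
  case (Suc n)
  have [simp]: "lcn M n a h \<in> carrier M" using Suc.prems by auto
  show ?case using Suc by (simp add: msimps)
qed simp

lemma lcn_minus_right:
  assumes "\<And>j. j < n \<Longrightarrow> a j \<in> carrier R" "\<And>j. j < n \<Longrightarrow> g j \<in> carrier M" "\<And>j. j < n \<Longrightarrow> h j \<in> carrier M"
  shows "lcn M n a (\<lambda>j. g j \<ominus>\<^sub>M h j) = lcn M n a g \<ominus>\<^sub>M lcn M n a h"
proof -
  have "lcn M n a (\<lambda>j. g j \<ominus>\<^sub>M h j) = lcn M n a (\<lambda>j. g j \<oplus>\<^sub>M (\<ominus> \<one>) \<odot>\<^sub>M h j)"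
    using assms by (intro lcn_cong) (auto simp: a_minus_def smult_minus_1)
  also have "\<dots> = lcn M n a g \<oplus>\<^sub>M (\<ominus> \<one>) \<odot>\<^sub>M lcn M n a h"
    using assms by (subst lcn_add_right) (auto simp: lcn_smult_right)
  also have "\<dots> = lcn M n a g \<ominus>\<^sub>M lcn M n a h"
    using assms lcn_closed[of n a h] by (simp add: a_minus_def smult_minus_1)
  finally show ?thesis .
qed

lemma lcn_zero_left:
  "(\<And>j. j < n \<Longrightarrow> h j \<in> carrier M) \<Longrightarrow> (\<And>j. j < n \<Longrightarrow> a j = \<zero>) \<Longrightarrow> lcn M n a h = \<zero>\<^sub>M" by (induction n) auto

lemma lcn_zero_right:
  "(\<And>j. j < n \<Longrightarrow> a j \<in> carrier R) \<Longrightarrow> lcn M n a (\<lambda>j. \<zero>\<^sub>M) = \<zero>\<^sub>M" by (induction n) auto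

lemma lcn_vec:
  assumes "\<And>j. j < n \<Longrightarrow> a j \<in> carrier R" "\<And>j. j < n \<Longrightarrow> b j \<in> carrier R" "w \<in> carrier M"
  shows "lcn M n a (\<lambda>j. b j \<odot>\<^sub>M w) = lcn RM n a b \<odot>\<^sub>M w"
  using assms
proof (induction n)
  case (Suc n)
  have [simp]: "lcn RM n a b \<in> carrier R" using Suc.prems module.lcn_closed[OF R.self_module, of n a b] by auto
  show ?case using Suc by (simp add: msimps)
qed simp

lemma lcn_unit:
  assumes "\<And>j. j < n \<Longrightarrow> h j \<in> carrier M" "i < n"
  shows "lcn M n (\<lambda>j. if j = i then \<one> else \<zero>) h = h i"
  using assms
proof (induction n)
  case (Suc n)
  show ?case
  proof (cases "i = n")
    case True
    have "lcn M n (\<lambda>j. if j = i then \<one> else \<zero>) h = \<zero>\<^sub>M" using True Suc.prems by (intro lcn_zero_left) auto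
    thus ?thesis using True Suc.prems by simp
  next
    case False
    thus ?thesis using Suc by auto
  qed
qed simp

text \<open>Associativity of the product of a row, a matrix and a column. Relations among the rows
  \<open>l j\<close> therefore kill every tuple that the matrix produces from a column
  \<open>c\<close>.\<close>

lemma lcn_swap:
  assumes "\<And>j. j < m \<Longrightarrow> a j \<in> carrier R" "\<And>j k. j < m \<Longrightarrow> k < n \<Longrightarrow> l j k \<in> carrier R"
    "\<And>k. k < n \<Longrightarrow> c k \<in> carrier M"
  shows "lcn M m a (\<lambda>j. lcn M n (l j) c) = lcn M n (\<lambda>k. lcn RM m a (\<lambda>j. l j k)) c"
  using assms(2,3)
proof (induction n)
  case 0
  show ?case using assms(1) by (induction m) auto
next
  case (Suc n)
  have "lcn M m a (\<lambda>j. lcn M (Suc n) (l j) c) =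
      lcn M m a (\<lambda>j. lcn M n (l j) c) \<oplus>\<^sub>M lcn M m a (\<lambda>j. l j n \<odot>\<^sub>M c n)"
    using Suc.prems assms(1) by (simp add: lcn_add_right lcn_closed)
  also have "lcn M m a (\<lambda>j. l j n \<odot>\<^sub>M c n) = lcn RM m a (\<lambda>j. l j n) \<odot>\<^sub>M c n"
    using Suc.prems assms(1) by (intro lcn_vec) auto
  finally show ?case using Suc by simp
qed

lemma lcn_append:
  assumes "\<And>j. j < p + q \<Longrightarrow> a j \<in> carrier R" "\<And>j. j < p + q \<Longrightarrow> h j \<in> carrier M"
  shows "lcn M (p + q) a h = lcn M p a h \<oplus>\<^sub>M lcn M q (\<lambda>i. a (p + i)) (\<lambda>i. h (p + i))"
  using assms
proof (induction q)
  case 0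
  thus ?case using lcn_closed[of p a h] by simp
next
  case (Suc q)
  have "lcn M p a h \<in> carrier M" "lcn M q (\<lambda>i. a (p + i)) (\<lambda>i. h (p + i)) \<in> carrier M" using Suc.prems by auto
  thus ?case using Suc by (simp add: M.a_assoc)
qed

lemma lincomb_lcn:
  assumes "finite G" "G \<subseteq> carrier M"
  shows "\<exists>p g. (\<forall>i<p. g i \<in> G) \<and> (\<forall>a\<in>G \<rightarrow> carrier R. \<exists>b. (\<forall>i<p. b i \<in> carrier R) \<and> lincomb a G = lcn M p b g)"
  using assms
proof (induction G)
  case empty
  show ?case by (intro exI[of _ 0]) (auto simp: lincomb_def)
next
  case (insert x G)
  then obtain p g where g: "\<forall>i<p. g i \<in> G"
    "\<forall>a\<in>G \<rightarrow> carrier R. \<exists>b. (\<forall>i<p. b i \<in> carrier R) \<and> lincomb a G = lcn M p b g" by auto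
  let ?g = "g(p := x)"
  have "\<exists>b. (\<forall>i<Suc p. b i \<in> carrier R) \<and> lincomb a (insert x G) = lcn M (Suc p) b ?g"
    if a: "a \<in> insert x G \<rightarrow> carrier R" for a
  proof -
    obtain b where b: "\<forall>i<p. b i \<in> carrier R" "lincomb a G = lcn M p b g" using g a by fastforce
    have "lincomb a (G \<union> {x}) = a x \<odot>\<^sub>M x \<oplus>\<^sub>M lincomb a G" using insert a by (intro lincomb_insert) auto
    moreover have "lincomb a G \<in> carrier M" using a insert.prems by (intro lincomb_closed) auto
    ultimately have "lincomb a (insert x G) = lcn M p b g \<oplus>\<^sub>M a x \<odot>\<^sub>M x"
      using b a insert.prems by (simp add: M.a_comm Pi_iff)
    also have "\<dots> = lcn M (Suc p) (b(p := a x)) ?g" by (simp cong: lcn_cong)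
    finally show ?thesis using b a by (intro exI[of _ "b(p := a x)"]) (auto simp: Pi_iff less_Suc_eq)
  qed
  moreover have "\<forall>i<Suc p. ?g i \<in> insert x G" using g by (auto simp: less_Suc_eq)
  ultimately show ?case by blast
qed

end

lemma lcn_hom:
  assumes "module R M" "module R N" "f \<in> module_hom R M N"
    "\<And>j. j < n \<Longrightarrow> a j \<in> carrier R" "\<And>j. j < n \<Longrightarrow> h j \<in> carrier M"
  shows "f (lcn M n a h) = lcn N n a (\<lambda>j. f (h j))"
proof -
  interpret mod_hom R M N f using assms by (simp add: mod_hom_def mod_hom_axioms_def)
  show ?thesis using assms(4,5) by (induction n) (auto simp: M.lcn_closed)
qed

subsection \<open>Submodules of \<open>R\<^sup>m\<close>\<close>

text \<open>Tuples are functions on \<^typ>\<open>nat\<close> of which only the first \<open>m\<close> values matter.\<close>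

definition tuple_module :: "('a, 'k) ring_scheme \<Rightarrow> nat \<Rightarrow> (nat \<Rightarrow> 'a) set \<Rightarrow> bool" where
  "tuple_module R m H \<longleftrightarrow> H \<noteq> {} \<and> (\<forall>h\<in>H. \<forall>j<m. h j \<in> carrier R) \<and>
     (\<forall>g\<in>H. \<forall>h\<in>H. (\<lambda>j. g j \<oplus>\<^sub>R h j) \<in> H) \<and> (\<forall>c\<in>carrier R. \<forall>h\<in>H. (\<lambda>j. c \<otimes>\<^sub>R h j) \<in> H) \<and>
     (\<forall>h\<in>H. \<forall>g. (\<forall>j<m. g j = h j) \<longrightarrow> g \<in> H)"

context cring
begin

lemma minus_add_cancel_right: "u \<in> carrier R \<Longrightarrow> v \<in> carrier R \<Longrightarrow> u \<ominus> v \<oplus> v = u" by algebra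

lemma tuple_moduleD:
  assumes "tuple_module R m H"
  shows "h \<in> H \<Longrightarrow> j < m \<Longrightarrow> h j \<in> carrier R" "g \<in> H \<Longrightarrow> h \<in> H \<Longrightarrow> (\<lambda>j. g j \<oplus> h j) \<in> H"
    "c \<in> carrier R \<Longrightarrow> h \<in> H \<Longrightarrow> (\<lambda>j. c \<otimes> h j) \<in> H" "h \<in> H \<Longrightarrow> (\<And>j. j < m \<Longrightarrow> g j = h j) \<Longrightarrow> g \<in> H"
    "\<exists>h. h \<in> H" using assms unfolding tuple_module_def by blast+

lemma tuple_module_minus:
  assumes H: "tuple_module R m H" and "g \<in> H" "h \<in> H"
  shows "(\<lambda>j. g j \<ominus> h j) \<in> H"
proof (rule tuple_moduleD(4)[OF H])
  show "(\<lambda>j. g j \<oplus> (\<ominus> \<one>) \<otimes> h j) \<in> H" using assms tuple_moduleD(2,3)[OF H] by auto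
  fix j assume j: "j < m"
  hence "g j \<in> carrier R" "h j \<in> carrier R" using tuple_moduleD(1)[OF H] assms by auto
  thus "g j \<ominus> h j = g j \<oplus> (\<ominus> \<one>) \<otimes> h j" by algebra
qed

text \<open>The last coordinates of \<open>H\<close>, and the elements with last coordinate zero in
  \<open>tuple_module_kernel\<close>, are the two ends of an exact sequence; induction on the number
  of coordinates reduces submodules of a free module to ideals.\<close>

lemma tuple_module_coord:
  assumes H: "tuple_module R (Suc m) H"
  shows "ideal {h m | h. h \<in> H} R"
  unfolding ideal_iff
proof (intro conjI ballI)
  show "{h m | h. h \<in> H} \<subseteq> carrier R" using tuple_moduleD(1)[OF H] by auto
  obtain h where h: "h \<in> H" using tuple_moduleD(5)[OF H] by blast
  hence "\<zero> = (\<lambda>j. \<zero> \<otimes> h j) m" using tuple_moduleD(1)[OF H] by auto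
  thus "\<zero> \<in> {h m | h. h \<in> H}" using tuple_moduleD(3)[OF H zero_closed h]
    by (intro CollectI exI[of _ "\<lambda>j. \<zero> \<otimes> h j"]) auto
next
  fix x y assume "x \<in> {h m | h. h \<in> H}" "y \<in> {h m | h. h \<in> H}"
  then obtain g h where g: "g \<in> H" "h \<in> H" "x = g m" "y = h m" by blast
  hence "x \<oplus> y = (\<lambda>j. g j \<oplus> h j) m" by simp
  thus "x \<oplus> y \<in> {h m | h. h \<in> H}" using tuple_moduleD(2)[OF H g(1,2)]
    by (intro CollectI exI[of _ "\<lambda>j. g j \<oplus> h j"]) auto
next
  fix c x assume c: "c \<in> carrier R" "x \<in> {h m | h. h \<in> H}"
  then obtain h where h: "h \<in> H" "x = h m" by blast
  hence "c \<otimes> x = (\<lambda>j. c \<otimes> h j) m" by simp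
  thus "c \<otimes> x \<in> {h m | h. h \<in> H}" using tuple_moduleD(3)[OF H c(1) h(1)]
    by (intro CollectI exI[of _ "\<lambda>j. c \<otimes> h j"]) auto
qed

lemma tuple_module_kernel:
  assumes H: "tuple_module R (Suc m) H"
  shows "tuple_module R m {h. \<exists>h'\<in>H. h' m = \<zero> \<and> (\<forall>j<m. h j = h' j)}"
  unfolding tuple_module_def
proof (intro conjI ballI allI impI)
  obtain h where h: "h \<in> H" using tuple_moduleD(5)[OF H] by blast
  have "(\<lambda>j. \<zero> \<otimes> h j) \<in> {h. \<exists>h'\<in>H. h' m = \<zero> \<and> (\<forall>j<m. h j = h' j)}"
    using tuple_moduleD(1,3)[OF H] h by (intro CollectI bexI[of _ "\<lambda>j. \<zero> \<otimes> h j"]) auto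
  thus "{h. \<exists>h'\<in>H. h' m = \<zero> \<and> (\<forall>j<m. h j = h' j)} \<noteq> {}" by (metis (no_types) empty_iff)
next
  fix h j assume "h \<in> {h. \<exists>h'\<in>H. h' m = \<zero> \<and> (\<forall>j<m. h j = h' j)}" "j < m"
  thus "h j \<in> carrier R" using tuple_moduleD(1)[OF H] by auto
next
  fix g h assume "g \<in> {h. \<exists>h'\<in>H. h' m = \<zero> \<and> (\<forall>j<m. h j = h' j)}"
    "h \<in> {h. \<exists>h'\<in>H. h' m = \<zero> \<and> (\<forall>j<m. h j = h' j)}"
  then obtain g' h' where g: "g' \<in> H" "h' \<in> H" "g' m = \<zero>" "h' m = \<zero>" "\<forall>j<m. h j = h' j" "\<forall>j<m. g j = g' j"
    by blast
  show "(\<lambda>j. g j \<oplus> h j) \<in> {h. \<exists>h'\<in>H. h' m = \<zero> \<and> (\<forall>j<m. h j = h' j)}"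
    using g tuple_moduleD(2)[OF H g(1,2)] by (intro CollectI bexI[of _ "\<lambda>j. g' j \<oplus> h' j"]) auto
next
  fix c h assume "c \<in> carrier R" "h \<in> {h. \<exists>h'\<in>H. h' m = \<zero> \<and> (\<forall>j<m. h j = h' j)}"
  then obtain h' where g: "c \<in> carrier R" "h' \<in> H" "h' m = \<zero>" "\<forall>j<m. h j = h' j" by blast
  show "(\<lambda>j. c \<otimes> h j) \<in> {h. \<exists>h'\<in>H. h' m = \<zero> \<and> (\<forall>j<m. h j = h' j)}"
    using g tuple_moduleD(3)[OF H g(1,2)] by (intro CollectI bexI[of _ "\<lambda>j. c \<otimes> h' j"]) auto
next
  fix h g assume "h \<in> {h. \<exists>h'\<in>H. h' m = \<zero> \<and> (\<forall>j<m. h j = h' j)}" "\<forall>j<m. g j = h j"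
  thus "g \<in> {h. \<exists>h'\<in>H. h' m = \<zero> \<and> (\<forall>j<m. h j = h' j)}" by auto
qed

end

lemma (in noeth_cring) ideal_fg_tuple:
  assumes "ideal J R"
  shows "\<exists>p g. (\<forall>i<p. g i \<in> J) \<and> (\<forall>x\<in>J. \<exists>b. (\<forall>i<p. b i \<in> carrier R) \<and> x = lcn RM p b g)"
proof -
  obtain G where G: "finite G" "G \<subseteq> J" "J = self.span G" using ideal_fg[OF assms] .
  have Gc: "G \<subseteq> carrier RM" using G idealD[OF assms] by auto
  obtain p g where g: "\<forall>i<p. g i \<in> G"
    "\<forall>a\<in>G \<rightarrow> carrier R. \<exists>b. (\<forall>i<p. b i \<in> carrier R) \<and> self.lincomb a G = lcn RM p b g"
    using self.lincomb_lcn[OF G(1) Gc] by blast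
  have "\<exists>b. (\<forall>i<p. b i \<in> carrier R) \<and> x = lcn RM p b g" if "x \<in> J" for x
  proof -
    obtain a where "a \<in> G \<rightarrow> carrier R" "self.lincomb a G = x"
      using self.finite_in_span[OF G(1) Gc] G(3) \<open>x \<in> J\<close> by blast
    thus ?thesis using g(2) by metis
  qed
  thus ?thesis using g(1) G(2) by blast
qed

text \<open>Generators of the kernel of the last coordinate, followed by lifts of generators of the
  ideal of last coordinates. Applied later to the syzygies of a matrix.\<close>

lemma (in noeth_cring) tuple_module_fg:
  assumes "tuple_module R m H"
  shows "\<exists>p G. (\<forall>i<p. G i \<in> H) \<and>
    (\<forall>h\<in>H. \<exists>a. (\<forall>i<p. a i \<in> carrier R) \<and> (\<forall>j<m. h j = lcn RM p a (\<lambda>i. G i j)))" using assms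
proof (induction m arbitrary: H)
  case 0
  thus ?case by (intro exI[of _ 0]) auto
next
  case (Suc m)
  note H = Suc.prems
  let ?H0 = "{h. \<exists>h'\<in>H. h' m = \<zero> \<and> (\<forall>j<m. h j = h' j)}"
  obtain p G where G: "\<forall>i<p. G i \<in> ?H0"
    "\<forall>h\<in>?H0. \<exists>a. (\<forall>i<p. a i \<in> carrier R) \<and> (\<forall>j<m. h j = lcn RM p a (\<lambda>i. G i j))"
    using Suc.IH[OF tuple_module_kernel[OF H]] by blast
  hence "\<forall>i. \<exists>h'. i < p \<longrightarrow> h' \<in> H \<and> h' m = \<zero> \<and> (\<forall>j<m. G i j = h' j)" by blast
  then obtain G' where G': "\<And>i. i < p \<Longrightarrow> G' i \<in> H \<and> G' i m = \<zero> \<and> (\<forall>j<m. G i j = G' i j)" by metis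
  obtain q g where g: "\<forall>i<q. g i \<in> {h m | h. h \<in> H}"
    "\<forall>x\<in>{h m | h. h \<in> H}. \<exists>b. (\<forall>i<q. b i \<in> carrier R) \<and> x = lcn RM q b g"
    using ideal_fg_tuple[OF tuple_module_coord[OF H]] by blast
  hence "\<forall>i. \<exists>h. i < q \<longrightarrow> h \<in> H \<and> g i = h m" by blast
  then obtain F where F: "\<And>i. i < q \<Longrightarrow> F i \<in> H \<and> g i = F i m" by metis
  let ?G = "\<lambda>i. if i < p then G' i else F (i - p)"
  have GH: "?G i \<in> H" if "i < p + q" for i using that G' F by auto
  have Hc: "h j \<in> carrier R" if "h \<in> H" "j < Suc m" for h j using tuple_moduleD(1)[OF H] that by blast
  have lcH: "(\<lambda>j. lcn RM k b (\<lambda>i. Y i j)) \<in> H"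
    if "\<forall>i<k. b i \<in> carrier R" "\<forall>i<k. Y i \<in> H" for k b Y using that
  proof (induction k)
    case 0
    obtain h where h: "h \<in> H" using tuple_moduleD(5)[OF H] by blast
    show ?case by (rule tuple_moduleD(4)[OF H tuple_moduleD(3)[OF H zero_closed h]]) (use Hc h in auto)
  next
    case (Suc k)
    have "(\<lambda>j. b k \<otimes> Y k j) \<in> H" using tuple_moduleD(3)[OF H] Suc.prems by auto
    thus ?case using Suc tuple_moduleD(2)[OF H] by auto
  qed
  have "\<exists>a. (\<forall>i<p + q. a i \<in> carrier R) \<and> (\<forall>j<Suc m. h j = lcn RM (p + q) a (\<lambda>i. ?G i j))"
    if h: "h \<in> H" for h
  proof -
    obtain b where b: "\<forall>i<q. b i \<in> carrier R" "h m = lcn RM q b g" using g(2) h by blast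
    let ?f = "\<lambda>j. lcn RM q b (\<lambda>i. F i j)"
    have f: "?f \<in> H" using lcH[of q b F] b F by blast
    have fm: "?f m = h m" unfolding b(2) using F by (intro self.lcn_cong) auto
    have d: "(\<lambda>j. h j \<ominus> ?f j) \<in> H" using tuple_module_minus[OF H h f] .
    have "h m \<ominus> ?f m = \<zero>" unfolding fm using Hc[OF h, of m] by (simp add: r_neg a_minus_def)
    hence d0: "(\<lambda>j. h j \<ominus> ?f j) \<in> ?H0" by (intro CollectI bexI[OF _ d]) auto
    obtain a where a: "\<forall>i<p. a i \<in> carrier R"
      "\<forall>j<m. h j \<ominus> ?f j = lcn RM p a (\<lambda>i. G i j)" using bspec[OF G(2) d0] by blast
    let ?a = "\<lambda>i. if i < p then a i else b (i - p)"
    have ac: "\<forall>i<p+q. ?a i \<in> carrier R" using a b by auto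
    have "h j = lcn RM (p + q) ?a (\<lambda>i. ?G i j)" if j: "j < Suc m" for j
    proof -
      have hc: "h j \<in> carrier R" "?f j \<in> carrier R" using Hc[OF h j] Hc[OF f j] by auto
      have "lcn RM (p + q) ?a (\<lambda>i. ?G i j) =
        lcn RM p ?a (\<lambda>i. ?G i j) \<oplus> lcn RM q (\<lambda>i. ?a (p + i)) (\<lambda>i. ?G (p + i) j)"
        using self.lcn_append[of p q ?a "\<lambda>i. ?G i j"] ac GH Hc j by auto
      also have "lcn RM q (\<lambda>i. ?a (p + i)) (\<lambda>i. ?G (p + i) j) = ?f j" by simp
      also have "lcn RM p ?a (\<lambda>i. ?G i j) = lcn RM p a (\<lambda>i. G' i j)" by (intro self.lcn_cong) auto
      also have "\<dots> = h j \<ominus> ?f j"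
      proof (cases "j = m")
        case True
        have "lcn RM p a (\<lambda>i. G' i j) = lcn RM p a (\<lambda>i. \<zero>)" using True G' a by (intro self.lcn_cong) auto
        also have "\<dots> = \<zero>" using self.lcn_zero_right[of p a] a by auto
        finally show ?thesis using True \<open>h m \<ominus> ?f m = \<zero>\<close> by simp
      next
        case False
        hence "j < m" using j by simp
        moreover have "lcn RM p a (\<lambda>i. G' i j) = lcn RM p a (\<lambda>i. G i j)"
          using G' \<open>j < m\<close> by (intro self.lcn_cong) auto
        ultimately show ?thesis using a by auto
      qed
      also have "h j \<ominus> ?f j \<oplus> ?f j = h j" using minus_add_cancel_right[OF hc] .
      finally show ?thesis by simp
    qed
    hence "\<forall>j<Suc m. h j = lcn RM (p + q) ?a (\<lambda>i. ?G i j)" by blast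
    with ac show ?thesis by (intro exI[of _ ?a] conjI)
  qed
  hence "\<forall>h\<in>H. \<exists>a. (\<forall>i<p + q. a i \<in> carrier R) \<and>
    (\<forall>j<Suc m. h j = lcn RM (p + q) a (\<lambda>i. ?G i j))" by (rule ballI)
  moreover have "\<forall>i<p + q. ?G i \<in> H" using GH by blast
  ultimately show ?case by (intro exI[of _ "p + q"] exI[of _ ?G] conjI)
qed

text \<open>For the ideal of last coordinates this is \<open>nakayama_ideal_local\<close>. For the
  kernel of the last coordinate the hypothesis has to be corrected first, since the element
  \<open>h'\<close> that it supplies may have a nonzero last coordinate.\<close>

lemma (in noeth_local) nakayama_tuple:
  assumes "tuple_module R m N" "tuple_module R m H" "N \<subseteq> H" "y \<in> \<mm>"
    and "\<And>h. h \<in> H \<Longrightarrow> \<exists>n\<in>N. \<exists>h'\<in>H. \<forall>j<m. h j = n j \<oplus> y \<otimes> h' j"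
  shows "H \<subseteq> N"
  using assms(1-3,5)
proof (induction m arbitrary: N H)
  case 0
  thus ?case using tuple_moduleD(4,5)[OF 0(1)] by blast
next
  case (Suc m)
  note N = Suc.prems(1) and H = Suc.prems(2)
  have yc: "y \<in> carrier R" using assms(4) m_carrier by blast
  have Hc: "h j \<in> carrier R" if "h \<in> H" "j < Suc m" for h j using tuple_moduleD(1)[OF H] that by blast
  have NH: "n \<in> H" if "n \<in> N" for n using Suc.prems(3) that by blast
  have pi: "{h m | h. h \<in> H} \<subseteq> {h m | h. h \<in> N}"
  proof (rule nakayama_ideal_local[OF tuple_module_coord[OF N] tuple_module_coord[OF H] assms(4)])
    fix x assume "x \<in> {h m | h. h \<in> H}"
    then obtain h where h: "h \<in> H" "x = h m" by blast
    then obtain n h' where "n \<in> N" "h' \<in> H" "h m = n m \<oplus> y \<otimes> h' m" using Suc.prems(4)[OF h(1)] by blast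
    thus "\<exists>n\<in>{h m | h. h \<in> N}. \<exists>h'\<in>{h m | h. h \<in> H}. x = n \<oplus> y \<otimes> h'" using h by blast
  qed
  let ?H0 = "{h. \<exists>h'\<in>H. h' m = \<zero> \<and> (\<forall>j<m. h j = h' j)}"
  let ?N0 = "{h. \<exists>h'\<in>N. h' m = \<zero> \<and> (\<forall>j<m. h j = h' j)}"
  have HN0: "?H0 \<subseteq> ?N0"
  proof (rule Suc.IH[OF tuple_module_kernel[OF N] tuple_module_kernel[OF H]])
    show "?N0 \<subseteq> ?H0" using NH by blast
    fix h assume "h \<in> ?H0"
    then obtain h' where h': "h' \<in> H" "h' m = \<zero>" "\<forall>j<m. h j = h' j" by blast
    obtain n g where n: "n \<in> N" "g \<in> H" "\<forall>j<Suc m. h' j = n j \<oplus> y \<otimes> g j" using Suc.prems(4)[OF h'(1)] by blast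
    obtain n' where n': "n' \<in> N" "g m = n' m" using pi n(2) by blast
    \<comment> \<open>\<open>N\<close> already attains every last coordinate of \<open>H\<close>, so
      \<open>n'\<close> can match \<open>g\<close> there. Moving \<open>y \<otimes> n'\<close> from
      one summand to the other makes both summands vanish in the last coordinate.\<close>
    let ?n = "\<lambda>j. n j \<oplus> y \<otimes> n' j" let ?g = "\<lambda>j. g j \<ominus> n' j"
    have nN: "?n \<in> N" using tuple_moduleD(2)[OF N n(1) tuple_moduleD(3)[OF N yc n'(1)]] .
    have gH: "?g \<in> H" using tuple_module_minus[OF H n(2) NH[OF n'(1)]] .
    have gm: "?g m = \<zero>" using n' Hc[OF n(2), of m] by (simp add: a_minus_def r_neg)
    have nm: "?n m = \<zero>" using n(3) n'(2) h'(2) by auto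
    have "h j = ?n j \<oplus> y \<otimes> ?g j" if j: "j < m" for j
    proof -
      have "n j \<in> carrier R" "n' j \<in> carrier R" "g j \<in> carrier R" using j Hc NH n n' by auto
      hence "n j \<oplus> y \<otimes> g j = n j \<oplus> y \<otimes> n' j \<oplus> y \<otimes> (g j \<ominus> n' j)" using yc by algebra
      thus ?thesis using h'(3) n(3) j by simp
    qed
    hence "\<forall>j<m. h j = ?n j \<oplus> y \<otimes> ?g j" by blast
    moreover have n0: "?n \<in> ?N0" by (intro CollectI bexI[OF _ nN]) (use nm in auto)
    moreover have g0: "?g \<in> ?H0" by (intro CollectI bexI[OF _ gH]) (use gm in auto)
    ultimately show "\<exists>n\<in>?N0. \<exists>h'\<in>?H0. \<forall>j<m. h j = n j \<oplus> y \<otimes> h' j" by (rule_tac bexI[OF bexI[OF _ g0] n0])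
  qed
  show ?case
  proof
    fix h assume h: "h \<in> H"
    then obtain n where n: "n \<in> N" "h m = n m" using pi by blast
    have d: "(\<lambda>j. h j \<ominus> n j) \<in> H" using tuple_module_minus[OF H h NH[OF n(1)]] .
    have "h m \<ominus> n m = \<zero>" using n Hc[OF h, of m] by (simp add: a_minus_def r_neg)
    hence "(\<lambda>j. h j \<ominus> n j) \<in> ?H0" by (intro CollectI bexI[OF _ d]) auto
    from subsetD[OF HN0 this] obtain n' where n': "n' \<in> N" "n' m = \<zero>" "\<forall>j<m. h j \<ominus> n j = n' j" by blast
    show "h \<in> N"
    proof (rule tuple_moduleD(4)[OF N tuple_moduleD(2)[OF N n'(1) n(1)]])
      fix j assume j: "j < Suc m"
      have c: "h j \<in> carrier R" "n j \<in> carrier R" using j Hc h NH n by auto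
      show "h j = n' j \<oplus> n j"
      proof (cases "j = m")
        case True thus ?thesis using n n' c by simp
      next
        case False
        hence "n' j = h j \<ominus> n j" using n' j by simp
        moreover have "h j = h j \<ominus> n j \<oplus> n j" using c by algebra
        ultimately show ?thesis by simp
      qed
    qed
  qed
qed

section \<open>Injectivity and linear systems\<close>

text \<open>Baer's criterion taken as injectivity of a subset \<open>K\<close> of \<open>E\<close>,
  so that it can be asked of the kernels in a resolution without forming new module records. The
  function \<open>f\<close> is total, but only its values on \<open>J\<close> count.\<close>

definition baer :: "('a, 'k) ring_scheme \<Rightarrow> ('a, 'm, 'l) module_scheme \<Rightarrow> 'm set \<Rightarrow> bool" where
  "baer R E K \<longleftrightarrow> (\<forall>J f. ideal J R \<and> (\<forall>a\<in>J. f a \<in> K) \<and> (\<forall>a\<in>J. \<forall>b\<in>J. f (a \<oplus>\<^sub>R b) = f a \<oplus>\<^sub>E f b) \<and>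
     (\<forall>c\<in>carrier R. \<forall>a\<in>J. f (c \<otimes>\<^sub>R a) = c \<odot>\<^sub>E f a) \<longrightarrow> (\<exists>w\<in>K. \<forall>a\<in>J. f a = a \<odot>\<^sub>E w))"

text \<open>The definition of injective modules tests only modules with elements in
  \<open>(nat \<times> 'a) set\<close>. To reach Baer's criterion the ring is copied into that type,
  \<open>a\<close> being represented by the singleton of \<open>(0, a)\<close>.\<close>

definition coded_ring_module :: "('a, 'k) ring_scheme \<Rightarrow> ('a, (nat \<times> 'a) set) module" where
  "coded_ring_module R =
     \<lparr>carrier = (\<lambda>a. {(0, a)}) ` carrier R, mult = undefined, one = undefined, zero = {(0, \<zero>\<^sub>R)},
      add = (\<lambda>X Y. {(0, snd (the_elem X) \<oplus>\<^sub>R snd (the_elem Y))}),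
      smult = (\<lambda>c X. {(0, c \<otimes>\<^sub>R snd (the_elem X))})\<rparr>"

lemma (in cring) coded_ring_module: "module R (coded_ring_module R)"
proof (rule moduleI)
  show "abelian_group (coded_ring_module R)"
  proof (rule abelian_groupI)
    fix x assume "x \<in> carrier (coded_ring_module R)"
    then obtain a where a: "a \<in> carrier R" "x = {(0, a)}" by (auto simp: coded_ring_module_def)
    hence "{(0, \<ominus> a)} \<in> carrier (coded_ring_module R)"
      "{(0, \<ominus> a)} \<oplus>\<^bsub>coded_ring_module R\<^esub> x = \<zero>\<^bsub>coded_ring_module R\<^esub>" by (auto simp: coded_ring_module_def l_neg)
    thus "\<exists>y\<in>carrier (coded_ring_module R). y \<oplus>\<^bsub>coded_ring_module R\<^esub> x = \<zero>\<^bsub>coded_ring_module R\<^esub>" by blast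
  qed (auto simp: coded_ring_module_def a_ac)
qed (auto simp: coded_ring_module_def l_distr r_distr m_assoc is_cring)

lemma injective_module_baer:
  fixes R :: "('a, 'k) ring_scheme" and E :: "('a, 'e, 'l) module_scheme"
  assumes R: "cring R" and E: "injective_module R E"
  shows "baer R E (carrier E)"
  unfolding baer_def
proof (intro allI impI, elim conjE)
  interpret cring R by fact
  fix J f
  assume J: "ideal J R" and f: "\<forall>a\<in>J. f a \<in> carrier E" "\<forall>a\<in>J. \<forall>b\<in>J. f (a \<oplus>\<^sub>R b) = f a \<oplus>\<^sub>E f b"
    "\<forall>c\<in>carrier R. \<forall>a\<in>J. f (c \<otimes>\<^sub>R a) = c \<odot>\<^sub>E f a"
  let ?P = "coded_ring_module R" and ?c = "\<lambda>a :: 'a. {(0 :: nat, a)}"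
  let ?N = "?c ` J" and ?f = "\<lambda>X. f (snd (the_elem X))"
  interpret P: module R ?P by (rule coded_ring_module)
  note Jd = idealD[OF J]
  have N: "submodule R ?N ?P" unfolding P.submodule_iff
  proof (intro conjI ballI)
    show "?N \<subseteq> carrier ?P" using Jd(1) by (auto simp: coded_ring_module_def)
    show "\<zero>\<^bsub>?P\<^esub> \<in> ?N" using Jd(2) by (auto simp: coded_ring_module_def)
    fix x y assume "x \<in> ?N" "y \<in> ?N"
    thus "x \<oplus>\<^bsub>?P\<^esub> y \<in> ?N" using Jd(3) by (auto simp: coded_ring_module_def)
  next
    fix a x assume "a \<in> carrier R" "x \<in> ?N"
    thus "a \<odot>\<^bsub>?P\<^esub> x \<in> ?N" using Jd(4) by (auto simp: coded_ring_module_def)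
  qed
  have "?f \<in> module_hom R (?P\<lparr>carrier := ?N\<rparr>) E"
    unfolding module_hom_def using f by (auto simp: coded_ring_module_def)
  then obtain g where g: "g \<in> module_hom R ?P E" "\<forall>x\<in>?N. g x = ?f x"
    using E P.module_axioms N unfolding injective_module_def by blast
  let ?w = "g (?c \<one>\<^sub>R)"
  have one: "?c \<one>\<^sub>R \<in> carrier ?P" by (auto simp: coded_ring_module_def)
  have w: "?w \<in> carrier E" using g(1) one unfolding module_hom_def by blast
  have "f a = a \<odot>\<^sub>E ?w" if a: "a \<in> J" for a
  proof -
    have ac: "a \<in> carrier R" using a Jd(1) by blast
    have "f a = g (?c a)" using g(2) a by auto
    also have "?c a = a \<odot>\<^bsub>?P\<^esub> ?c \<one>\<^sub>R" using ac by (auto simp: coded_ring_module_def)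
    also have "g \<dots> = a \<odot>\<^sub>E ?w" using module_hom_smult[OF g(1) ac one] .
    finally show ?thesis .
  qed
  thus "\<exists>w\<in>carrier E. \<forall>a\<in>J. f a = a \<odot>\<^sub>E w" using w by blast
qed

text \<open>Homomorphisms from an ideal are given here as graphs: many of them send something like
  \<open>y a + j\<close> to \<open>a z\<close>, where \<open>a\<close> and \<open>j\<close> are not
  determined by the sum. Additivity together with a trivial fibre over zero makes the relation
  single valued.\<close>

lemma (in module) baer_relation:
  assumes K: "baer R M K" "submodule R K M"
    and r: "\<And>a z. (a, z) \<in> r \<Longrightarrow> a \<in> carrier R \<and> z \<in> K" "(\<zero>, \<zero>\<^sub>M) \<in> r"
    "\<And>a z b w. (a, z) \<in> r \<Longrightarrow> (b, w) \<in> r \<Longrightarrow> (a \<oplus> b, z \<oplus>\<^sub>M w) \<in> r"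
    "\<And>c a z. c \<in> carrier R \<Longrightarrow> (a, z) \<in> r \<Longrightarrow> (c \<otimes> a, c \<odot>\<^sub>M z) \<in> r"
    and single: "\<And>z. (\<zero>, z) \<in> r \<Longrightarrow> z = \<zero>\<^sub>M"
  shows "\<exists>w\<in>K. \<forall>a z. (a, z) \<in> r \<longrightarrow> z = a \<odot>\<^sub>M w"
proof -
  have Kc: "z \<in> carrier M" if "z \<in> K" for z using submoduleD(1)[OF K(2) that] .
  have uniq: "z = w" if h: "(a, z) \<in> r" "(a, w) \<in> r" for a z w
  proof -
    have c: "a \<in> carrier R" "z \<in> carrier M" "w \<in> carrier M" using h r(1) Kc by blast+
    have "(a \<oplus> (\<ominus> \<one>) \<otimes> a, z \<oplus>\<^sub>M (\<ominus> \<one>) \<odot>\<^sub>M w) \<in> r" using h r(3,4) by simp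
    moreover have "a \<oplus> (\<ominus> \<one>) \<otimes> a = \<zero>" using c by algebra
    ultimately have "z \<oplus>\<^sub>M (\<ominus> \<one>) \<odot>\<^sub>M w = \<zero>\<^sub>M" using single by simp
    hence "z \<ominus>\<^sub>M w = \<zero>\<^sub>M" using c by (simp add: a_minus_def smult_minus_1)
    thus ?thesis using c by simp
  qed
  define J where "J = {a. \<exists>z. (a, z) \<in> r}"
  define f where "f a = (SOME z. (a, z) \<in> r)" for a
  have f: "(a, f a) \<in> r" if "a \<in> J" for a
    using that someI_ex[of "\<lambda>z. (a, z) \<in> r"] unfolding J_def f_def by blast
  have fe: "f a = z" if "(a, z) \<in> r" for a z using uniq[OF _ that] f that unfolding J_def by blast
  have "ideal J R" unfolding R.ideal_iff J_def using r by blast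
  moreover have "\<forall>a\<in>J. f a \<in> K" using f r(1) by blast
  moreover have "\<forall>a\<in>J. \<forall>b\<in>J. f (a \<oplus> b) = f a \<oplus>\<^sub>M f b" using f fe r(3) by blast
  moreover have "\<forall>c\<in>carrier R. \<forall>a\<in>J. f (c \<otimes> a) = c \<odot>\<^sub>M f a" using f fe r(4) by blast
  ultimately obtain w where w: "w \<in> K" "\<forall>a\<in>J. f a = a \<odot>\<^sub>M w" using K(1) unfolding baer_def by blast
  have "z = a \<odot>\<^sub>M w" if "(a, z) \<in> r" for a z using w(2) fe[OF that] that unfolding J_def by blast
  thus ?thesis using w(1) by blast
qed

text \<open>
  The rows \<open>l j\<close> of an \<open>m \<times> n\<close> matrix span a submodule \<open>L\<close> of \<open>R\<^sup>n\<close>. The tuples satisfying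
  \<open>consistent\<close> are the homomorphisms from \<open>L\<close> to \<open>K\<close>, given by their values on the rows, and
  \<open>solvable\<close> singles out the restrictions of homomorphisms from \<open>R\<^sup>n\<close> to \<open>K\<close>. So consistent
  modulo solvable tuples form \<open>Ext\<^sup>1(R\<^sup>n / L, K)\<close>.
\<close>

definition consistent ::
  "('a, 'k) ring_scheme \<Rightarrow> ('a, 'm, 'l) module_scheme \<Rightarrow> 'm set \<Rightarrow> nat \<Rightarrow> nat \<Rightarrow> (nat \<Rightarrow> nat \<Rightarrow> 'a) \<Rightarrow>
   (nat \<Rightarrow> 'm) \<Rightarrow> bool" where
  "consistent R E K m n l h \<longleftrightarrow> (\<forall>j<m. h j \<in> K) \<and>
     (\<forall>a. (\<forall>j<m. a j \<in> carrier R) \<and> (\<forall>k<n. lcn (self_module R) m a (\<lambda>j. l j k) = \<zero>\<^sub>R) \<longrightarrow>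
        lcn E m a h = \<zero>\<^sub>E)"

definition solvable ::
  "('a, 'm, 'l) module_scheme \<Rightarrow> 'm set \<Rightarrow> nat \<Rightarrow> nat \<Rightarrow> (nat \<Rightarrow> nat \<Rightarrow> 'a) \<Rightarrow> (nat \<Rightarrow> 'm) \<Rightarrow> bool" where
  "solvable E K m n l h \<longleftrightarrow> (\<exists>c. (\<forall>k<n. c k \<in> K) \<and> (\<forall>j<m. h j = lcn E n (l j) c))"

context module
begin

lemma consistent_cong:
  "(\<And>j. j < m \<Longrightarrow> g j = h j) \<Longrightarrow> consistent R M K m n l g \<longleftrightarrow> consistent R M K m n l h"
  using lcn_cong[of m _ _ g h] unfolding consistent_def by simp

lemma solvable_cong:
  "(\<And>j. j < m \<Longrightarrow> g j = h j) \<Longrightarrow> solvable M K m n l g \<longleftrightarrow> solvable M K m n l h" unfolding solvable_def by simp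

lemma consistent_add:
  assumes K: "submodule R K M" and "consistent R M K m n l g" "consistent R M K m n l h"
  shows "consistent R M K m n l (\<lambda>j. g j \<oplus>\<^sub>M h j)"
  unfolding consistent_def
proof (intro conjI allI impI)
  fix j assume "j < m"
  thus "g j \<oplus>\<^sub>M h j \<in> K" using assms submoduleD(3)[OF K] unfolding consistent_def by blast
next
  fix a assume a: "(\<forall>j<m. a j \<in> carrier R) \<and> (\<forall>k<n. lcn RM m a (\<lambda>j. l j k) = \<zero>)"
  have "\<forall>j<m. g j \<in> carrier M" "\<forall>j<m. h j \<in> carrier M"
    using assms submoduleD(1)[OF K] unfolding consistent_def by blast+
  moreover have "lcn M m a g = \<zero>\<^sub>M" "lcn M m a h = \<zero>\<^sub>M" using a assms unfolding consistent_def by blast+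
  ultimately show "lcn M m a (\<lambda>j. g j \<oplus>\<^sub>M h j) = \<zero>\<^sub>M" using a by (subst lcn_add_right) auto
qed

lemma consistent_smult:
  assumes K: "submodule R K M" and "consistent R M K m n l h" "c \<in> carrier R"
  shows "consistent R M K m n l (\<lambda>j. c \<odot>\<^sub>M h j)"
  unfolding consistent_def
proof (intro conjI allI impI)
  fix j assume "j < m"
  thus "c \<odot>\<^sub>M h j \<in> K" using assms submoduleD(4)[OF K] unfolding consistent_def by blast
next
  fix a assume a: "(\<forall>j<m. a j \<in> carrier R) \<and> (\<forall>k<n. lcn RM m a (\<lambda>j. l j k) = \<zero>)"
  have "\<forall>j<m. h j \<in> carrier M" using assms submoduleD(1)[OF K] unfolding consistent_def by blast+
  moreover have "lcn M m a h = \<zero>\<^sub>M" using a assms unfolding consistent_def by blast+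
  ultimately show "lcn M m a (\<lambda>j. c \<odot>\<^sub>M h j) = \<zero>\<^sub>M" using a assms(3) by (subst lcn_smult_right) auto
qed

lemma solvable_add:
  assumes K: "submodule R K M" and l: "\<And>j k. j < m \<Longrightarrow> k < n \<Longrightarrow> l j k \<in> carrier R"
    and "solvable M K m n l g" "solvable M K m n l h"
  shows "solvable M K m n l (\<lambda>j. g j \<oplus>\<^sub>M h j)"
proof -
  obtain c d where c: "\<forall>k<n. c k \<in> K" "\<forall>j<m. g j = lcn M n (l j) c"
    and d: "\<forall>k<n. d k \<in> K" "\<forall>j<m. h j = lcn M n (l j) d"
    using assms(3,4) unfolding solvable_def by blast
  have "\<forall>j<m. g j \<oplus>\<^sub>M h j = lcn M n (l j) (\<lambda>k. c k \<oplus>\<^sub>M d k)"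
    using c d l submoduleD(1)[OF K] by (auto simp: lcn_add_right)
  moreover have "\<forall>k<n. c k \<oplus>\<^sub>M d k \<in> K" using c d submoduleD(3)[OF K] by blast
  ultimately show ?thesis unfolding solvable_def by (intro exI[of _ "\<lambda>k. c k \<oplus>\<^sub>M d k"] conjI)
qed

lemma solvable_smult:
  assumes K: "submodule R K M" and l: "\<And>j k. j < m \<Longrightarrow> k < n \<Longrightarrow> l j k \<in> carrier R"
    and "solvable M K m n l h" and e: "e \<in> carrier R"
  shows "solvable M K m n l (\<lambda>j. e \<odot>\<^sub>M h j)"
proof -
  obtain d where d: "\<forall>k<n. d k \<in> K" "\<forall>j<m. h j = lcn M n (l j) d" using assms(3) unfolding solvable_def by blast
  have "\<forall>j<m. e \<odot>\<^sub>M h j = lcn M n (l j) (\<lambda>k. e \<odot>\<^sub>M d k)"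
    using d e l submoduleD(1)[OF K] by (auto simp: lcn_smult_right)
  moreover have "\<forall>k<n. e \<odot>\<^sub>M d k \<in> K" using d e submoduleD(4)[OF K] by blast
  ultimately show ?thesis unfolding solvable_def by (intro exI[of _ "\<lambda>k. e \<odot>\<^sub>M d k"] conjI)
qed

lemma solvable_consistent:
  assumes K: "submodule R K M" and l: "\<And>j k. j < m \<Longrightarrow> k < n \<Longrightarrow> l j k \<in> carrier R"
    and h: "solvable M K m n l h"
  shows "consistent R M K m n l h"
  unfolding consistent_def
proof (intro conjI allI impI)
  obtain c where c: "\<forall>k<n. c k \<in> K" "\<forall>j<m. h j = lcn M n (l j) c" using h unfolding solvable_def by blast
  have cc: "\<And>k. k < n \<Longrightarrow> c k \<in> carrier M" using c submoduleD(1)[OF K] by blast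
  {
    fix j assume "j < m"
    thus "h j \<in> K" using c l lcn_submodule[OF K, of n "l j" c] by auto
  next
    fix a assume a: "(\<forall>j<m. a j \<in> carrier R) \<and> (\<forall>k<n. lcn RM m a (\<lambda>j. l j k) = \<zero>)"
    have "lcn M m a h = lcn M m a (\<lambda>j. lcn M n (l j) c)" using c by (intro lcn_cong) auto
    also have "\<dots> = lcn M n (\<lambda>k. lcn RM m a (\<lambda>j. l j k)) c" using a l cc by (intro lcn_swap) auto
    also have "\<dots> = \<zero>\<^sub>M" using a cc by (intro lcn_zero_left) auto
    finally show "lcn M m a h = \<zero>\<^sub>M" .
  }
qed

text \<open>\<open>Ext^1\<close> into an injective module vanishes. The unknowns are found one at a
  time: combinations of rows that vanish in the first \<open>n\<close> columns have an ideal of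
  entries in the last column, and the corresponding combinations of \<open>h\<close> define a map on
  it. Baer's criterion makes this map multiplication by \<open>w\<close>, the last unknown;
  subtracting its contribution leaves a consistent system with one column less.\<close>

lemma baer_solvable:
  assumes B: "baer R M K" "submodule R K M"
    and "\<And>j k. j < m \<Longrightarrow> k < n \<Longrightarrow> l j k \<in> carrier R" "consistent R M K m n l h"
  shows "solvable M K m n l h"
  using assms(3-)
proof (induction n arbitrary: h)
  case 0
  have h: "\<forall>j<m. h j \<in> K" using 0 unfolding consistent_def by blast
  hence hc: "\<forall>j<m. h j \<in> carrier M" using submoduleD(1)[OF B(2)] by blast
  have "h j = \<zero>\<^sub>M" if j: "j < m" for j
  proof -
    have "lcn M m (\<lambda>i. if i = j then \<one> else \<zero>) h = \<zero>\<^sub>M" using 0(2) unfolding consistent_def by auto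
    thus ?thesis using lcn_unit[of m h j] hc j by simp
  qed
  thus ?case unfolding solvable_def by auto
next
  case (Suc n)
  have h: "\<And>j. j < m \<Longrightarrow> h j \<in> K" using Suc.prems(2) unfolding consistent_def by blast
  hence hc: "\<And>j. j < m \<Longrightarrow> h j \<in> carrier M" using submoduleD(1)[OF B(2)] by blast
  let ?s = "\<lambda>a. (\<forall>j<m. a j \<in> carrier R) \<and> (\<forall>k<n. lcn RM m a (\<lambda>j. l j k) = \<zero>)"
  let ?l = "\<lambda>a. lcn RM m a (\<lambda>j. l j n)"
  define r where "r = {(?l a, lcn M m a h) | a. ?s a}"
  have lcl: "\<And>k j. k < Suc n \<Longrightarrow> j < m \<Longrightarrow> l j k \<in> carrier RM" using Suc.prems(1) by simp
  have s_add: "?s (\<lambda>j. a j \<oplus> b j)" if "?s a" "?s b" for a b using that lcl by (auto simp: R.self.lcn_add_left)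
  have s_smult: "?s (\<lambda>j. c \<otimes> a j)" if "?s a" "c \<in> carrier R" for a c
    using that lcl by (auto simp: R.self.lcn_smult_left)
  have "\<exists>w\<in>K. \<forall>a z. (a, z) \<in> r \<longrightarrow> z = a \<odot>\<^sub>M w"
  proof (rule baer_relation[OF B])
    fix a z assume "(a, z) \<in> r"
    then obtain b where b: "?s b" "a = ?l b" "z = lcn M m b h" unfolding r_def by blast
    thus "a \<in> carrier R \<and> z \<in> K"
      using R.self.lcn_closed[of m b "\<lambda>j. l j n"] lcl lcn_submodule[OF B(2), of m b h] h by auto
  next
    have "lcn M m (\<lambda>j. \<zero>) h = \<zero>\<^sub>M" "?l (\<lambda>j. \<zero>) = \<zero>" "?s (\<lambda>j. \<zero>)"
      using hc lcl lcn_zero_left[of m h "\<lambda>j. \<zero>"] R.self.lcn_zero_left[of m _ "\<lambda>j. \<zero>"] by auto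
    thus "(\<zero>, \<zero>\<^sub>M) \<in> r" unfolding r_def by (intro CollectI exI[of _ "\<lambda>j. \<zero>"]) auto
  next
    fix a z a' z' assume "(a, z) \<in> r" "(a', z') \<in> r"
    then obtain b b' where b: "?s b" "a = ?l b" "z = lcn M m b h" "?s b'" "a' = ?l b'" "z' = lcn M m b' h"
      unfolding r_def by blast
    have "a \<oplus> a' = ?l (\<lambda>j. b j \<oplus> b' j)" "z \<oplus>\<^sub>M z' = lcn M m (\<lambda>j. b j \<oplus> b' j) h"
      using b hc lcl by (auto simp: lcn_add_left R.self.lcn_add_left)
    thus "(a \<oplus> a', z \<oplus>\<^sub>M z') \<in> r" unfolding r_def using s_add[OF b(1,4)]
      by (intro CollectI exI[of _ "\<lambda>j. b j \<oplus> b' j"]) simp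
  next
    fix c a z assume c: "c \<in> carrier R" and "(a, z) \<in> r"
    then obtain b where b: "?s b" "a = ?l b" "z = lcn M m b h" unfolding r_def by blast
    have "c \<otimes> a = ?l (\<lambda>j. c \<otimes> b j)" "c \<odot>\<^sub>M z = lcn M m (\<lambda>j. c \<otimes> b j) h"
      using b hc lcl c by (auto simp: lcn_smult_left R.self.lcn_smult_left)
    thus "(c \<otimes> a, c \<odot>\<^sub>M z) \<in> r" unfolding r_def using s_smult[OF b(1) c]
      by (intro CollectI exI[of _ "\<lambda>j. c \<otimes> b j"]) simp
  next
    fix z assume "(\<zero>, z) \<in> r"
    then obtain b where b: "?s b" "?l b = \<zero>" "z = lcn M m b h" unfolding r_def by auto
    hence "\<forall>k<Suc n. lcn RM m b (\<lambda>j. l j k) = \<zero>" by (auto simp: less_Suc_eq)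
    thus "z = \<zero>\<^sub>M" using Suc.prems(2) b unfolding consistent_def by blast
  qed
  then obtain w where w: "w \<in> K" "\<And>a z. (a, z) \<in> r \<Longrightarrow> z = a \<odot>\<^sub>M w" by blast
  have wc: "w \<in> carrier M" using w submoduleD(1)[OF B(2)] by blast
  let ?h = "\<lambda>j. h j \<ominus>\<^sub>M l j n \<odot>\<^sub>M w"
  have lw: "l j n \<odot>\<^sub>M w \<in> K" "l j n \<odot>\<^sub>M w \<in> carrier M" if "j < m" for j
    using that Suc.prems(1)[of j n] w wc submoduleD(4)[OF B(2)] by auto
  have "consistent R M K m n l ?h" unfolding consistent_def
  proof (intro conjI allI impI)
    fix j assume "j < m" thus "?h j \<in> K" using submodule_minus[OF B(2)] h lw by auto
  next
    fix a assume a: "?s a"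
    have "lcn M m a ?h = lcn M m a h \<ominus>\<^sub>M lcn M m a (\<lambda>j. l j n \<odot>\<^sub>M w)"
      using a hc lw by (intro lcn_minus_right) auto
    also have "lcn M m a (\<lambda>j. l j n \<odot>\<^sub>M w) = ?l a \<odot>\<^sub>M w" using a Suc.prems(1) wc by (intro lcn_vec) auto
    also have "lcn M m a h = ?l a \<odot>\<^sub>M w" using w(2)[of "?l a" "lcn M m a h"] a unfolding r_def by blast
    finally show "lcn M m a ?h = \<zero>\<^sub>M"
      using a wc R.self.lcn_closed[of m a "\<lambda>j. l j n"] lcl by (simp add: a_minus_def M.r_neg)
  qed
  then obtain c where c: "\<forall>k<n. c k \<in> K" "\<forall>j<m. ?h j = lcn M n (l j) c"
    using Suc.IH[of ?h] Suc.prems(1) unfolding solvable_def by auto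
  have "h j = lcn M (Suc n) (l j) (c(n := w))" if j: "j < m" for j
  proof -
    have "lcn M n (l j) (c(n := w)) = lcn M n (l j) c" by (intro lcn_cong) auto
    hence "lcn M (Suc n) (l j) (c(n := w)) = ?h j \<oplus>\<^sub>M l j n \<odot>\<^sub>M w" using c j by simp
    thus ?thesis using lw(2)[OF j] hc[OF j] by (simp add: a_minus_def M.a_ac M.l_neg M.r_neg)
  qed
  moreover have "\<forall>k<Suc n. (c(n := w)) k \<in> K" using c w by (auto simp: less_Suc_eq)
  ultimately show ?case unfolding solvable_def by (intro exI[of _ "c(n := w)"]) auto
qed

end

text \<open>The assignment sending \<open>y a + j\<close> to \<open>a z\<close> on the ideal
  \<open>y R + J\<close> is well defined by the condition on annihilators; its extension to
  \<open>R\<close> is multiplication by \<open>z'\<close>. This is how injectivity is mostly used: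
  to divide by \<open>y\<close> within the elements killed by \<open>J\<close>.\<close>

lemma (in module) baer_divide:
  assumes K: "baer R M K" "submodule R K M" and J: "ideal J R" and y: "y \<in> carrier R" and z: "z \<in> K"
    and ann: "\<And>a. a \<in> carrier R \<Longrightarrow> y \<otimes> a \<in> J \<Longrightarrow> a \<odot>\<^sub>M z = \<zero>\<^sub>M"
  shows "\<exists>z'\<in>K. y \<odot>\<^sub>M z' = z \<and> (\<forall>j\<in>J. j \<odot>\<^sub>M z' = \<zero>\<^sub>M)"
proof -
  note Jd = R.idealD[OF J]
  have zc: "z \<in> carrier M" using submoduleD(1)[OF K(2) z] .
  define r where "r = {(y \<otimes> a \<oplus> j, a \<odot>\<^sub>M z) | a j. a \<in> carrier R \<and> j \<in> J}"
  have r: "(y \<otimes> a \<oplus> j, a \<odot>\<^sub>M z) \<in> r" if "a \<in> carrier R" "j \<in> J" for a j using that unfolding r_def by blast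
  have rE: "\<exists>a j. a \<in> carrier R \<and> j \<in> J \<and> u = y \<otimes> a \<oplus> j \<and> v = a \<odot>\<^sub>M z" if "(u, v) \<in> r" for u v
    using that unfolding r_def by blast
  have "\<exists>w\<in>K. \<forall>a v. (a, v) \<in> r \<longrightarrow> v = a \<odot>\<^sub>M w"
  proof (rule baer_relation[OF K])
    fix u v assume "(u, v) \<in> r"
    thus "u \<in> carrier R \<and> v \<in> K" using rE[of u v] y Jd(1) submoduleD(4)[OF K(2) _ z] by auto
  next
    show "(\<zero>, \<zero>\<^sub>M) \<in> r" using r[of \<zero> \<zero>] y Jd(2) zc by simp
  next
    fix u v u' v' assume "(u, v) \<in> r" "(u', v') \<in> r"
    then obtain a j b k where h: "a \<in> carrier R" "j \<in> J" "u = y \<otimes> a \<oplus> j" "v = a \<odot>\<^sub>M z"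
       "b \<in> carrier R" "k \<in> J" "u' = y \<otimes> b \<oplus> k" "v' = b \<odot>\<^sub>M z" using rE by metis
    have "j \<in> carrier R" "k \<in> carrier R" using h Jd(1) by auto
    hence "u \<oplus> u' = y \<otimes> (a \<oplus> b) \<oplus> (j \<oplus> k)" using h(1,5) y unfolding h(3,7) by algebra
    moreover have "v \<oplus>\<^sub>M v' = (a \<oplus> b) \<odot>\<^sub>M z" using h zc by (simp add: smult_l_distr)
    ultimately show "(u \<oplus> u', v \<oplus>\<^sub>M v') \<in> r" using r[of "a \<oplus> b" "j \<oplus> k"] h Jd(3) by auto
  next
    fix c u v assume c: "c \<in> carrier R" "(u, v) \<in> r"
    then obtain a j where h: "a \<in> carrier R" "j \<in> J" "u = y \<otimes> a \<oplus> j" "v = a \<odot>\<^sub>M z" using rE by metis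
    have "j \<in> carrier R" using h Jd(1) by auto
    hence "c \<otimes> u = y \<otimes> (c \<otimes> a) \<oplus> c \<otimes> j" using h(1) y c(1) unfolding h(3) by algebra
    moreover have "c \<odot>\<^sub>M v = (c \<otimes> a) \<odot>\<^sub>M z" using h zc c by (simp add: smult_assoc1)
    ultimately show "(c \<otimes> u, c \<odot>\<^sub>M v) \<in> r" using r[of "c \<otimes> a" "c \<otimes> j"] h c Jd(4) by auto
  next
    fix v assume "(\<zero>, v) \<in> r"
    then obtain a j where h: "a \<in> carrier R" "j \<in> J" "\<zero> = y \<otimes> a \<oplus> j" "v = a \<odot>\<^sub>M z" using rE by metis
    have "y \<otimes> a \<in> J" using R.ideal_add_cancel[OF J _ h(2)] h Jd(2) y by (metis R.m_closed)
    thus "v = \<zero>\<^sub>M" using ann h by blast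
  qed
  then obtain w where w: "w \<in> K" "\<And>a v. (a, v) \<in> r \<Longrightarrow> v = a \<odot>\<^sub>M w" by blast
  have "z = y \<odot>\<^sub>M w" using w(2)[OF r[of \<one> \<zero>]] Jd(2) zc y by simp
  moreover have "j \<odot>\<^sub>M w = \<zero>\<^sub>M" if "j \<in> J" for j using w(2)[OF r[of \<zero> j]] that Jd(1) zc y by simp
  ultimately show ?thesis using w(1) by blast
qed

section \<open>Nakayama's lemma for Ext\<close>

text \<open>If multiplication by some \<open>y\<close> in the maximal ideal is surjective on
  \<open>Ext^1(R^n / L, K)\<close>, then this group is zero. The property stands in for finite
  generation of Ext, and it is asked for all matrices at once so that a dimension shift may pass
  from a matrix to the matrix of its syzygies.\<close>

definition ext_nakayama ::
  "('a, 'k) ring_scheme \<Rightarrow> 'a set \<Rightarrow> ('a, 'm, 'l) module_scheme \<Rightarrow> 'm set \<Rightarrow> bool" where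
  "ext_nakayama R \<mm> E K \<longleftrightarrow> (\<forall>m n l. \<forall>y\<in>\<mm>. (\<forall>j<m. \<forall>k<n. l j k \<in> carrier R) \<longrightarrow>
     (\<forall>h. consistent R E K m n l h \<longrightarrow> (\<exists>h' g. consistent R E K m n l h' \<and> solvable E K m n l g \<and>
        (\<forall>j<m. h j = y \<odot>\<^sub>E h' j \<oplus>\<^sub>E g j))) \<longrightarrow>
     (\<forall>h. consistent R E K m n l h \<longrightarrow> solvable E K m n l h))"

context noeth_local
begin

text \<open>For \<open>K\<close> a copy of \<open>R\<close>, consistent and solvable right-hand
  sides are submodules of \<open>R^m\<close>, so Nakayama's lemma for tuples applies to them
  directly.\<close>

lemma ext_nakayama_base:
  assumes E: "module R E" and e: "e \<in> module_hom R RM E" "inj_on e (carrier R)"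
    and K: "K = e ` carrier R" "submodule R K E"
  shows "ext_nakayama R \<mm> E K"
  unfolding ext_nakayama_def
proof (intro allI ballI impI)
  fix m n and l :: "nat \<Rightarrow> nat \<Rightarrow> 'a" and y h
  assume y: "y \<in> \<mm>" and l: "\<forall>j<m. \<forall>k<n. l j k \<in> carrier R"
    and hyp: "\<forall>h. consistent R E K m n l h \<longrightarrow> (\<exists>h' g. consistent R E K m n l h' \<and> solvable E K m n l g \<and>
        (\<forall>j<m. h j = y \<odot>\<^sub>E h' j \<oplus>\<^sub>E g j))"
    and h: "consistent R E K m n l h"
  interpret E: module R E by fact
  interpret e: mod_hom R "RM" E e using E e self_module by (simp add: mod_hom_def mod_hom_axioms_def)
  have e_add: "e (a \<oplus> b) = e a \<oplus>\<^sub>E e b" if "a \<in> carrier R" "b \<in> carrier R" for a b using e.f_add that by simp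
  have e_smult: "e (a \<otimes> b) = a \<odot>\<^sub>E e b" if "a \<in> carrier R" "b \<in> carrier R" for a b using e.f_smult that by simp
  have l': "\<And>j k. j < m \<Longrightarrow> k < n \<Longrightarrow> l j k \<in> carrier R" using l by blast
  have yc: "y \<in> carrier R" using y m_carrier by blast
  let ?c = "\<lambda>b. \<forall>j<m. b j \<in> carrier R"
  define H where "H = {b. ?c b \<and> consistent R E K m n l (\<lambda>j. e (b j))}"
  define N where "N = {b. ?c b \<and> solvable E K m n l (\<lambda>j. e (b j))}"
  have lift: "\<exists>b. ?c b \<and> (\<forall>j<m. h j = e (b j))" if "\<forall>j<m. h j \<in> K" for h
  proof -
    have "\<forall>j. \<exists>b. j < m \<longrightarrow> b \<in> carrier R \<and> h j = e b" using that K(1) by blast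
    then obtain b where "\<forall>j. j < m \<longrightarrow> b j \<in> carrier R \<and> h j = e (b j)" by metis
    thus ?thesis by blast
  qed
  have cons_b: "b \<in> H" if "?c b" "\<forall>j<m. h j = e (b j)" "consistent R E K m n l h" for b h
    using that E.consistent_cong[of m h "\<lambda>j. e (b j)"] unfolding H_def by auto
  have solv_b: "b \<in> N" if "?c b" "\<forall>j<m. h j = e (b j)" "solvable E K m n l h" for b h
    using that E.solvable_cong[of m h "\<lambda>j. e (b j)"] unfolding N_def by auto
  have NH: "N \<subseteq> H" unfolding N_def H_def using E.solvable_consistent[where m=m and n=n and l=l, OF K(2) l'] by blast
  have "solvable E K m n l (\<lambda>j. lcn E n (l j) (\<lambda>k. \<zero>\<^sub>E))"
    unfolding solvable_def using E.submoduleD(2)[OF K(2)] by (intro exI[of _ "\<lambda>k. \<zero>\<^sub>E"]) auto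
  moreover have "\<forall>j<m. lcn E n (l j) (\<lambda>k. \<zero>\<^sub>E) = e \<zero>" using l' E.lcn_zero_right e.f0_is_0 by auto
  ultimately have zN: "(\<lambda>j. \<zero>) \<in> N" using solv_b[of "\<lambda>j. \<zero>"] by auto
  have Hm: "tuple_module R m H" unfolding tuple_module_def
  proof (intro conjI ballI allI impI)
    show "H \<noteq> {}" using zN NH by blast
  next
    fix b j assume "b \<in> H" "j < m" thus "b j \<in> carrier R" unfolding H_def by blast
  next
    fix b b' assume b: "b \<in> H" "b' \<in> H"
    show "(\<lambda>j. b j \<oplus> b' j) \<in> H" using b E.consistent_add[OF K(2), of m n l "\<lambda>j. e (b j)" "\<lambda>j. e (b' j)"]
      by (intro cons_b[of _ "\<lambda>j. e (b j) \<oplus>\<^sub>E e (b' j)"]) (auto simp: H_def e_add)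
  next
    fix c b assume b: "c \<in> carrier R" "b \<in> H"
    show "(\<lambda>j. c \<otimes> b j) \<in> H" using b E.consistent_smult[OF K(2), of m n l "\<lambda>j. e (b j)" c]
      by (intro cons_b[of _ "\<lambda>j. c \<odot>\<^sub>E e (b j)"]) (auto simp: H_def e_smult)
  next
    fix b g assume b: "b \<in> H" "\<forall>j<m. g j = b j"
    show "g \<in> H" using b by (intro cons_b[of _ "\<lambda>j. e (b j)"]) (auto simp: H_def)
  qed
  have Nm: "tuple_module R m N" unfolding tuple_module_def
  proof (intro conjI ballI allI impI)
    show "N \<noteq> {}" using zN by blast
  next
    fix b j assume "b \<in> N" "j < m" thus "b j \<in> carrier R" unfolding N_def by blast
  next
    fix b b' assume b: "b \<in> N" "b' \<in> N"
    show "(\<lambda>j. b j \<oplus> b' j) \<in> N"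
      using b E.solvable_add[where m=m and n=n and l=l and g="\<lambda>j. e (b j)" and h="\<lambda>j. e (b' j)", OF K(2) l']
      by (intro solv_b[of _ "\<lambda>j. e (b j) \<oplus>\<^sub>E e (b' j)"]) (auto simp: N_def e_add)
  next
    fix c b assume b: "c \<in> carrier R" "b \<in> N"
    show "(\<lambda>j. c \<otimes> b j) \<in> N"
      using b E.solvable_smult[where m=m and n=n and l=l and h="\<lambda>j. e (b j)" and e=c, OF K(2) l']
      by (intro solv_b[of _ "\<lambda>j. c \<odot>\<^sub>E e (b j)"]) (auto simp: N_def e_smult)
  next
    fix b g assume b: "b \<in> N" "\<forall>j<m. g j = b j"
    show "g \<in> N" using b by (intro solv_b[of _ "\<lambda>j. e (b j)"]) (auto simp: N_def)
  qed
  have "H \<subseteq> N"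
  proof (rule nakayama_tuple[OF Nm Hm NH y])
    fix b assume b: "b \<in> H"
    hence "consistent R E K m n l (\<lambda>j. e (b j))" unfolding H_def by blast
    then obtain h' g where g: "consistent R E K m n l h'" "solvable E K m n l g"
      "\<forall>j<m. e (b j) = y \<odot>\<^sub>E h' j \<oplus>\<^sub>E g j" using hyp by blast
    have gK: "\<forall>j<m. g j \<in> K" "\<forall>j<m. h' j \<in> K"
      using g(1) E.solvable_consistent[OF K(2) l' g(2)] unfolding consistent_def by blast+
    obtain b' where b': "?c b'" "\<forall>j<m. h' j = e (b' j)" using lift[OF gK(2)] by blast
    obtain c where c: "?c c" "\<forall>j<m. g j = e (c j)" using lift[OF gK(1)] by blast
    have "b j = c j \<oplus> y \<otimes> b' j" if j: "j < m" for j
    proof (rule inj_onD[OF e(2)])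
      show "e (b j) = e (c j \<oplus> y \<otimes> b' j)" using g(3) b' c j yc e.f_im by (simp add: e_add e_smult E.M.a_comm)
    qed (use b b' c j yc in \<open>auto simp: H_def\<close>)
    thus "\<exists>n\<in>N. \<exists>h'\<in>H. \<forall>j<m. b j = n j \<oplus> y \<otimes> h' j"
      using cons_b[OF b' g(1)] solv_b[OF c g(2)] by (intro bexI[of _ c] bexI[of _ b']) auto
  qed
  obtain b where b: "?c b" "\<forall>j<m. h j = e (b j)" using lift[of h] h unfolding consistent_def by blast
  hence "b \<in> N" using cons_b[OF b h] \<open>H \<subseteq> N\<close> by blast
  thus "solvable E K m n l h" using b(2) E.solvable_cong[of m h "\<lambda>j. e (b j)"] unfolding N_def by auto
qed

text \<open>Dimension shifting: \<open>Ext\<^sup>1(R\<^sup>n / L, K') = Ext\<^sup>1(L, K)\<close> for \<open>0 \<rightarrow> K \<rightarrow> E \<rightarrow> K' \<rightarrow> 0\<close> with \<open>E\<close> injective,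
  where \<open>L\<close> is presented by a finite matrix of syzygies.\<close>

lemma ext_nakayama_step:
  assumes E: "module R E" and E': "module R E'" and d: "d \<in> module_hom R E E'"
    and B: "baer R E (carrier E)"
    and K: "K = {z \<in> carrier E. d z = \<zero>\<^bsub>E'\<^esub>}" and K': "K' = d ` carrier E"
    and nak: "ext_nakayama R \<mm> E K"
  shows "ext_nakayama R \<mm> E' K'"
  unfolding ext_nakayama_def
proof (intro allI ballI impI)
  fix m n and l :: "nat \<Rightarrow> nat \<Rightarrow> 'a" and y h
  assume y: "y \<in> \<mm>" and l: "\<forall>j<m. \<forall>k<n. l j k \<in> carrier R"
    and hyp: "\<forall>h. consistent R E' K' m n l h \<longrightarrow> (\<exists>h' g. consistent R E' K' m n l h' \<and> solvable E' K' m n l g \<and>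
        (\<forall>j<m. h j = y \<odot>\<^bsub>E'\<^esub> h' j \<oplus>\<^bsub>E'\<^esub> g j))"
    and h: "consistent R E' K' m n l h"
  interpret E: module R E by fact
  interpret E': module R E' by fact
  interpret d: mod_hom R E E' d using E E' d by (simp add: mod_hom_def mod_hom_axioms_def)
  have l': "\<And>j k. j < m \<Longrightarrow> k < n \<Longrightarrow> l j k \<in> carrier R" using l by blast
  have yc: "y \<in> carrier R" using y m_carrier by blast
  have Ksub: "submodule R K E" using d.ker_is_submodule unfolding K d.ker_def .
  have lcd: "d (lcn E p a e) = lcn E' p a (\<lambda>j. d (e j))"
    if "\<And>j. j < p \<Longrightarrow> a j \<in> carrier R" "\<And>j. j < p \<Longrightarrow> e j \<in> carrier E" for p a e
    using lcn_hom[OF E E' d] that by blast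
  define S where "S = {a. (\<forall>j<m. a j \<in> carrier R) \<and> (\<forall>k<n. lcn RM m a (\<lambda>j. l j k) = \<zero>)}"
  have lc: "\<And>j k. j < m \<Longrightarrow> k < n \<Longrightarrow> l j k \<in> carrier RM" using l' by simp
  have Sm: "tuple_module R m S" unfolding tuple_module_def
  proof (intro conjI ballI allI impI)
    have "(\<lambda>j. \<zero>) \<in> S" unfolding S_def using lc self.lcn_zero_left[of m _ "\<lambda>j. \<zero>"] by auto
    thus "S \<noteq> {}" by (metis empty_iff)
  next
    fix a j assume "a \<in> S" "j < m" thus "a j \<in> carrier R" unfolding S_def by blast
  next
    fix a b assume "a \<in> S" "b \<in> S"
    thus "(\<lambda>j. a j \<oplus> b j) \<in> S" using lc by (auto simp: S_def self.lcn_add_left)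
  next
    fix c a assume "c \<in> carrier R" "a \<in> S"
    thus "(\<lambda>j. c \<otimes> a j) \<in> S" using lc by (auto simp: S_def self.lcn_smult_left)
  next
    fix a b assume ab: "a \<in> S" "\<forall>j<m. b j = a j"
    hence "lcn RM m b f = lcn RM m a f" for f by (intro self.lcn_cong) auto
    thus "b \<in> S" using ab by (auto simp: S_def)
  qed
  obtain p L where L: "\<forall>i<p. L i \<in> S"
    "\<forall>h\<in>S. \<exists>a. (\<forall>i<p. a i \<in> carrier R) \<and> (\<forall>j<m. h j = lcn RM p a (\<lambda>i. L i j))"
    using tuple_module_fg[OF Sm] by blast
  have Lc: "L i j \<in> carrier R" if "i < p" "j < m" for i j using L(1) that unfolding S_def by blast
  let ?L = "\<lambda>e i. lcn E m (L i) e"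
  have S_comb: "lcn E m a e = lcn E p b (?L e)"
    if "\<forall>i<p. b i \<in> carrier R" "\<forall>j<m. a j = lcn RM p b (\<lambda>i. L i j)" "\<forall>j<m. e j \<in> carrier E"
    for a b e
  proof -
    have "lcn E m a e = lcn E m (\<lambda>j. lcn RM p b (\<lambda>i. L i j)) e" using that by (intro E.lcn_cong) auto
    also have "\<dots> = lcn E p b (?L e)" using that Lc by (intro E.lcn_swap[symmetric]) auto
    finally show ?thesis .
  qed
  \<comment> \<open>The connecting map: a homomorphism on the row module with values in
    \<open>K'\<close> is lifted to values \<open>e\<close> in \<open>E\<close>; on the syzygies
    \<open>L\<close> the lift takes values in \<open>K\<close>.\<close>
  have A: "consistent R E K p m L (?L e)"
    if e: "\<forall>j<m. e j \<in> carrier E" and c: "consistent R E' K' m n l (\<lambda>j. d (e j))" for e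
  proof -
    have "solvable E (carrier E) p m L (?L e)" unfolding solvable_def using e by blast
    hence 1: "consistent R E (carrier E) p m L (?L e)"
      using E.solvable_consistent[where m=p and n=m and l=L, OF E.submodule_carrier Lc] by blast
    have "?L e i \<in> K" if i: "i < p" for i
    proof -
      have "d (?L e i) = lcn E' m (L i) (\<lambda>j. d (e j))" using Lc i e by (intro lcd) auto
      also have "\<dots> = \<zero>\<^bsub>E'\<^esub>" using c L(1) i unfolding consistent_def S_def by blast
      finally show ?thesis using e Lc i unfolding K by auto
    qed
    thus ?thesis using 1 unfolding consistent_def by blast
  qed
  \<comment> \<open>Conversely, values in \<open>K\<close> on the generators of the syzygies make
    \<open>d\<close> of the lift respect all relations of the rows.\<close>
  have Bc: "consistent R E' K' m n l (\<lambda>j. d (e j))"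
    if e: "\<forall>j<m. e j \<in> carrier E" and k: "\<forall>i<p. ?L e i \<in> K" for e unfolding consistent_def
  proof (intro conjI allI impI)
    fix j assume "j < m" thus "d (e j) \<in> K'" using e K' by blast
  next
    fix a assume a: "(\<forall>j<m. a j \<in> carrier R) \<and> (\<forall>k<n. lcn RM m a (\<lambda>j. l j k) = \<zero>)"
    hence "a \<in> S" unfolding S_def by blast
    then obtain b where b: "\<forall>i<p. b i \<in> carrier R" "\<forall>j<m. a j = lcn RM p b (\<lambda>i. L i j)" using L(2) by blast
    have "lcn E m a e \<in> K" unfolding S_comb[OF b e] using b k E.lcn_submodule[OF Ksub, of p b "?L e"] by auto
    hence "d (lcn E m a e) = \<zero>\<^bsub>E'\<^esub>" unfolding K by blast
    thus "lcn E' m a (\<lambda>j. d (e j)) = \<zero>\<^bsub>E'\<^esub>" using lcd[of m a e] a e by auto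
  qed
  \<comment> \<open>Injectivity of the connecting map: if a solution \<open>k\<close> in
    \<open>K\<close> accounts for the values on the syzygies, then \<open>e - k\<close> respects the
    relations of the rows, hence extends because \<open>E\<close> is injective, and \<open>d\<close>
    does not see \<open>k\<close>.\<close>
  have C: "solvable E' K' m n l (\<lambda>j. d (e j))"
    if e: "\<forall>j<m. e j \<in> carrier E" and k: "\<forall>j<m. k j \<in> K" and ek: "\<forall>i<p. ?L e i = ?L k i" for e k
  proof -
    have kc: "\<forall>j<m. k j \<in> carrier E" using k unfolding K by blast
    let ?e = "\<lambda>j. e j \<ominus>\<^sub>E k j"
    have "consistent R E (carrier E) m n l ?e" unfolding consistent_def
    proof (intro conjI allI impI)
      fix j assume "j < m" thus "?e j \<in> carrier E" using e kc by auto
    next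
      fix a assume a: "(\<forall>j<m. a j \<in> carrier R) \<and> (\<forall>k<n. lcn RM m a (\<lambda>j. l j k) = \<zero>)"
      hence "a \<in> S" unfolding S_def by blast
      then obtain b where b: "\<forall>i<p. b i \<in> carrier R" "\<forall>j<m. a j = lcn RM p b (\<lambda>i. L i j)" using L(2) by blast
      have "lcn E m a ?e = lcn E m a e \<ominus>\<^sub>E lcn E m a k" using a e kc by (intro E.lcn_minus_right) auto
      also have "lcn E m a e = lcn E m a k"
        unfolding S_comb[OF b e] S_comb[OF b kc] using ek E.lcn_cong[of p b b "?L e" "?L k"] by auto
      finally show "lcn E m a ?e = \<zero>\<^sub>E" using a kc E.lcn_closed[of m a k] by (simp add: a_minus_def E.M.r_neg)
    qed
    hence "solvable E (carrier E) m n l ?e" by (intro E.baer_solvable[OF B E.submodule_carrier] l')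
    then obtain c where c: "\<forall>k<n. c k \<in> carrier E" "\<forall>j<m. ?e j = lcn E n (l j) c"
      unfolding solvable_def by (elim exE conjE)
    have "d (e j) = lcn E' n (l j) (\<lambda>k. d (c k))" if j: "j < m" for j
    proof -
      have "k j \<in> K" using k j by blast
      hence "d (k j) = \<zero>\<^bsub>E'\<^esub>" unfolding K by blast
      hence "d (e j) = d (?e j)" using e kc j by (simp add: a_minus_def)
      also have "\<dots> = lcn E' n (l j) (\<lambda>k. d (c k))" using c j l' lcd[of n "l j" c] by auto
      finally show ?thesis .
    qed
    moreover have "\<forall>k<n. d (c k) \<in> K'" using c K' by blast
    ultimately show ?thesis unfolding solvable_def by (intro exI[of _ "\<lambda>k. d (c k)"]) auto
  qed
  have lift: "\<exists>e. (\<forall>j<q. e j \<in> carrier E) \<and> (\<forall>j<q. g j = d (e j))" if "\<forall>j<q. g j \<in> K'" for g and q :: nat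
  proof -
    have "\<forall>j. \<exists>b. j < q \<longrightarrow> b \<in> carrier E \<and> g j = d b" using that K' by blast
    then obtain b where "\<forall>j. j < q \<longrightarrow> b j \<in> carrier E \<and> g j = d (b j)" by metis
    thus ?thesis by blast
  qed
  \<comment> \<open>Divisibility by \<open>y\<close> is transported along the connecting map. The
    solvable part \<open>f\<close> lifts to a solvable right-hand side over \<open>E\<close>, which
    vanishes on the syzygies; the remaining discrepancy \<open>?k\<close> lies in
    \<open>K\<close>.\<close>
  have hyp': "\<exists>g' f. consistent R E K p m L g' \<and> solvable E K p m L f \<and> (\<forall>i<p. g i = y \<odot>\<^sub>E g' i \<oplus>\<^sub>E f i)"
    if g: "consistent R E K p m L g" for g
  proof -
    have "consistent R E (carrier E) p m L g" using g E.submoduleD(1)[OF Ksub] unfolding consistent_def by blast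
    hence "solvable E (carrier E) p m L g" by (intro E.baer_solvable[OF B E.submodule_carrier] Lc)
    then obtain e where e: "\<forall>j<m. e j \<in> carrier E" "\<forall>i<p. g i = ?L e i"
      unfolding solvable_def by (elim exE conjE)
    have "\<forall>i<p. ?L e i \<in> K" using g e(2) unfolding consistent_def by auto
    hence "consistent R E' K' m n l (\<lambda>j. d (e j))" using Bc e(1) by blast
    then obtain h' f where f: "consistent R E' K' m n l h'" "solvable E' K' m n l f"
      "\<forall>j<m. d (e j) = y \<odot>\<^bsub>E'\<^esub> h' j \<oplus>\<^bsub>E'\<^esub> f j" using hyp by blast
    obtain c where c: "\<forall>k<n. c k \<in> K'" "\<forall>j<m. f j = lcn E' n (l j) c" using f(2) unfolding solvable_def by blast
    obtain c' where c': "\<forall>k<n. c' k \<in> carrier E" "\<forall>k<n. c k = d (c' k)" using lift[OF c(1)] by blast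
    have "\<forall>j<m. h' j \<in> K'" using f(1) unfolding consistent_def by blast
    then obtain e' where e': "\<forall>j<m. e' j \<in> carrier E" "\<forall>j<m. h' j = d (e' j)" using lift by blast
    have h'c: "consistent R E' K' m n l (\<lambda>j. d (e' j))"
      using f(1) e'(2) E'.consistent_cong[of m h' "\<lambda>j. d (e' j)"] by auto
    let ?f = "\<lambda>j. lcn E n (l j) c'"
    have fc: "\<forall>j<m. ?f j \<in> carrier E" using l' c' by auto
    have df: "d (?f j) = f j" if j: "j < m" for j
    proof -
      have "d (?f j) = lcn E' n (l j) (\<lambda>k. d (c' k))" using l' j c' by (intro lcd) auto
      also have "\<dots> = lcn E' n (l j) c" using c' by (intro E'.lcn_cong) auto
      finally show ?thesis using c j by simp
    qed
    let ?k = "\<lambda>j. e j \<ominus>\<^sub>E (y \<odot>\<^sub>E e' j \<oplus>\<^sub>E ?f j)"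
    have kK: "?k j \<in> K" if j: "j < m" for j
    proof -
      have cc: "e j \<in> carrier E" "e' j \<in> carrier E" "?f j \<in> carrier E" using e e' fc j by auto
      have "d (?k j) = d (e j) \<ominus>\<^bsub>E'\<^esub> (y \<odot>\<^bsub>E'\<^esub> d (e' j) \<oplus>\<^bsub>E'\<^esub> d (?f j))" using cc yc by (simp add: d.f_minus)
      also have "\<dots> = d (e j) \<ominus>\<^bsub>E'\<^esub> d (e j)" using f(3) e'(2) df j by simp
      also have "\<dots> = \<zero>\<^bsub>E'\<^esub>" using cc by (simp add: a_minus_def E'.M.r_neg)
      finally show ?thesis using cc yc unfolding K by auto
    qed
    have "g i = y \<odot>\<^sub>E ?L e' i \<oplus>\<^sub>E ?L ?k i" if i: "i < p" for i
    proof -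
      have cc: "\<And>j. j < m \<Longrightarrow> e j \<in> carrier E" "\<And>j. j < m \<Longrightarrow> e' j \<in> carrier E" "\<And>j. j < m \<Longrightarrow> ?f j \<in> carrier E"
        using e e' fc by auto
      have Li: "\<And>j. j < m \<Longrightarrow> L i j \<in> carrier R" using Lc i by blast
      have "solvable E (carrier E) m n l ?f" unfolding solvable_def using c' by blast
      hence "consistent R E (carrier E) m n l ?f" using E.solvable_consistent[where m=m and n=n and l=l, OF E.submodule_carrier l'] by blast
      hence f0: "?L ?f i = \<zero>\<^sub>E" using L(1) i unfolding consistent_def S_def by blast
      have "?L ?k i = ?L e i \<ominus>\<^sub>E ?L (\<lambda>j. y \<odot>\<^sub>E e' j \<oplus>\<^sub>E ?f j) i" using cc Li yc by (intro E.lcn_minus_right) auto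
      also have "?L (\<lambda>j. y \<odot>\<^sub>E e' j \<oplus>\<^sub>E ?f j) i = ?L (\<lambda>j. y \<odot>\<^sub>E e' j) i \<oplus>\<^sub>E ?L ?f i"
        using cc Li yc by (intro E.lcn_add_right) auto
      also have "?L (\<lambda>j. y \<odot>\<^sub>E e' j) i = y \<odot>\<^sub>E ?L e' i" using cc Li yc by (intro E.lcn_smult_right) auto
      finally have k: "?L ?k i = ?L e i \<ominus>\<^sub>E y \<odot>\<^sub>E ?L e' i"
        using f0 yc cc(2) Li E.lcn_closed[of m "L i" e'] by simp
      have "?L e i \<in> carrier E" "?L e' i \<in> carrier E" using cc Li by auto
      thus ?thesis unfolding k using e(2) i yc by (simp add: E.msimps)
    qed
    moreover have "consistent R E K p m L (?L e')" using A[OF e'(1) h'c] .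
    moreover have "solvable E K p m L (?L ?k)" unfolding solvable_def using kK by (intro exI[of _ ?k]) auto
    ultimately show ?thesis by (intro exI[of _ "?L e'"] exI[of _ "?L ?k"]) auto
  qed
  have concl: "solvable E K p m L g" if "consistent R E K p m L g" for g
    using nak[unfolded ext_nakayama_def, rule_format, OF y, of p m L] Lc hyp' that by blast
  have "\<forall>j<m. h j \<in> K'" using h unfolding consistent_def by blast
  then obtain e where e: "\<forall>j<m. e j \<in> carrier E" "\<forall>j<m. h j = d (e j)" using lift by blast
  have hc: "consistent R E' K' m n l (\<lambda>j. d (e j))"
    using h e(2) E'.consistent_cong[of m h "\<lambda>j. d (e j)"] by auto
  obtain k where k: "\<forall>j<m. k j \<in> K" "\<forall>i<p. ?L e i = ?L k i"
    using concl[OF A[OF e(1) hc]] unfolding solvable_def by blast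
  show "solvable E' K' m n l h" using C[OF e(1) k] e(2) E'.solvable_cong[of m h "\<lambda>j. d (e j)"] by auto
qed

end

section \<open>Bass's lemma on the length of an injective resolution of the ring\<close>

locale ring_injective_resolution = noeth_local +
  fixes I :: "nat \<Rightarrow> ('a, 'e) module" and d :: "nat \<Rightarrow> 'e \<Rightarrow> 'e" and \<epsilon> :: "'a \<Rightarrow> 'e"
  assumes I_module: "\<And>i. module R (I i)" and I_baer: "\<And>i. baer R (I i) (carrier (I i))"
    and eps_hom: "\<epsilon> \<in> module_hom R RM (I 0)" and eps_inj: "inj_on \<epsilon> (carrier R)"
    and d_hom: "\<And>i. d i \<in> module_hom R (I i) (I (Suc i))"
    and exact_0: "\<epsilon> ` carrier R = {z \<in> carrier (I 0). d 0 z = \<zero>\<^bsub>I (Suc 0)\<^esub>}"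
    and exact_Suc: "\<And>i. d i ` carrier (I i) = {z \<in> carrier (I (Suc i)). d (Suc i) z = \<zero>\<^bsub>I (Suc (Suc i))\<^esub>}"
begin

text \<open>The cosyzygies: \<open>K 0\<close> is a copy of \<open>R\<close>, and
  \<open>K (Suc i)\<close> is the image of \<open>d i\<close>. Injectivity of \<open>K i\<close>
  means that the resolution may be cut off in degree \<open>i\<close>.\<close>

definition K :: "nat \<Rightarrow> 'e set" where
  "K i = {z \<in> carrier (I i). d i z = \<zero>\<^bsub>I (Suc i)\<^esub>}"

sublocale I: module R "I i" for i by (rule I_module)

sublocale d: mod_hom R "I i" "I (Suc i)" "d i" for i
  using I_module d_hom by (simp add: mod_hom_def mod_hom_axioms_def)

sublocale eps: mod_hom R "RM" "I 0" \<epsilon>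
  using I_module eps_hom self_module by (simp add: mod_hom_def mod_hom_axioms_def)

lemma K_0: "K 0 = \<epsilon> ` carrier R" by (simp add: K_def exact_0)

lemma K_Suc: "K (Suc i) = d i ` carrier (I i)" by (simp add: K_def exact_Suc)

lemma K_submodule: "submodule R (K i) (I i)" using d.ker_is_submodule unfolding K_def d.ker_def .

lemma K_carrier: "z \<in> K i \<Longrightarrow> z \<in> carrier (I i)" by (simp add: K_def)

lemma d_K: "w \<in> carrier (I i) \<Longrightarrow> d i w \<in> K (Suc i)" by (simp add: K_Suc)

lemma K_ext_nakayama: "ext_nakayama R \<mm> (I i) (K i)"
proof (induction i)
  case 0
  show ?case using ext_nakayama_base[OF I_module eps_hom eps_inj K_0 K_submodule] .
next
  case (Suc i)
  show ?case using ext_nakayama_step[OF I_module I_module d_hom I_baer K_def K_Suc Suc] .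
qed

text \<open>\<open>Ext\<^sup>i\<^sup>+\<^sup>1(R / J, R) = 0\<close>\<close>

definition ext_vanish :: "nat \<Rightarrow> 'a set \<Rightarrow> bool" where
  "ext_vanish i J \<longleftrightarrow> (\<forall>z\<in>K (Suc i). (\<forall>a\<in>J. a \<odot>\<^bsub>I (Suc i)\<^esub> z = \<zero>\<^bsub>I (Suc i)\<^esub>) \<longrightarrow>
     (\<exists>w\<in>carrier (I i). (\<forall>a\<in>J. a \<odot>\<^bsub>I i\<^esub> w = \<zero>\<^bsub>I i\<^esub>) \<and> d i w = z))"

text \<open>As \<open>K (Suc i)\<close> is injective and \<open>y\<close> is regular on
  \<open>R / J\<close>, every homomorphism from \<open>R / J\<close> to \<open>K (Suc i)\<close> is
  divisible by \<open>y\<close>. So multiplication by \<open>y\<close> is surjective on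
  \<open>Ext^1(R / J, K i)\<close>, and \<open>K_ext_nakayama\<close> kills this group.\<close>

lemma ext_vanish_regular:
  assumes J: "ideal J R" and y: "y \<in> \<mm>" and reg: "\<And>a. a \<in> carrier R \<Longrightarrow> y \<otimes> a \<in> J \<Longrightarrow> a \<in> J"
    and B: "baer R (I (Suc i)) (K (Suc i))"
  shows "ext_vanish i J"
  unfolding ext_vanish_def
proof (intro ballI impI)
  note Jd = idealD[OF J]
  have yc: "y \<in> carrier R" using y m_carrier by blast
  obtain p g where g: "\<forall>j<p. g j \<in> J"
    "\<forall>x\<in>J. \<exists>b. (\<forall>j<p. b j \<in> carrier R) \<and> x = lcn RM p b g" using ideal_fg_tuple[OF J] by blast
  have gc: "\<And>j. j < p \<Longrightarrow> g j \<in> carrier R" using g(1) Jd(1) by blast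
  \<comment> \<open>The matrix with a single column listing generators of \<open>J\<close>: its rows
    span the submodule \<open>J\<close> of \<open>R\<close>, so a consistent right-hand side is a
    homomorphism from \<open>J\<close>.\<close>
  let ?l = "\<lambda>j (k :: nat). g j"
  have lc: "\<And>j k. j < p \<Longrightarrow> k < Suc 0 \<Longrightarrow> ?l j k \<in> carrier R" using gc by blast
  let ?h = "\<lambda>w j. g j \<odot>\<^bsub>I i\<^esub> w"
  have lcn1: "lcn (I i) (Suc 0) (?l j) c = g j \<odot>\<^bsub>I i\<^esub> c 0" if "g j \<in> carrier R" "c 0 \<in> carrier (I i)" for j c
    using that by simp
  have hcons: "consistent R (I i) (K i) p (Suc 0) ?l (?h w)"
    if w: "w \<in> carrier (I i)" "\<forall>j<p. ?h w j \<in> K i" for w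
  proof -
    have "solvable (I i) (carrier (I i)) p (Suc 0) ?l (?h w)"
      unfolding solvable_def using w(1) gc lcn1[of _ "\<lambda>_. w"] by (intro exI[of _ "\<lambda>_. w"]) auto
    hence "consistent R (I i) (carrier (I i)) p (Suc 0) ?l (?h w)"
      by (intro I.solvable_consistent[OF I.submodule_carrier] lc)
    thus ?thesis using w(2) unfolding consistent_def by blast
  qed
  have kill: "\<forall>a\<in>J. a \<odot>\<^bsub>I i\<^esub> w = \<zero>\<^bsub>I i\<^esub>" if w: "w \<in> carrier (I i)" "\<forall>j<p. ?h w j = \<zero>\<^bsub>I i\<^esub>" for w
  proof
    fix a assume "a \<in> J"
    then obtain b where b: "\<forall>j<p. b j \<in> carrier R" "a = lcn RM p b g" using g(2) by blast
    have "a \<odot>\<^bsub>I i\<^esub> w = lcn (I i) p b (?h w)" unfolding b(2) using b gc w by (intro I.lcn_vec[symmetric]) auto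
    also have "\<dots> = lcn (I i) p b (\<lambda>j. \<zero>\<^bsub>I i\<^esub>)" using w by (intro I.lcn_cong) auto
    also have "\<dots> = \<zero>\<^bsub>I i\<^esub>" using b by (intro I.lcn_zero_right) auto
    finally show "a \<odot>\<^bsub>I i\<^esub> w = \<zero>\<^bsub>I i\<^esub>" .
  qed
  have dkill: "\<forall>a\<in>J. a \<odot>\<^bsub>I (Suc i)\<^esub> d i w = \<zero>\<^bsub>I (Suc i)\<^esub>"
    if w: "w \<in> carrier (I i)" "\<forall>j<p. ?h w j \<in> K i" for w
  proof
    fix a assume a: "a \<in> J"
    then obtain b where b: "\<forall>j<p. b j \<in> carrier R" "a = lcn RM p b g" using g(2) by blast
    have "a \<odot>\<^bsub>I i\<^esub> w = lcn (I i) p b (?h w)" unfolding b(2) using b gc w by (intro I.lcn_vec[symmetric]) auto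
    also have "\<dots> \<in> K i" using b w I.lcn_submodule[OF K_submodule, of p b "?h w"] by auto
    finally have "d i (a \<odot>\<^bsub>I i\<^esub> w) = \<zero>\<^bsub>I (Suc i)\<^esub>" by (simp add: K_def)
    thus "a \<odot>\<^bsub>I (Suc i)\<^esub> d i w = \<zero>\<^bsub>I (Suc i)\<^esub>" using w a Jd(1) by simp
  qed
  have hK: "\<forall>j<p. ?h w j \<in> K i"
    if w: "w \<in> carrier (I i)" "\<forall>a\<in>J. a \<odot>\<^bsub>I (Suc i)\<^esub> d i w = \<zero>\<^bsub>I (Suc i)\<^esub>" for w
    using w g(1) gc by (auto simp: K_def)
  have ext: "solvable (I i) (K i) p (Suc 0) ?l h" if h: "consistent R (I i) (K i) p (Suc 0) ?l h" for h
  proof (rule K_ext_nakayama[unfolded ext_nakayama_def, rule_format, OF y _ _ h])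
    fix j k assume "j < p" "k < Suc 0" thus "g j \<in> carrier R" using gc by blast
  next
    fix h assume h: "consistent R (I i) (K i) p (Suc 0) ?l h"
    hence "consistent R (I i) (carrier (I i)) p (Suc 0) ?l h" unfolding consistent_def using K_carrier by blast
    hence "solvable (I i) (carrier (I i)) p (Suc 0) ?l h"
      by (intro I.baer_solvable[OF I_baer I.submodule_carrier] lc)
    then obtain c where c: "\<forall>k<Suc 0. c k \<in> carrier (I i)" "\<forall>j<p. h j = lcn (I i) (Suc 0) (?l j) c"
      unfolding solvable_def by (elim exE conjE)
    define w where "w = c 0"
    have w: "w \<in> carrier (I i)" "\<forall>j<p. h j = ?h w j" using c gc by (auto simp: w_def)
    have wK: "\<forall>j<p. ?h w j \<in> K i" using h w(2) unfolding consistent_def by auto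
    have "\<exists>z'\<in>K (Suc i). y \<odot>\<^bsub>I (Suc i)\<^esub> z' = d i w \<and> (\<forall>j\<in>J. j \<odot>\<^bsub>I (Suc i)\<^esub> z' = \<zero>\<^bsub>I (Suc i)\<^esub>)"
      using dkill[OF w(1) wK] reg by (intro I.baer_divide[OF B K_submodule J yc d_K[OF w(1)]]) blast
    then obtain w' where w': "w' \<in> carrier (I i)" "y \<odot>\<^bsub>I (Suc i)\<^esub> d i w' = d i w"
      "\<forall>j\<in>J. j \<odot>\<^bsub>I (Suc i)\<^esub> d i w' = \<zero>\<^bsub>I (Suc i)\<^esub>" unfolding K_Suc by blast
    let ?c = "w \<ominus>\<^bsub>I i\<^esub> y \<odot>\<^bsub>I i\<^esub> w'"
    have cK: "?c \<in> K i" using w w' yc by (simp add: K_def a_minus_def I.M.r_neg)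
    have "h j = y \<odot>\<^bsub>I i\<^esub> ?h w' j \<oplus>\<^bsub>I i\<^esub> ?h ?c j" if j: "j < p" for j using w w' yc gc j by (simp add: I.msimps)
    moreover have "consistent R (I i) (K i) p (Suc 0) ?l (?h w')" using hcons[OF w'(1) hK[OF w'(1,3)]] .
    moreover have "solvable (I i) (K i) p (Suc 0) ?l (?h ?c)"
      unfolding solvable_def using cK K_carrier[OF cK] gc lcn1[of _ "\<lambda>_. ?c"] by (intro exI[of _ "\<lambda>_. ?c"]) auto
    ultimately show "\<exists>h' g. consistent R (I i) (K i) p (Suc 0) ?l h' \<and> solvable (I i) (K i) p (Suc 0) ?l g \<and>
        (\<forall>j<p. h j = y \<odot>\<^bsub>I i\<^esub> h' j \<oplus>\<^bsub>I i\<^esub> g j)" by (intro exI[of _ "?h w'"] exI[of _ "?h ?c"]) auto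
  qed
  fix z assume z: "z \<in> K (Suc i)" "\<forall>a\<in>J. a \<odot>\<^bsub>I (Suc i)\<^esub> z = \<zero>\<^bsub>I (Suc i)\<^esub>"
  then obtain w where w: "w \<in> carrier (I i)" "d i w = z" unfolding K_Suc by blast
  have "solvable (I i) (K i) p (Suc 0) ?l (?h w)" using ext[OF hcons[OF w(1) hK[OF w(1)]]] z(2) w(2) by blast
  then obtain c where c: "\<forall>k<Suc 0. c k \<in> K i" "\<forall>j<p. ?h w j = lcn (I i) (Suc 0) (?l j) c"
    unfolding solvable_def by blast
  have c0: "c 0 \<in> K i" "c 0 \<in> carrier (I i)" using c(1) K_carrier by auto
  have "\<forall>j<p. ?h (w \<ominus>\<^bsub>I i\<^esub> c 0) j = \<zero>\<^bsub>I i\<^esub>"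
  proof (intro allI impI)
    fix j assume j: "j < p"
    have "?h w j = g j \<odot>\<^bsub>I i\<^esub> c 0" using c(2) j lcn1[of j c, OF gc[OF j] c0(2)] by simp
    thus "?h (w \<ominus>\<^bsub>I i\<^esub> c 0) j = \<zero>\<^bsub>I i\<^esub>"
      using gc[OF j] w c0 by (simp add: a_minus_def I.smult_r_distr I.smult_r_minus I.M.r_neg)
  qed
  moreover have "d i (w \<ominus>\<^bsub>I i\<^esub> c 0) = z" using w c0 K_carrier[OF z(1)] by (simp add: K_def a_minus_def)
  ultimately show "\<exists>w\<in>carrier (I i). (\<forall>a\<in>J. a \<odot>\<^bsub>I i\<^esub> w = \<zero>\<^bsub>I i\<^esub>) \<and> d i w = z"
    using kill[of "w \<ominus>\<^bsub>I i\<^esub> c 0"] w c0 by (intro bexI[of _ "w \<ominus>\<^bsub>I i\<^esub> c 0"]) auto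
qed

text \<open>Half exactness for \<open>R / (J : y)\<close> inside \<open>R / J\<close> with quotient
  \<open>R / (J + y R)\<close>. The class of \<open>z\<close> becomes trivial after multiplication
  by \<open>y\<close>; dividing the primitive \<open>w\<close> of \<open>y z\<close> by
  \<open>y\<close> inside the injective \<open>I i\<close> and subtracting leaves a class that is
  also killed by \<open>y\<close>.\<close>

lemma ext_vanish_split:
  assumes J: "ideal J R" and y: "y \<in> carrier R"
    and 1: "ext_vanish i {a \<in> carrier R. a \<otimes> y \<in> J}" and 2: "ext_vanish i (self.adjoin J y)"
  shows "ext_vanish i J"
  unfolding ext_vanish_def
proof (intro ballI impI)
  note Jd = idealD[OF J]
  fix z assume z: "z \<in> K (Suc i)" "\<forall>a\<in>J. a \<odot>\<^bsub>I (Suc i)\<^esub> z = \<zero>\<^bsub>I (Suc i)\<^esub>"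
  have zc: "z \<in> carrier (I (Suc i))" using z K_carrier by blast
  have yz: "y \<odot>\<^bsub>I (Suc i)\<^esub> z \<in> K (Suc i)" using I.submoduleD(4)[OF K_submodule] z y by blast
  have "\<forall>a\<in>{a \<in> carrier R. a \<otimes> y \<in> J}. a \<odot>\<^bsub>I (Suc i)\<^esub> (y \<odot>\<^bsub>I (Suc i)\<^esub> z) = \<zero>\<^bsub>I (Suc i)\<^esub>"
    using z y zc by (auto simp: I.smult_assoc1[symmetric])
  then obtain w where w: "w \<in> carrier (I i)" "\<forall>a\<in>{a \<in> carrier R. a \<otimes> y \<in> J}. a \<odot>\<^bsub>I i\<^esub> w = \<zero>\<^bsub>I i\<^esub>"
    "d i w = y \<odot>\<^bsub>I (Suc i)\<^esub> z" using 1 yz unfolding ext_vanish_def by blast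
  have "\<exists>w'\<in>carrier (I i). y \<odot>\<^bsub>I i\<^esub> w' = w \<and> (\<forall>j\<in>J. j \<odot>\<^bsub>I i\<^esub> w' = \<zero>\<^bsub>I i\<^esub>)"
    using w(2) y by (intro I.baer_divide[OF I_baer I.submodule_carrier J y w(1)]) (auto simp: m_comm)
  then obtain w' where w': "w' \<in> carrier (I i)" "y \<odot>\<^bsub>I i\<^esub> w' = w" "\<forall>j\<in>J. j \<odot>\<^bsub>I i\<^esub> w' = \<zero>\<^bsub>I i\<^esub>" by blast
  let ?z = "z \<ominus>\<^bsub>I (Suc i)\<^esub> d i w'"
  have dw': "d i w' \<in> K (Suc i)" "d i w' \<in> carrier (I (Suc i))" using d_K w' K_carrier by auto
  have z': "?z \<in> K (Suc i)" using I.submodule_minus[OF K_submodule z(1) dw'(1)] .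
  have yw': "y \<odot>\<^bsub>I (Suc i)\<^esub> d i w' = y \<odot>\<^bsub>I (Suc i)\<^esub> z" 
  proof -
    have "y \<odot>\<^bsub>I (Suc i)\<^esub> d i w' = d i (y \<odot>\<^bsub>I i\<^esub> w')" using y w'(1) by simp
    also have "\<dots> = d i w" unfolding w'(2) ..
    finally show ?thesis using w(3) by simp
  qed
  have "a \<odot>\<^bsub>I (Suc i)\<^esub> ?z = \<zero>\<^bsub>I (Suc i)\<^esub>" if a: "a \<in> self.adjoin J y" for a
  proof -
    obtain j b where b: "j \<in> J" "b \<in> carrier R" "a = j \<oplus> b \<otimes> y" using a unfolding adjoin_eq_self by blast
    have jc: "j \<in> carrier R" using b Jd(1) by blast
    have "j \<odot>\<^bsub>I (Suc i)\<^esub> ?z = \<zero>\<^bsub>I (Suc i)\<^esub>"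
    proof -
      have e: "j \<odot>\<^bsub>I i\<^esub> w' = \<zero>\<^bsub>I i\<^esub>" using w' b by blast
      have "j \<odot>\<^bsub>I (Suc i)\<^esub> d i w' = d i (j \<odot>\<^bsub>I i\<^esub> w')" using jc w' by simp
      hence "j \<odot>\<^bsub>I (Suc i)\<^esub> d i w' = \<zero>\<^bsub>I (Suc i)\<^esub>" unfolding e by simp
      moreover have "j \<odot>\<^bsub>I (Suc i)\<^esub> z = \<zero>\<^bsub>I (Suc i)\<^esub>" using z b by blast
      ultimately show ?thesis using jc zc dw' by (simp add: a_minus_def I.smult_r_distr I.smult_r_minus)
    qed
    moreover have "y \<odot>\<^bsub>I (Suc i)\<^esub> ?z = \<zero>\<^bsub>I (Suc i)\<^esub>"
      using y zc dw' yw' by (simp add: a_minus_def I.smult_r_distr I.smult_r_minus I.M.r_neg)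
    ultimately show ?thesis unfolding b(3) using b jc y zc dw' by (simp add: I.smult_l_distr I.smult_assoc1)
  qed
  then obtain v where v: "v \<in> carrier (I i)" "\<forall>a\<in>self.adjoin J y. a \<odot>\<^bsub>I i\<^esub> v = \<zero>\<^bsub>I i\<^esub>" "d i v = ?z"
    using 2 z' unfolding ext_vanish_def by blast
  have "\<forall>a\<in>J. a \<odot>\<^bsub>I i\<^esub> (v \<oplus>\<^bsub>I i\<^esub> w') = \<zero>\<^bsub>I i\<^esub>"
    using v w' Jd(1) self.adjoin_superset(1)[of J y] J y by (auto simp: I.smult_r_distr ideal_iff_submodule)
  moreover have "d i (v \<oplus>\<^bsub>I i\<^esub> w') = z" using v w' zc dw' by (simp add: I.msimps)
  ultimately show "\<exists>w\<in>carrier (I i). (\<forall>a\<in>J. a \<odot>\<^bsub>I i\<^esub> w = \<zero>\<^bsub>I i\<^esub>) \<and> d i w = z"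
    using v w' by (intro bexI[of _ "v \<oplus>\<^bsub>I i\<^esub> w'"]) auto
qed

lemma ext_vanish_unit:
  assumes "ideal J R" "\<one> \<in> J"
  shows "ext_vanish i J"
  unfolding ext_vanish_def
proof (intro ballI impI)
  fix z assume "z \<in> K (Suc i)" "\<forall>a\<in>J. a \<odot>\<^bsub>I (Suc i)\<^esub> z = \<zero>\<^bsub>I (Suc i)\<^esub>"
  hence "z = \<zero>\<^bsub>I (Suc i)\<^esub>" using assms K_carrier[of z "Suc i"] by force
  thus "\<exists>w\<in>carrier (I i). (\<forall>a\<in>J. a \<odot>\<^bsub>I i\<^esub> w = \<zero>\<^bsub>I i\<^esub>) \<and> d i w = z"
    using idealD(1)[OF assms(1)] by (intro bexI[of _ "\<zero>\<^bsub>I i\<^esub>"]) auto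
qed

text \<open>An ideal maximal among those with nonvanishing Ext is \<open>\<mm>\<close>.\<close>

lemma ext_vanish_all:
  assumes B: "baer R (I (Suc i)) (K (Suc i))" and m: "ext_vanish i \<mm>" and J: "ideal J R"
  shows "ext_vanish i J"
proof (rule ccontr)
  let ?S = "{J. ideal J R \<and> \<not> ext_vanish i J}"
  assume "\<not> ext_vanish i J"
  hence "?S \<noteq> {}" using J by blast
  moreover have "\<And>J. J \<in> ?S \<Longrightarrow> ideal J R" by blast
  ultimately have "\<exists>L\<in>?S. \<forall>J'\<in>?S. L \<subseteq> J' \<longrightarrow> J' = L" by (rule maximal_ideal_in_family)
  then obtain L where L: "L \<in> ?S" "\<forall>J'\<in>?S. L \<subseteq> J' \<longrightarrow> J' = L" by blast
  have Li: "ideal L R" and Ln: "\<not> ext_vanish i L" using L by auto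
  have "L \<subseteq> \<mm>" using proper_ideal_le_m[OF Li] ext_vanish_unit[OF Li] Ln by blast
  moreover have "L \<noteq> \<mm>" using m Ln by blast
  ultimately obtain y where y: "y \<in> \<mm>" "y \<notin> L" by blast
  have yc: "y \<in> carrier R" using y m_carrier by blast
  have sup: "L \<subseteq> self.adjoin L y" "y \<in> self.adjoin L y"
    using self.adjoin_superset[of L y] Li yc by (auto simp: ideal_iff_submodule)
  have 2: "ext_vanish i (self.adjoin L y)" using L(2) ideal_adjoin[OF Li yc] sup y(2) by blast
  let ?C = "{a \<in> carrier R. a \<otimes> y \<in> L}"
  have C: "ideal ?C R" using self.ideal_colon[of L "{y}"] Li yc by (simp add: ideal_iff_submodule)
  have LC: "L \<subseteq> ?C"
  proof
    fix a assume a: "a \<in> L"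
    hence "y \<otimes> a \<in> L" "a \<in> carrier R" using idealD(1,4)[OF Li] yc by auto
    thus "a \<in> ?C" using yc by (simp add: m_comm)
  qed
  \<comment> \<open>Either \<open>y\<close> is regular modulo \<open>L\<close>, or both
    \<open>L : y\<close> and \<open>L + y R\<close> are strictly larger than \<open>L\<close> and so
    have vanishing Ext.\<close>
  show False
  proof (cases "?C = L")
    case True
    hence "\<And>a. a \<in> carrier R \<Longrightarrow> y \<otimes> a \<in> L \<Longrightarrow> a \<in> L" using yc by (auto simp: m_comm)
    thus False using ext_vanish_regular[OF Li y(1) _ B] Ln by blast
  next
    case False
    hence "ext_vanish i ?C" using L(2) C LC by blast
    thus False using ext_vanish_split[OF Li yc _ 2] Ln by blast
  qed
qed

text \<open>A map from \<open>J\<close> to \<open>K i\<close> extends into \<open>I i\<close> as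
  multiplication by some \<open>w\<close>. The differential of \<open>w\<close> is killed by
  \<open>J\<close>, so it is also the differential of some \<open>w'\<close> killed by
  \<open>J\<close>, and \<open>w - w'\<close> is an extension lying in \<open>K i\<close>.\<close>

lemma baer_of_ext_vanish:
  assumes "\<And>J. ideal J R \<Longrightarrow> ext_vanish i J"
  shows "baer R (I i) (K i)"
  unfolding baer_def
proof (intro allI impI, elim conjE)
  fix J f
  assume J: "ideal J R" and f: "\<forall>a\<in>J. f a \<in> K i" "\<forall>a\<in>J. \<forall>b\<in>J. f (a \<oplus> b) = f a \<oplus>\<^bsub>I i\<^esub> f b"
    "\<forall>c\<in>carrier R. \<forall>a\<in>J. f (c \<otimes> a) = c \<odot>\<^bsub>I i\<^esub> f a"
  note Jd = idealD[OF J]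
  have "\<forall>a\<in>J. f a \<in> carrier (I i)" using f(1) K_carrier by blast
  from I_baer[of i, unfolded baer_def, THEN spec, THEN spec, THEN mp, OF conjI[OF J conjI[OF this conjI[OF f(2,3)]]]]
  obtain w where w: "w \<in> carrier (I i)" "\<forall>a\<in>J. f a = a \<odot>\<^bsub>I i\<^esub> w" by (elim bexE)
  have "\<forall>a\<in>J. a \<odot>\<^bsub>I (Suc i)\<^esub> d i w = \<zero>\<^bsub>I (Suc i)\<^esub>"
  proof
    fix a assume a: "a \<in> J"
    hence "a \<odot>\<^bsub>I i\<^esub> w \<in> K i" using f(1) w(2) by auto
    hence "d i (a \<odot>\<^bsub>I i\<^esub> w) = \<zero>\<^bsub>I (Suc i)\<^esub>" by (simp add: K_def)
    thus "a \<odot>\<^bsub>I (Suc i)\<^esub> d i w = \<zero>\<^bsub>I (Suc i)\<^esub>" using a Jd(1) w by simp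
  qed
  then obtain w' where w': "w' \<in> carrier (I i)" "\<forall>a\<in>J. a \<odot>\<^bsub>I i\<^esub> w' = \<zero>\<^bsub>I i\<^esub>" "d i w' = d i w"
    using assms[OF J] d_K[OF w(1)] unfolding ext_vanish_def by blast
  have "w \<ominus>\<^bsub>I i\<^esub> w' \<in> K i" using w w' by (simp add: K_def a_minus_def I.M.r_neg)
  moreover have "\<forall>a\<in>J. f a = a \<odot>\<^bsub>I i\<^esub> (w \<ominus>\<^bsub>I i\<^esub> w')"
    using w w' Jd(1) by (simp add: a_minus_def I.smult_r_distr I.smult_r_minus)
  ultimately show "\<exists>w\<in>K i. \<forall>a\<in>J. f a = a \<odot>\<^bsub>I i\<^esub> w" by blast
qed

text \<open>One step down the resolution; only the residue field has to be tested.\<close>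

lemma bass:
  assumes "baer R (I (Suc i)) (K (Suc i))" "ext_vanish i \<mm>"
  shows "baer R (I i) (K i)"
  using baer_of_ext_vanish ext_vanish_all[OF assms] by blast

lemma bass_descend:
  assumes "baer R (I n) (K n)" "t \<le> n"
    and "\<And>i. t \<le> i \<Longrightarrow> baer R (I (Suc i)) (K (Suc i)) \<Longrightarrow> ext_vanish i \<mm>"
  shows "baer R (I t) (K t)"
  using assms(2,1)
proof (induction n rule: dec_induct)
  case (step n)
  thus ?case using bass assms(3) by blast
qed

end

section \<open>Annihilators and regular elements\<close>

context cring
begin

definition ann :: "'a set \<Rightarrow> 'a set" where
  "ann J = {e \<in> carrier R. \<forall>a\<in>J. a \<otimes> e = \<zero>}"

lemma ann_ideal: "J \<subseteq> carrier R \<Longrightarrow> ideal (ann J) R" using self.submodule_torsion[of J "{\<zero>}"] self.submodule_zero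
  by (simp add: ann_def ideal_iff_submodule)

lemma annD: "e \<in> ann J \<Longrightarrow> e \<in> carrier R" "e \<in> ann J \<Longrightarrow> a \<in> J \<Longrightarrow> a \<otimes> e = \<zero>" by (auto simp: ann_def)

lemma ideal_zero: "ideal {\<zero>} R" by (rule zeroideal)

lemma PIdl_iff: "a \<in> PIdl x \<longleftrightarrow> (\<exists>b\<in>carrier R. a = b \<otimes> x)" by (auto simp: cgenideal_def)

definition regular_on :: "'a \<Rightarrow> 'a set \<Rightarrow> bool" where
  "regular_on x J \<longleftrightarrow> (\<forall>a\<in>carrier R. x \<otimes> a \<in> J \<longrightarrow> a \<in> J)"

lemma regular_onD: "regular_on x J \<Longrightarrow> a \<in> carrier R \<Longrightarrow> x \<otimes> a \<in> J \<Longrightarrow> a \<in> J" by (simp add: regular_on_def)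

lemma regular_on_prime:
  assumes "primeideal Q R" "x \<in> carrier R" "x \<notin> Q"
  shows "regular_on x Q"
  using primeideal.I_prime[OF assms(1)] assms(2,3) unfolding regular_on_def by blast

end

section \<open>Vanishing of Ext of the residue field\<close>

context ring_injective_resolution
begin

lemma eps_simps:
  "a \<in> carrier R \<Longrightarrow> \<epsilon> a \<in> carrier (I 0)" "\<epsilon> \<zero> = \<zero>\<^bsub>I 0\<^esub>"
  "a \<in> carrier R \<Longrightarrow> b \<in> carrier R \<Longrightarrow> \<epsilon> (a \<otimes> b) = a \<odot>\<^bsub>I 0\<^esub> \<epsilon> b"
  "a \<in> carrier R \<Longrightarrow> b \<in> carrier R \<Longrightarrow> \<epsilon> (a \<oplus> b) = \<epsilon> a \<oplus>\<^bsub>I 0\<^esub> \<epsilon> b"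
  "a \<in> carrier R \<Longrightarrow> b \<in> carrier R \<Longrightarrow> \<epsilon> (a \<ominus> b) = \<epsilon> a \<ominus>\<^bsub>I 0\<^esub> \<epsilon> b"
  using eps.f_im[of a] eps.f0_is_0 eps.f_smult[of a b] eps.f_add[of a b] eps.f_minus[of a b] by auto

lemma eps_eqD: "\<epsilon> a = \<epsilon> b \<Longrightarrow> a \<in> carrier R \<Longrightarrow> b \<in> carrier R \<Longrightarrow> a = b" using eps_inj by (meson inj_onD)

text \<open>A nonzero \<open>u\<close> killed by \<open>\<mm>\<close> embeds the residue field in
  \<open>R\<close>. Any \<open>z\<close> killed by \<open>\<mm>\<close> is then \<open>u z'\<close>
  with \<open>z'\<close> in the injective \<open>K (Suc i)\<close>, and for a lift \<open>w\<close>
  of \<open>z'\<close> the multiple \<open>u w\<close> is a lift of \<open>z\<close> killed by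
  \<open>\<mm>\<close>.\<close>

lemma ext_vanish_of_socle_element:
  assumes u: "u \<in> carrier R" "u \<noteq> \<zero>" "\<And>a. a \<in> \<mm> \<Longrightarrow> a \<otimes> u = \<zero>"
    and B: "baer R (I (Suc i)) (K (Suc i))"
  shows "ext_vanish i \<mm>"
  unfolding ext_vanish_def
proof (intro ballI impI)
  fix z assume z: "z \<in> K (Suc i)" "\<forall>a\<in>\<mm>. a \<odot>\<^bsub>I (Suc i)\<^esub> z = \<zero>\<^bsub>I (Suc i)\<^esub>"
  have "\<exists>z'\<in>K (Suc i). u \<odot>\<^bsub>I (Suc i)\<^esub> z' = z \<and> (\<forall>j\<in>{\<zero>}. j \<odot>\<^bsub>I (Suc i)\<^esub> z' = \<zero>\<^bsub>I (Suc i)\<^esub>)"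
  proof (rule I.baer_divide[OF B K_submodule ideal_zero u(1) z(1)])
    fix a assume a: "a \<in> carrier R" "u \<otimes> a \<in> {\<zero>}"
    have "a \<in> \<mm>"
    proof (rule ccontr)
      assume "a \<notin> \<mm>"
      hence "a \<in> Units R" using m_units a by blast
      hence "inv a \<in> carrier R" "a \<otimes> inv a = \<one>" by auto
      moreover have "u \<otimes> a = \<zero>" using a by simp
      ultimately have "u \<otimes> \<one> = \<zero>" using u(1) a(1) m_assoc[of u a "inv a"] by simp
      thus False using u by simp
    qed
    thus "a \<odot>\<^bsub>I (Suc i)\<^esub> z = \<zero>\<^bsub>I (Suc i)\<^esub>" using z by blast
  qed
  then obtain w where w: "w \<in> carrier (I i)" "u \<odot>\<^bsub>I (Suc i)\<^esub> d i w = z" unfolding K_Suc by blast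
  have "\<forall>a\<in>\<mm>. a \<odot>\<^bsub>I i\<^esub> (u \<odot>\<^bsub>I i\<^esub> w) = \<zero>\<^bsub>I i\<^esub>" using u w m_carrier by (simp add: I.smult_assoc1[symmetric])
  thus "\<exists>w\<in>carrier (I i). (\<forall>a\<in>\<mm>. a \<odot>\<^bsub>I i\<^esub> w = \<zero>\<^bsub>I i\<^esub>) \<and> d i w = z" using u w by (intro bexI[of _ "u \<odot>\<^bsub>I i\<^esub> w"]) auto
qed

text \<open>The same argument with the residue field embedded in \<open>R / x\<close>; this time the
  lift \<open>w\<close> of \<open>z'\<close> should itself be killed by \<open>x\<close>. To correct
  it, \<open>x w\<close> is written as \<open>d v\<close> with \<open>v\<close> one degree lower,
  and \<open>v\<close> is divided by \<open>x\<close>. This uses a lower term of the resolution,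
  hence the degree \<open>Suc k\<close>, and is the reason why the descent ends at
  \<open>K 1\<close>.\<close>

lemma ext_vanish_of_socle_element_mod:
  assumes x: "x \<in> \<mm>" "\<And>a. a \<in> carrier R \<Longrightarrow> x \<otimes> a = \<zero> \<Longrightarrow> a = \<zero>"
    and u: "u \<in> carrier R" "u \<notin> PIdl x" "\<And>a. a \<in> \<mm> \<Longrightarrow> a \<otimes> u \<in> PIdl x"
    and B: "baer R (I (Suc (Suc k))) (K (Suc (Suc k)))"
  shows "ext_vanish (Suc k) \<mm>"
  unfolding ext_vanish_def
proof (intro ballI impI)
  let ?i = "Suc k"
  have xc: "x \<in> carrier R" using x m_carrier by blast
  fix z assume z: "z \<in> K (Suc ?i)" "\<forall>a\<in>\<mm>. a \<odot>\<^bsub>I (Suc ?i)\<^esub> z = \<zero>\<^bsub>I (Suc ?i)\<^esub>"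
  have "\<exists>z'\<in>K (Suc ?i). u \<odot>\<^bsub>I (Suc ?i)\<^esub> z' = z \<and> (\<forall>j\<in>PIdl x. j \<odot>\<^bsub>I (Suc ?i)\<^esub> z' = \<zero>\<^bsub>I (Suc ?i)\<^esub>)"
  proof (rule I.baer_divide[OF B K_submodule cgenideal_ideal[OF xc] u(1) z(1)])
    fix a assume a: "a \<in> carrier R" "u \<otimes> a \<in> PIdl x"
    have "a \<in> \<mm>"
    proof (rule ccontr)
      assume "a \<notin> \<mm>"
      hence au: "a \<in> Units R" using m_units a by blast
      hence "u = inv a \<otimes> (u \<otimes> a)" using u a m_lcomm[of "inv a" u a] by simp
      thus False using idealD(4)[OF cgenideal_ideal[OF xc]] a(2) u(2) Units_inv_closed[OF au] by metis
    qed
    thus "a \<odot>\<^bsub>I (Suc ?i)\<^esub> z = \<zero>\<^bsub>I (Suc ?i)\<^esub>" using z by blast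
  qed
  then obtain z' where z': "z' \<in> K (Suc ?i)" "u \<odot>\<^bsub>I (Suc ?i)\<^esub> z' = z"
    "\<forall>j\<in>PIdl x. j \<odot>\<^bsub>I (Suc ?i)\<^esub> z' = \<zero>\<^bsub>I (Suc ?i)\<^esub>" by blast
  have xz': "x \<odot>\<^bsub>I (Suc ?i)\<^esub> z' = \<zero>\<^bsub>I (Suc ?i)\<^esub>" using z'(3) cgenideal_self[OF xc] by blast
  obtain w where w: "w \<in> carrier (I ?i)" "d ?i w = z'" using z'(1) unfolding K_Suc by blast
  have "x \<odot>\<^bsub>I ?i\<^esub> w \<in> K ?i" using w xc xz' by (simp add: K_def)
  then obtain v where v: "v \<in> carrier (I k)" "d k v = x \<odot>\<^bsub>I ?i\<^esub> w" unfolding K_Suc by force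
  have "\<exists>v'\<in>carrier (I k). x \<odot>\<^bsub>I k\<^esub> v' = v \<and> (\<forall>j\<in>{\<zero>}. j \<odot>\<^bsub>I k\<^esub> v' = \<zero>\<^bsub>I k\<^esub>)"
  proof (rule I.baer_divide[OF I_baer I.submodule_carrier ideal_zero xc v(1)])
    fix a assume "a \<in> carrier R" "x \<otimes> a \<in> {\<zero>}"
    hence "a = \<zero>" using x(2) by blast
    thus "a \<odot>\<^bsub>I k\<^esub> v = \<zero>\<^bsub>I k\<^esub>" using v(1) by simp
  qed
  then obtain v' where v': "v' \<in> carrier (I k)" "x \<odot>\<^bsub>I k\<^esub> v' = v" by blast
  let ?w = "w \<ominus>\<^bsub>I ?i\<^esub> d k v'"
  have dd: "d ?i (d k v') = \<zero>\<^bsub>I (Suc ?i)\<^esub>" using d_K[OF v'(1)] by (simp add: K_def)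
  have "z' \<in> carrier (I (Suc ?i))" using z' K_carrier by blast
  hence dw: "d ?i ?w = z'" using w v' dd by (simp add: a_minus_def)
  have "d k v = x \<odot>\<^bsub>I ?i\<^esub> d k v'" unfolding v'(2)[symmetric] using v'(1) xc by simp
  hence xw: "x \<odot>\<^bsub>I ?i\<^esub> ?w = \<zero>\<^bsub>I ?i\<^esub>"
    using v(2) w v' xc by (simp add: a_minus_def I.smult_r_distr I.smult_r_minus I.M.r_neg)
  have wc: "?w \<in> carrier (I ?i)" using w v' by simp
  have "a \<odot>\<^bsub>I ?i\<^esub> (u \<odot>\<^bsub>I ?i\<^esub> ?w) = \<zero>\<^bsub>I ?i\<^esub>" if a: "a \<in> \<mm>" for a
  proof -
    obtain b where b: "b \<in> carrier R" "a \<otimes> u = b \<otimes> x" using u(3)[OF a] PIdl_iff by blast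
    have "a \<odot>\<^bsub>I ?i\<^esub> (u \<odot>\<^bsub>I ?i\<^esub> ?w) = (b \<otimes> x) \<odot>\<^bsub>I ?i\<^esub> ?w"
      unfolding b(2)[symmetric] using wc a m_carrier u by (simp only: I.smult_assoc1)
    also have "\<dots> = b \<odot>\<^bsub>I ?i\<^esub> (x \<odot>\<^bsub>I ?i\<^esub> ?w)" using wc b(1) xc by (simp only: I.smult_assoc1)
    finally show ?thesis using xw b(1) by simp
  qed
  moreover have "d ?i (u \<odot>\<^bsub>I ?i\<^esub> ?w) = z" using dw z'(2) u(1) wc by simp
  ultimately show "\<exists>w\<in>carrier (I ?i). (\<forall>a\<in>\<mm>. a \<odot>\<^bsub>I ?i\<^esub> w = \<zero>\<^bsub>I ?i\<^esub>) \<and> d ?i w = z"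
    using u wc by (intro bexI[of _ "u \<odot>\<^bsub>I ?i\<^esub> ?w"]) auto
qed

text \<open>If \<open>R\<close> were injective over itself, then multiplication by an element of \<open>\<mm> - P\<close> would be
  surjective on \<open>Hom(R / P, R)\<close>.\<close>

lemma not_self_injective:
  assumes P: "primeideal P R" and y: "y \<in> \<mm>" "y \<notin> P"
    and s: "s \<in> carrier R" "s \<noteq> \<zero>" "\<And>a. a \<in> P \<Longrightarrow> s \<otimes> a = \<zero>"
    and B: "baer R (I 0) (K 0)"
  shows False
proof -
  interpret P: primeideal P R by fact
  have yc: "y \<in> carrier R" using y m_carrier by blast
  have Pc: "P \<subseteq> carrier R" using P.a_subset by blast
  have "ann P \<subseteq> {\<zero>}"
  proof (rule nakayama_ideal_local[OF ideal_zero ann_ideal[OF Pc] y(1)])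
    fix e assume e: "e \<in> ann P"
    have ec: "e \<in> carrier R" using annD e by blast
    have "\<exists>z'\<in>K 0. y \<odot>\<^bsub>I 0\<^esub> z' = \<epsilon> e \<and> (\<forall>j\<in>P. j \<odot>\<^bsub>I 0\<^esub> z' = \<zero>\<^bsub>I 0\<^esub>)"
    proof (rule I.baer_divide[OF B K_submodule P.ideal_axioms yc])
      show "\<epsilon> e \<in> K 0" using ec K_0 by blast
      fix a assume a: "a \<in> carrier R" "y \<otimes> a \<in> P"
      hence "a \<in> P" using P.I_prime[OF yc] y by blast
      hence "a \<otimes> e = \<zero>" using e annD by blast
      thus "a \<odot>\<^bsub>I 0\<^esub> \<epsilon> e = \<zero>\<^bsub>I 0\<^esub>" using eps_simps(2) eps_simps(3)[of a e] a(1) ec by simp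
    qed
    then obtain e' where e': "e' \<in> carrier R" "y \<odot>\<^bsub>I 0\<^esub> \<epsilon> e' = \<epsilon> e" "\<forall>j\<in>P. j \<odot>\<^bsub>I 0\<^esub> \<epsilon> e' = \<zero>\<^bsub>I 0\<^esub>"
      unfolding K_0 by blast
    have "\<epsilon> (y \<otimes> e') = \<epsilon> e" using e' eps_simps(3)[OF yc e'(1)] by simp
    hence 1: "e = \<zero> \<oplus> y \<otimes> e'" using eps_eqD e' yc ec by simp
    have "j \<otimes> e' = \<zero>" if "j \<in> P" for j
    proof -
      have "\<epsilon> (j \<otimes> e') = \<epsilon> \<zero>" using e' that Pc eps_simps(2) eps_simps(3)[of j e'] by auto
      thus ?thesis using eps_eqD e' that Pc by auto
    qed
    hence "e' \<in> ann P" using e' by (simp add: ann_def)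
    thus "\<exists>n\<in>{\<zero>}. \<exists>h'\<in>ann P. e = n \<oplus> y \<otimes> h'" using 1 by blast
  qed
  moreover have "s \<in> ann P" using s Pc m_comm[of s] by (auto simp: ann_def)
  ultimately show False using s by blast
qed

end

section \<open>One-dimensional Gorenstein local rings\<close>

text \<open>The injective dimension is at most 1: \<open>K 1 = I 0 / R\<close> is injective.\<close>

locale gorenstein_dim_1 = ring_injective_resolution +
  fixes x
  assumes x_m: "x \<in> \<mm>" and x_regular: "\<And>a. a \<in> carrier R \<Longrightarrow> x \<otimes> a = \<zero> \<Longrightarrow> a = \<zero>"
    and K_1_baer: "baer R (I (Suc 0)) (K (Suc 0))"
begin

lemma x_carrier: "x \<in> carrier R" using x_m m_carrier by blast

lemma x_ideal: "ideal (PIdl x) R" using cgenideal_ideal x_carrier by blast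

lemma xI: "b \<in> carrier R \<Longrightarrow> x \<otimes> b \<in> PIdl x" using x_carrier by (auto simp: PIdl_iff m_comm)

lemma xE: "a \<in> PIdl x \<Longrightarrow> \<exists>b\<in>carrier R. a = x \<otimes> b" using x_carrier by (auto simp: PIdl_iff m_comm)

lemma x_proper: "\<one> \<notin> PIdl x"
proof
  assume "\<one> \<in> PIdl x"
  then obtain b where "b \<in> carrier R" "\<one> = b \<otimes> x" using PIdl_iff by blast
  hence "\<one> \<in> \<mm>" using idealD(4)[OF m_ideal _ x_m] by simp
  thus False using m_proper by blast
qed

text \<open>\<open>R / x\<close> embeds into \<open>K 1\<close> as a direct summand of the elements killed by \<open>x\<close>, so it is
  injective over itself.\<close>

lemma divide_mod_x:
  assumes J: "ideal J R" "x \<in> J" and y: "y \<in> carrier R" and z: "z \<in> carrier R"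
    and ann: "\<And>a. a \<in> carrier R \<Longrightarrow> y \<otimes> a \<in> J \<Longrightarrow> a \<otimes> z \<in> PIdl x"
  shows "\<exists>c\<in>carrier R. y \<otimes> c \<ominus> z \<in> PIdl x \<and> (\<forall>j\<in>J. j \<otimes> c \<in> PIdl x)"
proof -
  note [simp] = x_carrier
  have "\<exists>w\<in>carrier (I 0). x \<odot>\<^bsub>I 0\<^esub> w = \<epsilon> \<one> \<and> (\<forall>j\<in>{\<zero>}. j \<odot>\<^bsub>I 0\<^esub> w = \<zero>\<^bsub>I 0\<^esub>)"
  proof (rule I.baer_divide[OF I_baer I.submodule_carrier ideal_zero x_carrier eps_simps(1)[OF one_closed]])
    fix a assume "a \<in> carrier R" "x \<otimes> a \<in> {\<zero>}"
    hence "a = \<zero>" using x_regular by blast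
    thus "a \<odot>\<^bsub>I 0\<^esub> \<epsilon> \<one> = \<zero>\<^bsub>I 0\<^esub>" using eps_simps(1)[OF one_closed] by simp
  qed
  then obtain w1 where w1: "w1 \<in> carrier (I 0)" "x \<odot>\<^bsub>I 0\<^esub> w1 = \<epsilon> \<one>" by blast
  \<comment> \<open>\<open>w1\<close> plays the role of \<open>1 / x\<close> in \<open>I 0\<close>,
    so \<open>?t\<close> generates the copy of \<open>R / x\<close> in \<open>K 1\<close>.\<close>
  let ?t = "d 0 w1"
  have tc: "?t \<in> K (Suc 0)" "?t \<in> carrier (I (Suc 0))" using d_K w1 K_carrier by auto
  have e1: "\<epsilon> \<one> \<in> K 0" using K_0 by blast
  have "x \<odot>\<^bsub>I (Suc 0)\<^esub> ?t = d 0 (x \<odot>\<^bsub>I 0\<^esub> w1)" using w1(1) by simp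
  also have "\<dots> = \<zero>\<^bsub>I (Suc 0)\<^esub>" unfolding w1(2) using e1 by (simp add: K_def)
  finally have xt: "x \<odot>\<^bsub>I (Suc 0)\<^esub> ?t = \<zero>\<^bsub>I (Suc 0)\<^esub>" .
  have zt: "z \<odot>\<^bsub>I (Suc 0)\<^esub> ?t \<in> K (Suc 0)" using I.submoduleD(4)[OF K_submodule z tc(1)] .
  have "\<exists>z'\<in>K (Suc 0). y \<odot>\<^bsub>I (Suc 0)\<^esub> z' = z \<odot>\<^bsub>I (Suc 0)\<^esub> ?t \<and> (\<forall>j\<in>J. j \<odot>\<^bsub>I (Suc 0)\<^esub> z' = \<zero>\<^bsub>I (Suc 0)\<^esub>)"
  proof (rule I.baer_divide[OF K_1_baer K_submodule J(1) y zt])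
    fix a assume a: "a \<in> carrier R" "y \<otimes> a \<in> J"
    then obtain b where b: "b \<in> carrier R" "a \<otimes> z = b \<otimes> x" using ann PIdl_iff by blast
    have "a \<odot>\<^bsub>I (Suc 0)\<^esub> (z \<odot>\<^bsub>I (Suc 0)\<^esub> ?t) = (b \<otimes> x) \<odot>\<^bsub>I (Suc 0)\<^esub> ?t"
      unfolding b(2)[symmetric] using a z tc by (simp only: I.smult_assoc1)
    also have "\<dots> = b \<odot>\<^bsub>I (Suc 0)\<^esub> (x \<odot>\<^bsub>I (Suc 0)\<^esub> ?t)" using b(1) tc x_carrier by (simp only: I.smult_assoc1)
    finally show "a \<odot>\<^bsub>I (Suc 0)\<^esub> (z \<odot>\<^bsub>I (Suc 0)\<^esub> ?t) = \<zero>\<^bsub>I (Suc 0)\<^esub>" using xt b(1) by simp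
  qed
  then obtain w where w: "w \<in> carrier (I 0)" "y \<odot>\<^bsub>I (Suc 0)\<^esub> d 0 w = z \<odot>\<^bsub>I (Suc 0)\<^esub> ?t"
     "\<forall>j\<in>J. j \<odot>\<^bsub>I (Suc 0)\<^esub> d 0 w = \<zero>\<^bsub>I (Suc 0)\<^esub>" unfolding K_Suc by blast
  have jw: "\<exists>b\<in>carrier R. j \<odot>\<^bsub>I 0\<^esub> w = \<epsilon> b" if "j \<in> J" for j
  proof -
    have "j \<odot>\<^bsub>I 0\<^esub> w \<in> K 0" using w that idealD(1)[OF J(1)] by (simp add: K_def)
    thus ?thesis unfolding K_0 by blast
  qed
  \<comment> \<open>Since \<open>x\<close> lies in \<open>J\<close>, clearing the denominator of
    \<open>w\<close> gives an element of the ring; \<open>c\<close> is the desired quotient modulo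
    \<open>x\<close>.\<close>
  obtain c where c: "c \<in> carrier R" "x \<odot>\<^bsub>I 0\<^esub> w = \<epsilon> c" using jw[OF J(2)] by blast
  have cancel: "a \<in> PIdl x" if a: "a \<in> carrier R" "b \<in> carrier R" "\<epsilon> a = x \<odot>\<^bsub>I 0\<^esub> \<epsilon> b" for a b
  proof -
    have "a = x \<otimes> b" using eps_eqD[of a "x \<otimes> b"] a eps_simps(3)[of x b] by simp
    thus ?thesis using xI a by simp
  qed
  have "y \<otimes> c \<ominus> z \<in> PIdl x"
  proof -
    have "y \<odot>\<^bsub>I 0\<^esub> w \<ominus>\<^bsub>I 0\<^esub> z \<odot>\<^bsub>I 0\<^esub> w1 \<in> K 0" using w w1 y z tc by (simp add: K_def I.M.r_neg a_minus_def)
    then obtain b where b: "b \<in> carrier R" "y \<odot>\<^bsub>I 0\<^esub> w \<ominus>\<^bsub>I 0\<^esub> z \<odot>\<^bsub>I 0\<^esub> w1 = \<epsilon> b" unfolding K_0 by blast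
    have "x \<odot>\<^bsub>I 0\<^esub> \<epsilon> b = y \<odot>\<^bsub>I 0\<^esub> (x \<odot>\<^bsub>I 0\<^esub> w) \<ominus>\<^bsub>I 0\<^esub> z \<odot>\<^bsub>I 0\<^esub> (x \<odot>\<^bsub>I 0\<^esub> w1)"
      unfolding b(2)[symmetric] using w(1) w1(1) y z by (simp add: I.msimps)
    also have "\<dots> = \<epsilon> (y \<otimes> c \<ominus> z)"
      unfolding c(2) w1(2) using y z c(1) eps_simps(3)[of y c] eps_simps(3)[of z \<one>] eps_simps(5)[of "y \<otimes> c" z] by simp
    finally show ?thesis using cancel[of "y \<otimes> c \<ominus> z" b] y z c b by simp
  qed
  moreover have "j \<otimes> c \<in> PIdl x" if j: "j \<in> J" for j
  proof -
    have jc: "j \<in> carrier R" using j idealD(1)[OF J(1)] by blast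
    obtain b where b: "b \<in> carrier R" "j \<odot>\<^bsub>I 0\<^esub> w = \<epsilon> b" using jw[OF j] by blast
    have "x \<odot>\<^bsub>I 0\<^esub> \<epsilon> b = j \<odot>\<^bsub>I 0\<^esub> (x \<odot>\<^bsub>I 0\<^esub> w)" unfolding b(2)[symmetric] using w(1) jc by (simp add: I.msimps)
    also have "\<dots> = \<epsilon> (j \<otimes> c)" unfolding c(2) using jc c(1) eps_simps(3)[of j c] by simp
    finally show ?thesis using cancel[of "j \<otimes> c" b] jc c b by simp
  qed
  ultimately show ?thesis using c(1) by blast
qed

text \<open>\<open>Ext\<^sup>1(R / S, R) = 0\<close> when \<open>x\<close> is regular on \<open>R / S\<close>, for the domain \<open>S\<close> of the graph \<open>r\<close> of a
  homomorphism.\<close>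

lemma hom_extends:
  assumes r: "\<And>a z. (a, z) \<in> r \<Longrightarrow> a \<in> carrier R \<and> z \<in> carrier R" "(\<zero>, \<zero>) \<in> r"
    "\<And>a z b w. (a, z) \<in> r \<Longrightarrow> (b, w) \<in> r \<Longrightarrow> (a \<oplus> b, z \<oplus> w) \<in> r"
    "\<And>c a z. c \<in> carrier R \<Longrightarrow> (a, z) \<in> r \<Longrightarrow> (c \<otimes> a, c \<otimes> z) \<in> r"
    and single: "\<And>z. (\<zero>, z) \<in> r \<Longrightarrow> z = \<zero>"
    and reg: "regular_on x {a. \<exists>z. (a, z) \<in> r}"
  shows "\<exists>c\<in>carrier R. \<forall>a z. (a, z) \<in> r \<longrightarrow> z = a \<otimes> c"
proof -
  let ?S = "{a. \<exists>z. (a, z) \<in> r}"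
  have S: "ideal ?S R" unfolding ideal_iff using r by blast
  have ev: "ext_vanish 0 ?S" using ext_vanish_regular[OF S x_m _ K_1_baer] regular_onD[OF reg] by blast
  let ?r = "{(a, \<epsilon> z) | a z. (a, z) \<in> r}"
  have "\<exists>w\<in>carrier (I 0). \<forall>a v. (a, v) \<in> ?r \<longrightarrow> v = a \<odot>\<^bsub>I 0\<^esub> w"
  proof (rule I.baer_relation[OF I_baer I.submodule_carrier])
    fix a v assume "(a, v) \<in> ?r"
    thus "a \<in> carrier R \<and> v \<in> carrier (I 0)" using r(1) eps_simps(1) by blast
  next
    show "(\<zero>, \<zero>\<^bsub>I 0\<^esub>) \<in> ?r" using r(2) eps_simps(2) by force
  next
    fix a v b w assume "(a, v) \<in> ?r" "(b, w) \<in> ?r"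
    then obtain z z' where h: "(a, z) \<in> r" "v = \<epsilon> z" "(b, z') \<in> r" "w = \<epsilon> z'" by blast
    hence "v \<oplus>\<^bsub>I 0\<^esub> w = \<epsilon> (z \<oplus> z')" using eps_simps(4)[of z z'] r(1) by auto
    thus "(a \<oplus> b, v \<oplus>\<^bsub>I 0\<^esub> w) \<in> ?r" using r(3)[OF h(1,3)] by blast
  next
    fix c a v assume c: "c \<in> carrier R" "(a, v) \<in> ?r"
    then obtain z where h: "(a, z) \<in> r" "v = \<epsilon> z" by blast
    hence "c \<odot>\<^bsub>I 0\<^esub> v = \<epsilon> (c \<otimes> z)" using eps_simps(3)[of c z] r(1) c by auto
    thus "(c \<otimes> a, c \<odot>\<^bsub>I 0\<^esub> v) \<in> ?r" using r(4)[OF c(1) h(1)] by blast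
  next
    fix v assume "(\<zero>, v) \<in> ?r"
    thus "v = \<zero>\<^bsub>I 0\<^esub>" using single eps_simps(2) by blast
  qed
  then obtain w where w: "w \<in> carrier (I 0)" "\<And>a z. (a, z) \<in> r \<Longrightarrow> \<epsilon> z = a \<odot>\<^bsub>I 0\<^esub> w" by blast
  \<comment> \<open>The element \<open>w\<close> extends the map only into \<open>I 0\<close>. Its
    differential represents the obstruction in \<open>Ext^1(R / S, R)\<close>, which
    \<open>ev\<close> makes trivial.\<close>
  have "\<forall>a\<in>?S. a \<odot>\<^bsub>I (Suc 0)\<^esub> d 0 w = \<zero>\<^bsub>I (Suc 0)\<^esub>"
  proof
    fix a assume "a \<in> ?S"
    then obtain z where z: "(a, z) \<in> r" by blast
    hence "a \<odot>\<^bsub>I 0\<^esub> w \<in> K 0" using w(2)[OF z] K_0 r(1) by force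
    hence "d 0 (a \<odot>\<^bsub>I 0\<^esub> w) = \<zero>\<^bsub>I (Suc 0)\<^esub>" by (simp add: K_def)
    thus "a \<odot>\<^bsub>I (Suc 0)\<^esub> d 0 w = \<zero>\<^bsub>I (Suc 0)\<^esub>" using r(1)[OF z] w(1) by simp
  qed
  then obtain w' where w': "w' \<in> carrier (I 0)" "\<forall>a\<in>?S. a \<odot>\<^bsub>I 0\<^esub> w' = \<zero>\<^bsub>I 0\<^esub>" "d 0 w' = d 0 w"
    using ev d_K[OF w(1)] unfolding ext_vanish_def by blast
  have "w \<ominus>\<^bsub>I 0\<^esub> w' \<in> K 0" using w w' by (simp add: K_def a_minus_def I.M.r_neg)
  then obtain c where c: "c \<in> carrier R" "w \<ominus>\<^bsub>I 0\<^esub> w' = \<epsilon> c" unfolding K_0 by blast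
  have "z = a \<otimes> c" if az: "(a, z) \<in> r" for a z
  proof -
    have ac: "a \<in> carrier R" "z \<in> carrier R" using r(1)[OF az] by auto
    have "a \<odot>\<^bsub>I 0\<^esub> w' = \<zero>\<^bsub>I 0\<^esub>" using w'(2) az by blast
    hence "a \<odot>\<^bsub>I 0\<^esub> (w \<ominus>\<^bsub>I 0\<^esub> w') = a \<odot>\<^bsub>I 0\<^esub> w"
      using ac w w' by (simp add: a_minus_def I.smult_r_distr I.smult_r_minus)
    hence "\<epsilon> z = \<epsilon> (a \<otimes> c)" using w(2)[OF az] c eps_simps(3)[OF ac(1) c(1)] by simp
    thus ?thesis using eps_eqD ac c by simp
  qed
  thus ?thesis using c(1) by blast
qed

end

section \<open>The socle of R/x and the primes that avoid x\<close>

context gorenstein_dim_1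
begin

lemma x_submodule: "submodule R (PIdl x) RM" using x_ideal ideal_iff_submodule by blast

lemma colon_x_ideal: "v \<in> carrier R \<Longrightarrow> ideal {a \<in> carrier R. a \<otimes> v \<in> PIdl x} R"
  using self.ideal_colon[OF x_submodule, of "{v}"] by simp

text \<open>An associated prime \<open>Q\<close> of \<open>R / x\<close> must be
  \<open>\<mm>\<close>: for \<open>y\<close> in \<open>\<mm>\<close> outside \<open>Q\<close>,
  self-injectivity of \<open>R / x\<close> would make \<open>y\<close> surjective on the elements of
  \<open>R / x\<close> killed by \<open>Q\<close>, and Nakayama's lemma would leave none except
  zero.\<close>

lemma socle_element_exists:
  assumes v: "v \<in> carrier R" "v \<notin> PIdl x"
  obtains b where "b \<in> carrier R" "b \<otimes> v \<notin> PIdl x" "\<And>a. a \<in> \<mm> \<Longrightarrow> a \<otimes> (b \<otimes> v) \<in> PIdl x"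
proof -
  obtain b Q where b: "b \<in> carrier R" "b \<otimes> v \<notin> PIdl x" "Q = {a \<in> carrier R. a \<otimes> (b \<otimes> v) \<in> PIdl x}"
    "primeideal Q R" using associated_prime[OF self_module x_submodule, of v] v by auto
  interpret Q: primeideal Q R by fact
  let ?V = "{w \<in> carrier R. \<forall>q\<in>Q. q \<otimes> w \<in> PIdl x}"
  have V: "ideal ?V R" using self.submodule_torsion[OF Q.a_subset x_submodule] by (simp add: ideal_iff_submodule)
  have bv: "b \<otimes> v \<in> carrier R" using m_closed[OF b(1) v(1)] .
  have xQ: "PIdl x \<subseteq> Q"
  proof
    fix a assume a: "a \<in> PIdl x"
    hence ac: "a \<in> carrier R" using idealD(1)[OF x_ideal] by blast
    have "(b \<otimes> v) \<otimes> a \<in> PIdl x" using idealD(4)[OF x_ideal bv a] .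
    hence "a \<otimes> (b \<otimes> v) \<in> PIdl x" unfolding m_comm[OF bv ac] .
    thus "a \<in> Q" unfolding b(3) using ac by blast
  qed
  have "\<mm> \<subseteq> Q"
  proof (rule ccontr)
    assume "\<not> \<mm> \<subseteq> Q"
    then obtain y where y: "y \<in> \<mm>" "y \<notin> Q" by blast
    have yc: "y \<in> carrier R" using y m_carrier by blast
    have "?V \<subseteq> PIdl x"
    proof (rule nakayama_ideal_local[OF x_ideal V y(1)])
      fix w assume w: "w \<in> ?V"
      have "\<exists>c\<in>carrier R. y \<otimes> c \<ominus> w \<in> PIdl x \<and> (\<forall>j\<in>Q. j \<otimes> c \<in> PIdl x)"
      proof (rule divide_mod_x[OF Q.ideal_axioms _ yc])
        show "x \<in> Q" using xQ cgenideal_self[OF x_carrier] by blast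
        show "w \<in> carrier R" using w by blast
        fix a assume "a \<in> carrier R" "y \<otimes> a \<in> Q"
        hence "a \<in> Q" using Q.I_prime[OF yc] y by blast
        thus "a \<otimes> w \<in> PIdl x" using w by blast
      qed
      then obtain c where c: "c \<in> carrier R" "y \<otimes> c \<ominus> w \<in> PIdl x" "\<forall>j\<in>Q. j \<otimes> c \<in> PIdl x" by blast
      have wc: "w \<in> carrier R" using w by blast
      have "w = \<ominus> (y \<otimes> c \<ominus> w) \<oplus> y \<otimes> c" using c(1) yc wc by algebra
      moreover have "\<ominus> (y \<otimes> c \<ominus> w) \<in> PIdl x"
        using ideal_minus[OF x_ideal idealD(2)[OF x_ideal] c(2)] c(1) yc wc by (simp add: a_minus_def)
      ultimately show "\<exists>n\<in>PIdl x. \<exists>h'\<in>?V. w = n \<oplus> y \<otimes> h'" using c by blast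
    qed
    moreover have "b \<otimes> v \<in> ?V" using b(3) bv by blast
    ultimately show False using b(2) by blast
  qed
  thus ?thesis using that[OF b(1,2)] b(3) by blast
qed

lemma unit_of_not_mult:
  assumes "a \<in> carrier R" "u \<in> carrier R" "a \<otimes> u \<in> J" "u \<notin> J" "ideal J R"
  shows "a \<in> \<mm>"
proof (rule ccontr)
  assume "a \<notin> \<mm>"
  hence au: "a \<in> Units R" using m_units assms by blast
  have "inv a \<otimes> (a \<otimes> u) \<in> J" using idealD(4)[OF assms(5) Units_inv_closed[OF au] assms(3)] .
  moreover have "inv a \<otimes> (a \<otimes> u) = u" using au assms m_assoc[of "inv a" a u] by simp
  ultimately show False using assms(4) by simp
qed

text \<open>If \<open>v\<close> were outside \<open>x R + u R\<close>, self-injectivity of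
  \<open>R / x\<close> would give a multiplier \<open>c\<close> that fixes \<open>u\<close> and
  kills \<open>v\<close> modulo \<open>x\<close>. Killing \<open>v\<close> puts \<open>c\<close> in
  \<open>\<mm>\<close>, but then \<open>c\<close> also kills \<open>u\<close>.\<close>

lemma socle_unique:
  assumes u: "u \<in> carrier R" "u \<notin> PIdl x" "\<And>a. a \<in> \<mm> \<Longrightarrow> a \<otimes> u \<in> PIdl x"
    and v: "v \<in> carrier R" "\<And>a. a \<in> \<mm> \<Longrightarrow> a \<otimes> v \<in> PIdl x"
  obtains b where "b \<in> carrier R" "v \<ominus> b \<otimes> u \<in> PIdl x"
proof -
  have "v \<in> self.adjoin (PIdl x) u"
  proof (rule ccontr)
    assume n: "v \<notin> self.adjoin (PIdl x) u"
    have A: "ideal (self.adjoin (PIdl x) u) R" "ideal (self.adjoin (PIdl x) v) R"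
      using ideal_adjoin x_ideal u v by blast+
    have xA: "PIdl x \<subseteq> self.adjoin (PIdl x) w" "w \<in> self.adjoin (PIdl x) w" if "w \<in> carrier R" for w
      using self.adjoin_superset[OF x_submodule, of w] that by auto
    have "\<exists>c\<in>carrier R. u \<otimes> c \<ominus> u \<in> PIdl x \<and> (\<forall>j\<in>self.adjoin (PIdl x) v. j \<otimes> c \<in> PIdl x)"
    proof (rule divide_mod_x[OF A(2) _ u(1) u(1)])
      show "x \<in> self.adjoin (PIdl x) v" using xA(1)[OF v(1)] cgenideal_self[OF x_carrier] by blast
      fix a assume a: "a \<in> carrier R" "u \<otimes> a \<in> self.adjoin (PIdl x) v"
      then obtain n' b where b: "n' \<in> PIdl x" "b \<in> carrier R" "u \<otimes> a = n' \<oplus> b \<otimes> v"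
        unfolding adjoin_eq_self by blast
      have nc: "n' \<in> carrier R" using b idealD(1)[OF x_ideal] by blast
      have bv: "b \<otimes> v = a \<otimes> u \<ominus> n'"
      proof -
        have "b \<otimes> v = (n' \<oplus> b \<otimes> v) \<ominus> n'" using b(2) v(1) nc by algebra
        thus ?thesis using b(3) a(1) u(1) m_comm by metis
      qed
      have "a \<otimes> u \<ominus> n' \<in> self.adjoin (PIdl x) u"
        using ideal_minus[OF A(1)] idealD(4)[OF A(1) a(1) xA(2)[OF u(1)]] xA(1)[OF u(1)] b(1) by blast
      hence "b \<in> \<mm>" using unit_of_not_mult[OF b(2) v(1) _ n A(1)] bv by simp
      hence "b \<otimes> v \<in> PIdl x" using v(2) by blast
      hence "n' \<oplus> b \<otimes> v \<in> PIdl x" using idealD(3)[OF x_ideal b(1)] by blast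
      thus "a \<otimes> u \<in> PIdl x" using b(3) m_comm[OF u(1) a(1)] by simp
    qed
    then obtain c where c: "c \<in> carrier R" "u \<otimes> c \<ominus> u \<in> PIdl x" "v \<otimes> c \<in> PIdl x" using xA(2)[OF v(1)] by blast
    have vn: "v \<notin> PIdl x" using n xA(1)[OF u(1)] by blast
    have "c \<otimes> v \<in> PIdl x" using c v m_comm by simp
    hence "c \<in> \<mm>" using unit_of_not_mult[OF c(1) v(1) _ vn x_ideal] by blast
    hence "c \<otimes> u \<in> PIdl x" using u(3) by blast
    hence "c \<otimes> u \<ominus> (u \<otimes> c \<ominus> u) \<in> PIdl x" using ideal_minus[OF x_ideal] c(2) by blast
    moreover have "c \<otimes> u \<ominus> (u \<otimes> c \<ominus> u) = u" using c(1) u(1) by algebra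
    ultimately show False using u(2) by simp
  qed
  then obtain n b where b: "n \<in> PIdl x" "b \<in> carrier R" "v = n \<oplus> b \<otimes> u" unfolding adjoin_eq_self by blast
  have "n \<in> carrier R" using b idealD(1)[OF x_ideal] by blast
  hence "v \<ominus> b \<otimes> u = n" unfolding b(3) using b(2) u(1) by algebra
  thus ?thesis using that b by simp
qed

text \<open>The annihilators of the powers of \<open>y\<close> modulo \<open>x\<close> become
  stationary at some \<open>k\<close>. Were no power in \<open>x R\<close>, some multiple of
  \<open>y [^] k\<close> would be a socle element outside \<open>x R\<close>, hence killed modulo
  \<open>x\<close> by one more factor \<open>y\<close>, against stationarity.\<close>

lemma m_nilpotent_mod_x:
  assumes y: "y \<in> \<mm>"
  shows "\<exists>k::nat. y [^] k \<in> PIdl x"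
proof (rule ccontr)
  assume n: "\<not> ?thesis"
  have yc: "y \<in> carrier R" using y m_carrier by blast
  let ?C = "\<lambda>k::nat. {a \<in> carrier R. a \<otimes> y [^] k \<in> PIdl x}"
  have "\<exists>J\<in>range ?C. \<forall>J'\<in>range ?C. J \<subseteq> J' \<longrightarrow> J' = J"
    using colon_x_ideal yc by (intro maximal_ideal_in_family) auto
  then obtain k where k: "\<forall>k'. ?C k \<subseteq> ?C k' \<longrightarrow> ?C k' = ?C k" by auto
  have "?C k \<subseteq> ?C (Suc k)"
  proof
    fix a assume a: "a \<in> ?C k"
    hence "y \<otimes> (a \<otimes> y [^] k) \<in> PIdl x" using idealD(4)[OF x_ideal yc] by blast
    moreover have "y \<otimes> (a \<otimes> y [^] k) = a \<otimes> y [^] Suc k" using a yc by (simp add: m_ac)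
    ultimately show "a \<in> ?C (Suc k)" using a by auto
  qed
  hence eq: "?C (Suc k) = ?C k" using k by blast
  have yk: "y [^] k \<in> carrier R" "y [^] k \<notin> PIdl x" using yc n by auto
  obtain b where b: "b \<in> carrier R" "b \<otimes> y [^] k \<notin> PIdl x"
    "\<And>a. a \<in> \<mm> \<Longrightarrow> a \<otimes> (b \<otimes> y [^] k) \<in> PIdl x" using socle_element_exists[OF yk] by blast
  have "y \<otimes> (b \<otimes> y [^] k) \<in> PIdl x" using b(3) y by blast
  moreover have "y \<otimes> (b \<otimes> y [^] k) = b \<otimes> y [^] Suc k" using b yc by (simp add: m_ac)
  ultimately have "b \<in> ?C (Suc k)" using b(1) by auto
  thus False using eq b(2) by blast
qed

lemma prime_containing_x:
  assumes Q: "primeideal Q R" "x \<in> Q"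
  shows "Q = \<mm>"
proof
  interpret Q: primeideal Q R by fact
  have "\<one> \<notin> Q" using Q.one_imp_carrier Q.I_notcarr by blast
  thus "Q \<subseteq> \<mm>" using proper_ideal_le_m[OF Q.ideal_axioms] by blast
  show "\<mm> \<subseteq> Q"
  proof
    fix y assume y: "y \<in> \<mm>"
    then obtain k :: nat where "y [^] k \<in> PIdl x" using m_nilpotent_mod_x by blast
    hence "y [^] k \<in> Q" using cgenideal_minimal[OF Q.ideal_axioms Q(2)] by blast
    thus "y \<in> Q" using primeideal_pow[OF Q(1)] y m_carrier by blast
  qed
qed

text \<open>Reflexivity of \<open>R / Q\<close> when \<open>x\<close> is regular on it.\<close>

lemma ann_ann:
  assumes Q: "ideal Q R" and reg: "regular_on x Q" and Q1: "\<one> \<notin> Q"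
    and s: "s \<in> carrier R" "\<And>w. w \<in> ann Q \<Longrightarrow> s \<otimes> w = \<zero>"
  shows "s \<in> Q"
proof -
  note Qd = idealD[OF Q]
  let ?N = "{s \<in> carrier R. \<forall>w\<in>ann Q. s \<otimes> w \<in> {\<zero>}}"
  have annc: "ann Q \<subseteq> carrier R" using annD(1) by blast
  have N: "ideal ?N R" using self.ideal_colon[OF self.submodule_zero, of "ann Q"] annc by simp
  have "?N \<subseteq> Q"
  proof (rule nakayama_ideal_local[OF Q N x_m])
    fix s assume s: "s \<in> ?N"
    have sc: "s \<in> carrier R" using s by blast
    have A: "ideal (self.adjoin Q x) R" using ideal_adjoin Q x_carrier by blast
    have Asup: "Q \<subseteq> self.adjoin Q x" "x \<in> self.adjoin Q x"
      using self.adjoin_superset[of Q x] Q x_carrier by (auto simp: ideal_iff_submodule)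
    \<comment> \<open>Enough for Nakayama's lemma: if \<open>s = q + s1 x\<close>, then
      \<open>s1\<close> again annihilates \<open>ann Q\<close> because \<open>x\<close> is
      regular.\<close>
    have "s \<in> self.adjoin Q x"
    proof (rule ccontr)
      assume n: "s \<notin> self.adjoin Q x"
      obtain u0 where u0: "u0 \<in> carrier R" "u0 \<notin> PIdl x" "\<And>a. a \<in> \<mm> \<Longrightarrow> a \<otimes> u0 \<in> PIdl x"
        using socle_element_exists[OF one_closed x_proper] by (metis r_one)
      \<comment> \<open>Self-injectivity of \<open>R / x\<close> provides \<open>u\<close>, killed
        by \<open>Q\<close> modulo \<open>x\<close>, with \<open>s u\<close> congruent to the socle
        element \<open>u0\<close>.\<close>
      have "\<exists>u\<in>carrier R. s \<otimes> u \<ominus> u0 \<in> PIdl x \<and> (\<forall>j\<in>self.adjoin Q x. j \<otimes> u \<in> PIdl x)"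
      proof (rule divide_mod_x[OF A Asup(2) sc u0(1)])
        fix a assume a: "a \<in> carrier R" "s \<otimes> a \<in> self.adjoin Q x"
        hence "a \<otimes> s \<in> self.adjoin Q x" using sc m_comm by simp
        hence "a \<in> \<mm>" using unit_of_not_mult[OF a(1) sc _ n A] by blast
        thus "a \<otimes> u0 \<in> PIdl x" using u0 by blast
      qed
      then obtain u where u: "u \<in> carrier R" "s \<otimes> u \<ominus> u0 \<in> PIdl x" "\<forall>j\<in>self.adjoin Q x. j \<otimes> u \<in> PIdl x" by blast
      have su: "s \<otimes> u \<notin> PIdl x"
      proof
        assume "s \<otimes> u \<in> PIdl x"
        hence "s \<otimes> u \<ominus> (s \<otimes> u \<ominus> u0) \<in> PIdl x" using ideal_minus[OF x_ideal] u(2) by blast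
        moreover have "s \<otimes> u \<ominus> (s \<otimes> u \<ominus> u0) = u0" using sc u(1) u0(1) by algebra
        ultimately show False using u0(2) by simp
      qed
      \<comment> \<open>The map from \<open>Q\<close> to \<open>R\<close> that divides
        \<open>q u\<close> by \<open>x\<close>. Its extension, multiplication by \<open>c\<close>,
        lifts \<open>u\<close> to the honest element \<open>u - x c\<close> of
        \<open>ann Q\<close>.\<close>
      let ?r = "{(q, v). q \<in> Q \<and> v \<in> carrier R \<and> x \<otimes> v = q \<otimes> u}"
      have dom: "{a. \<exists>z. (a, z) \<in> ?r} = Q"
      proof
        show "Q \<subseteq> {a. \<exists>z. (a, z) \<in> ?r}"
        proof
          fix q assume q: "q \<in> Q"
          hence "q \<otimes> u \<in> PIdl x" using u(3) Asup(1) by blast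
          then obtain v where "v \<in> carrier R" "q \<otimes> u = x \<otimes> v" using xE by blast
          thus "q \<in> {a. \<exists>z. (a, z) \<in> ?r}" using q by auto
        qed
      qed auto
      have "\<exists>c\<in>carrier R. \<forall>a z. (a, z) \<in> ?r \<longrightarrow> z = a \<otimes> c"
      proof (rule hom_extends)
        show "regular_on x {a. \<exists>z. (a, z) \<in> ?r}" unfolding dom by (rule reg)
        show "(\<zero>, \<zero>) \<in> ?r" using Qd(2) x_carrier u(1) by simp
      next
        fix a z assume "(a, z) \<in> ?r" thus "a \<in> carrier R \<and> z \<in> carrier R" using Qd(1) by blast
      next
        fix a z b w assume "(a, z) \<in> ?r" "(b, w) \<in> ?r"
        thus "(a \<oplus> b, z \<oplus> w) \<in> ?r" using Qd(1,3) x_carrier u(1) by (auto simp: r_distr l_distr)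
      next
        fix c a z assume c: "c \<in> carrier R" "(a, z) \<in> ?r"
        hence "x \<otimes> (c \<otimes> z) = c \<otimes> (x \<otimes> z)" using x_carrier by (auto simp: m_ac)
        also have "\<dots> = (c \<otimes> a) \<otimes> u" using c Qd(1) u(1) by (auto simp: m_assoc)
        finally show "(c \<otimes> a, c \<otimes> z) \<in> ?r" using c Qd(4) by auto
      next
        fix z assume "(\<zero>, z) \<in> ?r"
        thus "z = \<zero>" using u(1) x_regular by auto
      qed
      then obtain c where c: "c \<in> carrier R" "\<And>a z. (a, z) \<in> ?r \<Longrightarrow> z = a \<otimes> c" by blast
      let ?w = "u \<ominus> x \<otimes> c"
      have "q \<otimes> ?w = \<zero>" if q: "q \<in> Q" for q
      proof -
        have qc: "q \<in> carrier R" using q Qd(1) by blast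
        obtain v where v: "(q, v) \<in> ?r" using q dom by blast
        hence "q \<otimes> u = x \<otimes> (q \<otimes> c)" using c(2)[OF v] by auto
        moreover have "q \<otimes> ?w = q \<otimes> u \<ominus> x \<otimes> (q \<otimes> c)" using qc u(1) c(1) x_carrier by algebra
        ultimately show ?thesis using qc c(1) x_carrier by (simp add: a_minus_def r_neg)
      qed
      hence "?w \<in> ann Q" using u(1) c(1) x_carrier by (simp add: ann_def)
      hence "s \<otimes> ?w = \<zero>" using s by blast
      moreover have "s \<otimes> u = s \<otimes> ?w \<oplus> x \<otimes> (s \<otimes> c)" using sc u(1) c(1) x_carrier by algebra
      ultimately have "s \<otimes> u = x \<otimes> (s \<otimes> c)" using sc c(1) x_carrier by simp
      thus False using su xI[of "s \<otimes> c"] sc c(1) by simp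
    qed
    then obtain q s1 where q: "q \<in> Q" "s1 \<in> carrier R" "s = q \<oplus> s1 \<otimes> x" unfolding adjoin_eq_self by blast
    have qc: "q \<in> carrier R" using q Qd(1) by blast
    have "s1 \<otimes> w = \<zero>" if w: "w \<in> ann Q" for w
    proof (rule x_regular)
      have wc: "w \<in> carrier R" using w annD by blast
      show "s1 \<otimes> w \<in> carrier R" using wc q by simp
      have "s \<otimes> w = \<zero>" using s w by blast
      moreover have "q \<otimes> w = \<zero>" using annD(2)[OF w q(1)] .
      moreover have "s \<otimes> w = q \<otimes> w \<oplus> x \<otimes> (s1 \<otimes> w)" unfolding q(3) using qc q(2) wc x_carrier by algebra
      ultimately show "x \<otimes> (s1 \<otimes> w) = \<zero>" using q wc x_carrier by simp
    qed
    hence s1: "s1 \<in> ?N" using q(2) by simp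
    have "s = q \<oplus> x \<otimes> s1" using q(3) m_comm[OF q(2) x_carrier] by simp
    thus "\<exists>n\<in>Q. \<exists>h'\<in>?N. s = n \<oplus> x \<otimes> h'" using q(1) s1 by blast
  qed
  thus ?thesis using s by blast
qed

text \<open>Suppose \<open>b\<close> is in \<open>Q\<close> but not in \<open>P\<close>. A map built
  from each \<open>w\<close> in \<open>ann P\<close> shows that \<open>ann P\<close> is divisible by
  \<open>b\<close> at \<open>Q\<close>; Nakayama's lemma gives \<open>s\<close> outside
  \<open>Q\<close> annihilating \<open>ann P\<close>, and reflexivity puts \<open>s\<close> in
  \<open>P\<close>, inside \<open>Q\<close>.\<close>

lemma prime_not_containing_x_minimal:
  assumes Q: "primeideal Q R" "x \<notin> Q" and P: "primeideal P R" "P \<subseteq> Q"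
  shows "P = Q"
proof (rule ccontr)
  assume "P \<noteq> Q"
  then obtain b where b: "b \<in> Q" "b \<notin> P" using P by blast
  interpret Q: primeideal Q R by fact
  interpret P: primeideal P R by fact
  have bc: "b \<in> carrier R" using b Q.Icarr by blast
  have Pc: "P \<subseteq> carrier R" using P.a_subset .
  have P1: "\<one> \<notin> P" using P.one_imp_carrier P.I_notcarr by blast
  have xP: "x \<notin> P" using Q P by blast
  note [simp] = x_carrier bc
  let ?J = "self.adjoin P b"
  have J: "ideal ?J R" using ideal_adjoin P.ideal_axioms bc by blast
  have Jsub: "submodule R ?J RM" using J ideal_iff_submodule by blast
  let ?C = "\<lambda>k::nat. {a \<in> carrier R. a \<otimes> x [^] k \<in> ?J}"
  have C: "ideal (?C k) R" for k using self.ideal_colon[OF Jsub, of "{x [^] k}"] by simp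
  have "\<exists>L\<in>range ?C. \<forall>J'\<in>range ?C. L \<subseteq> J' \<longrightarrow> J' = L" using C by (intro maximal_ideal_in_family) auto
  then obtain k where k: "\<forall>k'. ?C k \<subseteq> ?C k' \<longrightarrow> ?C k' = ?C k" by auto
  have "?C k \<subseteq> ?C (Suc k)"
  proof
    fix a assume a: "a \<in> ?C k"
    hence "x \<otimes> (a \<otimes> x [^] k) \<in> ?J" using idealD(4)[OF J x_carrier] by blast
    moreover have "x \<otimes> (a \<otimes> x [^] k) = a \<otimes> x [^] Suc k" using a by (simp add: m_ac)
    ultimately show "a \<in> ?C (Suc k)" using a by auto
  qed
  hence eq: "?C (Suc k) = ?C k" using k by blast
  have J_iff: "z \<in> ?J \<longleftrightarrow> (\<exists>q c. q \<in> P \<and> c \<in> carrier R \<and> z = q \<oplus> c \<otimes> b)" for z unfolding adjoin_eq_self by blast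
  \<comment> \<open>The ideal \<open>P + b R\<close> saturated with respect to \<open>x\<close>,
    which makes \<open>x\<close> regular modulo \<open>S\<close> and \<open>hom_extends\<close>
    applicable. The price is the denominator \<open>t\<close>, a power of \<open>x\<close> and so
    outside \<open>Q\<close>.\<close>
  define S where "S = ?C k"
  define t where "t = x [^] k"
  have tc[simp]: "t \<in> carrier R" by (simp add: t_def)
  have tQ: "t \<notin> Q" using primeideal_pow[OF Q(1) x_carrier] Q(2) unfolding t_def by blast
  have S_iff: "a \<in> S \<longleftrightarrow> a \<in> carrier R \<and> (\<exists>q c. q \<in> P \<and> c \<in> carrier R \<and> a \<otimes> t = q \<oplus> c \<otimes> b)" for a
    unfolding S_def t_def by (simp only: mem_Collect_eq J_iff)
  have S_reg: "regular_on x S" unfolding regular_on_def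
  proof (intro ballI impI)
    fix a assume a: "a \<in> carrier R" "x \<otimes> a \<in> S"
    hence "x \<otimes> a \<otimes> x [^] k \<in> ?J" unfolding S_def by blast
    moreover have "x \<otimes> a \<otimes> x [^] k = a \<otimes> x [^] Suc k" using a by (simp add: m_ac)
    ultimately have "a \<in> ?C (Suc k)" using a by auto
    thus "a \<in> S" unfolding S_def eq .
  qed
  have "\<exists>s\<in>carrier R - Q. \<forall>h\<in>ann P. s \<otimes> h \<in> {\<zero>}"
  proof (rule nakayama_ideal[OF Q(1) ideal_zero ann_ideal[OF Pc] b(1)])
    fix w assume w: "w \<in> ann P"
    have wc[simp]: "w \<in> carrier R" using w annD by blast
    have wP: "q \<otimes> w = \<zero>" if "q \<in> P" for q using annD(2)[OF w that] .
    \<comment> \<open>The quotient of \<open>a t\<close> by \<open>b\<close> modulo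
      \<open>P\<close>, applied to \<open>w\<close>. It is well defined because \<open>b\<close> is
      regular modulo the prime \<open>P\<close> and \<open>P\<close> kills \<open>w\<close>.\<close>
    let ?r = "{(a, v). a \<in> carrier R \<and> (\<exists>q c. q \<in> P \<and> c \<in> carrier R \<and> a \<otimes> t = q \<oplus> c \<otimes> b \<and> v = c \<otimes> w)}"
    have rE: "\<exists>q c. a \<in> carrier R \<and> q \<in> P \<and> c \<in> carrier R \<and> a \<otimes> t = q \<oplus> c \<otimes> b \<and> v = c \<otimes> w" if "(a, v) \<in> ?r" for a v
      using that by blast
    have rI: "(a, c \<otimes> w) \<in> ?r" if "a \<in> carrier R" "q \<in> P" "c \<in> carrier R" "a \<otimes> t = q \<oplus> c \<otimes> b" for a q c
      using that by blast
    have "\<exists>c\<in>carrier R. \<forall>a z. (a, z) \<in> ?r \<longrightarrow> z = a \<otimes> c"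
    proof (rule hom_extends)
      have "{a. \<exists>z. (a, z) \<in> ?r} = S" using S_iff by blast
      thus "regular_on x {a. \<exists>z. (a, z) \<in> ?r}" using S_reg by simp
      show "(\<zero>, \<zero>) \<in> ?r" using rI[of \<zero> \<zero> \<zero>] P.zero_closed by simp
    next
      fix a z assume "(a, z) \<in> ?r" thus "a \<in> carrier R \<and> z \<in> carrier R" using rE[of a z] by auto
    next
      fix a z a' z' assume "(a, z) \<in> ?r" "(a', z') \<in> ?r"
      then obtain q c q' c' where h: "a \<in> carrier R" "q \<in> P" "c \<in> carrier R" "a \<otimes> t = q \<oplus> c \<otimes> b" "z = c \<otimes> w"
        "a' \<in> carrier R" "q' \<in> P" "c' \<in> carrier R" "a' \<otimes> t = q' \<oplus> c' \<otimes> b" "z' = c' \<otimes> w"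
        using rE[of a z] rE[of a' z'] by blast
      have qc: "q \<in> carrier R" "q' \<in> carrier R" using h Pc by auto
      have "(a \<oplus> a') \<otimes> t = a \<otimes> t \<oplus> a' \<otimes> t" using h(1,6) by (simp add: l_distr)
      also have "\<dots> = (q \<oplus> q') \<oplus> (c \<oplus> c') \<otimes> b" unfolding h(4,9) using qc h(3,8) bc by algebra
      finally have "(a \<oplus> a', (c \<oplus> c') \<otimes> w) \<in> ?r" using h qc by (intro rI[of _ "q \<oplus> q'"]) auto
      thus "(a \<oplus> a', z \<oplus> z') \<in> ?r" using h by (simp add: l_distr)
    next
      fix e a z assume e: "e \<in> carrier R" "(a, z) \<in> ?r"
      then obtain q c where h: "a \<in> carrier R" "q \<in> P" "c \<in> carrier R" "a \<otimes> t = q \<oplus> c \<otimes> b" "z = c \<otimes> w"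
        using rE[of a z] by blast
      have qc: "q \<in> carrier R" using h Pc by auto
      have "(e \<otimes> a) \<otimes> t = e \<otimes> (a \<otimes> t)" using h(1) e by (simp add: m_assoc)
      also have "\<dots> = e \<otimes> q \<oplus> (e \<otimes> c) \<otimes> b" unfolding h(4) using qc h(3) bc e(1) by algebra
      finally have "(e \<otimes> a, (e \<otimes> c) \<otimes> w) \<in> ?r" using h e P.I_l_closed by (intro rI[of _ "e \<otimes> q"]) auto
      thus "(e \<otimes> a, e \<otimes> z) \<in> ?r" using h e by (simp add: m_assoc)
    next
      fix z assume "(\<zero>, z) \<in> ?r"
      then obtain q c where h: "q \<in> P" "c \<in> carrier R" "\<zero> \<otimes> t = q \<oplus> c \<otimes> b" "z = c \<otimes> w" using rE[of \<zero> z] by blast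
      have "q \<in> carrier R" using h Pc by blast
      hence "c \<otimes> b \<oplus> q \<in> P" using h(2,3) P.zero_closed a_comm[of q "c \<otimes> b"] by simp
      hence "c \<otimes> b \<in> P" by (rule ideal_add_cancel[OF P.ideal_axioms _ h(1)]) (simp add: h(2))
      from P.I_prime[OF h(2) bc this] have "c \<in> P" using b(2) by (elim disjE) simp_all
      from wP[OF this] show "z = \<zero>" unfolding h(4) .
    qed
    then obtain c where c: "c \<in> carrier R" "\<forall>a z. (a, z) \<in> ?r \<longrightarrow> z = a \<otimes> c" by (elim bexE)
    have "(b, t \<otimes> w) \<in> ?r" using rI[of b \<zero> t] P.zero_closed by (simp add: m_comm)
    from c(2)[rule_format, OF this] have tw: "t \<otimes> w = b \<otimes> c" .
    have "q \<otimes> c = \<zero>" if q: "q \<in> P" for q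
    proof -
      have qc: "q \<in> carrier R" using q Pc by blast
      have tq: "t \<otimes> q \<in> P" using P.I_l_closed[OF q tc] .
      have "q \<otimes> t = t \<otimes> q \<oplus> \<zero> \<otimes> b" using m_comm[OF qc tc] qc by simp
      from rI[OF qc tq zero_closed this] have "(q, \<zero> \<otimes> w) \<in> ?r" .
      from c(2)[rule_format, OF this] show ?thesis by simp
    qed
    hence "c \<in> ann P" using c by (simp add: ann_def)
    thus "\<exists>s\<in>carrier R - Q. \<exists>n\<in>{\<zero>}. \<exists>h'\<in>ann P. s \<otimes> w = n \<oplus> b \<otimes> h'"
      using tw tQ c(1) by (intro bexI[of _ t] bexI[of _ \<zero>] bexI[of _ c]) auto
  qed
  then obtain s where s: "s \<in> carrier R" "s \<notin> Q" "\<forall>h\<in>ann P. s \<otimes> h = \<zero>" by blast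
  have "s \<in> P" using ann_ann[OF P.ideal_axioms regular_on_prime[OF P(1) x_carrier xP] P1 s(1)] s(3) by blast
  thus False using s(2) P(2) by blast
qed

lemma prime_not_containing_x_minimal_prime:
  assumes "primeideal Q R" "x \<notin> Q"
  shows "minimal_prime R Q"
  using assms prime_not_containing_x_minimal unfolding minimal_prime_def by blast

text \<open>Reflexivity makes \<open>ann Q\<close> nonzero. An associated prime arising from one of
  its elements contains \<open>Q\<close> and, by regularity, not \<open>x\<close>; such primes have
  nothing strictly below them.\<close>

lemma prime_not_containing_x_associated:
  assumes Q: "primeideal Q R" "x \<notin> Q"
  obtains w where "w \<in> carrier R" "Q = {a \<in> carrier R. a \<otimes> w = \<zero>}"
proof -
  interpret Q: primeideal Q R by fact
  have Q1: "\<one> \<notin> Q" using Q.one_imp_carrier Q.I_notcarr by blast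
  obtain v where v: "v \<in> ann Q" "\<one> \<otimes> v \<noteq> \<zero>"
    using ann_ann[OF Q.ideal_axioms regular_on_prime[OF Q(1) x_carrier Q(2)] Q1 one_closed] Q1 by blast
  have vc: "v \<in> carrier R" using annD v by blast
  obtain c Q' where c: "c \<in> carrier R" "c \<otimes> v \<noteq> \<zero>" "Q' = {a \<in> carrier R. a \<otimes> (c \<otimes> v) = \<zero>}" "primeideal Q' R"
    using associated_prime[OF self_module self.submodule_zero, of v] v(2) vc by auto
  have "x \<notin> Q'" using c(3) x_regular[of "c \<otimes> v"] c(1,2) vc by auto
  moreover have "Q \<subseteq> Q'"
  proof
    fix a assume a: "a \<in> Q"
    hence ac: "a \<in> carrier R" using Q.Icarr by blast
    have "a \<otimes> (c \<otimes> v) = c \<otimes> (a \<otimes> v)" using ac c vc by (simp add: m_lcomm)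
    also have "\<dots> = \<zero>" using annD(2)[OF v(1) a] c by simp
    finally show "a \<in> Q'" using c(3) ac by blast
  qed
  ultimately have "Q = Q'" using prime_not_containing_x_minimal[OF c(4) _ Q(1)] by blast
  hence "Q = {a \<in> carrier R. a \<otimes> (c \<otimes> v) = \<zero>}" using c(3) by (rule trans)
  from that[OF m_closed[OF c(1) vc] this] show ?thesis .
qed

end

section \<open>Regular elements\<close>

context cring
begin

lemma prime_avoid_intersection:
  assumes P: "primeideal P R" and N: "ideal N R" "\<not> N \<subseteq> P"
    and "finite G" "\<And>Q. Q \<in> G \<Longrightarrow> ideal Q R \<and> \<not> Q \<subseteq> P"
  shows "\<exists>z\<in>N. (\<forall>Q\<in>G. z \<in> Q) \<and> z \<notin> P"
  using assms(4,5)
proof (induction G)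
  case empty
  thus ?case using N(2) by blast
next
  case (insert Q G)
  then obtain z where z: "z \<in> N" "\<forall>Q\<in>G. z \<in> Q" "z \<notin> P" by auto
  have Q: "ideal Q R" "\<not> Q \<subseteq> P" using insert.prems by auto
  then obtain b where b: "b \<in> Q" "b \<notin> P" by blast
  have c: "z \<in> carrier R" "b \<in> carrier R" using idealD(1)[OF N(1) z(1)] idealD(1)[OF Q(1) b(1)] by auto
  have "b \<otimes> z \<notin> P" using primeideal.I_prime[OF P c(2,1)] b(2) z(3) by blast
  moreover have "b \<otimes> z \<in> N" using idealD(4)[OF N(1) c(2) z(1)] .
  moreover have "b \<otimes> z \<in> Q" using idealD(4)[OF Q(1) c(1) b(1)] m_comm[OF c] by simp
  moreover have "b \<otimes> z \<in> Q'" if "Q' \<in> G" for Q'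
  proof -
    have "ideal Q' R" using insert.prems[of Q'] that by simp
    thus ?thesis using idealD(4)[OF _ c(2), of Q' z] z(2) that by blast
  qed
  ultimately show ?case by blast
qed

text \<open>For an antichain of primes the induction is direct: an element that avoids all but
  \<open>P\<close> is corrected by one lying in all the others and not in \<open>P\<close>.\<close>

lemma prime_avoidance:
  assumes N: "ideal N R" and "finite G" "\<And>Q. Q \<in> G \<Longrightarrow> primeideal Q R \<and> \<not> N \<subseteq> Q"
    "\<And>P Q. P \<in> G \<Longrightarrow> Q \<in> G \<Longrightarrow> P \<subseteq> Q \<Longrightarrow> P = Q"
  shows "\<exists>x\<in>N. \<forall>Q\<in>G. x \<notin> Q"
  using assms(2-)
proof (induction G)
  case empty
  thus ?case using idealD(2)[OF N] by blast
next
  case (insert P G)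
  have P: "primeideal P R" "\<not> N \<subseteq> P" using insert.prems(1)[of P] by auto
  interpret P: primeideal P R by (rule P)
  have Gp: "primeideal Q R" if "Q \<in> G" for Q using insert.prems(1)[of Q] that by simp
  have Gi: "ideal Q R" if "Q \<in> G" for Q using Gp[OF that] by (rule primeideal.axioms(1))
  have inc: "\<not> Q \<subseteq> P" if "Q \<in> G" for Q using insert.prems(2)[of Q P] insert.hyps(2) that by blast
  obtain x where x: "x \<in> N" "\<forall>Q\<in>G. x \<notin> Q" using insert.IH[OF insert.prems] by auto
  show ?case
  proof (cases "x \<in> P")
    case False
    thus ?thesis using x by blast
  next
    case True
    obtain z where z: "z \<in> N" "\<forall>Q\<in>G. z \<in> Q" "z \<notin> P"
      using prime_avoid_intersection[OF P(1) N P(2) insert.hyps(1)] Gi inc by blast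
    have c: "x \<in> carrier R" "z \<in> carrier R" using idealD(1)[OF N] x z by auto
    have "x \<oplus> z \<notin> P"
    proof
      assume "x \<oplus> z \<in> P"
      hence "z \<oplus> x \<in> P" using c a_comm by simp
      hence "z \<in> P" by (rule ideal_add_cancel[OF P.ideal_axioms _ True c(2)])
      thus False using z by blast
    qed
    moreover have "x \<oplus> z \<notin> Q" if Q: "Q \<in> G" for Q
    proof
      assume "x \<oplus> z \<in> Q"
      hence "x \<in> Q" by (rule ideal_add_cancel[OF Gi[OF Q] _ bspec[OF z(2) Q] c(1)])
      thus False using x Q by blast
    qed
    moreover have "x \<oplus> z \<in> N" using idealD(3)[OF N x(1) z(1)] .
    ultimately show ?thesis by blast
  qed
qed

end

text \<open>The maximal annihilators of nonzero elements are finitely many primes, and their union is the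
  set of zero divisors.\<close>

lemma (in noeth_local) regular_or_socle:
  "(\<exists>u\<in>carrier R. u \<noteq> \<zero> \<and> (\<forall>a\<in>\<mm>. a \<otimes> u = \<zero>)) \<or> (\<exists>x\<in>\<mm>. \<forall>a\<in>carrier R. x \<otimes> a = \<zero> \<longrightarrow> a = \<zero>)"
proof (rule disjCI)
  assume nreg: "\<not> (\<exists>x\<in>\<mm>. \<forall>a\<in>carrier R. x \<otimes> a = \<zero> \<longrightarrow> a = \<zero>)"
  define an where "an b = {a \<in> carrier R. a \<otimes> b = \<zero>}" for b
  have an_ideal: "ideal (an b) R" if "b \<in> carrier R" for b
    using self.ideal_colon[OF self.submodule_zero, of "{b}"] that by (simp add: an_def)
  define Z where "Z = {an b | b. b \<in> carrier R \<and> b \<noteq> \<zero> \<and>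
    (\<forall>c\<in>carrier R. c \<noteq> \<zero> \<longrightarrow> an b \<subseteq> an c \<longrightarrow> an c = an b)}"
  have ZE: "\<exists>b. b \<in> carrier R \<and> b \<noteq> \<zero> \<and> Q = an b \<and> (\<forall>c\<in>carrier R. c \<noteq> \<zero> \<longrightarrow> an b \<subseteq> an c \<longrightarrow> an c = an b)"
    if "Q \<in> Z" for Q using that unfolding Z_def by blast
  define g where "g Q = (SOME b. b \<in> carrier R \<and> b \<noteq> \<zero> \<and> Q = an b \<and>
    (\<forall>c\<in>carrier R. c \<noteq> \<zero> \<longrightarrow> an b \<subseteq> an c \<longrightarrow> an c = an b))" for Q
  have gs: "g Q \<in> carrier R \<and> g Q \<noteq> \<zero> \<and> Q = an (g Q) \<and>
    (\<forall>c\<in>carrier R. c \<noteq> \<zero> \<longrightarrow> an (g Q) \<subseteq> an c \<longrightarrow> an c = an (g Q))" if "Q \<in> Z" for Q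
    unfolding g_def by (rule someI_ex[OF ZE[OF that]])
  have g: "g Q \<in> carrier R" "g Q \<noteq> \<zero>" "Q = an (g Q)" if "Q \<in> Z" for Q using gs[OF that] by blast+
  have g4: "an c = Q" if "Q \<in> Z" "c \<in> carrier R" "c \<noteq> \<zero>" "Q \<subseteq> an c" for Q c
  proof -
    have "an (g Q) \<subseteq> an c" using that(4) g(3)[OF that(1)] by simp
    hence "an c = an (g Q)" using gs[OF that(1)] that(2,3) by blast
    thus ?thesis using g(3)[OF that(1)] by simp
  qed
  have Zi: "ideal Q R" if "Q \<in> Z" for Q using an_ideal[OF g(1)[OF that]] g(3)[OF that] by simp
  have Zmax: "P = Q" if "P \<in> Z" "Q \<in> Z" "P \<subseteq> Q" for P Q
    using g4[OF that(1) g(1,2)[OF that(2)]] g(3)[OF that(2)] that(3) by simp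
  have Zp: "primeideal Q R" if Q: "Q \<in> Z" for Q
  proof (rule primeidealI'[OF Zi[OF Q]])
    have mem: "a \<in> Q \<longleftrightarrow> a \<in> carrier R \<and> a \<otimes> g Q = \<zero>" for a using g(3)[OF Q] unfolding an_def by blast
    show "\<one> \<notin> Q" using mem g(1,2)[OF Q] by simp
    fix a b assume ab: "a \<in> carrier R" "b \<in> carrier R" "a \<otimes> b \<in> Q" "a \<notin> Q"
    have c: "a \<otimes> g Q \<in> carrier R" "a \<otimes> g Q \<noteq> \<zero>" using ab mem g(1)[OF Q] by auto
    have "Q \<subseteq> an (a \<otimes> g Q)"
    proof
      fix r assume "r \<in> Q"
      hence r: "r \<in> carrier R" "r \<otimes> g Q = \<zero>" using mem by auto
      have "r \<otimes> (a \<otimes> g Q) = a \<otimes> (r \<otimes> g Q)" using r(1) ab(1) g(1)[OF Q] by (rule m_lcomm)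
      thus "r \<in> an (a \<otimes> g Q)" using r ab(1) by (simp add: an_def)
    qed
    hence eq: "an (a \<otimes> g Q) = Q" using g4[OF Q c] by blast
    have "b \<otimes> (a \<otimes> g Q) = (a \<otimes> b) \<otimes> g Q" using ab(1,2) g(1)[OF Q] by (simp add: m_ac)
    also have "\<dots> = \<zero>" using mem ab(3) by blast
    finally have "b \<in> an (a \<otimes> g Q)" using ab(2) by (simp add: an_def)
    thus "b \<in> Q" using eq by simp
  qed
  have cover: "\<exists>Q\<in>Z. r \<in> Q" if r: "r \<in> carrier R" "a \<in> carrier R" "a \<noteq> \<zero>" "r \<otimes> a = \<zero>" for r a
  proof -
    let ?S = "{an b | b. b \<in> carrier R \<and> b \<noteq> \<zero> \<and> an a \<subseteq> an b}"
    have "an a \<in> ?S" using r by blast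
    hence "?S \<noteq> {}" by blast
    hence "\<exists>J\<in>?S. \<forall>J'\<in>?S. J \<subseteq> J' \<longrightarrow> J' = J" by (rule maximal_ideal_in_family) (use an_ideal in blast)
    then obtain b where b: "b \<in> carrier R" "b \<noteq> \<zero>" "an a \<subseteq> an b" "\<forall>J'\<in>?S. an b \<subseteq> J' \<longrightarrow> J' = an b" by blast
    have "\<forall>c\<in>carrier R. c \<noteq> \<zero> \<longrightarrow> an b \<subseteq> an c \<longrightarrow> an c = an b" using b(3,4) by blast
    hence "an b \<in> Z" unfolding Z_def using b(1,2) by blast
    moreover have "r \<in> an b" using b(3) r by (auto simp: an_def)
    ultimately show ?thesis by blast
  qed
  \<comment> \<open>Choose \<open>G\<close> so that the ideal generated by the witnesses
    \<open>g Q\<close> is maximal. If \<open>P\<close> is not in \<open>G\<close>, the witness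
    \<open>g P\<close> lies in this ideal; an element \<open>z\<close> in all members of
    \<open>G\<close> but not in \<open>P\<close> annihilates the ideal, hence \<open>g P\<close>,
    and so would lie in \<open>P\<close>.\<close>
  have "finite Z"
  proof -
    let ?S = "{Idl (g ` G) | G. finite G \<and> G \<subseteq> Z}"
    have gc: "g ` G \<subseteq> carrier R" if "G \<subseteq> Z" for G using g(1) that by blast
    have "Idl (g ` {}) \<in> ?S" by blast
    hence "?S \<noteq> {}" by blast
    hence "\<exists>J\<in>?S. \<forall>J'\<in>?S. J \<subseteq> J' \<longrightarrow> J' = J"
      by (rule maximal_ideal_in_family) (use genideal_ideal[OF gc] in blast)
    then obtain G where G: "finite G" "G \<subseteq> Z" "\<forall>J'\<in>?S. Idl (g ` G) \<subseteq> J' \<longrightarrow> J' = Idl (g ` G)" by blast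
    have "Z \<subseteq> G"
    proof
      fix P assume P: "P \<in> Z"
      show "P \<in> G"
      proof (rule ccontr)
        assume n: "P \<notin> G"
        have PG: "insert P G \<subseteq> Z" "finite (insert P G)" using P G by auto
        hence "Idl (g ` insert P G) \<in> ?S" by blast
        moreover have "Idl (g ` G) \<subseteq> Idl (g ` insert P G)"
          by (rule genideal_minimal[OF genideal_ideal[OF gc[OF PG(1)]]])
            (use genideal_self[OF gc[OF PG(1)]] in auto)
        ultimately have "Idl (g ` insert P G) = Idl (g ` G)" using G(3) by blast
        hence gP: "g P \<in> Idl (g ` G)" using genideal_self[OF gc[OF PG(1)]] by auto
        have "\<not> Q \<subseteq> P" if "Q \<in> G" for Q using Zmax[of Q P] that G(2) P n by blast
        moreover have "\<not> carrier R \<subseteq> P" using primeideal.I_notcarr[OF Zp[OF P]] idealD(5)[OF Zi[OF P]] by blast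
        ultimately have "\<exists>z\<in>carrier R. (\<forall>Q\<in>G. z \<in> Q) \<and> z \<notin> P"
          using Zi G(2) by (intro prime_avoid_intersection[OF Zp[OF P] oneideal _ G(1)]) auto
        then obtain z where z: "z \<in> carrier R" "\<forall>Q\<in>G. z \<in> Q" "z \<notin> P" by blast
        have "ideal (an z) R" using an_ideal z by blast
        moreover have "g ` G \<subseteq> an z"
        proof
          fix y assume "y \<in> g ` G"
          then obtain Q where Q: "Q \<in> G" "y = g Q" by blast
          hence QZ: "Q \<in> Z" using G by blast
          have "z \<in> an (g Q)" using z(2) Q(1) g(3)[OF QZ] by blast
          hence "z \<otimes> g Q = \<zero>" by (simp add: an_def)
          thus "y \<in> an z" using Q(2) g(1)[OF QZ] m_comm[OF z(1) g(1)[OF QZ]] by (simp add: an_def)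
        qed
        ultimately have "g P \<in> an z" using genideal_minimal gP by blast
        hence "g P \<otimes> z = \<zero>" by (simp add: an_def)
        hence "z \<in> an (g P)" using m_comm[OF z(1) g(1)[OF P]] z(1) by (simp add: an_def)
        thus False using g(3)[OF P] z(3) by blast
      qed
    qed
    thus ?thesis using G(1) finite_subset by blast
  qed
  show "\<exists>u\<in>carrier R. u \<noteq> \<zero> \<and> (\<forall>a\<in>\<mm>. a \<otimes> u = \<zero>)"
  proof (rule ccontr)
    assume ns: "\<not> ?thesis"
    have "\<not> \<mm> \<subseteq> Q" if Q: "Q \<in> Z" for Q
    proof
      assume "\<mm> \<subseteq> Q"
      hence "\<mm> \<subseteq> an (g Q)" using g(3)[OF Q] by simp
      hence "\<forall>a\<in>\<mm>. a \<otimes> g Q = \<zero>" unfolding an_def by blast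
      thus False using ns g(1,2)[OF Q] by blast
    qed
    then obtain x where x: "x \<in> \<mm>" "\<forall>Q\<in>Z. x \<notin> Q" using prime_avoidance[OF m_ideal \<open>finite Z\<close>] Zp Zmax by blast
    obtain a where "a \<in> carrier R" "x \<otimes> a = \<zero>" "a \<noteq> \<zero>" using nreg x(1) by blast
    thus False using cover[of x a] x m_carrier by blast
  qed
qed

section \<open>Gorenstein local rings with a one-dimensional generically reduced component\<close>

context ring_injective_resolution
begin

text \<open>In the application \<open>P\<close> is the kernel of the map to the valuation ring. A
  socle element of \<open>R\<close> would carry the descent down to \<open>K 0\<close> and make
  \<open>R\<close> self-injective, which an element of \<open>\<mm>\<close> outside \<open>P\<close>
  excludes; so there is a regular element, and \<open>P\<close> also leads to a socle element modulo
  it.\<close>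

lemma gorenstein_dim_1_exists:
  assumes fin: "\<And>i. n < i \<Longrightarrow> carrier (I i) = {\<zero>\<^bsub>I i\<^esub>}"
    and P: "primeideal P R" "P \<subset> \<mm>" and dim1: "\<And>Q. primeideal Q R \<Longrightarrow> P \<subset> Q \<Longrightarrow> \<mm> \<subseteq> Q"
    and s: "s \<in> carrier R" "s \<noteq> \<zero>" "\<And>a. a \<in> P \<Longrightarrow> s \<otimes> a = \<zero>"
  shows "\<exists>x. gorenstein_dim_1 R \<mm> I d \<epsilon> x \<and> x \<notin> P"
proof -
  interpret P: primeideal P R by (rule P)
  have Pc: "P \<subseteq> carrier R" using P.a_subset .
  \<comment> \<open>Beyond degree \<open>n\<close> the cosyzygies are zero and injective for trivial
    reasons; the descent starts here.\<close>
  have base: "baer R (I (Suc n)) (K (Suc n))"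
  proof -
    have "z \<in> K (Suc n) \<longleftrightarrow> z = \<zero>\<^bsub>I (Suc n)\<^esub>" for z
      using fin[of "Suc n"] I.submoduleD(2)[OF K_submodule] K_carrier by auto
    hence Kn: "K (Suc n) = {\<zero>\<^bsub>I (Suc n)\<^esub>}" by blast
    show ?thesis unfolding baer_def Kn
    proof (intro allI impI, elim conjE)
      fix J f assume "ideal J R" "\<forall>a\<in>J. f a \<in> {\<zero>\<^bsub>I (Suc n)\<^esub>}"
      thus "\<exists>w\<in>{\<zero>\<^bsub>I (Suc n)\<^esub>}. \<forall>a\<in>J. f a = a \<odot>\<^bsub>I (Suc n)\<^esub> w" using idealD(1)[of J] by simp
    qed
  qed
  obtain y where y: "y \<in> \<mm>" "y \<notin> P" using P(2) by blast
  have "\<not> (\<exists>u\<in>carrier R. u \<noteq> \<zero> \<and> (\<forall>a\<in>\<mm>. a \<otimes> u = \<zero>))"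
  proof
    assume "\<exists>u\<in>carrier R. u \<noteq> \<zero> \<and> (\<forall>a\<in>\<mm>. a \<otimes> u = \<zero>)"
    then obtain u where u: "u \<in> carrier R" "u \<noteq> \<zero>" "\<And>a. a \<in> \<mm> \<Longrightarrow> a \<otimes> u = \<zero>" by blast
    have "baer R (I 0) (K 0)" using bass_descend[OF base, of 0] ext_vanish_of_socle_element[OF u] by blast
    thus False using not_self_injective[OF P(1) y s] by blast
  qed
  then obtain x where x: "x \<in> \<mm>" "\<And>a. a \<in> carrier R \<Longrightarrow> x \<otimes> a = \<zero> \<Longrightarrow> a = \<zero>" using regular_or_socle by blast
  have xc: "x \<in> carrier R" using x m_carrier by blast
  have sann: "s \<in> ann P" using s Pc m_comm[OF s(1)] by (auto simp: ann_def)
  have xP: "x \<notin> P" using x(2)[OF s(1)] s m_comm[OF s(1) xc] by auto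
  have xid: "ideal (PIdl x) R" using cgenideal_ideal xc by blast
  have xsub: "submodule R (PIdl x) RM" using xid ideal_iff_submodule by blast
  \<comment> \<open>Otherwise \<open>ann P\<close> would be divisible by \<open>x\<close> within
    itself and vanish, but \<open>s\<close> belongs to it.\<close>
  have "\<not> ann P \<subseteq> PIdl x"
  proof
    assume sub: "ann P \<subseteq> PIdl x"
    have "ann P \<subseteq> {\<zero>}"
    proof (rule nakayama_ideal_local[OF ideal_zero ann_ideal[OF Pc] x(1)])
      fix e assume e: "e \<in> ann P"
      then obtain b where b: "b \<in> carrier R" "e = b \<otimes> x" using sub PIdl_iff by blast
      hence e2: "e = x \<otimes> b" using m_comm[OF b(1) xc] by simp
      have "a \<otimes> b = \<zero>" if a: "a \<in> P" for a
      proof (rule x(2))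
        have ac: "a \<in> carrier R" using a Pc by blast
        show "a \<otimes> b \<in> carrier R" using ac b by simp
        have "x \<otimes> (a \<otimes> b) = a \<otimes> e" unfolding e2 using m_lcomm[OF xc ac b(1)] .
        also have "\<dots> = \<zero>" using annD(2)[OF e a] .
        finally show "x \<otimes> (a \<otimes> b) = \<zero>" .
      qed
      hence "b \<in> ann P" using b by (simp add: ann_def)
      thus "\<exists>n\<in>{\<zero>}. \<exists>h'\<in>ann P. e = n \<oplus> x \<otimes> h'" using e2 b xc by (intro bexI[of _ \<zero>] bexI[of _ b]) auto
    qed
    thus False using sann s(2) by blast
  qed
  then obtain e where e: "e \<in> ann P" "e \<notin> PIdl x" by blast
  have ec: "e \<in> carrier R" using annD e by blast
  \<comment> \<open>An associated prime of \<open>R / x\<close> found inside the image of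
    \<open>ann P\<close> contains both \<open>P\<close> and \<open>x\<close>, so it is
    \<open>\<mm>\<close> by \<open>dim1\<close>.\<close>
  obtain c Q where Q: "c \<in> carrier R" "c \<otimes> e \<notin> PIdl x" "Q = {a \<in> carrier R. a \<otimes> (c \<otimes> e) \<in> PIdl x}"
    "primeideal Q R" using associated_prime[OF self_module xsub, of e] ec e(2) by auto
  have ce: "c \<otimes> e \<in> carrier R" using Q ec by simp
  have Qmem: "a \<in> Q \<longleftrightarrow> a \<in> carrier R \<and> a \<otimes> (c \<otimes> e) \<in> PIdl x" for a using Q(3) by blast
  have "P \<subseteq> Q"
  proof
    fix a assume a: "a \<in> P"
    hence ac: "a \<in> carrier R" using Pc by blast
    have "a \<otimes> (c \<otimes> e) = c \<otimes> (a \<otimes> e)" using m_lcomm[OF ac Q(1) ec] .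
    also have "\<dots> = \<zero>" using annD(2)[OF e(1) a] Q(1) by simp
    finally show "a \<in> Q" using Qmem ac idealD(2)[OF xid] by simp
  qed
  moreover have "x \<in> Q" using Qmem xc ce m_comm[OF xc ce] PIdl_iff by blast
  ultimately have mQ: "\<mm> \<subseteq> Q" using dim1[OF Q(4)] xP by blast
  hence soc: "\<And>a. a \<in> \<mm> \<Longrightarrow> a \<otimes> (c \<otimes> e) \<in> PIdl x" using Qmem by blast
  have ev: "ext_vanish i \<mm>" if i: "Suc 0 \<le> i" "baer R (I (Suc i)) (K (Suc i))" for i
  proof -
    obtain k where k: "i = Suc k" using i by (cases i) auto
    show ?thesis unfolding k by (rule ext_vanish_of_socle_element_mod[OF x ce Q(2) soc i(2)[unfolded k]])
  qed
  have "baer R (I (Suc 0)) (K (Suc 0))" by (rule bass_descend[OF base _ ev]) auto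
  hence "gorenstein_dim_1 R \<mm> I d \<epsilon> x" using x by unfold_locales auto
  thus ?thesis using xP by blast
qed

end

section \<open>Local rings and the definition of the injective dimension\<close>

lemma noeth_cringI: "cring R \<Longrightarrow> noetherian_ring R \<Longrightarrow> noeth_cring R" by (rule noeth_cring.intro)

lemma (in noeth_cring) proper_ideal_in_maximal:
  assumes "ideal J R" "\<one> \<notin> J"
  shows "\<exists>N. maximalideal N R \<and> J \<subseteq> N"
proof -
  let ?S = "{L. ideal L R \<and> \<one> \<notin> L \<and> J \<subseteq> L}"
  have "J \<in> ?S" using assms by blast
  hence "?S \<noteq> {}" by blast
  hence "\<exists>L\<in>?S. \<forall>L'\<in>?S. L \<subseteq> L' \<longrightarrow> L' = L" by (rule maximal_ideal_in_family) blast
  then obtain L where L: "ideal L R" "\<one> \<notin> L" "J \<subseteq> L" "\<forall>L'\<in>?S. L \<subseteq> L' \<longrightarrow> L' = L" by blast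
  have "maximalideal L R"
  proof (rule maximalidealI[OF L(1)])
    show "carrier R \<noteq> L" using L(2) one_closed by blast
    fix N assume N: "ideal N R" "L \<subseteq> N" "N \<subseteq> carrier R"
    show "N = L \<or> N = carrier R"
    proof (cases "\<one> \<in> N")
      case True
      thus ?thesis using ideal.one_imp_carrier[OF N(1)] by blast
    next
      case False
      thus ?thesis using L N by blast
    qed
  qed
  thus ?thesis using L by blast
qed

lemma local_ring_max_ideal:
  assumes "local_ring R"
  shows "maximalideal (max_ideal R) R" "\<And>N. maximalideal N R \<Longrightarrow> N = max_ideal R"
proof -
  have ex: "\<exists>!N. maximalideal N R" using assms by (simp add: local_ring_def)
  show 1: "maximalideal (max_ideal R) R" unfolding max_ideal_def by (rule theI'[OF ex])
  show "\<And>N. maximalideal N R \<Longrightarrow> N = max_ideal R" using ex 1 by blast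
qed

lemma noeth_localI:
  fixes R (structure)
  assumes "cring R" "noetherian_ring R" "local_ring R"
  shows "noeth_local R (max_ideal R)"
proof -
  interpret noeth_cring R using assms noeth_cringI by blast
  have M: "maximalideal (max_ideal R) R" using local_ring_max_ideal[OF assms(3)] by blast
  interpret M: maximalideal "max_ideal R" R by (rule M)
  show ?thesis
  proof (unfold_locales)
    show "\<one> \<notin> max_ideal R" using M.one_imp_carrier M.I_notcarr by blast
    fix a assume a: "a \<in> carrier R" "a \<notin> max_ideal R"
    show "a \<in> Units R"
    proof (rule ccontr)
      assume n: "a \<notin> Units R"
      have "\<one> \<notin> PIdl a"
      proof
        assume "\<one> \<in> PIdl a"
        then obtain b where "b \<in> carrier R" "b \<otimes> a = \<one>" using PIdl_iff by metis
        hence "a \<in> Units R" using a m_comm[of b a] unfolding Units_def by auto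
        thus False using n by blast
      qed
      then obtain N where "maximalideal N R" "PIdl a \<subseteq> N"
        using proper_ideal_in_maximal[OF cgenideal_ideal[OF a(1)]] by blast
      thus False using local_ring_max_ideal(2)[OF assms(3)] cgenideal_self[OF a(1)] a(2) by blast
    qed
  qed
qed

text \<open>A finite infimum is taken over a nonempty set, so some finite resolution exists. Its
  length is arbitrary; the descent later does not depend on minimality.\<close>

lemma injective_dimension_finite:
  fixes R :: "('a, 'k) ring_scheme"
  assumes L: "noeth_local R \<mm>" and "injective_dimension R (self_module R) < \<infinity>"
  obtains n I d and \<epsilon> :: "'a \<Rightarrow> (nat \<times> 'a) set" where "ring_injective_resolution R \<mm> I d \<epsilon>"
    "\<And>i. n < i \<Longrightarrow> carrier (I i) = {\<zero>\<^bsub>I i\<^esub>}"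
proof -
  interpret noeth_local R \<mm> by (rule L)
  define res where "res n \<longleftrightarrow> (\<exists>\<epsilon> (I :: nat \<Rightarrow> ('a, (nat \<times> 'a) set) module) d.
       injective_resolution R (self_module R) \<epsilon> I d \<and> (\<forall>i > n. carrier (I i) = {\<zero>\<^bsub>I i\<^esub>}))" for n
  let ?S = "{enat n | n. res n}"
  have "?S \<noteq> {}"
  proof
    assume e: "?S = {}"
    have "injective_dimension R (self_module R) = \<infinity>" 
      unfolding injective_dimension_def res_def[symmetric] e by (simp add: Inf_enat_def)
    thus False using assms(2) by simp
  qed
  then obtain n where "res n" by blast
  then obtain \<epsilon> d and I :: "nat \<Rightarrow> ('a, (nat \<times> 'a) set) module"
    where r: "injective_resolution R (self_module R) \<epsilon> I d" "\<forall>i > n. carrier (I i) = {\<zero>\<^bsub>I i\<^esub>}"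
    unfolding res_def by (elim exE conjE)
  note r0 = r(1)[unfolded injective_resolution_def]
  note r1 = conjunct1[OF r0] and r2 = conjunct2[OF r0]
  note r3 = conjunct2[OF r2] note r4 = conjunct2[OF r3] note r5 = conjunct2[OF r4]
  have "ring_injective_resolution R \<mm> I d \<epsilon>"
  proof (rule ring_injective_resolution.intro[OF L], rule ring_injective_resolution_axioms.intro)
    fix i
    have i: "injective_module R (I i)" using r1 by blast
    show "module R (I i)" using i unfolding injective_module_def by (rule conjunct1)
    show "baer R (I i) (carrier (I i))" by (rule injective_module_baer[OF is_cring i])
    show "\<epsilon> \<in> module_hom R (self_module R) (I 0)" using conjunct1[OF r2] .
    show "inj_on \<epsilon> (carrier R)" using conjunct1[OF r3] by simp
    show "d i \<in> module_hom R (I i) (I (Suc i))" using conjunct1[OF r4] by blast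
    show "\<epsilon> ` carrier R = {z \<in> carrier (I 0). d 0 z = \<zero>\<^bsub>I (Suc 0)\<^esub>}" using conjunct1[OF r5] by simp
    show "d i ` carrier (I i) = {z \<in> carrier (I (Suc i)). d (Suc i) z = \<zero>\<^bsub>I (Suc (Suc i))\<^esub>}"
      using conjunct2[OF r5] by (rule spec)
  qed
  thus ?thesis using that r(2) by blast
qed

section \<open>Localization at a prime\<close>

text \<open>Collapses the unions over all representatives by which sums and products of fractions
  are defined.\<close>

lemma Union_eqI: "c \<in> F \<Longrightarrow> (\<And>Z. Z \<in> F \<Longrightarrow> Z = c) \<Longrightarrow> \<Union>F = c" by blast

locale ring_at_prime = primeideal q R for q and R (structure)
begin

abbreviation (input) S where "S \<equiv> carrier R - q"

abbreviation fr where "fr \<equiv> loc_frac R q"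

abbreviation L where "L \<equiv> localization_at R q"

lemma S_one: "\<one> \<in> S" using one_imp_carrier I_notcarr by blast

lemma S_mult: "s \<in> S \<Longrightarrow> t \<in> S \<Longrightarrow> s \<otimes> t \<in> S" using I_prime by blast

lemma mem_fr_iff:
  "(b, t) \<in> fr a s \<longleftrightarrow> b \<in> carrier R \<and> t \<in> S \<and> (\<exists>u\<in>S. u \<otimes> (t \<otimes> a) = u \<otimes> (s \<otimes> b))" by (simp add: loc_frac_def)

lemma fr_eqI:
  assumes c: "a \<in> carrier R" "b \<in> carrier R" "s \<in> S" "t \<in> S" and u: "u \<in> S" "u \<otimes> (t \<otimes> a) = u \<otimes> (s \<otimes> b)"
  shows "fr a s = fr b t"
proof -
  have sub: "fr a s \<subseteq> fr b t"
    if c: "a \<in> carrier R" "b \<in> carrier R" "s \<in> S" "t \<in> S" and u: "u \<in> S" "u \<otimes> (t \<otimes> a) = u \<otimes> (s \<otimes> b)"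
    for a b s t u
  proof
    fix p assume "p \<in> fr a s"
    then obtain e r v where p: "p = (e, r)" "e \<in> carrier R" "r \<in> S" "v \<in> S" "v \<otimes> (r \<otimes> a) = v \<otimes> (s \<otimes> e)"
      using mem_fr_iff by (metis surj_pair)
    have cc: "s \<in> carrier R" "t \<in> carrier R" "u \<in> carrier R" "r \<in> carrier R" "v \<in> carrier R"
      using c u p by blast+
    have "(u \<otimes> v \<otimes> s) \<otimes> (r \<otimes> b) = (v \<otimes> r) \<otimes> (u \<otimes> (s \<otimes> b))" using cc c p(2) by algebra
    also have "\<dots> = (u \<otimes> t) \<otimes> (v \<otimes> (r \<otimes> a))" unfolding u(2)[symmetric] using cc c(1,2) p(2) by algebra
    also have "\<dots> = (u \<otimes> v \<otimes> s) \<otimes> (t \<otimes> e)" unfolding p(5) using cc c(1,2) p(2) by algebra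
    finally have "(u \<otimes> v \<otimes> s) \<otimes> (r \<otimes> b) = (u \<otimes> v \<otimes> s) \<otimes> (t \<otimes> e)" .
    moreover have "u \<otimes> v \<otimes> s \<in> S" using S_mult u p c by blast
    ultimately show "p \<in> fr b t" unfolding p(1) mem_fr_iff using p by blast
  qed
  show ?thesis using sub[OF c u] sub[OF c(2,1,4,3) u(1) u(2)[symmetric]] by blast
qed

lemma fr_eqI1:
  assumes "a \<in> carrier R" "b \<in> carrier R" "s \<in> S" "t \<in> S" "t \<otimes> a = s \<otimes> b"
  shows "fr a s = fr b t"
  using fr_eqI[OF assms(1-4) S_one] assms(5) by simp

lemma fr_self: "a \<in> carrier R \<Longrightarrow> s \<in> S \<Longrightarrow> (a, s) \<in> fr a s" using S_one unfolding mem_fr_iff by blast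

lemma fr_eqD:
  assumes "a \<in> carrier R" "s \<in> S" "fr a s = fr b t"
  shows "\<exists>u\<in>S. u \<otimes> (s \<otimes> b) = u \<otimes> (t \<otimes> a)"
  using fr_self[OF assms(1,2)] unfolding assms(3) mem_fr_iff by blast

lemma Loc_simps:
  "carrier L = {fr a s | a s. a \<in> carrier R \<and> s \<in> S}" "\<one>\<^sub>L = fr \<one> \<one>" "\<zero>\<^sub>L = fr \<zero> \<one>"
  by (simp_all add: localization_at_def)

lemma Loc_closed [intro]: "a \<in> carrier R \<Longrightarrow> s \<in> S \<Longrightarrow> fr a s \<in> carrier L" unfolding Loc_simps by blast

lemma LocE:
  assumes "z \<in> carrier L"
  obtains a s where "a \<in> carrier R" "s \<in> S" "z = fr a s" using assms unfolding Loc_simps by blast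

lemma Loc_mult:
  assumes c: "a \<in> carrier R" "b \<in> carrier R" "s \<in> S" "t \<in> S"
  shows "fr a s \<otimes>\<^sub>L fr b t = fr (a \<otimes> b) (s \<otimes> t)"
proof -
  let ?F = "{fr (a' \<otimes> b') (s' \<otimes> t') | a' s' b' t'. (a', s') \<in> fr a s \<and> (b', t') \<in> fr b t}"
  have key: "fr (a' \<otimes> b') (s' \<otimes> t') = fr (a \<otimes> b) (s \<otimes> t)"
    if h: "(a', s') \<in> fr a s" "(b', t') \<in> fr b t" for a' s' b' t'
  proof -
    obtain u v where u: "u \<in> S" "u \<otimes> (s' \<otimes> a) = u \<otimes> (s \<otimes> a')" "a' \<in> carrier R" "s' \<in> S"
      and v: "v \<in> S" "v \<otimes> (t' \<otimes> b) = v \<otimes> (t \<otimes> b')" "b' \<in> carrier R" "t' \<in> S"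
      using h unfolding mem_fr_iff by blast
    have cc: "s \<in> carrier R" "t \<in> carrier R" "s' \<in> carrier R" "t' \<in> carrier R" "u \<in> carrier R" "v \<in> carrier R"
      using c u v by blast+
    have "(u \<otimes> v) \<otimes> ((s \<otimes> t) \<otimes> (a' \<otimes> b')) = (u \<otimes> (s \<otimes> a')) \<otimes> (v \<otimes> (t \<otimes> b'))"
      using cc c(1,2) u(3) v(3) by algebra
    also have "\<dots> = (u \<otimes> v) \<otimes> ((s' \<otimes> t') \<otimes> (a \<otimes> b))"
      unfolding u(2)[symmetric] v(2)[symmetric] using cc c(1,2) u(3) v(3) by algebra
    finally show ?thesis using u v c S_mult by (intro fr_eqI[of _ _ _ _ "u \<otimes> v"]) auto
  qed
  have "\<Union>?F = fr (a \<otimes> b) (s \<otimes> t)" by (rule Union_eqI) (use key fr_self[OF c(1,3)] fr_self[OF c(2,4)] in blast)+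
  thus ?thesis by (simp add: localization_at_def)
qed

lemma Loc_add:
  assumes c: "a \<in> carrier R" "b \<in> carrier R" "s \<in> S" "t \<in> S"
  shows "fr a s \<oplus>\<^sub>L fr b t = fr (a \<otimes> t \<oplus> b \<otimes> s) (s \<otimes> t)"
proof -
  let ?F = "{fr (a' \<otimes> t' \<oplus> b' \<otimes> s') (s' \<otimes> t') | a' s' b' t'. (a', s') \<in> fr a s \<and> (b', t') \<in> fr b t}"
  have key: "fr (a' \<otimes> t' \<oplus> b' \<otimes> s') (s' \<otimes> t') = fr (a \<otimes> t \<oplus> b \<otimes> s) (s \<otimes> t)"
    if h: "(a', s') \<in> fr a s" "(b', t') \<in> fr b t" for a' s' b' t'
  proof -
    obtain u v where u: "u \<in> S" "u \<otimes> (s' \<otimes> a) = u \<otimes> (s \<otimes> a')" "a' \<in> carrier R" "s' \<in> S"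
      and v: "v \<in> S" "v \<otimes> (t' \<otimes> b) = v \<otimes> (t \<otimes> b')" "b' \<in> carrier R" "t' \<in> S"
      using h unfolding mem_fr_iff by blast
    have cc: "s \<in> carrier R" "t \<in> carrier R" "s' \<in> carrier R" "t' \<in> carrier R" "u \<in> carrier R" "v \<in> carrier R"
      using c u v by blast+
    have "(u \<otimes> v) \<otimes> ((s \<otimes> t) \<otimes> (a' \<otimes> t' \<oplus> b' \<otimes> s')) =
        (u \<otimes> (s \<otimes> a')) \<otimes> (v \<otimes> t \<otimes> t') \<oplus> (v \<otimes> (t \<otimes> b')) \<otimes> (u \<otimes> s \<otimes> s')" using cc c(1,2) u(3) v(3) by algebra
    also have "\<dots> = (u \<otimes> v) \<otimes> ((s' \<otimes> t') \<otimes> (a \<otimes> t \<oplus> b \<otimes> s))"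
      unfolding u(2)[symmetric] v(2)[symmetric] using cc c(1,2) u(3) v(3) by algebra
    finally show ?thesis using u v c S_mult by (intro fr_eqI[of _ _ _ _ "u \<otimes> v"]) auto
  qed
  have "\<Union>?F = fr (a \<otimes> t \<oplus> b \<otimes> s) (s \<otimes> t)"
    by (rule Union_eqI) (use key fr_self[OF c(1,3)] fr_self[OF c(2,4)] in blast)+
  thus ?thesis by (simp add: localization_at_def)
qed

lemma Loc_cring: "cring L"
proof (rule cringI)
  note cl = S_mult S_one
  show "abelian_group L"
  proof (rule abelian_groupI)
    fix x y assume "x \<in> carrier L" "y \<in> carrier L"
    then obtain a s b t where h: "a \<in> carrier R" "s \<in> S" "x = fr a s" "b \<in> carrier R" "t \<in> S" "y = fr b t"
      by (metis LocE)
    have c: "s \<in> carrier R" "t \<in> carrier R" using h by blast+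
    show "x \<oplus>\<^sub>L y \<in> carrier L" unfolding h(3,6) Loc_add[OF h(1,4,2,5)] using h c cl by (intro Loc_closed) auto
    have "a \<otimes> t \<oplus> b \<otimes> s = b \<otimes> s \<oplus> a \<otimes> t" "s \<otimes> t = t \<otimes> s" using h(1,4) c by algebra+
    thus "x \<oplus>\<^sub>L y = y \<oplus>\<^sub>L x" unfolding h(3,6) Loc_add[OF h(1,4,2,5)] Loc_add[OF h(4,1,5,2)] by simp
    fix z assume "z \<in> carrier L"
    then obtain d r where k: "d \<in> carrier R" "r \<in> S" "z = fr d r" by (metis LocE)
    have kc: "r \<in> carrier R" using k by blast
    have "(a \<otimes> t \<oplus> b \<otimes> s) \<otimes> r \<oplus> d \<otimes> (s \<otimes> t) = a \<otimes> (t \<otimes> r) \<oplus> (b \<otimes> r \<oplus> d \<otimes> t) \<otimes> s" "s \<otimes> t \<otimes> r = s \<otimes> (t \<otimes> r)"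
      using h(1,4) k(1) kc c by algebra+
    thus "x \<oplus>\<^sub>L y \<oplus>\<^sub>L z = x \<oplus>\<^sub>L (y \<oplus>\<^sub>L z)" unfolding h(3,6) k(3) using h k c kc cl by (simp add: Loc_add)
  next
    show "\<zero>\<^sub>L \<in> carrier L" unfolding Loc_simps(3) using S_one by blast
  next
    fix x assume "x \<in> carrier L"
    then obtain a s where h: "a \<in> carrier R" "s \<in> S" "x = fr a s" by (metis LocE)
    have c: "s \<in> carrier R" using h by blast
    show "\<zero>\<^sub>L \<oplus>\<^sub>L x = x" unfolding h(3) Loc_simps(3) Loc_add[OF zero_closed h(1) S_one h(2)] using h c by simp
    have "fr (\<ominus> a) s \<oplus>\<^sub>L fr a s = fr (\<ominus> a \<otimes> s \<oplus> a \<otimes> s) (s \<otimes> s)" using h by (intro Loc_add) auto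
    also have "\<dots> = fr \<zero> \<one>"
    proof (rule fr_eqI1)
      have "\<ominus> a \<otimes> s \<oplus> a \<otimes> s = \<zero>" using h(1) c by algebra
      thus "\<one> \<otimes> (\<ominus> a \<otimes> s \<oplus> a \<otimes> s) = s \<otimes> s \<otimes> \<zero>" using c by simp
    qed (use h c cl in auto)
    finally show "\<exists>y\<in>carrier L. y \<oplus>\<^sub>L x = \<zero>\<^sub>L"
      unfolding Loc_simps(3) h(3) using h(1,2) by (intro bexI[of _ "fr (\<ominus> a) s"]) auto
  qed
  show "comm_monoid L"
  proof (rule comm_monoidI)
    fix x y assume "x \<in> carrier L" "y \<in> carrier L"
    then obtain a s b t where h: "a \<in> carrier R" "s \<in> S" "x = fr a s" "b \<in> carrier R" "t \<in> S" "y = fr b t"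
      by (metis LocE)
    have c: "s \<in> carrier R" "t \<in> carrier R" using h by blast+
    show "x \<otimes>\<^sub>L y \<in> carrier L" unfolding h(3,6) Loc_mult[OF h(1,4,2,5)] using h c cl by (intro Loc_closed) auto
    show "x \<otimes>\<^sub>L y = y \<otimes>\<^sub>L x" unfolding h(3,6) Loc_mult[OF h(1,4,2,5)] Loc_mult[OF h(4,1,5,2)]
      using m_comm[OF h(1,4)] m_comm[OF c] by simp
    fix z assume "z \<in> carrier L"
    then obtain d r where k: "d \<in> carrier R" "r \<in> S" "z = fr d r" by (metis LocE)
    have kc: "r \<in> carrier R" using k by blast
    show "x \<otimes>\<^sub>L y \<otimes>\<^sub>L z = x \<otimes>\<^sub>L (y \<otimes>\<^sub>L z)" unfolding h(3,6) k(3) using h k c kc cl by (simp add: Loc_mult m_assoc)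
  next
    show "\<one>\<^sub>L \<in> carrier L" unfolding Loc_simps(2) using S_one by blast
  next
    fix x assume "x \<in> carrier L"
    then obtain a s where h: "a \<in> carrier R" "s \<in> S" "x = fr a s" by (metis LocE)
    have c: "s \<in> carrier R" using h by blast
    show "\<one>\<^sub>L \<otimes>\<^sub>L x = x" unfolding h(3) Loc_simps(2) Loc_mult[OF one_closed h(1) S_one h(2)] using h c by simp
  qed
  fix x y z assume "x \<in> carrier L" "y \<in> carrier L" "z \<in> carrier L"
  then obtain a s b t d r where h: "a \<in> carrier R" "s \<in> S" "x = fr a s" "b \<in> carrier R" "t \<in> S" "y = fr b t"
    "d \<in> carrier R" "r \<in> S" "z = fr d r" by (metis LocE)
  have c: "s \<in> carrier R" "t \<in> carrier R" "r \<in> carrier R" using h by blast+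
  have "(x \<oplus>\<^sub>L y) \<otimes>\<^sub>L z = fr ((a \<otimes> t \<oplus> b \<otimes> s) \<otimes> d) ((s \<otimes> t) \<otimes> r)"
    unfolding h(3,6,9) using h c cl by (simp add: Loc_add Loc_mult)
  also have "\<dots> = fr ((a \<otimes> d) \<otimes> (t \<otimes> r) \<oplus> (b \<otimes> d) \<otimes> (s \<otimes> r)) ((s \<otimes> r) \<otimes> (t \<otimes> r))"
  proof (rule fr_eqI1)
    show "(s \<otimes> r) \<otimes> (t \<otimes> r) \<otimes> ((a \<otimes> t \<oplus> b \<otimes> s) \<otimes> d) = (s \<otimes> t) \<otimes> r \<otimes> ((a \<otimes> d) \<otimes> (t \<otimes> r) \<oplus> (b \<otimes> d) \<otimes> (s \<otimes> r))"
      using h(1,4,7) c by algebra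
  qed (use h c cl in auto)
  also have "\<dots> = x \<otimes>\<^sub>L z \<oplus>\<^sub>L y \<otimes>\<^sub>L z" unfolding h(3,6,9) using h c cl by (simp add: Loc_add Loc_mult)
  finally show "(x \<oplus>\<^sub>L y) \<otimes>\<^sub>L z = x \<otimes>\<^sub>L z \<oplus>\<^sub>L y \<otimes>\<^sub>L z" .
qed

lemma fr_hom: "(\<lambda>a. fr a \<one>) \<in> ring_hom R L"
  using S_one by (intro ring_hom_memI) (auto simp: Loc_mult Loc_add Loc_simps(2))

definition qLoc where "qLoc = {fr a s | a s. a \<in> q \<and> s \<in> S}"

lemma fr_in_qLoc:
  assumes a: "a \<in> carrier R" "s \<in> S"
  shows "fr a s \<in> qLoc \<longleftrightarrow> a \<in> q"
proof
  assume "fr a s \<in> qLoc"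
  then obtain b t where b: "b \<in> q" "t \<in> S" "fr a s = fr b t" unfolding qLoc_def by blast
  then obtain u where u: "u \<in> S" "u \<otimes> (s \<otimes> b) = u \<otimes> (t \<otimes> a)" using fr_eqD[OF a] by blast
  have c: "u \<in> carrier R" "t \<in> carrier R" "s \<in> carrier R" using u b a by blast+
  have "u \<otimes> (s \<otimes> b) \<in> q" using I_l_closed b(1) c by blast
  hence "(u \<otimes> t) \<otimes> a \<in> q" unfolding u(2) using c a(1) by (simp add: m_assoc)
  thus "a \<in> q" using I_prime[of "u \<otimes> t" a] S_mult[OF u(1) b(2)] a(1) by blast
next
  assume "a \<in> q" thus "fr a s \<in> qLoc" unfolding qLoc_def using a by blast
qed

lemma qLoc_ideal: "ideal qLoc L"
proof -
  interpret L: cring L by (rule Loc_cring)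
  have sub: "qLoc \<subseteq> carrier L" unfolding qLoc_def using Icarr by blast
  show ?thesis unfolding L.ideal_iff
  proof (intro conjI ballI sub)
    show "\<zero>\<^sub>L \<in> qLoc" unfolding Loc_simps(3) using fr_in_qLoc[OF zero_closed S_one] by simp
  next
    fix x y assume "x \<in> qLoc" "y \<in> qLoc"
    then obtain a s b t where h: "a \<in> q" "s \<in> S" "x = fr a s" "b \<in> q" "t \<in> S" "y = fr b t"
      unfolding qLoc_def by blast
    have c: "a \<in> carrier R" "b \<in> carrier R" "s \<in> carrier R" "t \<in> carrier R" using h Icarr by blast+
    have "a \<otimes> t \<oplus> b \<otimes> s \<in> q" using h(1,4) c I_r_closed by auto
    thus "x \<oplus>\<^sub>L y \<in> qLoc" unfolding h(3,6) Loc_add[OF c(1,2) h(2,5)]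
      using S_mult[OF h(2,5)] unfolding qLoc_def by blast
  next
    fix x y assume "x \<in> carrier L" "y \<in> qLoc"
    then obtain a s where h1: "a \<in> carrier R" "s \<in> S" "x = fr a s" by (metis LocE)
    obtain b t where h2: "b \<in> q" "t \<in> S" "y = fr b t" using \<open>y \<in> qLoc\<close> unfolding qLoc_def by blast
    note h = h1 h2
    have c: "b \<in> carrier R" using h Icarr by blast
    have "a \<otimes> b \<in> q" using h(1,4) I_l_closed by auto
    thus "x \<otimes>\<^sub>L y \<in> qLoc" unfolding h(3,6) Loc_mult[OF h(1) c h(2,5)]
      using S_mult[OF h(2,5)] unfolding qLoc_def by blast
  qed
qed

lemma not_qLoc_unit:
  assumes "z \<in> carrier L" "z \<notin> qLoc"
  shows "\<exists>y\<in>carrier L. y \<otimes>\<^sub>L z = \<one>\<^sub>L"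
proof -
  obtain a s where h: "a \<in> carrier R" "s \<in> S" "z = fr a s" using assms(1) by (metis LocE)
  have aS: "a \<in> S" using fr_in_qLoc[OF h(1,2)] assms(2) h by blast
  have c: "s \<in> carrier R" using h by blast
  have "fr s a \<otimes>\<^sub>L fr a s = fr (s \<otimes> a) (a \<otimes> s)" using h aS c by (intro Loc_mult) auto
  also have "\<dots> = fr \<one> \<one>" using h c aS S_mult S_one by (intro fr_eqI1) (auto simp: m_comm)
  finally show ?thesis unfolding h(3) Loc_simps(2) using aS c by (intro bexI[of _ "fr s a"] Loc_closed) auto
qed

lemma qLoc_maximal: "maximalideal qLoc L" "max_ideal L = qLoc"
proof -
  interpret L: cring L by (rule Loc_cring)
  have one: "\<one>\<^sub>L \<notin> qLoc" unfolding Loc_simps(2) using fr_in_qLoc[OF one_closed S_one] S_one by blast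
  have full: "N = carrier L" if N: "ideal N L" "\<not> N \<subseteq> qLoc" for N
  proof -
    obtain z where z: "z \<in> N" "z \<notin> qLoc" using N by blast
    have zc: "z \<in> carrier L" using L.idealD(1)[OF N(1) z(1)] .
    obtain y where y: "y \<in> carrier L" "y \<otimes>\<^sub>L z = \<one>\<^sub>L" using not_qLoc_unit[OF zc z(2)] by blast
    have "\<one>\<^sub>L \<in> N" using L.idealD(4)[OF N(1) y(1) z(1)] y(2) by simp
    thus ?thesis using ideal.one_imp_carrier[OF N(1)] by blast
  qed
  show m: "maximalideal qLoc L"
  proof (rule maximalidealI[OF qLoc_ideal])
    show "carrier L \<noteq> qLoc" using one L.one_closed by blast
    fix N assume "ideal N L" "qLoc \<subseteq> N" "N \<subseteq> carrier L"
    thus "N = qLoc \<or> N = carrier L" using full by blast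
  qed
  show "max_ideal L = qLoc" unfolding max_ideal_def
  proof (rule the_equality)
    show "maximalideal qLoc L" by (rule m)
  next
    fix N assume N: "maximalideal N L"
    interpret N: maximalideal N L by (rule N)
    have "N \<subseteq> qLoc" using full[OF N.ideal_axioms] N.I_notcarr by blast
    moreover have "qLoc \<noteq> carrier L" using one L.one_closed by blast
    ultimately show "N = qLoc" using N.I_maximal[OF qLoc_ideal] L.idealD(5)[OF qLoc_ideal] by blast
  qed
qed

lemma kappa_eq: "kappa R q = L Quot qLoc" by (simp add: kappa_def residue_field_def qLoc_maximal(2))

lemma kappa_field: "field (kappa R q)"
  unfolding kappa_eq using maximalideal.quotient_is_field[OF qLoc_maximal(1) Loc_cring] .

lemma to_kappa_eq: "to_kappa R q a = qLoc +>\<^sub>L fr a \<one>" by (simp add: to_kappa_def qLoc_maximal(2))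

lemma to_kappa_hom: "to_kappa R q \<in> ring_hom R (kappa R q)"
proof -
  interpret qL: ideal qLoc L by (rule qLoc_ideal)
  have "(+>\<^sub>L) qLoc \<circ> (\<lambda>a. fr a \<one>) \<in> ring_hom R (L Quot qLoc)" using ring_hom_trans[OF fr_hom qL.rcos_ring_hom] .
  moreover have "(+>\<^sub>L) qLoc \<circ> (\<lambda>a. fr a \<one>) = to_kappa R q" by (auto simp: to_kappa_eq)
  ultimately show ?thesis unfolding kappa_eq by simp
qed

lemma to_kappa_zero:
  assumes a: "a \<in> carrier R"
  shows "to_kappa R q a = \<zero>\<^bsub>kappa R q\<^esub> \<longleftrightarrow> a \<in> q"
proof -
  interpret qL: ideal qLoc L by (rule qLoc_ideal)
  have f: "fr a \<one> \<in> carrier L" using a S_one by blast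
  have "to_kappa R q a = \<zero>\<^bsub>kappa R q\<^esub> \<longleftrightarrow> fr a \<one> \<in> qLoc"
    unfolding kappa_eq to_kappa_eq FactRing_def using qL.a_rcos_const[of "fr a \<one>"] qL.a_rcos_self[OF f] by auto
  thus ?thesis using fr_in_qLoc[OF a S_one] by simp
qed

lemma kappa_frac:
  assumes k: "k \<in> carrier (kappa R q)"
  shows "\<exists>s\<in>S. \<exists>a\<in>carrier R. to_kappa R q s \<otimes>\<^bsub>kappa R q\<^esub> k = to_kappa R q a"
proof -
  interpret qL: ideal qLoc L by (rule qLoc_ideal)
  obtain z where "z \<in> carrier L" "k = qLoc +>\<^sub>L z" using k unfolding kappa_eq FactRing_def A_RCOSETS_def' by auto
  then obtain a s where h: "a \<in> carrier R" "s \<in> S" "k = qLoc +>\<^sub>L fr a s" by (metis LocE)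
  have c: "s \<in> carrier R" using h by blast
  have "to_kappa R q s \<otimes>\<^bsub>kappa R q\<^esub> k = qLoc +>\<^sub>L (fr s \<one> \<otimes>\<^sub>L fr a s)" unfolding kappa_eq to_kappa_eq h(3)
    using ring_hom_mult[OF qL.rcos_ring_hom] Loc_closed[OF c S_one] Loc_closed[OF h(1,2)] by simp
  also have "fr s \<one> \<otimes>\<^sub>L fr a s = fr (s \<otimes> a) (\<one> \<otimes> s)" by (rule Loc_mult[OF c h(1) S_one h(2)])
  also have "\<dots> = fr a \<one>" using h c S_one by (intro fr_eqI1) auto
  finally show ?thesis using h unfolding to_kappa_eq by blast
qed

end

section \<open>Quotient modules\<close>

context module
begin

lemma submodule_abelian_subgroup:
  assumes N: "submodule R N M"
  shows "abelian_subgroup N M"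
proof (rule abelian_subgroupI3)
  show "additive_subgroup N M"
  proof (rule additive_subgroup.intro)
    show "subgroup N (add_monoid M)"
    proof (rule M.add.subgroupI)
      show "N \<subseteq> carrier M" using submoduleD(1)[OF N] by blast
      show "N \<noteq> {}" using submoduleD(2)[OF N] by blast
      fix a assume a: "a \<in> N"
      hence ac: "a \<in> carrier M" using submoduleD(1)[OF N] by blast
      have "(\<ominus> \<one>) \<odot>\<^sub>M a \<in> N" using submoduleD(4)[OF N _ a] by simp
      thus "\<ominus>\<^sub>M a \<in> N" using ac by (simp add: smult_minus_1)
      fix b assume b: "b \<in> N"
      show "a \<oplus>\<^sub>M b \<in> N" using submoduleD(3)[OF N a b] .
    qed
  qed
  show "abelian_group M" by (rule M.abelian_group_axioms)
qed

lemma coset_eq_iff: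
  assumes N: "submodule R N M" and x: "x \<in> carrier M" "y \<in> carrier M"
  shows "N +>\<^sub>M x = N +>\<^sub>M y \<longleftrightarrow> x \<ominus>\<^sub>M y \<in> N"
proof -
  interpret N: abelian_subgroup N M using submodule_abelian_subgroup[OF N] .
  show ?thesis
  proof
    assume "N +>\<^sub>M x = N +>\<^sub>M y"
    hence "x \<in> N +>\<^sub>M y" using N.a_rcos_self[OF x(1)] by simp
    then obtain n where n: "n \<in> N" "x = n \<oplus>\<^sub>M y" unfolding a_r_coset_def' by blast
    hence "x \<ominus>\<^sub>M y = n" using x submoduleD(1)[OF N n(1)] by (simp add: msimps)
    thus "x \<ominus>\<^sub>M y \<in> N" using n by simp
  next
    assume d: "x \<ominus>\<^sub>M y \<in> N"
    have "x = (x \<ominus>\<^sub>M y) \<oplus>\<^sub>M y" using x by (simp add: msimps)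
    hence "x \<in> N +>\<^sub>M y" using d unfolding a_r_coset_def' by blast
    thus "N +>\<^sub>M x = N +>\<^sub>M y" using N.a_repr_independence'[OF _ x(2)] by simp
  qed
qed

lemma quot_module_simps:
  assumes N: "submodule R N M"
  shows "carrier (quot_module M N) = {N +>\<^sub>M x | x. x \<in> carrier M}"
    "\<zero>\<^bsub>quot_module M N\<^esub> = N +>\<^sub>M \<zero>\<^sub>M"
    "x \<in> carrier M \<Longrightarrow> y \<in> carrier M \<Longrightarrow> (N +>\<^sub>M x) \<oplus>\<^bsub>quot_module M N\<^esub> (N +>\<^sub>M y) = N +>\<^sub>M (x \<oplus>\<^sub>M y)"
    "a \<in> carrier R \<Longrightarrow> x \<in> carrier M \<Longrightarrow> a \<odot>\<^bsub>quot_module M N\<^esub> (N +>\<^sub>M x) = N +>\<^sub>M (a \<odot>\<^sub>M x)"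
proof -
  interpret N: abelian_subgroup N M using submodule_abelian_subgroup[OF N] .
  show "carrier (quot_module M N) = {N +>\<^sub>M x | x. x \<in> carrier M}"
    unfolding quot_module_def A_RCOSETS_def' by auto
  show "\<zero>\<^bsub>quot_module M N\<^esub> = N +>\<^sub>M \<zero>\<^sub>M" using N.a_rcos_const[OF submoduleD(2)[OF N]] by (simp add: quot_module_def)
  show "(N +>\<^sub>M x) \<oplus>\<^bsub>quot_module M N\<^esub> (N +>\<^sub>M y) = N +>\<^sub>M (x \<oplus>\<^sub>M y)"
    if "x \<in> carrier M" "y \<in> carrier M" using N.a_rcos_sum[OF that] by (simp add: quot_module_def)
  show "a \<odot>\<^bsub>quot_module M N\<^esub> (N +>\<^sub>M x) = N +>\<^sub>M (a \<odot>\<^sub>M x)"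
    if h: "a \<in> carrier R" "x \<in> carrier M"
  proof -
    have eq: "N +>\<^sub>M (a \<odot>\<^sub>M y) = N +>\<^sub>M (a \<odot>\<^sub>M x)" if y: "y \<in> N +>\<^sub>M x" for y
    proof -
      obtain n where n: "n \<in> N" "y = n \<oplus>\<^sub>M x" using y unfolding a_r_coset_def' by blast
      have nc: "n \<in> carrier M" using submoduleD(1)[OF N n(1)] .
      have "a \<odot>\<^sub>M y \<ominus>\<^sub>M a \<odot>\<^sub>M x = a \<odot>\<^sub>M n" unfolding n(2) using nc h by (simp add: msimps)
      hence "a \<odot>\<^sub>M y \<ominus>\<^sub>M a \<odot>\<^sub>M x \<in> N" using submoduleD(4)[OF N h(1) n(1)] by simp
      thus ?thesis using coset_eq_iff[OF N] nc h n(2) by simp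
    qed
    have "(\<Union>y \<in> N +>\<^sub>M x. N +>\<^sub>M (a \<odot>\<^sub>M y)) = N +>\<^sub>M (a \<odot>\<^sub>M x)" using eq N.a_rcos_self[OF h(2)] by blast
    thus ?thesis by (simp add: quot_module_def)
  qed
qed

lemma quot_module_is_module:
  assumes N: "submodule R N M"
  shows "module R (quot_module M N)"
proof (rule moduleI)
  note q = quot_module_simps[OF N]
  have el: "\<exists>x\<in>carrier M. X = N +>\<^sub>M x" if "X \<in> carrier (quot_module M N)" for X
    using that unfolding q(1) by blast
  have mem: "N +>\<^sub>M x \<in> carrier (quot_module M N)" if "x \<in> carrier M" for x using that unfolding q(1) by blast
  show "cring R" by (rule R.is_cring)
  show "abelian_group (quot_module M N)"
  proof (rule abelian_groupI)
    fix X Y assume "X \<in> carrier (quot_module M N)" "Y \<in> carrier (quot_module M N)"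
    then obtain x y where x: "x \<in> carrier M" "X = N +>\<^sub>M x" "y \<in> carrier M" "Y = N +>\<^sub>M y" using el by metis
    show "X \<oplus>\<^bsub>quot_module M N\<^esub> Y \<in> carrier (quot_module M N)" using x mem by (simp add: q)
    show "X \<oplus>\<^bsub>quot_module M N\<^esub> Y = Y \<oplus>\<^bsub>quot_module M N\<^esub> X" using x by (simp add: q M.a_comm)
    fix Z assume "Z \<in> carrier (quot_module M N)"
    then obtain z where z: "z \<in> carrier M" "Z = N +>\<^sub>M z" using el by metis
    show "X \<oplus>\<^bsub>quot_module M N\<^esub> Y \<oplus>\<^bsub>quot_module M N\<^esub> Z = X \<oplus>\<^bsub>quot_module M N\<^esub> (Y \<oplus>\<^bsub>quot_module M N\<^esub> Z)"
      using x z by (simp add: q M.a_assoc)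
  next
    show "\<zero>\<^bsub>quot_module M N\<^esub> \<in> carrier (quot_module M N)" unfolding q(2) using mem by blast
    fix X assume "X \<in> carrier (quot_module M N)"
    then obtain x where x: "x \<in> carrier M" "X = N +>\<^sub>M x" using el by metis
    show "\<zero>\<^bsub>quot_module M N\<^esub> \<oplus>\<^bsub>quot_module M N\<^esub> X = X" using x by (simp add: q)
    show "\<exists>Y\<in>carrier (quot_module M N). Y \<oplus>\<^bsub>quot_module M N\<^esub> X = \<zero>\<^bsub>quot_module M N\<^esub>"
      using x mem by (intro bexI[of _ "N +>\<^sub>M (\<ominus>\<^sub>M x)"]) (auto simp: q M.l_neg)
  qed
next
  note q = quot_module_simps[OF N]
  have el: "\<exists>x\<in>carrier M. X = N +>\<^sub>M x" if "X \<in> carrier (quot_module M N)" for X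
    using that unfolding q(1) by blast
  have mem: "N +>\<^sub>M x \<in> carrier (quot_module M N)" if "x \<in> carrier M" for x using that unfolding q(1) by blast
  {
    fix a X assume a: "a \<in> carrier R" "X \<in> carrier (quot_module M N)"
    then obtain x where x: "x \<in> carrier M" "X = N +>\<^sub>M x" using el by metis
    show "a \<odot>\<^bsub>quot_module M N\<^esub> X \<in> carrier (quot_module M N)" using x a mem by (simp add: q)
    {
      fix b assume b: "b \<in> carrier R"
      show "(a \<oplus> b) \<odot>\<^bsub>quot_module M N\<^esub> X = a \<odot>\<^bsub>quot_module M N\<^esub> X \<oplus>\<^bsub>quot_module M N\<^esub> b \<odot>\<^bsub>quot_module M N\<^esub> X"
        using x a b by (simp add: q smult_l_distr)
      show "(a \<otimes> b) \<odot>\<^bsub>quot_module M N\<^esub> X = a \<odot>\<^bsub>quot_module M N\<^esub> (b \<odot>\<^bsub>quot_module M N\<^esub> X)"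
        using x a b by (simp add: q smult_assoc1)
    }
    fix Y assume "Y \<in> carrier (quot_module M N)"
    then obtain y where y: "y \<in> carrier M" "Y = N +>\<^sub>M y" using el by metis
    show "a \<odot>\<^bsub>quot_module M N\<^esub> (X \<oplus>\<^bsub>quot_module M N\<^esub> Y) = a \<odot>\<^bsub>quot_module M N\<^esub> X \<oplus>\<^bsub>quot_module M N\<^esub> a \<odot>\<^bsub>quot_module M N\<^esub> Y"
      using x y a by (simp add: q smult_r_distr)
  }
  fix X assume "X \<in> carrier (quot_module M N)"
  then obtain x where x: "x \<in> carrier M" "X = N +>\<^sub>M x" using el by metis
  show "\<one> \<odot>\<^bsub>quot_module M N\<^esub> X = X" using x by (simp add: q)
qed

lemma lincomb_extend:
  assumes "finite T" "S \<subseteq> T" "T \<subseteq> carrier M" "a \<in> T \<rightarrow> carrier R" "\<And>x. x \<in> T - S \<Longrightarrow> a x = \<zero>"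
  shows "lincomb a T = lincomb a S"
proof -
  have fS: "finite S" using assms finite_subset by blast
  have "lincomb a (S \<union> (T - S)) = lincomb a S \<oplus>\<^sub>M lincomb a (T - S)" using assms fS by (intro lincomb_union) auto
  moreover have "lincomb a (T - S) = \<zero>\<^sub>M"
  proof -
    have "lincomb a (T - S) \<in> {\<zero>\<^sub>M}" using assms by (intro lincomb_in_submodule[OF _ submodule_zero]) auto
    thus ?thesis by blast
  qed
  moreover have "lincomb a S \<in> carrier M" using assms by (intro lincomb_closed) auto
  moreover have "S \<union> (T - S) = T" using assms by blast
  ultimately show ?thesis by simp
qed

lemma lincomb_linear:
  assumes "finite S" "S \<subseteq> carrier M" "a \<in> S \<rightarrow> carrier R" "b \<in> S \<rightarrow> carrier R" "s \<in> carrier R" "t \<in> carrier R"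
  shows "lincomb (\<lambda>x. t \<otimes> a x \<oplus> s \<otimes> b x) S = t \<odot>\<^sub>M lincomb a S \<oplus>\<^sub>M s \<odot>\<^sub>M lincomb b S"
proof -
  have "lincomb (\<lambda>x. t \<otimes> a x \<oplus> s \<otimes> b x) S = lincomb (\<lambda>x. t \<otimes> a x) S \<oplus>\<^sub>M lincomb (\<lambda>x. s \<otimes> b x) S"
    using assms by (intro lincomb_sum) auto
  thus ?thesis using assms by (simp add: lincomb_smult)
qed

lemma lincomb_zero_fun: "X \<subseteq> carrier M \<Longrightarrow> lincomb (\<lambda>_. \<zero>) X = \<zero>\<^sub>M" by (rule lincomb_zero) auto

lemma submodule_lincomb_ideal:
  assumes G: "finite G" "G \<subseteq> carrier M" and J: "ideal J R"
  shows "submodule R {lincomb a G | a. a \<in> G \<rightarrow> J} M"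
  unfolding submodule_iff
proof (intro conjI ballI)
  note Jd = R.idealD[OF J]
  let ?L = "{lincomb a G | a. a \<in> G \<rightarrow> J}"
  have GJ: "a \<in> G \<rightarrow> carrier R" if "a \<in> G \<rightarrow> J" for a using that Jd(5) by (auto simp: Pi_iff)
  show "?L \<subseteq> carrier M"
  proof
    fix z assume "z \<in> ?L"
    then obtain a where a: "a \<in> G \<rightarrow> J" "z = lincomb a G" by blast
    show "z \<in> carrier M" unfolding a(2) by (rule lincomb_closed[OF G(2) GJ[OF a(1)]])
  qed
  show "\<zero>\<^sub>M \<in> ?L" using lincomb_zero_fun[OF G(2)] Jd(2) by (intro CollectI exI[of _ "\<lambda>_. \<zero>"]) auto
  fix y assume "y \<in> ?L"
  then obtain b where b: "b \<in> G \<rightarrow> J" "y = lincomb b G" by blast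
  {
    fix z assume "z \<in> ?L"
    then obtain a where a: "a \<in> G \<rightarrow> J" "z = lincomb a G" by blast
    have "lincomb (\<lambda>g. b g \<oplus> a g) G = y \<oplus>\<^sub>M z" using lincomb_sum[OF G GJ[OF b(1)] GJ[OF a(1)]] a(2) b(2) by simp
    thus "y \<oplus>\<^sub>M z \<in> ?L" using a b Jd(3) by (intro CollectI exI[of _ "\<lambda>g. b g \<oplus> a g"]) auto
  next
    fix c assume c: "c \<in> carrier R"
    have "lincomb (\<lambda>g. c \<otimes> b g) G = c \<odot>\<^sub>M y" using lincomb_smult[OF G(2) GJ[OF b(1)] c] b(2) by simp
    thus "c \<odot>\<^sub>M y \<in> ?L" using b c Jd(4) by (intro CollectI exI[of _ "\<lambda>g. c \<otimes> b g"]) auto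
  }
qed

end

lemma (in cring) free_on_module:
  fixes X :: "'x set"
  shows "module R (free_on R X)"
proof (rule moduleI)
  let ?F = "free_on R X"
  have fin2: "finite {x. f x \<oplus> g x \<noteq> \<zero>}" if "finite {x. f x \<noteq> \<zero>}" "finite {x. g x \<noteq> \<zero>}" for f g :: "'x \<Rightarrow> 'a"
    by (rule finite_subset[OF _ finite_UnI[OF that]]) auto
  have finc: "finite {x. c \<otimes> f x \<noteq> \<zero>}" if "finite {x. f x \<noteq> \<zero>}" "c \<in> carrier R" for f :: "'x \<Rightarrow> 'a" and c
    by (rule finite_subset[OF _ that(1)]) (use that(2) in auto)
  have finn: "finite {x. \<ominus> f x \<noteq> \<zero>}" if "finite {x. f x \<noteq> \<zero>}" for f :: "'x \<Rightarrow> 'a"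
    by (rule finite_subset[OF _ that(1)]) auto
  show "cring R" by (rule is_cring)
  show "abelian_group ?F"
  proof (rule abelian_groupI)
    fix x assume x: "x \<in> carrier ?F"
    hence "(\<lambda>y. \<ominus> x y) \<in> carrier ?F" using finn by (auto simp: free_on_def)
    moreover have "(\<lambda>y. \<ominus> x y) \<oplus>\<^bsub>?F\<^esub> x = \<zero>\<^bsub>?F\<^esub>" using x by (auto simp: free_on_def l_neg)
    ultimately show "\<exists>y\<in>carrier ?F. y \<oplus>\<^bsub>?F\<^esub> x = \<zero>\<^bsub>?F\<^esub>" by (intro bexI[of _ "\<lambda>y. \<ominus> x y"])
  qed (auto simp: free_on_def a_ac fin2)
  show "a \<odot>\<^bsub>?F\<^esub> x \<in> carrier ?F" if "a \<in> carrier R" "x \<in> carrier ?F" for a x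
    using that finc by (auto simp: free_on_def)
qed (auto simp: free_on_def l_distr r_distr m_assoc)

section \<open>Extension of scalars to the residue field\<close>

text \<open>The map to the residue field of a localization enters only through three properties: its
  target is a field, its kernel is \<open>q\<close>, and every element is a quotient of images. The
  rank can then be computed with denominators in \<open>R\<close>.\<close>

locale residue_hom = primeideal q R + M: module R M for q and R (structure) and M +
  fixes F :: "('f, 'l) ring_scheme" and h
  assumes F_field: "field F" and h_hom: "h \<in> ring_hom R F"
    and h_zero: "\<And>a. a \<in> carrier R \<Longrightarrow> h a = \<zero>\<^sub>F \<longleftrightarrow> a \<in> q"
    and h_frac: "\<And>k. k \<in> carrier F \<Longrightarrow> \<exists>s\<in>carrier R - q. \<exists>a\<in>carrier R. h s \<otimes>\<^sub>F k = h a"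
begin

sublocale F: field F by (rule F_field)

definition P where "P = free_on F (carrier M)"

sublocale P: module F P unfolding P_def by (rule F.free_on_module)

definition rel where "rel = tensor_relations R F h M"

definition V where "V = tensor_scalars R F h M"

definition qM where "qM = ideal_smult R q M"

text \<open>The elements that vanish in the tensor product with the residue field, as
  \<open>tau_zero_iff\<close> will show.\<close>

definition T where "T = {m \<in> carrier M. \<exists>s\<in>carrier R - q. s \<odot>\<^sub>M m \<in> qM}"

definition tau where "tau m = P.span rel +>\<^sub>P free_gen F m"

lemma FM_simps:
  "\<zero>\<^sub>P = (\<lambda>_. \<zero>\<^sub>F)" "f \<oplus>\<^sub>P g = (\<lambda>x. f x \<oplus>\<^sub>F g x)" "c \<odot>\<^sub>P f = (\<lambda>x. c \<otimes>\<^sub>F f x)" by (auto simp: P_def free_on_def)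

lemma FM_carrier: "f \<in> carrier P \<longleftrightarrow> (\<forall>x. f x \<in> carrier F) \<and> (\<forall>x. x \<notin> carrier M \<longrightarrow> f x = \<zero>\<^sub>F) \<and> finite {x. f x \<noteq> \<zero>\<^sub>F}"
  by (auto simp: P_def free_on_def)

lemma h_simps:
  "a \<in> carrier R \<Longrightarrow> h a \<in> carrier F" "h \<one> = \<one>\<^sub>F" "h \<zero> = \<zero>\<^sub>F"
  "a \<in> carrier R \<Longrightarrow> b \<in> carrier R \<Longrightarrow> h (a \<otimes> b) = h a \<otimes>\<^sub>F h b"
  "a \<in> carrier R \<Longrightarrow> b \<in> carrier R \<Longrightarrow> h (a \<oplus> b) = h a \<oplus>\<^sub>F h b"
  "a \<in> carrier R \<Longrightarrow> h (\<ominus> a) = \<ominus>\<^sub>F h a"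
proof -
  interpret hh: ring_hom_ring R F h using h_hom F.ring_axioms ring_axioms by (simp add: ring_hom_ringI2)
  show "a \<in> carrier R \<Longrightarrow> h a \<in> carrier F" "h \<one> = \<one>\<^sub>F" "h \<zero> = \<zero>\<^sub>F"
  "a \<in> carrier R \<Longrightarrow> b \<in> carrier R \<Longrightarrow> h (a \<otimes> b) = h a \<otimes>\<^sub>F h b"
  "a \<in> carrier R \<Longrightarrow> b \<in> carrier R \<Longrightarrow> h (a \<oplus> b) = h a \<oplus>\<^sub>F h b"
  "a \<in> carrier R \<Longrightarrow> h (\<ominus> a) = \<ominus>\<^sub>F h a" by auto
qed

lemma one_S: "\<one> \<in> carrier R - q" using one_imp_carrier I_notcarr by blast

lemma S_mult: "s \<in> carrier R - q \<Longrightarrow> t \<in> carrier R - q \<Longrightarrow> s \<otimes> t \<in> carrier R - q" using I_prime by blast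

lemma h_unit: "s \<in> carrier R - q \<Longrightarrow> h s \<in> carrier F \<and> h s \<noteq> \<zero>\<^sub>F" using h_zero h_simps(1) by blast

lemma qM_submodule: "submodule R qM M"
  unfolding qM_def ideal_smult_def by (rule M.span_is_submodule) (use Icarr in auto)

lemma qM_gen: "a \<in> q \<Longrightarrow> x \<in> carrier M \<Longrightarrow> a \<odot>\<^sub>M x \<in> qM"
  unfolding qM_def ideal_smult_def by (rule subsetD[OF M.in_own_span]) (use Icarr in auto)

lemma T_submodule: "submodule R T M" unfolding M.submodule_iff
proof (intro conjI ballI)
  show "T \<subseteq> carrier M" unfolding T_def by blast
  show "\<zero>\<^sub>M \<in> T" unfolding T_def using one_S M.submoduleD(2)[OF qM_submodule] by auto
next
  fix x y assume "x \<in> T" "y \<in> T"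
  then obtain s t where s: "x \<in> carrier M" "y \<in> carrier M" "s \<in> carrier R - q" "s \<odot>\<^sub>M x \<in> qM"
     "t \<in> carrier R - q" "t \<odot>\<^sub>M y \<in> qM" unfolding T_def by blast
  have c: "s \<in> carrier R" "t \<in> carrier R" using s by blast+
  have "(s \<otimes> t) \<odot>\<^sub>M (x \<oplus>\<^sub>M y) = t \<odot>\<^sub>M (s \<odot>\<^sub>M x) \<oplus>\<^sub>M s \<odot>\<^sub>M (t \<odot>\<^sub>M y)" using c s(1,2) by (simp add: M.msimps)
  moreover have "\<dots> \<in> qM"
    using M.submoduleD(3)[OF qM_submodule M.submoduleD(4)[OF qM_submodule c(2) s(4)] M.submoduleD(4)[OF qM_submodule c(1) s(6)]] .
  ultimately have "(s \<otimes> t) \<odot>\<^sub>M (x \<oplus>\<^sub>M y) \<in> qM" by simp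
  thus "x \<oplus>\<^sub>M y \<in> T" unfolding T_def using S_mult[OF s(3,5)] s(1,2) by blast
next
  fix a x assume a: "a \<in> carrier R" "x \<in> T"
  then obtain s where s: "x \<in> carrier M" "s \<in> carrier R - q" "s \<odot>\<^sub>M x \<in> qM" unfolding T_def by blast
  have c: "s \<in> carrier R" using s by blast
  have "s \<odot>\<^sub>M (a \<odot>\<^sub>M x) = a \<odot>\<^sub>M (s \<odot>\<^sub>M x)" using a(1) c s(1) by (simp add: M.msimps)
  moreover have "\<dots> \<in> qM" using M.submoduleD(4)[OF qM_submodule a(1) s(3)] .
  ultimately have "s \<odot>\<^sub>M (a \<odot>\<^sub>M x) \<in> qM" by simp
  thus "a \<odot>\<^sub>M x \<in> T" unfolding T_def using s a by blast
qed

lemma T_saturated: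
  assumes "s \<in> carrier R - q" "x \<in> carrier M" "s \<odot>\<^sub>M x \<in> T"
  shows "x \<in> T"
proof -
  obtain t where t: "t \<in> carrier R - q" "t \<odot>\<^sub>M (s \<odot>\<^sub>M x) \<in> qM" using assms unfolding T_def by blast
  hence "(t \<otimes> s) \<odot>\<^sub>M x \<in> qM" using assms by (simp add: M.smult_assoc1)
  thus ?thesis unfolding T_def using S_mult[OF t(1) assms(1)] assms(2) by blast
qed

lemma qM_T: "x \<in> qM \<Longrightarrow> x \<in> T" unfolding T_def using one_S M.submoduleD(1)[OF qM_submodule] by force

text \<open>
  \<open>lifts f s m\<close>: after multiplication by the denominator \<open>s\<close>, the formal combination \<open>f\<close> has a lift
  to \<open>R\<close>-coefficients, whose value in \<open>M\<close> is \<open>m\<close>.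
\<close>

definition lifts where
  "lifts f s m \<longleftrightarrow> s \<in> carrier R - q \<and> (\<exists>S a. finite S \<and> S \<subseteq> carrier M \<and> (\<forall>x. a x \<in> carrier R) \<and>
     (\<forall>x. x \<notin> S \<longrightarrow> a x = \<zero> \<and> f x = \<zero>\<^sub>F) \<and> (\<forall>x. h (a x) = h s \<otimes>\<^sub>F f x) \<and> M.lincomb a S = m)"

lemma lifts_closed: "lifts f s m \<Longrightarrow> m \<in> carrier M" unfolding lifts_def by (auto intro!: M.lincomb_closed)

lemma lifts_add:
  assumes f: "lifts f s m" "f \<in> carrier P" and g: "lifts g t n" "g \<in> carrier P"
  shows "lifts (f \<oplus>\<^sub>P g) (s \<otimes> t) (t \<odot>\<^sub>M m \<oplus>\<^sub>M s \<odot>\<^sub>M n)"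
proof -
  obtain S a where S: "s \<in> carrier R - q" "finite S" "S \<subseteq> carrier M" "\<forall>x. a x \<in> carrier R"
     "\<forall>x. x \<notin> S \<longrightarrow> a x = \<zero> \<and> f x = \<zero>\<^sub>F" "\<forall>x. h (a x) = h s \<otimes>\<^sub>F f x" "M.lincomb a S = m"
    using f(1) unfolding lifts_def by blast
  obtain S' b where S': "t \<in> carrier R - q" "finite S'" "S' \<subseteq> carrier M" "\<forall>x. b x \<in> carrier R"
     "\<forall>x. x \<notin> S' \<longrightarrow> b x = \<zero> \<and> g x = \<zero>\<^sub>F" "\<forall>x. h (b x) = h t \<otimes>\<^sub>F g x" "M.lincomb b S' = n"
    using g(1) unfolding lifts_def by blast
  have c: "s \<in> carrier R" "t \<in> carrier R" using S(1) S'(1) by blast+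
  have fc: "f x \<in> carrier F" "g x \<in> carrier F" for x using f(2) g(2) unfolding FM_carrier by blast+
  let ?U = "S \<union> S'" and ?c = "\<lambda>x. t \<otimes> a x \<oplus> s \<otimes> b x"
  have "M.lincomb a ?U = m" "M.lincomb b ?U = n"
    using S S' M.lincomb_extend[of ?U S a] M.lincomb_extend[of ?U S' b] by auto
  hence "M.lincomb ?c ?U = t \<odot>\<^sub>M m \<oplus>\<^sub>M s \<odot>\<^sub>M n" using S S' c by (subst M.lincomb_linear) auto
  moreover have "h (?c x) = h (s \<otimes> t) \<otimes>\<^sub>F (f \<oplus>\<^sub>P g) x" for x
  proof -
    have "h (?c x) = h t \<otimes>\<^sub>F (h s \<otimes>\<^sub>F f x) \<oplus>\<^sub>F h s \<otimes>\<^sub>F (h t \<otimes>\<^sub>F g x)" using S S' c by (simp add: h_simps)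
    also have "\<dots> = (h s \<otimes>\<^sub>F h t) \<otimes>\<^sub>F (f x \<oplus>\<^sub>F g x)"
      using fc[of x] h_simps(1)[OF c(1)] h_simps(1)[OF c(2)] by algebra
    finally show ?thesis using c by (simp add: h_simps FM_simps)
  qed
  ultimately show ?thesis unfolding lifts_def using S S' S_mult[OF S(1) S'(1)] c
    by (intro conjI exI[of _ ?U] exI[of _ ?c]) (auto simp: FM_simps)
qed

lemma lifts_smult:
  assumes f: "lifts f s m" "f \<in> carrier P" and k: "k \<in> carrier F" "t \<in> carrier R - q" "c \<in> carrier R" "h t \<otimes>\<^sub>F k = h c"
  shows "lifts (k \<odot>\<^sub>P f) (s \<otimes> t) (c \<odot>\<^sub>M m)"
proof -
  obtain S a where S: "s \<in> carrier R - q" "finite S" "S \<subseteq> carrier M" "\<forall>x. a x \<in> carrier R"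
     "\<forall>x. x \<notin> S \<longrightarrow> a x = \<zero> \<and> f x = \<zero>\<^sub>F" "\<forall>x. h (a x) = h s \<otimes>\<^sub>F f x" "M.lincomb a S = m"
    using f(1) unfolding lifts_def by blast
  have cc: "s \<in> carrier R" "t \<in> carrier R" using S(1) k by blast+
  have fc: "f x \<in> carrier F" for x using f(2) unfolding FM_carrier by blast
  have "M.lincomb (\<lambda>x. c \<otimes> a x) S = c \<odot>\<^sub>M m" using S k by (subst M.lincomb_smult) auto
  moreover have "h (c \<otimes> a x) = h (s \<otimes> t) \<otimes>\<^sub>F (k \<odot>\<^sub>P f) x" for x
  proof -
    have "h (c \<otimes> a x) = (h t \<otimes>\<^sub>F k) \<otimes>\<^sub>F (h s \<otimes>\<^sub>F f x)" using S k by (simp add: h_simps)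
    also have "\<dots> = (h s \<otimes>\<^sub>F h t) \<otimes>\<^sub>F (k \<otimes>\<^sub>F f x)"
      using fc[of x] h_simps(1)[OF cc(1)] h_simps(1)[OF cc(2)] k(1) by algebra
    finally show ?thesis using cc by (simp add: h_simps FM_simps)
  qed
  ultimately show ?thesis unfolding lifts_def using S k S_mult[OF S(1) k(2)]
    by (intro conjI exI[of _ S] exI[of _ "\<lambda>x. c \<otimes> a x"]) (auto simp: FM_simps)
qed

lemma gen_FM: "x \<in> carrier M \<Longrightarrow> free_gen F x \<in> carrier P"
proof -
  assume x: "x \<in> carrier M"
  have "finite {y. free_gen F x y \<noteq> \<zero>\<^sub>F}" by (rule finite_subset[of _ "{x}"]) (auto simp: free_gen_def)
  thus ?thesis using x unfolding FM_carrier by (auto simp: free_gen_def)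
qed

lemma lifts_gen:
  assumes "x \<in> carrier M"
  shows "lifts (free_gen F x) \<one> x"
  unfolding lifts_def
proof (intro conjI one_S exI[of _ "{x}"] exI[of _ "\<lambda>y. if y = x then \<one> else \<zero>"])
  show "M.lincomb (\<lambda>y. if y = x then \<one> else \<zero>) {x} = x" using assms by (simp add: M.lincomb_def)
qed (use assms in \<open>auto simp: free_gen_def h_simps\<close>)

lemma lifts_zero: "lifts \<zero>\<^sub>P \<one> \<zero>\<^sub>M" unfolding lifts_def
  by (intro conjI one_S exI[of _ "{}"] exI[of _ "\<lambda>_. \<zero>"]) (auto simp: FM_simps h_simps M.lincomb_def)

text \<open>A submodule containing all relations of the tensor product. It takes the place of a
  linear map out of the tensor product: to see that a pure tensor vanishes only for elements of
  \<open>T\<close>, it suffices to know which generators lie in \<open>G\<close>.\<close>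

definition G where "G = {f \<in> carrier P. \<exists>s m. lifts f s m \<and> m \<in> T}"

lemma G_submodule: "submodule F G P" unfolding P.submodule_iff
proof (intro conjI ballI)
  show "G \<subseteq> carrier P" unfolding G_def by blast
  show "\<zero>\<^sub>P \<in> G" unfolding G_def using lifts_zero M.submoduleD(2)[OF T_submodule] by blast
next
  fix f g assume "f \<in> G" "g \<in> G"
  then obtain s m t n where h: "f \<in> carrier P" "g \<in> carrier P" "lifts f s m" "m \<in> T" "lifts g t n" "n \<in> T"
    unfolding G_def by blast
  have c: "s \<in> carrier R" "t \<in> carrier R" using h(3,5) unfolding lifts_def by blast+
  have "t \<odot>\<^sub>M m \<oplus>\<^sub>M s \<odot>\<^sub>M n \<in> T"
    using M.submoduleD(3)[OF T_submodule M.submoduleD(4)[OF T_submodule c(2) h(4)] M.submoduleD(4)[OF T_submodule c(1) h(6)]] .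
  thus "f \<oplus>\<^sub>P g \<in> G" unfolding G_def using lifts_add[OF h(3,1,5,2)] h(1,2) by blast
next
  fix k f assume k: "k \<in> carrier F" "f \<in> G"
  then obtain s m where h: "f \<in> carrier P" "lifts f s m" "m \<in> T" unfolding G_def by blast
  obtain t c where t: "t \<in> carrier R - q" "c \<in> carrier R" "h t \<otimes>\<^sub>F k = h c" using h_frac[OF k(1)] by blast
  have "c \<odot>\<^sub>M m \<in> T" using M.submoduleD(4)[OF T_submodule t(2) h(3)] .
  thus "k \<odot>\<^sub>P f \<in> G" unfolding G_def using lifts_smult[OF h(2,1) k(1) t] h(1) k(1) by blast
qed

lemma rel_cases:
  assumes "f \<in> rel"
  obtains (add) x y where "x \<in> carrier M" "y \<in> carrier M"
      "f = free_gen F (x \<oplus>\<^sub>M y) \<ominus>\<^sub>P (free_gen F x \<oplus>\<^sub>P free_gen F y)"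
    | (smult) a x where "a \<in> carrier R" "x \<in> carrier M"
      "f = free_gen F (a \<odot>\<^sub>M x) \<ominus>\<^sub>P (h a \<odot>\<^sub>P free_gen F x)"
  using assms unfolding rel_def tensor_relations_def Let_def P_def by blast

lemma rel_FM: "rel \<subseteq> carrier P"
proof
  fix f assume "f \<in> rel"
  thus "f \<in> carrier P" by (cases rule: rel_cases) (auto intro!: P.M.minus_closed gen_FM h_simps(1))
qed

lemma lifts_minus_gen:
  assumes "lifts g \<one> n" "g \<in> carrier P" "lifts f \<one> m" "f \<in> carrier P"
  shows "lifts (f \<ominus>\<^sub>P g) \<one> (m \<ominus>\<^sub>M n)"
proof -
  have c: "m \<in> carrier M" "n \<in> carrier M" using lifts_closed assms by blast+
  have "h \<one> \<otimes>\<^sub>F (\<ominus>\<^sub>F \<one>\<^sub>F) = h (\<ominus> \<one>)" by (simp add: h_simps)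
  hence "lifts ((\<ominus>\<^sub>F \<one>\<^sub>F) \<odot>\<^sub>P g) (\<one> \<otimes> \<one>) ((\<ominus> \<one>) \<odot>\<^sub>M n)" using assms by (intro lifts_smult one_S) auto
  hence "lifts (f \<oplus>\<^sub>P (\<ominus>\<^sub>F \<one>\<^sub>F) \<odot>\<^sub>P g) (\<one> \<otimes> (\<one> \<otimes> \<one>)) ((\<one> \<otimes> \<one>) \<odot>\<^sub>M m \<oplus>\<^sub>M \<one> \<odot>\<^sub>M ((\<ominus> \<one>) \<odot>\<^sub>M n))"
    using assms by (intro lifts_add) auto
  thus ?thesis using c assms(2) by (simp add: a_minus_def P.smult_minus_1 M.smult_minus_1)
qed

lemma rel_G: "rel \<subseteq> G"
proof
  fix f assume f: "f \<in> rel"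
  have z: "lifts f \<one> \<zero>\<^sub>M" using f
  proof (cases rule: rel_cases)
    case (add x y)
    have "lifts (free_gen F x \<oplus>\<^sub>P free_gen F y) (\<one> \<otimes> \<one>) (\<one> \<odot>\<^sub>M x \<oplus>\<^sub>M \<one> \<odot>\<^sub>M y)"
      using add by (intro lifts_add lifts_gen gen_FM)
    hence "lifts (free_gen F x \<oplus>\<^sub>P free_gen F y) \<one> (x \<oplus>\<^sub>M y)" using add by simp
    hence "lifts f \<one> ((x \<oplus>\<^sub>M y) \<ominus>\<^sub>M (x \<oplus>\<^sub>M y))"
      unfolding add(3) using add by (intro lifts_minus_gen lifts_gen gen_FM) (auto intro!: gen_FM)
    thus ?thesis using add by (simp add: a_minus_def M.M.r_neg)
  next
    case (smult a x)
    have "h \<one> \<otimes>\<^sub>F h a = h a" using smult by (simp add: h_simps)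
    hence "lifts (h a \<odot>\<^sub>P free_gen F x) (\<one> \<otimes> \<one>) (a \<odot>\<^sub>M x)"
      using smult by (intro lifts_smult lifts_gen gen_FM one_S) (auto simp: h_simps)
    hence "lifts f \<one> ((a \<odot>\<^sub>M x) \<ominus>\<^sub>M (a \<odot>\<^sub>M x))"
      unfolding smult(3) using smult by (intro lifts_minus_gen lifts_gen gen_FM) (auto intro!: gen_FM h_simps(1))
    thus ?thesis using smult by (simp add: a_minus_def M.M.r_neg)
  qed
  show "f \<in> G" unfolding G_def using z f rel_FM M.submoduleD(2)[OF T_submodule] by blast
qed

text \<open>In a lift of the generator at \<open>x\<close> with denominator \<open>s\<close>, the
  coefficient of \<open>x\<close> is \<open>s\<close> modulo \<open>q\<close> and all others lie in
  \<open>q\<close>. So the value of the lift is \<open>s x\<close> modulo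
  \<open>q M\<close>.\<close>

lemma gen_lift_unique:
  assumes x: "x \<in> carrier M" and l: "lifts (free_gen F x) s m" and m: "m \<in> T"
  shows "x \<in> T"
proof -
  obtain S a where S: "s \<in> carrier R - q" "finite S" "S \<subseteq> carrier M" "\<forall>y. a y \<in> carrier R"
     "\<forall>y. y \<notin> S \<longrightarrow> a y = \<zero> \<and> free_gen F x y = \<zero>\<^sub>F" "\<forall>y. h (a y) = h s \<otimes>\<^sub>F free_gen F x y" "M.lincomb a S = m"
    using l unfolding lifts_def by blast
  have sc: "s \<in> carrier R" using S by blast
  have xS: "x \<in> S" using S(5) F.one_not_zero by (auto simp: free_gen_def)
  have "h (a x) = h s" using S(6) sc by (auto simp: free_gen_def h_simps)
  hence "h (a x \<oplus> \<ominus> s) = \<zero>\<^sub>F" using S(4) sc by (simp add: h_simps F.r_neg)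
  hence as: "a x \<ominus> s \<in> q" using h_zero[of "a x \<oplus> \<ominus> s"] S(4) sc by (simp add: a_minus_def)
  have aq: "a y \<in> q" if "y \<noteq> x" for y using h_zero[of "a y"] S(4,6) that sc by (auto simp: free_gen_def h_simps)
  let ?r = "M.lincomb a (S - {x})"
  have r: "?r \<in> qM" using S aq by (intro M.lincomb_in_submodule[OF _ qM_submodule]) (auto intro!: qM_gen)
  have rc: "?r \<in> carrier M" using r M.submoduleD(1)[OF qM_submodule] by blast
  have "m = a x \<odot>\<^sub>M x \<oplus>\<^sub>M ?r" unfolding S(7)[symmetric] using S xS by (intro M.lincomb_del2) auto
  hence "s \<odot>\<^sub>M x = m \<ominus>\<^sub>M (?r \<oplus>\<^sub>M (a x \<ominus> s) \<odot>\<^sub>M x)" using x sc S(4) rc by (simp add: M.msimps)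
  moreover have "?r \<oplus>\<^sub>M (a x \<ominus> s) \<odot>\<^sub>M x \<in> T"
    using M.submoduleD(3)[OF qM_submodule r qM_gen[OF as x]] qM_T by blast
  ultimately have "s \<odot>\<^sub>M x \<in> T" using M.submodule_minus[OF T_submodule m] by simp
  thus ?thesis using T_saturated[OF S(1) x] by blast
qed

lemma rel_span: "submodule F (P.span rel) P" using P.span_is_submodule[OF rel_FM] .

lemma V_eq: "V = quot_module P (P.span rel)" unfolding V_def tensor_scalars_def P_def rel_def ..

sublocale V: vectorspace F V
proof (rule vectorspace.intro)
  show "module F V" unfolding V_eq by (rule P.quot_module_is_module[OF rel_span])
  show "field F" by (rule F_field)
qed

lemma tau_closed: "x \<in> carrier M \<Longrightarrow> tau x \<in> carrier V"
  unfolding V_eq P.quot_module_simps(1)[OF rel_span] tau_def using gen_FM by blast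

lemma tau_add:
  assumes "x \<in> carrier M" "y \<in> carrier M"
  shows "tau (x \<oplus>\<^sub>M y) = tau x \<oplus>\<^sub>V tau y"
proof -
  have "free_gen F (x \<oplus>\<^sub>M y) \<ominus>\<^sub>P (free_gen F x \<oplus>\<^sub>P free_gen F y) \<in> rel"
    unfolding rel_def tensor_relations_def Let_def P_def using assms by blast
  hence "free_gen F (x \<oplus>\<^sub>M y) \<ominus>\<^sub>P (free_gen F x \<oplus>\<^sub>P free_gen F y) \<in> P.span rel"
    using P.in_own_span[OF rel_FM] by blast
  thus ?thesis unfolding tau_def V_eq using assms gen_FM
    by (simp add: P.quot_module_simps(3)[OF rel_span] P.coset_eq_iff[OF rel_span])
qed

lemma tau_smult:
  assumes "a \<in> carrier R" "x \<in> carrier M"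
  shows "tau (a \<odot>\<^sub>M x) = h a \<odot>\<^sub>V tau x"
proof -
  have "free_gen F (a \<odot>\<^sub>M x) \<ominus>\<^sub>P (h a \<odot>\<^sub>P free_gen F x) \<in> rel"
    unfolding rel_def tensor_relations_def Let_def P_def using assms by blast
  hence "free_gen F (a \<odot>\<^sub>M x) \<ominus>\<^sub>P (h a \<odot>\<^sub>P free_gen F x) \<in> P.span rel" using P.in_own_span[OF rel_FM] by blast
  thus ?thesis unfolding tau_def V_eq using assms gen_FM h_simps(1)[OF assms(1)]
    by (simp add: P.quot_module_simps(4)[OF rel_span] P.coset_eq_iff[OF rel_span])
qed

lemma tau_zero_iff:
  assumes x: "x \<in> carrier M"
  shows "tau x = \<zero>\<^sub>V \<longleftrightarrow> x \<in> T"
proof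
  have z: "tau \<zero>\<^sub>M = \<zero>\<^sub>V"
    using tau_smult[OF zero_closed M.M.zero_closed] tau_closed[OF M.M.zero_closed] by (simp add: h_simps)
  assume t: "tau x = \<zero>\<^sub>V"
  have "free_gen F x \<ominus>\<^sub>P \<zero>\<^sub>P \<in> P.span rel" using t P.coset_eq_iff[OF rel_span gen_FM[OF x] P.M.zero_closed]
    unfolding tau_def V_eq P.quot_module_simps(2)[OF rel_span] by blast
  moreover have "\<ominus>\<^sub>P \<zero>\<^sub>P = \<zero>\<^sub>P"
    using P.M.r_neg[OF P.M.zero_closed] P.M.l_zero[OF P.M.a_inv_closed[OF P.M.zero_closed]] by (rule trans[OF sym, rotated])
  ultimately have "free_gen F x \<in> P.span rel" using P.M.r_zero[OF gen_FM[OF x]] unfolding a_minus_def by simp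
  hence "free_gen F x \<in> G" using P.span_least[OF G_submodule rel_G] by blast
  thus "x \<in> T" using gen_lift_unique[OF x] unfolding G_def by blast
next
  have z: "tau \<zero>\<^sub>M = \<zero>\<^sub>V"
    using tau_smult[OF zero_closed M.M.zero_closed] tau_closed[OF M.M.zero_closed] by (simp add: h_simps)
  let ?Z = "{x \<in> carrier M. tau x = \<zero>\<^sub>V}"
  have Z: "submodule R ?Z M" unfolding M.submodule_iff
  proof (intro conjI ballI)
    fix a x assume a: "a \<in> carrier R" "x \<in> ?Z"
    thus "a \<odot>\<^sub>M x \<in> ?Z" using tau_smult[of a x] h_simps(1)[of a] by simp
  next
    fix x y assume "x \<in> ?Z" "y \<in> ?Z"
    thus "x \<oplus>\<^sub>M y \<in> ?Z" using tau_add[of x y] by simp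
  qed (use z in auto)
  have "qM \<subseteq> ?Z" unfolding qM_def ideal_smult_def
  proof (rule M.span_least[OF Z], rule subsetI)
    fix z assume "z \<in> {a \<odot>\<^sub>M x | a x. a \<in> q \<and> x \<in> carrier M}"
    then obtain a x where a: "a \<in> q" "x \<in> carrier M" "z = a \<odot>\<^sub>M x" by blast
    have ac: "a \<in> carrier R" using a Icarr by blast
    hence "h a = \<zero>\<^sub>F" using h_zero a by blast
    thus "z \<in> ?Z" unfolding a(3) using tau_smult[OF ac a(2)] tau_closed[OF a(2)] ac a(2) by simp
  qed
  assume "x \<in> T"
  then obtain s where s: "s \<in> carrier R - q" "s \<odot>\<^sub>M x \<in> qM" unfolding T_def by blast
  have sc: "s \<in> carrier R" using s by blast
  have "h s \<odot>\<^sub>V tau x = \<zero>\<^sub>V" using \<open>qM \<subseteq> ?Z\<close> s(2) tau_smult[OF sc x] by auto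
  hence "tau x = inv\<^bsub>F\<^esub> (h s) \<odot>\<^sub>V \<zero>\<^sub>V"
    using V.mult_inverse[of "h s" "tau x"] h_unit[OF s(1)] tau_closed[OF x] by simp
  thus "tau x = \<zero>\<^sub>V" using h_unit[OF s(1)] by simp
qed

end

section \<open>The rank at a prime\<close>

context residue_hom
begin

text \<open>Vectors that become pure tensors after multiplication by a nonzero scalar coming from
  \<open>R\<close>. They form a subspace containing the generators, hence everything.\<close>

definition PV where
  "PV = {v \<in> carrier V. \<exists>s\<in>carrier R - q. \<exists>m\<in>carrier M. h s \<odot>\<^sub>V v = tau m}"

lemma PV_submodule: "submodule F PV V" unfolding V.submodule_iff
proof (intro conjI ballI)
  show "PV \<subseteq> carrier V" unfolding PV_def by blast
  have "h \<one> \<odot>\<^sub>V \<zero>\<^sub>V = tau \<zero>\<^sub>M"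
    using tau_zero_iff[OF M.M.zero_closed] M.submoduleD(2)[OF T_submodule] h_simps by simp
  thus "\<zero>\<^sub>V \<in> PV" unfolding PV_def using one_S by blast
next
  fix v w assume "v \<in> PV" "w \<in> PV"
  then obtain s m t n where k: "v \<in> carrier V" "w \<in> carrier V" "s \<in> carrier R - q" "m \<in> carrier M"
    "h s \<odot>\<^sub>V v = tau m" "t \<in> carrier R - q" "n \<in> carrier M" "h t \<odot>\<^sub>V w = tau n" unfolding PV_def by blast
  have c: "s \<in> carrier R" "t \<in> carrier R" "h s \<in> carrier F" "h t \<in> carrier F" using k h_simps(1) by blast+
  have "h (s \<otimes> t) \<odot>\<^sub>V (v \<oplus>\<^sub>V w) = h t \<odot>\<^sub>V (h s \<odot>\<^sub>V v) \<oplus>\<^sub>V h s \<odot>\<^sub>V (h t \<odot>\<^sub>V w)"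
    using c k(1,2) by (simp add: h_simps V.msimps)
  also have "\<dots> = tau (t \<odot>\<^sub>M m \<oplus>\<^sub>M s \<odot>\<^sub>M n)" unfolding k(5,8) using c k(4,7) by (simp add: tau_add tau_smult)
  finally have "h (s \<otimes> t) \<odot>\<^sub>V (v \<oplus>\<^sub>V w) = tau (t \<odot>\<^sub>M m \<oplus>\<^sub>M s \<odot>\<^sub>M n)" .
  moreover have "t \<odot>\<^sub>M m \<oplus>\<^sub>M s \<odot>\<^sub>M n \<in> carrier M" using c k(4,7) by simp
  moreover have "v \<oplus>\<^sub>V w \<in> carrier V" using k(1,2) by simp
  ultimately show "v \<oplus>\<^sub>V w \<in> PV" unfolding PV_def using S_mult[OF k(3,6)] by blast
next
  fix k v assume k: "k \<in> carrier F" "v \<in> PV"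
  then obtain s m where v: "v \<in> carrier V" "s \<in> carrier R - q" "m \<in> carrier M" "h s \<odot>\<^sub>V v = tau m"
    unfolding PV_def by blast
  obtain t a where t: "t \<in> carrier R - q" "a \<in> carrier R" "h t \<otimes>\<^sub>F k = h a" using h_frac[OF k(1)] by blast
  have c: "s \<in> carrier R" "t \<in> carrier R" "h s \<in> carrier F" "h t \<in> carrier F" using v t h_simps(1) by blast+
  have "h (s \<otimes> t) \<odot>\<^sub>V (k \<odot>\<^sub>V v) = (h t \<otimes>\<^sub>F k) \<odot>\<^sub>V (h s \<odot>\<^sub>V v)" using c k(1) v(1) by (simp add: h_simps V.msimps)
  also have "\<dots> = tau (a \<odot>\<^sub>M m)" unfolding t(3) v(4) using t(2) v(3) by (simp add: tau_smult)
  finally have "h (s \<otimes> t) \<odot>\<^sub>V (k \<odot>\<^sub>V v) = tau (a \<odot>\<^sub>M m)" .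
  moreover have "a \<odot>\<^sub>M m \<in> carrier M" "k \<odot>\<^sub>V v \<in> carrier V" using t(2) v k(1) by auto
  ultimately show "k \<odot>\<^sub>V v \<in> PV" unfolding PV_def using S_mult[OF v(2) t(1)] by blast
qed

lemma V_elem:
  assumes "v \<in> carrier V"
  shows "\<exists>s\<in>carrier R - q. \<exists>m\<in>carrier M. h s \<odot>\<^sub>V v = tau m"
proof -
  let ?c = "\<lambda>f. P.span rel +>\<^sub>P f"
  have gen: "tau x \<in> PV" if x: "x \<in> carrier M" for x
  proof -
    have "h \<one> \<odot>\<^sub>V tau x = tau x" using tau_closed[OF x] by (simp add: h_simps)
    thus ?thesis unfolding PV_def using tau_closed[OF x] one_S x by blast
  qed
  have supp: "?c f \<in> PV" if "finite S" "S \<subseteq> carrier M" "f \<in> carrier P" "\<And>x. x \<notin> S \<Longrightarrow> f x = \<zero>\<^sub>F" for S f using that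
  proof (induction S arbitrary: f)
    case empty
    hence "f = \<zero>\<^sub>P" unfolding FM_simps by auto
    hence "?c f = \<zero>\<^sub>V" unfolding V_eq P.quot_module_simps(2)[OF rel_span] by simp
    thus ?case using V.submoduleD(2)[OF PV_submodule] by simp
  next
    case (insert x S)
    let ?g = "f(x := \<zero>\<^sub>F)"
    have x: "x \<in> carrier M" using insert.prems by blast
    have fx: "f x \<in> carrier F" using insert.prems(2) unfolding FM_carrier by blast
    have fin: "finite {y. ?g y \<noteq> \<zero>\<^sub>F}"
      by (rule finite_subset[of _ "{y. f y \<noteq> \<zero>\<^sub>F}"]) (use insert.prems(2) in \<open>auto simp: FM_carrier\<close>)
    have g: "?g \<in> carrier P" using insert.prems(2) fin unfolding FM_carrier by auto
    have 1: "?c ?g \<in> PV" by (rule insert.IH[OF _ g]) (use insert.prems in auto)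
    have "f = ?g \<oplus>\<^sub>P f x \<odot>\<^sub>P free_gen F x"
      using insert.prems(2) by (auto simp: FM_simps free_gen_def FM_carrier fun_eq_iff)
    hence "?c f = ?c (?g \<oplus>\<^sub>P f x \<odot>\<^sub>P free_gen F x)" by (rule arg_cong)
    also have "\<dots> = ?c ?g \<oplus>\<^sub>V f x \<odot>\<^sub>V tau x" unfolding V_eq tau_def using g gen_FM[OF x] fx
      by (simp add: P.quot_module_simps(3,4)[OF rel_span])
    also have "\<dots> \<in> PV" using V.submoduleD(3)[OF PV_submodule 1 V.submoduleD(4)[OF PV_submodule fx gen[OF x]]] .
    finally show ?case .
  qed
  obtain f where f: "f \<in> carrier P" "v = ?c f"
    using assms unfolding V_eq P.quot_module_simps(1)[OF rel_span] by blast
  have "v \<in> PV" unfolding f(2) by (rule supp[of "{x. f x \<noteq> \<zero>\<^sub>F}"]) (use f(1) in \<open>auto simp: FM_carrier\<close>)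
  thus ?thesis unfolding PV_def by blast
qed

lemma gen_set_image:
  assumes Y: "Y \<subseteq> carrier M" and gen: "\<And>m. m \<in> carrier M \<Longrightarrow> \<exists>s\<in>carrier R - q. \<exists>y\<in>M.span Y. \<exists>z\<in>qM. s \<odot>\<^sub>M m = y \<oplus>\<^sub>M z"
  shows "V.span (tau ` Y) = carrier V"
proof
  have tY: "tau ` Y \<subseteq> carrier V" using tau_closed Y by blast
  have sub: "submodule F (V.span (tau ` Y)) V" using V.span_is_submodule[OF tY] .
  show "V.span (tau ` Y) \<subseteq> carrier V" using V.submoduleD(1)[OF sub] by blast
  let ?W = "{m \<in> carrier M. tau m \<in> V.span (tau ` Y)}"
  have W: "submodule R ?W M" unfolding M.submodule_iff
  proof (intro conjI ballI)
    show "\<zero>\<^sub>M \<in> ?W"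
      using V.submoduleD(2)[OF sub] tau_zero_iff[OF M.M.zero_closed] M.submoduleD(2)[OF T_submodule] by simp
  next
    fix x y assume "x \<in> ?W" "y \<in> ?W"
    thus "x \<oplus>\<^sub>M y \<in> ?W" using tau_add[of x y] V.submoduleD(3)[OF sub] by simp
  next
    fix a x assume "a \<in> carrier R" "x \<in> ?W"
    thus "a \<odot>\<^sub>M x \<in> ?W" using tau_smult[of a x] V.submoduleD(4)[OF sub] h_simps(1) by simp
  qed auto
  have "Y \<subseteq> ?W" using Y V.in_own_span[OF tY] by blast
  hence sY: "M.span Y \<subseteq> ?W" using M.span_least[OF W] by blast
  have qW: "qM \<subseteq> ?W"
  proof
    fix z assume z: "z \<in> qM"
    have zc: "z \<in> carrier M" using M.submoduleD(1)[OF qM_submodule z] .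
    thus "z \<in> ?W" using tau_zero_iff[OF zc] qM_T[OF z] V.submoduleD(2)[OF sub] by simp
  qed
  show "carrier V \<subseteq> V.span (tau ` Y)"
  proof
    fix v assume v: "v \<in> carrier V"
    then obtain s m where m: "s \<in> carrier R - q" "m \<in> carrier M" "h s \<odot>\<^sub>V v = tau m" using V_elem by blast
    obtain t y z where t: "t \<in> carrier R - q" "y \<in> M.span Y" "z \<in> qM" "t \<odot>\<^sub>M m = y \<oplus>\<^sub>M z"
      using gen[OF m(2)] by blast
    have "t \<odot>\<^sub>M m \<in> ?W" unfolding t(4) using M.submoduleD(3)[OF W] sY qW t by blast
    hence "h t \<odot>\<^sub>V tau m \<in> V.span (tau ` Y)" using tau_smult[of t m] t(1) m(2) by simp
    hence 1: "h t \<odot>\<^sub>V (h s \<odot>\<^sub>V v) \<in> V.span (tau ` Y)" unfolding m(3) .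
    let ?k = "inv\<^bsub>F\<^esub> (h s) \<otimes>\<^sub>F inv\<^bsub>F\<^esub> (h t)"
    have k: "h s \<in> Units F" "h t \<in> Units F" using h_unit[OF m(1)] h_unit[OF t(1)] F.field_Units by auto
    have cc: "h s \<in> carrier F" "h t \<in> carrier F" "inv\<^bsub>F\<^esub> (h s) \<in> carrier F" "inv\<^bsub>F\<^esub> (h t) \<in> carrier F"
      using k F.Units_closed F.Units_inv_closed by blast+
    have "u' \<otimes>\<^sub>F v' \<otimes>\<^sub>F (v \<otimes>\<^sub>F u) = (u' \<otimes>\<^sub>F u) \<otimes>\<^sub>F (v' \<otimes>\<^sub>F v)"
      if "u \<in> carrier F" "v \<in> carrier F" "u' \<in> carrier F" "v' \<in> carrier F" for u v u' v' using that by algebra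
    from this[OF cc] have kc: "?k \<in> carrier F" "?k \<otimes>\<^sub>F (h t \<otimes>\<^sub>F h s) = \<one>\<^sub>F"
      using cc F.Units_l_inv[OF k(1)] F.Units_l_inv[OF k(2)] by auto
    have "?k \<odot>\<^sub>V (h t \<odot>\<^sub>V (h s \<odot>\<^sub>V v)) = (?k \<otimes>\<^sub>F (h t \<otimes>\<^sub>F h s)) \<odot>\<^sub>V v"
      using kc(1) k F.Units_closed v by (simp add: V.smult_assoc1)
    hence "?k \<odot>\<^sub>V (h t \<odot>\<^sub>V (h s \<odot>\<^sub>V v)) = v" unfolding kc(2) using v by simp
    thus "v \<in> V.span (tau ` Y)" using V.submoduleD(4)[OF sub kc(1) 1] by simp
  qed
qed

lemma dim_le:
  assumes Y: "finite Y" "Y \<subseteq> carrier M"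
    and gen: "\<And>m. m \<in> carrier M \<Longrightarrow> \<exists>s\<in>carrier R - q. \<exists>y\<in>M.span Y. \<exists>z\<in>qM. s \<odot>\<^sub>M m = y \<oplus>\<^sub>M z"
  shows "V.dim \<le> card Y" "V.fin_dim"
proof -
  have g: "V.span (tau ` Y) = carrier V" using gen_set_image[OF Y(2) gen] .
  have tY: "tau ` Y \<subseteq> carrier V" using tau_closed Y by blast
  show "V.fin_dim" unfolding V.fin_dim_def using g tY Y(1) by blast
  have "V.dim \<le> card (tau ` Y)" using V.gen_ge_dim[OF _ tY g] Y(1) by blast
  thus "V.dim \<le> card Y" using card_image_le[OF Y(1), of tau] by linarith
qed

lemma fin_gen_fin_dim:
  assumes "fin_gen_module R M"
  shows "V.fin_dim"
proof -
  obtain G where G: "finite G" "G \<subseteq> carrier M" "M.span G = carrier M"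
    using assms unfolding fin_gen_module_def by blast
  show ?thesis
  proof (rule dim_le(2)[OF G(1,2)])
    fix m assume m: "m \<in> carrier M"
    hence "\<one> \<odot>\<^sub>M m = m \<oplus>\<^sub>M \<zero>\<^sub>M" by simp
    thus "\<exists>s\<in>carrier R - q. \<exists>y\<in>M.span G. \<exists>z\<in>qM. s \<odot>\<^sub>M m = y \<oplus>\<^sub>M z"
      using one_S m G(3) M.submoduleD(2)[OF qM_submodule] by blast
  qed
qed

lemma common_denominator:
  assumes "finite Y" "\<And>y. y \<in> Y \<Longrightarrow> b y \<in> carrier F"
  shows "\<exists>s\<in>carrier R - q. \<exists>a. (\<forall>y. a y \<in> carrier R) \<and> (\<forall>y\<in>Y. h s \<otimes>\<^sub>F b y = h (a y))"
  using assms
proof (induction Y)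
  case empty
  thus ?case using one_S by (intro bexI[of _ \<one>] exI[of _ "\<lambda>_. \<zero>"]) auto
next
  case (insert x Y)
  then obtain s a where s: "s \<in> carrier R - q" "\<forall>y. a y \<in> carrier R" "\<forall>y\<in>Y. h s \<otimes>\<^sub>F b y = h (a y)" by auto
  obtain t c where t: "t \<in> carrier R - q" "c \<in> carrier R" "h t \<otimes>\<^sub>F b x = h c"
    using h_frac[of "b x"] insert.prems by blast
  have sc: "s \<in> carrier R" "t \<in> carrier R" using s t by blast+
  let ?a = "\<lambda>y. if y = x then s \<otimes> c else t \<otimes> a y"
  have "h (s \<otimes> t) \<otimes>\<^sub>F b y = h (?a y)" if y: "y \<in> insert x Y" for y
  proof -
    have cc: "b y \<in> carrier F" "h s \<in> carrier F" "h t \<in> carrier F" using insert.prems[OF y] h_simps(1) sc by auto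
    show ?thesis
    proof (cases "y = x")
      case True
      have "h (s \<otimes> t) \<otimes>\<^sub>F b y = h s \<otimes>\<^sub>F (h t \<otimes>\<^sub>F b y)" using cc sc by (simp add: h_simps F.m_assoc)
      thus ?thesis using True t sc by (simp add: h_simps)
    next
      case False
      have "h (s \<otimes> t) \<otimes>\<^sub>F b y = h t \<otimes>\<^sub>F (h s \<otimes>\<^sub>F b y)" using cc sc by (simp add: h_simps F.m_ac)
      thus ?thesis using False s sc y by (simp add: h_simps)
    qed
  qed
  thus ?case using S_mult[OF s(1) t(1)] s t sc by (intro bexI[of _ "s \<otimes> t"] exI[of _ ?a]) auto
qed

lemma tau_lincomb:
  assumes "finite Y" "Y \<subseteq> carrier M" "inj_on tau Y" "\<And>y. y \<in> Y \<Longrightarrow> a y \<in> carrier R"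
    and "\<And>y. y \<in> Y \<Longrightarrow> c (tau y) = h (a y)"
  shows "tau (M.lincomb a Y) = V.lincomb c (tau ` Y)"
  using assms
proof (induction Y)
  case empty
  thus ?case using tau_zero_iff[OF M.M.zero_closed] M.submoduleD(2)[OF T_submodule]
    by (simp add: M.lincomb_def V.lincomb_def)
next
  case (insert x Y)
  have x: "x \<in> carrier M" "Y \<subseteq> carrier M" "a x \<in> carrier R" using insert.prems by auto
  have nx: "tau x \<notin> tau ` Y" using insert.prems(2) insert.hyps(2) by auto
  have IH: "tau (M.lincomb a Y) = V.lincomb c (tau ` Y)" by (rule insert.IH) (use insert.prems in auto)
  have lc: "M.lincomb a Y \<in> carrier M" using insert.prems by (intro M.lincomb_closed) auto
  have "M.lincomb a (Y \<union> {x}) = a x \<odot>\<^sub>M x \<oplus>\<^sub>M M.lincomb a Y" using insert by (intro M.lincomb_insert) auto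
  hence "tau (M.lincomb a (insert x Y)) = h (a x) \<odot>\<^sub>V tau x \<oplus>\<^sub>V V.lincomb c (tau ` Y)"
    using x lc IH by (simp add: tau_add tau_smult)
  also have "\<dots> = V.lincomb c (tau ` Y \<union> {tau x})" using insert.hyps insert.prems nx x tau_closed h_simps(1)
    by (subst V.lincomb_insert) auto
  finally show ?case by simp
qed

text \<open>Independence of \<open>Y\<close> modulo \<open>q M\<close>, tested with denominators,
  makes the pure tensors distinct and independent. If the dimension is no larger than
  \<open>card Y\<close> they form a basis, and the second part pulls this back to \<open>M\<close>
  with a common denominator.\<close>

lemma dim_ge:
  assumes fd: "V.fin_dim" and Y: "finite Y" "Y \<subseteq> carrier M"
    and ind: "\<And>a y. (\<And>y. y \<in> Y \<Longrightarrow> a y \<in> carrier R) \<Longrightarrow> M.lincomb a Y \<in> T \<Longrightarrow> y \<in> Y \<Longrightarrow> a y \<in> q"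
  shows "card Y \<le> V.dim"
    and "V.dim \<le> card Y \<Longrightarrow> m \<in> carrier M \<Longrightarrow> \<exists>s\<in>carrier R - q. \<exists>y\<in>M.span Y. s \<odot>\<^sub>M m \<ominus>\<^sub>M y \<in> T"
proof -
  have tY: "tau ` Y \<subseteq> carrier V" using tau_closed Y by blast
  have inj: "inj_on tau Y"
  proof (rule inj_onI, rule ccontr)
    fix x y assume h: "x \<in> Y" "y \<in> Y" "tau x = tau y" "x \<noteq> y"
    have c: "x \<in> carrier M" "y \<in> carrier M" using h Y by auto
    \<comment> \<open>Coefficients of \<open>x - y\<close>: if two tensors agreed, this combination
      would lie in \<open>T\<close> with a coefficient one, which is not in
      \<open>q\<close>.\<close>
    let ?a = "\<lambda>z. if z = x then \<one> else if z = y then \<ominus> \<one> else \<zero>"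
    have "M.lincomb ?a Y = M.lincomb ?a {x, y}" using Y h by (intro M.lincomb_extend) auto
    also have "\<dots> = x \<ominus>\<^sub>M y" using c h(4) by (simp add: M.lincomb_def M.smult_minus_1 a_minus_def)
    finally have e: "M.lincomb ?a Y = x \<ominus>\<^sub>M y" .
    have "tau (x \<oplus>\<^sub>M (\<ominus> \<one>) \<odot>\<^sub>M y) = \<zero>\<^sub>V"
      using c h(3) tau_closed[OF c(2)] by (simp add: tau_add tau_smult h_simps V.smult_minus_1 V.M.r_neg)
    hence "tau (x \<ominus>\<^sub>M y) = \<zero>\<^sub>V" using c by (simp add: a_minus_def M.smult_minus_1)
    hence aT: "M.lincomb ?a Y \<in> T" unfolding e using tau_zero_iff[of "x \<ominus>\<^sub>M y"] c by simp
    have "?a x \<in> q" by (rule ind[OF _ aT h(1)]) simp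
    thus False using one_S by simp
  qed
  have li: "\<not> V.lin_dep (tau ` Y)"
  proof (rule V.finite_lin_indpt2)
    show "finite (tau ` Y)" using Y(1) by blast
    show "tau ` Y \<subseteq> carrier V" by (rule tY)
    fix b assume b: "b \<in> tau ` Y \<rightarrow> carrier F" "V.lincomb b (tau ` Y) = \<zero>\<^sub>V"
    obtain s a where s: "s \<in> carrier R - q" "\<forall>y. a y \<in> carrier R" "\<forall>y\<in>Y. h s \<otimes>\<^sub>F b (tau y) = h (a y)"
      using common_denominator[of Y "\<lambda>y. b (tau y)"] Y(1) b(1) by blast
    have hs: "h s \<in> carrier F" "h s \<noteq> \<zero>\<^sub>F" using h_unit[OF s(1)] by auto
    have "tau (M.lincomb a Y) = V.lincomb (\<lambda>v. h s \<otimes>\<^sub>F b v) (tau ` Y)" using s Y inj by (intro tau_lincomb) auto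
    also have "\<dots> = h s \<odot>\<^sub>V \<zero>\<^sub>V" using V.lincomb_smult[OF tY b(1) hs(1)] b(2) by simp
    finally have "tau (M.lincomb a Y) = \<zero>\<^sub>V" using hs by simp
    hence T: "M.lincomb a Y \<in> T" using tau_zero_iff s(2) Y(2) by (auto intro: M.lincomb_closed)
    show "\<forall>v\<in>tau ` Y. b v = \<zero>\<^sub>F"
    proof
      fix v assume "v \<in> tau ` Y"
      then obtain y where y: "y \<in> Y" "v = tau y" by blast
      have "a y \<in> q" using ind[of a y] s(2) T y(1) by blast
      hence "h s \<otimes>\<^sub>F b v = \<zero>\<^sub>F" using h_zero[of "a y"] s(2,3) y by simp
      moreover have "b v \<in> carrier F" using b(1) y by blast
      ultimately show "b v = \<zero>\<^sub>F" using F.integral[of "h s" "b v"] hs by blast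
    qed
  qed
  have cY: "card (tau ` Y) = card Y" using card_image[OF inj] .
  show "card Y \<le> V.dim" using V.li_le_dim(2)[OF fd tY li] cY by simp
  show "\<exists>s\<in>carrier R - q. \<exists>y\<in>M.span Y. s \<odot>\<^sub>M m \<ominus>\<^sub>M y \<in> T" if d: "V.dim \<le> card Y" and m: "m \<in> carrier M"
  proof -
    have "V.basis (tau ` Y)" using V.dim_li_is_basis[OF fd _ tY li] Y(1) d cY by simp
    hence "tau m \<in> V.span (tau ` Y)" using tau_closed[OF m] unfolding V.basis_def by blast
    then obtain b where b: "b \<in> tau ` Y \<rightarrow> carrier F" "V.lincomb b (tau ` Y) = tau m"
      using V.finite_in_span[OF _ tY] Y(1) by blast
    obtain s a where s: "s \<in> carrier R - q" "\<forall>y. a y \<in> carrier R" "\<forall>y\<in>Y. h s \<otimes>\<^sub>F b (tau y) = h (a y)"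
      using common_denominator[of Y "\<lambda>y. b (tau y)"] Y(1) b(1) by blast
    have sc: "s \<in> carrier R" using s by blast
    have hs: "h s \<in> carrier F" using h_simps(1)[OF sc] .
    have lc: "M.lincomb a Y \<in> carrier M" using s(2) Y(2) by (auto intro: M.lincomb_closed)
    have "tau (M.lincomb a Y) = V.lincomb (\<lambda>v. h s \<otimes>\<^sub>F b v) (tau ` Y)" using s Y inj by (intro tau_lincomb) auto
    also have "\<dots> = h s \<odot>\<^sub>V tau m" using V.lincomb_smult[OF tY b(1) hs] b(2) by simp
    finally have e: "tau (M.lincomb a Y) = tau (s \<odot>\<^sub>M m)" using sc m by (simp add: tau_smult)
    have "tau (s \<odot>\<^sub>M m \<oplus>\<^sub>M (\<ominus> \<one>) \<odot>\<^sub>M M.lincomb a Y) = \<zero>\<^sub>V" using sc m lc e tau_closed[of "s \<odot>\<^sub>M m"]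
      by (simp add: tau_add tau_smult[of "\<ominus> \<one>"] h_simps V.smult_minus_1 V.M.r_neg)
    hence "tau (s \<odot>\<^sub>M m \<ominus>\<^sub>M M.lincomb a Y) = \<zero>\<^sub>V" using sc m lc by (simp add: a_minus_def M.smult_minus_1)
    hence "s \<odot>\<^sub>M m \<ominus>\<^sub>M M.lincomb a Y \<in> T" using tau_zero_iff[of "s \<odot>\<^sub>M m \<ominus>\<^sub>M M.lincomb a Y"] sc m lc by simp
    moreover have "M.lincomb a Y \<in> M.span Y" using s(2) Y M.finite_span[OF Y] by blast
    ultimately show ?thesis using s(1) by blast
  qed
qed

end

lemma residue_hom_kappa:
  assumes "primeideal q R" "module R M"
  shows "residue_hom q R M (kappa R q) (to_kappa R q)"
proof -
  interpret ring_at_prime q R using assms(1) by (rule ring_at_prime.intro)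
  show ?thesis using assms kappa_field to_kappa_hom to_kappa_zero kappa_frac
    by (intro residue_hom.intro residue_hom_axioms.intro) auto
qed

lemma rank_at_eq:
  assumes "primeideal q R" "module R M"
  shows "rank_at R M q = vectorspace.dim (kappa R q) (residue_hom.V R M (kappa R q) (to_kappa R q))"
  unfolding rank_at_def residue_hom.V_def[OF residue_hom_kappa[OF assms]] ..

section \<open>Length\<close>

context module
begin

text \<open>Chains between two submodules of \<open>M\<close> measure the length of their quotient
  without forming it; this keeps all estimates inside one ambient module.\<close>

definition chain_between :: "'c set \<Rightarrow> 'c set \<Rightarrow> nat \<Rightarrow> (nat \<Rightarrow> 'c set) \<Rightarrow> bool" where
  "chain_between W W' k N \<longleftrightarrow> (\<forall>i\<le>k. submodule R (N i) M \<and> W \<subseteq> N i \<and> N i \<subseteq> W') \<and> (\<forall>i<k. N i \<subset> N (Suc i))"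

definition length_le :: "'c set \<Rightarrow> 'c set \<Rightarrow> nat \<Rightarrow> bool" where
  "length_le W W' n \<longleftrightarrow> (\<forall>k N. chain_between W W' k N \<longrightarrow> k \<le> n)"

text \<open>Repetitions are deleted from a weakly increasing chain. That the new chain ends in
  \<open>P k\<close> is recorded so that a further strict step can be appended.\<close>

lemma weak_chain_strict_steps:
  assumes "\<And>i. i \<le> k \<Longrightarrow> submodule R (P i) M \<and> W \<subseteq> P i \<and> P i \<subseteq> W'" "\<And>i. i < k \<Longrightarrow> P i \<subseteq> P (Suc i)"
  shows "\<exists>N. chain_between W W' (card {i. i < k \<and> P i \<noteq> P (Suc i)}) N \<and>
    N (card {i. i < k \<and> P i \<noteq> P (Suc i)}) = P k" using assms
proof (induction k)
  case 0
  thus ?case by (intro exI[of _ P]) (auto simp: chain_between_def)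
next
  case (Suc k)
  let ?c = "card {i. i < k \<and> P i \<noteq> P (Suc i)}"
  obtain N where N: "chain_between W W' ?c N" "N ?c = P k" using Suc by auto
  show ?case
  proof (cases "P k = P (Suc k)")
    case True
    hence "{i. i < Suc k \<and> P i \<noteq> P (Suc i)} = {i. i < k \<and> P i \<noteq> P (Suc i)}" by (auto simp: less_Suc_eq)
    thus ?thesis using N True by auto
  next
    case False
    hence "{i. i < Suc k \<and> P i \<noteq> P (Suc i)} = insert k {i. i < k \<and> P i \<noteq> P (Suc i)}" by (auto simp: less_Suc_eq)
    hence c: "card {i. i < Suc k \<and> P i \<noteq> P (Suc i)} = Suc ?c" by simp
    let ?N = "N(Suc ?c := P (Suc k))"
    have "P k \<subset> P (Suc k)" using Suc.prems(2)[of k] False by blast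
    hence "chain_between W W' (Suc ?c) ?N"
      using N Suc.prems(1)[of "Suc k"] by (auto simp: chain_between_def less_Suc_eq le_Suc_eq)
    moreover have "?N (Suc ?c) = P (Suc k)" by simp
    ultimately show ?thesis unfolding c by blast
  qed
qed

lemma set_add_iff: "z \<in> H <+>\<^sub>M K \<longleftrightarrow> (\<exists>h\<in>H. \<exists>k\<in>K. z = h \<oplus>\<^sub>M k)" by (auto simp: set_add_def')

lemma submodule_set_add:
  assumes H: "submodule R H M" and K: "submodule R K M"
  shows "submodule R (H <+>\<^sub>M K) M" "H \<subseteq> H <+>\<^sub>M K" "K \<subseteq> H <+>\<^sub>M K"
proof -
  note Hd = submoduleD[OF H] and Kd = submoduleD[OF K]
  show "submodule R (H <+>\<^sub>M K) M" unfolding submodule_iff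
  proof (intro conjI ballI)
    show "H <+>\<^sub>M K \<subseteq> carrier M" using Hd(1) Kd(1) by (auto simp: set_add_iff)
    show "\<zero>\<^sub>M \<in> H <+>\<^sub>M K" using Hd(2) Kd(2) by (force simp: set_add_iff)
  next
    fix x y assume "x \<in> H <+>\<^sub>M K" "y \<in> H <+>\<^sub>M K"
    then obtain h k h' k' where z: "h \<in> H" "k \<in> K" "x = h \<oplus>\<^sub>M k" "h' \<in> H" "k' \<in> K" "y = h' \<oplus>\<^sub>M k'"
      unfolding set_add_iff by blast
    have "x \<oplus>\<^sub>M y = (h \<oplus>\<^sub>M h') \<oplus>\<^sub>M (k \<oplus>\<^sub>M k')" unfolding z(3,6) using z Hd(1) Kd(1) by (simp add: M.a_ac)
    thus "x \<oplus>\<^sub>M y \<in> H <+>\<^sub>M K" unfolding set_add_iff using Hd(3)[OF z(1,4)] Kd(3)[OF z(2,5)] by blast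
  next
    fix a x assume a: "a \<in> carrier R" "x \<in> H <+>\<^sub>M K"
    then obtain h k where z: "h \<in> H" "k \<in> K" "x = h \<oplus>\<^sub>M k" unfolding set_add_iff by blast
    have "a \<odot>\<^sub>M x = a \<odot>\<^sub>M h \<oplus>\<^sub>M a \<odot>\<^sub>M k" unfolding z(3) using z a Hd(1) Kd(1) by (simp add: smult_r_distr)
    thus "a \<odot>\<^sub>M x \<in> H <+>\<^sub>M K" unfolding set_add_iff using Hd(4)[OF a(1) z(1)] Kd(4)[OF a(1) z(2)] by blast
  qed
  show "H \<subseteq> H <+>\<^sub>M K"
  proof
    fix h assume h: "h \<in> H"
    hence "h = h \<oplus>\<^sub>M \<zero>\<^sub>M" using Hd(1) by simp
    thus "h \<in> H <+>\<^sub>M K" unfolding set_add_iff using h Kd(2) by blast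
  qed
  show "K \<subseteq> H <+>\<^sub>M K"
  proof
    fix k assume k: "k \<in> K"
    hence "k = \<zero>\<^sub>M \<oplus>\<^sub>M k" using Kd(1) by simp
    thus "k \<in> H <+>\<^sub>M K" unfolding set_add_iff using k Hd(2) by blast
  qed
qed

lemma set_add_least:
  assumes "submodule R L M" "H \<subseteq> L" "K \<subseteq> L"
  shows "H <+>\<^sub>M K \<subseteq> L"
  using submoduleD(3)[OF assms(1)] assms(2,3) unfolding subset_iff set_add_iff by blast

lemma submodule_inter: "submodule R H M \<Longrightarrow> submodule R K M \<Longrightarrow> submodule R (H \<inter> K) M"
  unfolding submodule_iff by blast

text \<open>At each strict step of a chain the intersection with \<open>W'\<close> or the sum with
  \<open>W'\<close> must grow, by the modular law; these two kinds of steps are bounded by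
  \<open>n\<close> and \<open>m\<close>.\<close>

lemma length_le_trans:
  assumes W': "submodule R W' M" "submodule R W'' M" and sub: "W \<subseteq> W'" "W' \<subseteq> W''"
    and n: "length_le W W' n" and m: "length_le W' W'' m"
  shows "length_le W W'' (n + m)"
  unfolding length_le_def
proof (intro allI impI)
  fix k N assume N: "chain_between W W'' k N"
  have Ns: "submodule R (N i) M" "W \<subseteq> N i" "N i \<subseteq> W''" if "i \<le> k" for i
    using N that unfolding chain_between_def by blast+
  have Nl: "N i \<subset> N (Suc i)" if "i < k" for i using N that unfolding chain_between_def by blast
  let ?P = "\<lambda>i. N i \<inter> W'" and ?S = "\<lambda>i. N i <+>\<^sub>M W'"
  let ?p = "{i. i < k \<and> ?P i \<noteq> ?P (Suc i)}" and ?s = "{i. i < k \<and> ?S i \<noteq> ?S (Suc i)}"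
  have "card ?p \<le> n"
  proof -
    have 1: "submodule R (?P i) M \<and> W \<subseteq> ?P i \<and> ?P i \<subseteq> W'" if "i \<le> k" for i
      using submodule_inter[OF Ns(1)[OF that] W'(1)] Ns(2)[OF that] sub(1) by blast
    have 2: "?P i \<subseteq> ?P (Suc i)" if "i < k" for i using Nl[OF that] by blast
    from weak_chain_strict_steps[of k ?P W W', OF 1 2]
    obtain P' where "chain_between W W' (card ?p) P'" by blast
    thus ?thesis using n unfolding length_le_def by blast
  qed
  moreover have "card ?s \<le> m"
  proof -
    have 1: "submodule R (?S i) M \<and> W' \<subseteq> ?S i \<and> ?S i \<subseteq> W''" if "i \<le> k" for i
      using submodule_set_add[OF Ns(1)[OF that] W'(1)] set_add_least[OF W'(2) Ns(3)[OF that] sub(2)] by blast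
    have 2: "?S i \<subseteq> ?S (Suc i)" if "i < k" for i
    proof
      fix z assume "z \<in> ?S i"
      thus "z \<in> ?S (Suc i)" using Nl[OF that] unfolding set_add_iff by blast
    qed
    from weak_chain_strict_steps[of k ?S W' W'', OF 1 2]
    obtain P' where "chain_between W' W'' (card ?s) P'" by blast
    thus ?thesis using m unfolding length_le_def by blast
  qed
  moreover have "{..<k} \<subseteq> ?p \<union> ?s"
  proof
    fix i assume "i \<in> {..<k}"
    hence i: "i < k" by simp
    show "i \<in> ?p \<union> ?s"
    proof (rule ccontr)
      assume "i \<notin> ?p \<union> ?s"
      hence eq: "?P i = ?P (Suc i)" "?S i = ?S (Suc i)" using i by auto
      obtain z where z: "z \<in> N (Suc i)" "z \<notin> N i" using Nl[OF i] by blast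
      have "z \<in> ?S i" unfolding eq(2) using submodule_set_add(2)[OF Ns(1)[of "Suc i"] W'(1)] z i by auto
      then obtain h w where h: "h \<in> N i" "w \<in> W'" "z = h \<oplus>\<^sub>M w" unfolding set_add_iff by blast
      have c: "h \<in> carrier M" "w \<in> carrier M" using submoduleD(1)[OF Ns(1)[of i] h(1)] submoduleD(1)[OF W'(1) h(2)] i by auto
      have "h \<in> N (Suc i)" using h Nl[OF i] by blast
      hence "z \<ominus>\<^sub>M h \<in> N (Suc i)" using submodule_minus[OF Ns(1) z(1)] i by simp
      moreover have "z \<ominus>\<^sub>M h = w" unfolding h(3) using c by (simp add: msimps)
      ultimately have "w \<in> ?P i" unfolding eq(1) using h by simp
      hence "z \<in> N i" unfolding h(3) using submoduleD(3)[OF Ns(1)] h i by simp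
      thus False using z by blast
    qed
  qed
  hence "k \<le> card (?p \<union> ?s)" using card_mono[of "?p \<union> ?s" "{..<k}"] by simp
  moreover have "card (?p \<union> ?s) \<le> card ?p + card ?s" by (rule card_Un_le)
  ultimately show "k \<le> n + m" by linarith
qed

end

text \<open>The quotient is generated by one element killed by \<open>\<mm>\<close>, so it is zero
  or the residue field.\<close>

lemma (in noeth_local) length_le_simple:
  assumes M: "module R M" and W: "submodule R W M" and y: "y \<in> carrier M" "\<And>a. a \<in> \<mm> \<Longrightarrow> a \<odot>\<^sub>M y \<in> W"
  shows "module.length_le R M W (module.adjoin R M W y) 1"
proof -
  interpret M: module R M by (rule M)
  show ?thesis unfolding M.length_le_def
  proof (intro allI impI)
    fix k N assume N: "M.chain_between W (M.adjoin W y) k N"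
    show "k \<le> 1"
    proof (rule ccontr)
      assume "\<not> k \<le> 1"
      hence k: "0 \<le> k" "1 \<le> k" "2 \<le> k" by auto
      have s: "submodule R (N i) M" "W \<subseteq> N i" "N i \<subseteq> M.adjoin W y" if "i \<le> k" for i
        using N that unfolding M.chain_between_def by blast+
      have st: "N 0 \<subset> N 1" "N 1 \<subset> N 2" using N k unfolding M.chain_between_def by (auto simp: numeral_2_eq_2)
      obtain z where z: "z \<in> N 1" "z \<notin> N 0" using st by blast
      obtain w a where w: "w \<in> W" "a \<in> carrier R" "z = w \<oplus>\<^sub>M a \<odot>\<^sub>M y"
        using s(3)[OF k(2)] z(1) unfolding M.adjoin_def by blast
      have wc: "w \<in> carrier M" using M.submoduleD(1)[OF W w(1)] .
      have "a \<notin> \<mm>"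
      proof
        assume "a \<in> \<mm>"
        hence "z \<in> W" unfolding w(3) using M.submoduleD(3)[OF W w(1) y(2)] by blast
        thus False using z s(2)[OF k(1)] by blast
      qed
      have "z \<ominus>\<^sub>M w \<in> N 1" using M.submodule_minus[OF s(1)[OF k(2)] z(1)] s(2)[OF k(2)] w(1) by blast
      moreover have "z \<ominus>\<^sub>M w = a \<odot>\<^sub>M y" unfolding w(3) using wc w(2) y by (simp add: M.msimps)
      ultimately have "a \<odot>\<^sub>M y \<in> N 1" by simp
      hence "y \<in> N 1" using unit_smult_cancel[OF M s(1)[OF k(2)], of a y] w(2) \<open>a \<notin> \<mm>\<close> y(1) by blast
      hence "M.adjoin W y \<subseteq> N 1" using M.adjoin_least[OF s(1)[OF k(2)] s(2)[OF k(2)]] by blast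
      thus False using st s(3)[OF k(3)] by blast
    qed
  qed
qed

context module
begin

lemma quot_submodule_lift:
  assumes N: "submodule R N M" and W: "submodule R W M" "N \<subseteq> W"
  shows "submodule R {N +>\<^sub>M w | w. w \<in> W} (quot_module M N)"
proof -
  interpret Q: module R "quot_module M N" by (rule quot_module_is_module[OF N])
  note q = quot_module_simps[OF N] and Wd = submoduleD[OF W(1)]
  show ?thesis unfolding Q.submodule_iff
  proof (intro conjI ballI)
    show "{N +>\<^sub>M w |w. w \<in> W} \<subseteq> carrier (quot_module M N)" unfolding q(1) using Wd(1) by blast
    show "\<zero>\<^bsub>quot_module M N\<^esub> \<in> {N +>\<^sub>M w |w. w \<in> W}" unfolding q(2) using Wd(2) by blast
  next
    fix X Y assume "X \<in> {N +>\<^sub>M w |w. w \<in> W}" "Y \<in> {N +>\<^sub>M w |w. w \<in> W}"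
    then obtain x y where x: "x \<in> W" "X = N +>\<^sub>M x" "y \<in> W" "Y = N +>\<^sub>M y" by blast
    hence "X \<oplus>\<^bsub>quot_module M N\<^esub> Y = N +>\<^sub>M (x \<oplus>\<^sub>M y)" using q(3) Wd(1) by simp
    thus "X \<oplus>\<^bsub>quot_module M N\<^esub> Y \<in> {N +>\<^sub>M w |w. w \<in> W}" using Wd(3)[OF x(1,3)] by blast
  next
    fix a X assume a: "a \<in> carrier R" "X \<in> {N +>\<^sub>M w |w. w \<in> W}"
    then obtain x where x: "x \<in> W" "X = N +>\<^sub>M x" by blast
    hence "a \<odot>\<^bsub>quot_module M N\<^esub> X = N +>\<^sub>M (a \<odot>\<^sub>M x)" using q(4) Wd(1) a by simp
    thus "a \<odot>\<^bsub>quot_module M N\<^esub> X \<in> {N +>\<^sub>M w |w. w \<in> W}" using Wd(4)[OF a(1) x(1)] by blast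
  qed
qed

lemma quot_submodule_preimage:
  assumes N: "submodule R N M" and Z: "submodule R Z (quot_module M N)"
  shows "submodule R {x \<in> carrier M. N +>\<^sub>M x \<in> Z} M" "N \<subseteq> {x \<in> carrier M. N +>\<^sub>M x \<in> Z}"
proof -
  interpret Q: module R "quot_module M N" by (rule quot_module_is_module[OF N])
  interpret N: abelian_subgroup N M using submodule_abelian_subgroup[OF N] .
  note q = quot_module_simps[OF N] and Zd = Q.submoduleD[OF Z]
  show "submodule R {x \<in> carrier M. N +>\<^sub>M x \<in> Z} M" unfolding submodule_iff
  proof (intro conjI ballI)
    show "\<zero>\<^sub>M \<in> {x \<in> carrier M. N +>\<^sub>M x \<in> Z}" using Zd(2) unfolding q(2) by simp
  next
    fix x y assume "x \<in> {x \<in> carrier M. N +>\<^sub>M x \<in> Z}" "y \<in> {x \<in> carrier M. N +>\<^sub>M x \<in> Z}"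
    thus "x \<oplus>\<^sub>M y \<in> {x \<in> carrier M. N +>\<^sub>M x \<in> Z}" using Zd(3)[of "N +>\<^sub>M x" "N +>\<^sub>M y"] q(3)[of x y] by simp
  next
    fix a x assume "a \<in> carrier R" "x \<in> {x \<in> carrier M. N +>\<^sub>M x \<in> Z}"
    thus "a \<odot>\<^sub>M x \<in> {x \<in> carrier M. N +>\<^sub>M x \<in> Z}" using Zd(4)[of a "N +>\<^sub>M x"] q(4)[of a x] by simp
  qed auto
  show "N \<subseteq> {x \<in> carrier M. N +>\<^sub>M x \<in> Z}"
  proof
    fix x assume x: "x \<in> N"
    have "N +>\<^sub>M x = N +>\<^sub>M \<zero>\<^sub>M" using N.a_rcos_const[OF x] N.a_rcos_const[OF submoduleD(2)[OF N]] by simp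
    thus "x \<in> {x \<in> carrier M. N +>\<^sub>M x \<in> Z}" using Zd(2) submoduleD(1)[OF N x] unfolding q(2) by simp
  qed
qed

lemma quot_module_length_ge:
  assumes N: "submodule R N M" and c: "chain_between N (carrier M) n W"
  shows "enat n \<le> module_length R (quot_module M N)"
  unfolding module_length_def
proof (rule Sup_upper, rule CollectI, rule exI[of _ n], intro conjI refl, rule exI, intro conjI allI impI)
  let ?Z = "\<lambda>i. {N +>\<^sub>M w | w. w \<in> W i}"
  have W: "submodule R (W i) M" "N \<subseteq> W i" if "i \<le> n" for i using c that unfolding chain_between_def by blast+
  fix i
  show "submodule R (?Z i) (quot_module M N)" if "i \<le> n" using quot_submodule_lift[OF N W[OF that]] .
  show "?Z i \<subset> ?Z (Suc i)" if i: "i < n"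
  proof
    have st: "W i \<subset> W (Suc i)" using c i unfolding chain_between_def by blast
    show "?Z i \<subseteq> ?Z (Suc i)" using st by blast
    obtain z where z: "z \<in> W (Suc i)" "z \<notin> W i" using st by blast
    have i': "i \<le> n" "Suc i \<le> n" using i by auto
    have zc: "z \<in> carrier M" using submoduleD(1)[OF W(1)[OF i'(2)] z(1)] .
    have "N +>\<^sub>M z \<notin> ?Z i"
    proof
      assume "N +>\<^sub>M z \<in> ?Z i"
      then obtain w where w: "w \<in> W i" "N +>\<^sub>M z = N +>\<^sub>M w" by blast
      have wc: "w \<in> carrier M" using submoduleD(1)[OF W(1)[OF i'(1)] w(1)] .
      have "z \<ominus>\<^sub>M w \<in> W i" using w(2) coset_eq_iff[OF N zc wc] W(2)[OF i'(1)] by blast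
      hence "(z \<ominus>\<^sub>M w) \<oplus>\<^sub>M w \<in> W i" using submoduleD(3)[OF W(1)[OF i'(1)] _ w(1)] by blast
      moreover have "(z \<ominus>\<^sub>M w) \<oplus>\<^sub>M w = z" using zc wc by (simp add: msimps)
      ultimately show False using z by simp
    qed
    thus "?Z i \<noteq> ?Z (Suc i)" using z(1) by blast
  qed
qed

lemma quot_module_length_le:
  assumes N: "submodule R N M" and c: "length_le N (carrier M) n"
  shows "module_length R (quot_module M N) \<le> enat n"
  unfolding module_length_def
proof (rule Sup_least)
  fix l assume "l \<in> {enat k | k. \<exists>Z. (\<forall>i\<le>k. submodule R (Z i) (quot_module M N)) \<and> (\<forall>i<k. Z i \<subset> Z (Suc i))}"
  then obtain k Z where Z: "l = enat k" "\<forall>i\<le>k. submodule R (Z i) (quot_module M N)" "\<forall>i<k. Z i \<subset> Z (Suc i)" by blast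
  let ?W = "\<lambda>i. {x \<in> carrier M. N +>\<^sub>M x \<in> Z i}"
  interpret Q: module R "quot_module M N" by (rule quot_module_is_module[OF N])
  have "chain_between N (carrier M) k ?W" unfolding chain_between_def
  proof (intro conjI allI impI)
    fix i assume i: "i \<le> k"
    show "submodule R (?W i) M" "N \<subseteq> ?W i" using quot_submodule_preimage[OF N] Z(2) i by blast+
    show "?W i \<subseteq> carrier M" by blast
  next
    fix i assume i: "i < k"
    hence st: "Z i \<subset> Z (Suc i)" using Z(3) by blast
    then obtain z where z: "z \<in> Z (Suc i)" "z \<notin> Z i" by blast
    have "submodule R (Z (Suc i)) (quot_module M N)" using Z(2) i by auto
    hence "z \<in> carrier (quot_module M N)" using Q.submoduleD(1) z(1) by blast
    then obtain x where x: "x \<in> carrier M" "z = N +>\<^sub>M x" unfolding quot_module_simps(1)[OF N] by blast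
    have "x \<in> ?W (Suc i)" "x \<notin> ?W i" using x z by auto
    moreover have "?W i \<subseteq> ?W (Suc i)" using st by blast
    ultimately show "?W i \<subset> ?W (Suc i)" by blast
  qed
  hence "k \<le> n" using c unfolding length_le_def by blast
  thus "l \<le> enat n" unfolding Z(1) by simp
qed

end

section \<open>Modules over a quotient ring\<close>

locale ring_surjection = R: cring R + S: cring S for R (structure) and S (structure) +
  fixes \<phi>
  assumes phi_hom: "\<phi> \<in> ring_hom R S" and phi_surj: "\<phi> ` carrier R = carrier S"
begin

definition p where "p = a_kernel R S \<phi>"

sublocale phi: ring_hom_cring R S \<phi> using phi_hom R.is_cring S.is_cring by (simp add: ring_hom_cringI)

lemma p_iff: "a \<in> p \<longleftrightarrow> a \<in> carrier R \<and> \<phi> a = \<zero>\<^sub>S" unfolding p_def a_kernel_def' by auto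

lemma phi_eq_iff: "a \<in> carrier R \<Longrightarrow> b \<in> carrier R \<Longrightarrow> \<phi> a = \<phi> b \<longleftrightarrow> a \<ominus>\<^sub>R b \<in> p"
  unfolding p_iff by (simp add: a_minus_def S.add.inv_solve_right S.r_right_minus_eq[unfolded a_minus_def])

lemma p_ideal: "ideal p R"
  unfolding p_def by (rule ring_hom_ring.kernel_is_ideal[OF ring_hom_ringI2[OF R.ring_axioms S.ring_axioms phi_hom]])

lemma phi_inv: "c \<in> carrier S \<Longrightarrow> inv_into (carrier R) \<phi> c \<in> carrier R \<and> \<phi> (inv_into (carrier R) \<phi> c) = c"
  using phi_surj by (metis f_inv_into_f inv_into_into)

lemma phi_lift: "c \<in> carrier S \<Longrightarrow> \<exists>a\<in>carrier R. \<phi> a = c" using phi_inv by blast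

end

locale killed_module = ring_surjection + M: module R M for M +
  assumes killed: "\<And>a x. a \<in> p \<Longrightarrow> x \<in> carrier M \<Longrightarrow> a \<odot>\<^sub>M x = \<zero>\<^sub>M"
begin

abbreviation D where "D \<equiv> descend_scalars R \<phi> M"

lemma D_simps: "carrier D = carrier M" "\<zero>\<^sub>D = \<zero>\<^sub>M" "x \<oplus>\<^sub>D y = x \<oplus>\<^sub>M y" by (simp_all add: descend_scalars_def)

lemma D_smult:
  assumes a: "a \<in> carrier R" "x \<in> carrier M"
  shows "\<phi> a \<odot>\<^sub>D x = a \<odot>\<^sub>M x"
proof -
  let ?b = "inv_into (carrier R) \<phi> (\<phi> a)"
  have b: "?b \<in> carrier R" "\<phi> ?b = \<phi> a" using phi_inv[of "\<phi> a"] a by auto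
  hence "?b \<ominus>\<^sub>R a \<in> p" using phi_eq_iff[of ?b a] a by simp
  hence "(?b \<ominus>\<^sub>R a) \<odot>\<^sub>M x = \<zero>\<^sub>M" using killed a by blast
  moreover have "?b \<odot>\<^sub>M x = (?b \<ominus>\<^sub>R a) \<odot>\<^sub>M x \<oplus>\<^sub>M a \<odot>\<^sub>M x" using a b by (simp add: M.msimps)
  ultimately show ?thesis using a by (simp add: descend_scalars_def)
qed

lemma D_module: "module S D"
proof (rule moduleI)
  show "cring S" by (rule S.is_cring)
  show "abelian_group D"
  proof (rule abelian_groupI)
    fix x assume "x \<in> carrier D"
    thus "\<exists>y\<in>carrier D. y \<oplus>\<^sub>D x = \<zero>\<^sub>D" unfolding D_simps by (intro bexI[of _ "\<ominus>\<^sub>M x"]) (auto simp: M.M.l_neg)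
  qed (auto simp: D_simps M.M.a_ac)
next
  fix c x assume c: "c \<in> carrier S" and x: "x \<in> carrier D"
  obtain a where a: "a \<in> carrier R" "c = \<phi> a" using phi_lift[OF c] by blast
  have xM: "x \<in> carrier M" using x unfolding D_simps .
  show "c \<odot>\<^sub>D x \<in> carrier D" unfolding a(2) D_smult[OF a(1) xM] D_simps using a xM by simp
  {
    fix d assume d: "d \<in> carrier S"
    obtain b where b: "b \<in> carrier R" "d = \<phi> b" using phi_lift[OF d] by blast
    have "c \<oplus>\<^sub>S d = \<phi> (a \<oplus> b)" "c \<otimes>\<^sub>S d = \<phi> (a \<otimes> b)" using a b by simp_all
    thus "(c \<oplus>\<^sub>S d) \<odot>\<^sub>D x = c \<odot>\<^sub>D x \<oplus>\<^sub>D d \<odot>\<^sub>D x" "(c \<otimes>\<^sub>S d) \<odot>\<^sub>D x = c \<odot>\<^sub>D (d \<odot>\<^sub>D x)"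
      using a b xM D_smult[of "a \<oplus> b" x] D_smult[of "a \<otimes> b" x]
      by (simp_all add: D_smult D_simps M.smult_l_distr M.smult_assoc1)
  }
  fix y assume "y \<in> carrier D"
  thus "c \<odot>\<^sub>D (x \<oplus>\<^sub>D y) = c \<odot>\<^sub>D x \<oplus>\<^sub>D c \<odot>\<^sub>D y" using a xM by (simp add: D_smult D_simps M.smult_r_distr)
next
  fix x assume "x \<in> carrier D"
  thus "\<one>\<^sub>S \<odot>\<^sub>D x = x" using D_smult[of \<one> x] by (simp add: D_simps)
qed

sublocale D: module S D by (rule D_module)

lemma D_submodule_iff: "submodule S N D \<longleftrightarrow> submodule R N M"
proof
  assume N: "submodule S N D"
  note Nd = D.submoduleD[OF N, unfolded D_simps]
  show "submodule R N M" unfolding M.submodule_iff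
  proof (intro conjI ballI)
    fix a x assume a: "a \<in> carrier R" "x \<in> N"
    thus "a \<odot>\<^sub>M x \<in> N" using Nd(4)[of "\<phi> a" x] D_smult[of a x] Nd(1)[of x] by simp
  qed (use Nd in auto)
next
  assume N: "submodule R N M"
  note Nd = M.submoduleD[OF N]
  show "submodule S N D" unfolding D.submodule_iff
  proof (intro conjI ballI)
    fix c x assume c: "c \<in> carrier S" "x \<in> N"
    obtain a where a: "a \<in> carrier R" "c = \<phi> a" using phi_lift[OF c(1)] by blast
    show "c \<odot>\<^sub>D x \<in> N" using Nd(4)[OF a(1) c(2)] D_smult[OF a(1) Nd(1)[OF c(2)]] a(2) by simp
  qed (use Nd in \<open>auto simp: D_simps\<close>)
qed

lemma D_length: "module_length S D = module_length R M" unfolding module_length_def D_submodule_iff ..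

end

context ring_surjection
begin

lemma ann_part_submodule:
  assumes "module R M" "J \<subseteq> carrier R"
  shows "submodule R (ann_part M J) M"
  using module.submodule_torsion[OF assms(1,2) module.submodule_zero[OF assms(1)]] by (simp add: ann_part_def)

lemma ann_module_killed:
  assumes M: "module R M"
  shows "killed_module R S \<phi> (M\<lparr>carrier := ann_part M p\<rparr>)"
proof -
  interpret M: module R M by (rule M)
  have N: "submodule R (ann_part M p) M" by (rule ann_part_submodule[OF M]) (use p_iff in blast)
  show ?thesis
    by (intro killed_module.intro killed_module_axioms.intro ring_surjection_axioms M.submodule_is_module[OF N])
      (auto simp: ann_part_def)
qed

lemma ann_module_eq: "ann_module R S \<phi> M = descend_scalars R \<phi> (M\<lparr>carrier := ann_part M p\<rparr>)"
  unfolding ann_module_def p_def ..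

lemma ann_module_lincomb:
  assumes M: "module R M" and Y: "finite Y" "Y \<subseteq> ann_part M p"
    and c: "\<And>y. y \<in> Y \<Longrightarrow> a y \<in> carrier R \<and> c y = \<phi> (a y)"
  shows "module.lincomb (ann_module R S \<phi> M) c Y = module.lincomb M a Y"
  using Y c
proof (induction Y)
  interpret M: module R M by (rule M)
  interpret N: killed_module R S \<phi> "M\<lparr>carrier := ann_part M p\<rparr>" by (rule ann_module_killed[OF M])
  case empty
  show ?case unfolding ann_module_eq N.D.lincomb_def M.lincomb_def by (simp add: N.D_simps)
next
  interpret M: module R M by (rule M)
  interpret N: killed_module R S \<phi> "M\<lparr>carrier := ann_part M p\<rparr>" by (rule ann_module_killed[OF M])
  case (insert x Y)
  have Yc: "Y \<subseteq> carrier N.D" "x \<in> carrier N.D" using insert.prems(1) by (auto simp: N.D_simps)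
  have sub: "ann_part M p \<subseteq> carrier M" unfolding ann_part_def by blast
  have YM: "Y \<subseteq> carrier M" "x \<in> carrier M" using insert.prems(1) sub by auto
  have cc: "c y \<in> carrier S" if "y \<in> insert x Y" for y using insert.prems(2)[OF that] by simp
  have IH: "N.D.lincomb c Y = M.lincomb a Y" using insert.IH insert.prems unfolding ann_module_eq by auto
  have "N.D.lincomb c (Y \<union> {x}) = c x \<odot>\<^bsub>N.D\<^esub> x \<oplus>\<^bsub>N.D\<^esub> N.D.lincomb c Y"
    using insert.hyps Yc cc by (intro N.D.lincomb_insert) auto
  also have "c x \<odot>\<^bsub>N.D\<^esub> x = a x \<odot>\<^sub>M x" using insert.prems N.D_smult[of "a x" x] by simp
  finally have "N.D.lincomb c (insert x Y) = a x \<odot>\<^sub>M x \<oplus>\<^sub>M M.lincomb a Y" unfolding IH by (simp add: N.D_simps)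
  moreover have "M.lincomb a (Y \<union> {x}) = a x \<odot>\<^sub>M x \<oplus>\<^sub>M M.lincomb a Y"
    using insert YM by (intro M.lincomb_insert) auto
  ultimately show ?case unfolding ann_module_eq by simp
qed

end

section \<open>Local rings over a discrete valuation ring\<close>

locale dvr_quotient = noeth_local R \<mm> + ring_surjection R S \<phi> for R (structure) and \<mm> and S (structure) and \<phi> +
  assumes dvr: "discrete_valuation_ring S"
begin

lemma S_domain: "domain S" using dvr unfolding discrete_valuation_ring_def principal_domain_def by blast

lemma p_prime: "primeideal p R"
proof (rule primeidealI'[OF p_ideal])
  interpret S: domain S by (rule S_domain)
  show "\<one> \<notin> p" unfolding p_iff by simp
  fix a b assume "a \<in> carrier R" "b \<in> carrier R" "a \<otimes> b \<in> p" "a \<notin> p"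
  thus "b \<in> p" unfolding p_iff using S.integral[of "\<phi> a" "\<phi> b"] by auto
qed

sublocale p: primeideal p R by (rule p_prime)

lemma p_carrier: "p \<subseteq> carrier R" unfolding p_iff subset_iff by blast

lemma p_one: "\<one> \<notin> p" using p.one_imp_carrier p.I_notcarr by blast

lemma p_le_m: "p \<subseteq> \<mm>" using proper_ideal_le_m[OF p_ideal p_one] .

text \<open>A lift of a generator of the maximal ideal of \<open>S\<close>. An element of
  \<open>\<mm>\<close> does not map to a unit of \<open>S\<close>: lifting the inverse would put one
  into \<open>\<mm>\<close>, since \<open>p\<close> is contained in \<open>\<mm>\<close>.\<close>

lemma uniformizer_exists:
  "\<exists>t\<in>\<mm>. t \<notin> p \<and> (\<forall>a\<in>\<mm>. \<exists>b\<in>carrier R. a \<ominus> t \<otimes> b \<in> p)"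
proof -
  interpret S: principal_domain S using dvr unfolding discrete_valuation_ring_def by blast
  have lS: "local_ring S" "\<not> field S" using dvr unfolding discrete_valuation_ring_def by blast+
  interpret SL: noeth_local S "max_ideal S" by (rule noeth_localI[OF S.is_cring S.noetherian_ring_axioms lS(1)])
  obtain w where w: "w \<in> carrier S" "max_ideal S = PIdl\<^bsub>S\<^esub> w" using S.exists_gen[OF SL.m_ideal] by blast
  obtain t where t: "t \<in> carrier R" "\<phi> t = w" using phi_lift[OF w(1)] by blast
  have wm: "w \<in> max_ideal S" unfolding w(2) by (rule S.cgenideal_self[OF w(1)])
  have w0: "w \<noteq> \<zero>\<^sub>S"
  proof
    assume "w = \<zero>\<^sub>S"
    hence "max_ideal S = {\<zero>\<^sub>S}" unfolding w(2) cgenideal_def by (auto intro!: exI[of _ "\<zero>\<^sub>S"])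
    hence "carrier S - {\<zero>\<^sub>S} \<subseteq> Units S" using SL.m_units by blast
    moreover have "\<zero>\<^sub>S \<notin> Units S" using SL.m_nonunit \<open>max_ideal S = {\<zero>\<^sub>S}\<close> by blast
    ultimately have "Units S = carrier S - {\<zero>\<^sub>S}" by blast
    hence "field S" by (intro field.intro S.domain_axioms field_axioms.intro)
    thus False using lS by blast
  qed
  have tp: "t \<notin> p" unfolding p_iff using t w0 by simp
  have tm: "t \<in> \<mm>"
  proof (rule ccontr)
    assume "t \<notin> \<mm>"
    hence u: "t \<in> Units R" using m_units t by blast
    have "\<phi> (inv t \<otimes> t) = \<phi> (inv t) \<otimes>\<^sub>S w" unfolding t(2)[symmetric] using u t by (intro phi.hom_mult) auto
    hence "\<phi> (inv t) \<otimes>\<^sub>S w = \<one>\<^sub>S" using u by simp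
    hence "\<one>\<^sub>S \<in> max_ideal S" using S.idealD(4)[OF SL.m_ideal _ wm, of "\<phi> (inv t)"] u by simp
    thus False using SL.m_proper by blast
  qed
  have "\<exists>b\<in>carrier R. a \<ominus> t \<otimes> b \<in> p" if a: "a \<in> \<mm>" for a
  proof -
    have ac: "a \<in> carrier R" using a m_carrier by blast
    have "\<phi> a \<in> max_ideal S"
    proof (rule ccontr)
      assume n: "\<phi> a \<notin> max_ideal S"
      hence u: "\<phi> a \<in> Units S" using SL.m_units[of "\<phi> a"] ac by simp
      then obtain b where b: "b \<in> carrier R" "\<phi> b = inv\<^bsub>S\<^esub> (\<phi> a)" using phi_lift[of "inv\<^bsub>S\<^esub> (\<phi> a)"] by blast
      have "\<phi> (b \<otimes> a) = \<phi> \<one>" using b ac u by simp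
      hence "b \<otimes> a \<ominus> \<one> \<in> p" using phi_eq_iff[of "b \<otimes> a" \<one>] b ac by simp
      hence "b \<otimes> a \<ominus> \<one> \<in> \<mm>" using p_le_m by blast
      moreover have ba: "b \<otimes> a \<in> \<mm>" using idealD(4)[OF m_ideal b(1) a] .
      ultimately have "b \<otimes> a \<ominus> (b \<otimes> a \<ominus> \<one>) \<in> \<mm>" using ideal_minus[OF m_ideal] by blast
      moreover have "b \<otimes> a \<ominus> (b \<otimes> a \<ominus> \<one>) = \<one>" using b(1) ac by algebra
      ultimately show False using m_proper by simp
    qed
    then obtain c where c: "c \<in> carrier S" "\<phi> a = c \<otimes>\<^sub>S w" unfolding w(2) cgenideal_def by blast
    obtain b where b: "b \<in> carrier R" "\<phi> b = c" using phi_lift[OF c(1)] by blast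
    have "\<phi> a = \<phi> (t \<otimes> b)" using c b t w(1) by (simp add: S.m_comm)
    thus ?thesis using phi_eq_iff[of a "t \<otimes> b"] ac b t by auto
  qed
  thus ?thesis using tm tp by blast
qed

definition pi where "pi = (SOME t. t \<in> \<mm> \<and> t \<notin> p \<and> (\<forall>a\<in>\<mm>. \<exists>b\<in>carrier R. a \<ominus> t \<otimes> b \<in> p))"

lemma pi: "pi \<in> \<mm>" "pi \<notin> p" "pi \<in> carrier R"
  "a \<in> \<mm> \<Longrightarrow> \<exists>b\<in>carrier R. \<exists>q\<in>p. a = pi \<otimes> b \<oplus> q"
proof -
  have "pi \<in> \<mm> \<and> pi \<notin> p \<and> (\<forall>a\<in>\<mm>. \<exists>b\<in>carrier R. a \<ominus> pi \<otimes> b \<in> p)"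
    unfolding pi_def by (rule someI_ex) (use uniformizer_exists in blast)
  hence h: "pi \<in> \<mm>" "pi \<notin> p" "\<forall>a\<in>\<mm>. \<exists>b\<in>carrier R. a \<ominus> pi \<otimes> b \<in> p" by blast+
  show "pi \<in> \<mm>" "pi \<notin> p" using h by blast+
  show pc: "pi \<in> carrier R" using h m_carrier by blast
  assume a: "a \<in> \<mm>"
  then obtain b where b: "b \<in> carrier R" "a \<ominus> pi \<otimes> b \<in> p" using h by blast
  have ac: "a \<in> carrier R" using a m_carrier by blast
  have "a = pi \<otimes> b \<oplus> (a \<ominus> pi \<otimes> b)" using ac b(1) pc by algebra
  thus "\<exists>b\<in>carrier R. \<exists>q\<in>p. a = pi \<otimes> b \<oplus> q" using b by blast
qed

lemma pi_pow: "pi [^] (n::nat) \<in> carrier R" "pi [^] n \<notin> p"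
  using pi(3) primeideal_pow[OF p_prime pi(3)] pi(2) by auto

lemma one_minus_m: "a \<in> \<mm> \<Longrightarrow> \<one> \<ominus> a \<notin> \<mm>"
proof
  assume a: "a \<in> \<mm>" "\<one> \<ominus> a \<in> \<mm>"
  have "(\<one> \<ominus> a) \<oplus> a \<in> \<mm>" using idealD(3)[OF m_ideal a(2,1)] .
  moreover have "(\<one> \<ominus> a) \<oplus> a = \<one>" using m_carrier[OF a(1)] by algebra
  ultimately show False using m_proper by simp
qed

text \<open>The valuation of \<open>\<phi> a\<close>, expressed by an equation in \<open>R\<close>
  with a unit of \<open>R\<close>, so that all computations take place in \<open>R\<close> modulo
  \<open>p\<close>.\<close>

definition has_val where
  "has_val a n \<longleftrightarrow> (\<exists>v\<in>Units R. \<exists>q\<in>p. a = v \<otimes> pi [^] (n::nat) \<oplus> q)"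

text \<open>Noetherian induction on \<open>p + a R\<close>. An element of \<open>\<mm>\<close>
  without valuation is \<open>pi b\<close> modulo \<open>p\<close> with \<open>b\<close> again
  without valuation; maximality gives \<open>b\<close> in \<open>p + pi b R\<close>, so
  \<open>b (1 - c pi)\<close> lies in the prime \<open>p\<close>, which is impossible.\<close>

lemma val_exists:
  assumes a: "a \<in> carrier R" "a \<notin> p"
  shows "\<exists>n. has_val a n"
proof (rule ccontr)
  assume na: "\<not> ?thesis"
  let ?bad = "\<lambda>a. a \<in> carrier R \<and> a \<notin> p \<and> (\<forall>n. \<not> has_val a n)"
  let ?S = "{self.adjoin p a | a. ?bad a}"
  have "?S \<noteq> {}" using na a by blast
  moreover have "\<And>J. J \<in> ?S \<Longrightarrow> ideal J R" using ideal_adjoin[OF p_ideal] by blast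
  ultimately have "\<exists>J\<in>?S. \<forall>J'\<in>?S. J \<subseteq> J' \<longrightarrow> J' = J" by (rule maximal_ideal_in_family)
  then obtain a where a: "a \<in> carrier R" "a \<notin> p" "\<And>n. \<not> has_val a n"
    "\<forall>J'\<in>?S. self.adjoin p a \<subseteq> J' \<longrightarrow> J' = self.adjoin p a" by blast
  have am: "a \<in> \<mm>"
  proof (rule ccontr)
    assume "a \<notin> \<mm>"
    hence "a \<in> Units R" using m_units a by blast
    moreover have "a = a \<otimes> pi [^] (0::nat) \<oplus> \<zero>" using a by simp
    ultimately have "has_val a 0" unfolding has_val_def using idealD(2)[OF p_ideal] by blast
    thus False using a by blast
  qed
  obtain b q where b: "b \<in> carrier R" "q \<in> p" "a = pi \<otimes> b \<oplus> q" using pi(4)[OF am] by blast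
  have qc: "q \<in> carrier R" using b p_carrier by blast
  have pis: "submodule R p (self_module R)" using p_ideal ideal_iff_submodule by blast
  have bp: "b \<notin> p"
  proof
    assume "b \<in> p"
    hence "a \<in> p" unfolding b(3) using idealD(3)[OF p_ideal idealD(4)[OF p_ideal pi(3)] b(2)] by blast
    thus False using a by blast
  qed
  have bbad: "\<not> has_val b n" for n
  proof
    assume "has_val b n"
    then obtain v q' where v: "v \<in> Units R" "q' \<in> p" "b = v \<otimes> pi [^] n \<oplus> q'" unfolding has_val_def by blast
    have vc: "v \<in> carrier R" "q' \<in> carrier R" "pi [^] n \<in> carrier R" using v p_carrier pi_pow by auto
    have "a = v \<otimes> (pi [^] n \<otimes> pi) \<oplus> (pi \<otimes> q' \<oplus> q)" unfolding b(3) v(3) using vc qc pi(3) by algebra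
    hence "a = v \<otimes> pi [^] Suc n \<oplus> (pi \<otimes> q' \<oplus> q)" by simp
    moreover have "pi \<otimes> q' \<oplus> q \<in> p" using idealD(3)[OF p_ideal idealD(4)[OF p_ideal pi(3) v(2)] b(2)] .
    ultimately have "has_val a (Suc n)" unfolding has_val_def using v(1) by blast
    thus False using a by blast
  qed
  have bS: "self.adjoin p b \<in> ?S" using b(1) bp bbad by blast
  have bsup: "p \<subseteq> self.adjoin p b" "b \<in> self.adjoin p b" using self.adjoin_superset[OF pis, of b] b(1) by auto
  have bi: "ideal (self.adjoin p b) R" using ideal_adjoin[OF p_ideal b(1)] .
  have "a \<in> self.adjoin p b"
    unfolding b(3) using idealD(3)[OF bi idealD(4)[OF bi pi(3) bsup(2)]] bsup(1) b(2) by blast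
  hence "self.adjoin p a \<subseteq> self.adjoin p b"
    using self.adjoin_least[of "self.adjoin p b" p a] bi bsup(1) ideal_iff_submodule by blast
  hence "self.adjoin p b = self.adjoin p a" using a(4) bS by blast
  hence "b \<in> self.adjoin p a" using bsup(2) by blast
  then obtain q' c where c: "q' \<in> p" "c \<in> carrier R" "b = q' \<oplus> c \<otimes> a" unfolding adjoin_eq_self by blast
  have q'c: "q' \<in> carrier R" using c p_carrier by blast
  have "b \<otimes> (\<one> \<ominus> c \<otimes> pi) = (q' \<oplus> c \<otimes> (pi \<otimes> b \<oplus> q)) \<ominus> b \<otimes> (c \<otimes> pi)"
  proof -
    have e: "b \<otimes> (\<one> \<ominus> c \<otimes> pi) = b \<ominus> b \<otimes> (c \<otimes> pi)" using b(1) c(2) pi(3) by algebra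
    have "b = q' \<oplus> c \<otimes> (pi \<otimes> b \<oplus> q)" using c(3) unfolding b(3) .
    hence "b \<ominus> b \<otimes> (c \<otimes> pi) = (q' \<oplus> c \<otimes> (pi \<otimes> b \<oplus> q)) \<ominus> b \<otimes> (c \<otimes> pi)" by (rule arg_cong)
    thus ?thesis by (rule trans[OF e])
  qed
  also have "\<dots> = q' \<oplus> c \<otimes> q" using b(1) q'c c(2) pi(3) qc by algebra
  finally have "b \<otimes> (\<one> \<ominus> c \<otimes> pi) \<in> p" using idealD(3)[OF p_ideal c(1) idealD(4)[OF p_ideal c(2) b(2)]] by simp
  moreover have "\<one> \<ominus> c \<otimes> pi \<notin> p" using one_minus_m[OF idealD(4)[OF m_ideal c(2) pi(1)]] p_le_m by (rule contra_subsetD[rotated])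
  moreover have "\<one> \<ominus> c \<otimes> pi \<in> carrier R" using c(2) pi(3) by simp
  ultimately show False using p.I_prime[OF b(1)] bp by blast
qed

text \<open>A prime strictly above \<open>p\<close> contains an element with a valuation, hence a
  power of \<open>pi\<close>, hence \<open>pi\<close> and together with \<open>p\<close> all of
  \<open>\<mm>\<close>.\<close>

lemma dimension_one:
  assumes Q: "primeideal Q R" and pQ: "p \<subset> Q"
  shows "\<mm> \<subseteq> Q"
proof
  interpret Q: primeideal Q R by (rule Q)
  obtain a where a: "a \<in> Q" "a \<notin> p" using pQ by blast
  then obtain n v q where v: "v \<in> Units R" "q \<in> p" "a = v \<otimes> pi [^] (n::nat) \<oplus> q"
    using val_exists[of a] Q.Icarr unfolding has_val_def by blast
  have vc: "v \<in> carrier R" "pi [^] n \<in> carrier R" using v pi_pow by auto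
  have "q \<in> Q" using v pQ by blast
  hence "v \<otimes> pi [^] n \<in> Q" using ideal_add_cancel[OF Q.ideal_axioms, of "v \<otimes> pi [^] n" q] a(1) v(3) vc by simp
  moreover have "v \<notin> Q"
  proof
    assume "v \<in> Q"
    hence "inv v \<otimes> v \<in> Q" using Q.I_l_closed[OF \<open>v \<in> Q\<close> Units_inv_closed[OF v(1)]] by simp
    hence "\<one> \<in> Q" using v(1) by simp
    thus False using Q.one_imp_carrier Q.I_notcarr by blast
  qed
  ultimately have "pi [^] n \<in> Q" using Q.I_prime vc by blast
  hence piQ: "pi \<in> Q" using primeideal_pow[OF Q pi(3)] by blast
  fix b assume "b \<in> \<mm>"
  then obtain c q where c: "c \<in> carrier R" "q \<in> p" "b = pi \<otimes> c \<oplus> q" using pi(4) by blast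
  show "b \<in> Q" unfolding c(3) using Q.I_r_closed[OF piQ c(1)] c(2) pQ by blast
qed

text \<open>On \<open>M[p]\<close> the ring acts through \<open>S\<close>. There \<open>x\<close>
  acts as a multiple of \<open>pi\<close>, so regularity of \<open>x\<close> makes \<open>pi\<close>
  injective, and elements outside \<open>p\<close> act as a unit times a power of
  \<open>pi\<close>.\<close>

lemma torsion_free:
  assumes M: "module R M" and x: "x \<in> \<mm>" "\<And>z. z \<in> carrier M \<Longrightarrow> x \<odot>\<^sub>M z = \<zero>\<^sub>M \<Longrightarrow> z = \<zero>\<^sub>M"
    and z: "z \<in> ann_part M p" and a: "a \<in> carrier R" "a \<notin> p" "a \<odot>\<^sub>M z = \<zero>\<^sub>M"
  shows "z = \<zero>\<^sub>M"
proof -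
  interpret M: module R M by (rule M)
  have zc: "z \<in> carrier M" "\<And>q. q \<in> p \<Longrightarrow> q \<odot>\<^sub>M z = \<zero>\<^sub>M" using z unfolding ann_part_def by blast+
  have pi1: "w = \<zero>\<^sub>M" if w: "w \<in> ann_part M p" "pi \<odot>\<^sub>M w = \<zero>\<^sub>M" for w
  proof (rule x(2))
    have wc: "w \<in> carrier M" "\<And>q. q \<in> p \<Longrightarrow> q \<odot>\<^sub>M w = \<zero>\<^sub>M" using w unfolding ann_part_def by blast+
    show "w \<in> carrier M" by (rule wc)
    obtain b q where b: "b \<in> carrier R" "q \<in> p" "x = pi \<otimes> b \<oplus> q" using pi(4)[OF x(1)] by blast
    have "q \<in> carrier R" using b p_carrier by blast
    hence "x \<odot>\<^sub>M w = b \<odot>\<^sub>M (pi \<odot>\<^sub>M w) \<oplus>\<^sub>M q \<odot>\<^sub>M w" unfolding b(3) using b(1) pi(3) wc(1) by (simp add: M.msimps)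
    thus "x \<odot>\<^sub>M w = \<zero>\<^sub>M" using w(2) wc(2)[OF b(2)] b(1) by simp
  qed
  have sub: "submodule R (ann_part M p) M" by (rule ann_part_submodule[OF M p_carrier])
  have pin: "w = \<zero>\<^sub>M" if "w \<in> ann_part M p" "pi [^] (n::nat) \<odot>\<^sub>M w = \<zero>\<^sub>M" for w n using that
  proof (induction n arbitrary: w)
    case 0
    thus ?case using M.submoduleD(1)[OF sub] by simp
  next
    case (Suc n)
    have wc: "w \<in> carrier M" using M.submoduleD(1)[OF sub Suc.prems(1)] .
    have "pi \<odot>\<^sub>M w \<in> ann_part M p" using M.submoduleD(4)[OF sub pi(3) Suc.prems(1)] .
    moreover have "pi [^] n \<odot>\<^sub>M (pi \<odot>\<^sub>M w) = \<zero>\<^sub>M" using Suc.prems(2) wc pi(3) pi_pow by (simp add: M.smult_assoc1)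
    ultimately have "pi \<odot>\<^sub>M w = \<zero>\<^sub>M" by (rule Suc.IH)
    thus ?case using pi1 Suc.prems(1) by blast
  qed
  obtain n v q where v: "v \<in> Units R" "q \<in> p" "a = v \<otimes> pi [^] (n::nat) \<oplus> q"
    using val_exists[OF a(1,2)] unfolding has_val_def by blast
  have vc: "v \<in> carrier R" "pi [^] n \<in> carrier R" "q \<in> carrier R" using v pi_pow p_carrier by auto
  have "v \<odot>\<^sub>M (pi [^] n \<odot>\<^sub>M z) = \<zero>\<^sub>M"
    using a(3) zc(2)[OF v(2)] vc zc(1) unfolding v(3) by (simp add: M.smult_l_distr M.smult_assoc1)
  hence "inv v \<odot>\<^sub>M (v \<odot>\<^sub>M (pi [^] n \<odot>\<^sub>M z)) = \<zero>\<^sub>M" using v(1) by simp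
  hence "pi [^] n \<odot>\<^sub>M z = \<zero>\<^sub>M" using v(1) vc zc(1) M.smult_assoc1[of "inv v" v "pi [^] n \<odot>\<^sub>M z", symmetric] by simp
  thus ?thesis using pin z by blast
qed

text \<open>\<open>R\<^sub>p\<close> is a field.\<close>

lemma generically_reduced:
  assumes fin: "module_length S (cotangent_module R S \<phi>) < \<infinity>"
  shows "\<exists>s\<in>carrier R - p. \<forall>g\<in>p. s \<otimes> g = \<zero>"
proof -
  let ?P = "(self_module R)\<lparr>carrier := p\<rparr>" and ?pp = "p \<cdot> p"
  have psub: "submodule R p (self_module R)" using p_ideal ideal_iff_submodule by blast
  interpret P: module R ?P by (rule self.submodule_is_module[OF psub])
  have ppi: "ideal ?pp R" using ideal_prod_is_ideal[OF p_ideal p_ideal] .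
  have ppp: "?pp \<subseteq> p" using ideal_prod_inter[OF p_ideal p_ideal] by blast
  have subP: "submodule R W ?P" if "ideal W R" "W \<subseteq> p" for W
    using that idealD[OF that(1)] unfolding P.submodule_iff by auto
  have N: "submodule R ?pp ?P" using subP ppi ppp by blast
  have prod: "a \<otimes> b \<in> ?pp" if "a \<in> p" "b \<in> p" for a b using that by (rule ideal_prod.prod)
  have "killed_module R S \<phi> (quot_module ?P ?pp)"
  proof (intro killed_module.intro killed_module_axioms.intro ring_surjection_axioms P.quot_module_is_module[OF N])
    fix a X assume a: "a \<in> p" "X \<in> carrier (quot_module ?P ?pp)"
    obtain z where z: "z \<in> p" "X = ?pp +>\<^bsub>?P\<^esub> z" using a(2) unfolding P.quot_module_simps(1)[OF N] by auto
    have ac: "a \<in> carrier R" using a p_carrier by blast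
    have az: "a \<otimes> z \<in> p" using idealD(4)[OF p_ideal ac z(1)] .
    have "a \<odot>\<^bsub>quot_module ?P ?pp\<^esub> X = ?pp +>\<^bsub>?P\<^esub> (a \<otimes> z)"
      unfolding z(2) using P.quot_module_simps(4)[OF N ac, of z] z(1) by simp
    also have "\<dots> = ?pp +>\<^bsub>?P\<^esub> \<zero>"
    proof -
      have "(a \<otimes> z) \<oplus>\<^bsub>?P\<^esub> (\<ominus>\<^bsub>?P\<^esub> \<zero>\<^bsub>?P\<^esub>) \<in> ?pp"
        using P.submodule_minus[OF N prod[OF a(1) z(1)] P.submoduleD(2)[OF N]] by (simp add: a_minus_def)
      thus ?thesis using P.coset_eq_iff[OF N, of "a \<otimes> z" \<zero>] az idealD(2)[OF p_ideal] by (simp add: a_minus_def)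
    qed
    finally show "a \<odot>\<^bsub>quot_module ?P ?pp\<^esub> X = \<zero>\<^bsub>quot_module ?P ?pp\<^esub>" unfolding P.quot_module_simps(2)[OF N] by simp
  qed
  then interpret K: killed_module R S \<phi> "quot_module ?P ?pp" .
  have len: "module_length S (cotangent_module R S \<phi>) = module_length R (quot_module ?P ?pp)"
    unfolding cotangent_module_def Let_def p_def[symmetric] by (rule K.D_length)
  \<comment> \<open>Otherwise the ideals \<open>p^2 + pi^k g R\<close> decrease strictly for ever,
    against the finite length of \<open>p / p^2\<close>.\<close>
  have tors: "\<exists>s\<in>carrier R - p. s \<otimes> g \<in> ?pp" if g: "g \<in> p" for g
  proof (rule ccontr)
    assume n: "\<not> ?thesis"
    have gc: "g \<in> carrier R" using g p_carrier by blast
    have ppsub: "submodule R ?pp (self_module R)" using ppi ideal_iff_submodule by blast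
    let ?A = "\<lambda>k::nat. self.adjoin ?pp (pi [^] k \<otimes> g)"
    have pg: "pi [^] k \<otimes> g \<in> carrier R" "pi [^] k \<otimes> g \<in> p" for k :: nat
      using gc pi_pow(1) idealD(4)[OF p_ideal pi_pow(1) g] by auto
    have A: "ideal (?A k) R" "?A k \<subseteq> p" "?pp \<subseteq> ?A k" "pi [^] k \<otimes> g \<in> ?A k" for k
      using ideal_adjoin[OF ppi pg(1)] self.adjoin_least[OF psub ppp pg(2)] self.adjoin_superset[OF ppsub, of "pi [^] k \<otimes> g"] pg(1)
      by auto
    have sub: "?A (Suc k) \<subset> ?A k" for k
    proof
      have e: "pi [^] Suc k \<otimes> g = pi \<otimes> (pi [^] k \<otimes> g)" using pi(3) pi_pow(1) gc by (simp add: m_ac)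
      have "pi [^] Suc k \<otimes> g \<in> ?A k" unfolding e using idealD(4)[OF A(1) pi(3) A(4)] .
      thus "?A (Suc k) \<subseteq> ?A k" using self.adjoin_least[of "?A k" ?pp] A(1,3) ideal_iff_submodule by blast
      have "pi [^] k \<otimes> g \<notin> ?A (Suc k)"
      proof
        assume "pi [^] k \<otimes> g \<in> ?A (Suc k)"
        then obtain u c where u: "u \<in> ?pp" "c \<in> carrier R" "pi [^] k \<otimes> g = u \<oplus> c \<otimes> (pi \<otimes> (pi [^] k \<otimes> g))"
          unfolding adjoin_eq_self e by blast
        have uc: "u \<in> carrier R" using idealD(1)[OF ppi u(1)] .
        let ?s = "pi [^] k \<otimes> (\<one> \<ominus> c \<otimes> pi)"
        have "?s \<otimes> g = pi [^] k \<otimes> g \<ominus> c \<otimes> (pi \<otimes> (pi [^] k \<otimes> g))" using gc u(2) pi(3) pi_pow(1)[of k] by algebra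
        also have "\<dots> = (u \<oplus> c \<otimes> (pi \<otimes> (pi [^] k \<otimes> g))) \<ominus> c \<otimes> (pi \<otimes> (pi [^] k \<otimes> g))" using u(3) by simp
        also have "\<dots> = u" using uc gc u(2) pi(3) pi_pow(1)[of k] by algebra
        finally have "?s \<otimes> g \<in> ?pp" using u(1) by simp
        moreover have "\<one> \<ominus> c \<otimes> pi \<notin> p" using one_minus_m[OF idealD(4)[OF m_ideal u(2) pi(1)]] p_le_m by (rule contra_subsetD[rotated])
        moreover have "\<one> \<ominus> c \<otimes> pi \<in> carrier R" using u(2) pi(3) by simp
        ultimately have "?s \<in> carrier R - p" "?s \<otimes> g \<in> ?pp"
          using p.I_prime[OF pi_pow(1)] pi_pow by (blast intro: m_closed, blast)
        thus False using n by blast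
      qed
      thus "?A (Suc k) \<noteq> ?A k" using A(4) by blast
    qed
    have "enat k \<le> module_length R (quot_module ?P ?pp)" for k
    proof (rule P.quot_module_length_ge[OF N])
      show "P.chain_between ?pp (carrier ?P) k (\<lambda>i. ?A (k - i))" unfolding P.chain_between_def
      proof (intro conjI allI impI)
        fix i
        show "submodule R (?A (k - i)) ?P" using subP A(1,2) by blast
        show "?pp \<subseteq> ?A (k - i)" by (rule A(3))
        show "?A (k - i) \<subseteq> carrier ?P" using A(2) by simp
        assume "i < k"
        hence "k - i = Suc (k - Suc i)" by simp
        thus "?A (k - i) \<subset> ?A (k - Suc i)" using sub[of "k - Suc i"] by simp
      qed
    qed
    moreover obtain m where "module_length R (quot_module ?P ?pp) = enat m"
      using fin len by (metis less_infinityE)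
    ultimately have "enat (Suc m) \<le> enat m" by metis
    thus False by simp
  qed
  obtain G where G: "finite G" "G \<subseteq> p" "p = self.span G" using ideal_fg[OF p_ideal] .
  have Gc: "G \<subseteq> carrier (self_module R)" using G(2) p_carrier by auto
  let ?L = "{self.lincomb a G | a. a \<in> G \<rightarrow> p}"
  have Lsub: "submodule R ?L (self_module R)" by (rule self.submodule_lincomb_ideal[OF G(1) Gc p_ideal])
  have mult: "a \<otimes> b \<in> ?L" if ab: "a \<in> p" "b \<in> p" for a b
  proof -
    have ac: "a \<in> carrier R" using ab p_carrier by blast
    obtain c where c: "c \<in> G \<rightarrow> carrier R" "self.lincomb c G = b"
      using self.finite_in_span[OF G(1) Gc] ab(2) G(3) by blast
    have "self.lincomb (\<lambda>g. a \<otimes> c g) G = a \<otimes> b" using self.lincomb_smult[OF Gc c(1) ac] c(2) by simp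
    thus ?thesis using c(1) ab(1) p.I_r_closed by (intro CollectI exI[of _ "\<lambda>g. a \<otimes> c g"]) auto
  qed
  have ppL: "?pp \<subseteq> ?L"
  proof
    fix z assume "z \<in> ?pp"
    thus "z \<in> ?L"
    proof (induction rule: ideal_prod.induct)
      case (prod i j)
      thus ?case by (rule mult)
    next
      case (sum s1 s2)
      thus ?case using self.submoduleD(3)[OF Lsub] by simp
    qed
  qed
  \<comment> \<open>Now \<open>p\<close> lies in \<open>p^2\<close> at the prime \<open>p\<close>,
    so Nakayama's lemma there gives elements outside \<open>p\<close> annihilating the
    generators.\<close>
  have "\<forall>g\<in>G. \<exists>s\<in>carrier R - p. s \<odot>\<^bsub>self_module R\<^esub> g \<in> {\<zero>}"
  proof (rule self.nakayama_at_prime[OF G(1) Gc _ p_prime], goal_cases)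
    case 1 show ?case using self.submodule_zero by simp
  next
    case 2
    show ?case
    proof
      fix g assume "g \<in> G"
      then obtain s where s: "s \<in> carrier R - p" "s \<otimes> g \<in> ?pp" using tors G(2) by blast
      then obtain a where a: "a \<in> G \<rightarrow> p" "s \<otimes> g = self.lincomb a G" using ppL by blast
      have "self.lincomb a G \<in> carrier R" using a(2)[symmetric] s \<open>g \<in> G\<close> Gc by auto
      thus "\<exists>s\<in>carrier R - p. \<exists>f\<in>{\<zero>}. \<exists>a\<in>G \<rightarrow> p. s \<odot>\<^bsub>self_module R\<^esub> g = f \<oplus>\<^bsub>self_module R\<^esub> self.lincomb a G"
        using s a by (intro bexI[of _ s] bexI[of _ \<zero>] bexI[of _ a]) auto
    qed
  qed
  then obtain s where s: "s \<in> carrier R - p" "\<forall>g\<in>G. s \<otimes> g = \<zero>"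
    using self.prime_common_multiplier[OF p_prime, of "{\<zero>}" G] self.submodule_zero G(1) Gc by auto
  have sc: "s \<in> carrier R" using s by blast
  have "submodule R {g \<in> carrier R. \<forall>a\<in>{s}. a \<otimes> g \<in> {\<zero>}} (self_module R)"
    using self.submodule_torsion[of "{s}" "{\<zero>}"] self.submodule_zero sc by simp
  moreover have "G \<subseteq> {g \<in> carrier R. \<forall>a\<in>{s}. a \<otimes> g \<in> {\<zero>}}" using s(2) Gc by auto
  ultimately have "p \<subseteq> {g \<in> carrier R. \<forall>a\<in>{s}. a \<otimes> g \<in> {\<zero>}}" using self.span_least G(3) by blast
  thus ?thesis using s(1) by blast
qed

end

context module
begin

lemma lincomb_minus:
  assumes X: "finite X" "X \<subseteq> carrier M" and a: "a \<in> X \<rightarrow> carrier R" and b: "b \<in> X \<rightarrow> carrier R"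
  shows "lincomb (\<lambda>y. a y \<ominus> b y) X = lincomb a X \<ominus>\<^sub>M lincomb b X"
proof -
  have "lincomb (\<lambda>y. a y \<ominus> b y) X = lincomb (\<lambda>y. \<one> \<otimes> a y \<oplus> (\<ominus> \<one>) \<otimes> b y) X"
    using X a b by (intro lincomb_cong) (auto simp: a_minus_def Pi_iff R.l_minus)
  also have "\<dots> = lincomb a X \<ominus>\<^sub>M lincomb b X"
    using X a b by (subst lincomb_linear) (auto simp: a_minus_def smult_l_minus)
  finally show ?thesis .
qed

lemma lincomb_smult_image:
  assumes X: "finite X" "X \<subseteq> carrier M" and c: "c \<in> carrier R" and a: "a \<in> X \<rightarrow> carrier R"
    and inj: "inj_on (\<lambda>y. c \<odot>\<^sub>M y) X" and b: "\<And>y. y \<in> X \<Longrightarrow> b (c \<odot>\<^sub>M y) = a y"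
  shows "lincomb b ((\<lambda>y. c \<odot>\<^sub>M y) ` X) = c \<odot>\<^sub>M lincomb a X"
proof -
  have Xc: "y \<in> carrier M" "a y \<in> carrier R" if "y \<in> X" for y using X a that by auto
  have "lincomb b ((\<lambda>y. c \<odot>\<^sub>M y) ` X) = (\<Oplus>\<^bsub>M\<^esub>y\<in>X. b (c \<odot>\<^sub>M y) \<odot>\<^sub>M (c \<odot>\<^sub>M y))"
    unfolding lincomb_def using Xc c b inj by (intro M.finsum_reindex) auto
  also have "\<dots> = lincomb (\<lambda>y. c \<otimes> a y) X" unfolding lincomb_def using Xc c b
    by (intro M.finsum_cong') (auto simp: smult_assoc1[symmetric] R.m_comm)
  also have "\<dots> = c \<odot>\<^sub>M lincomb a X" by (rule lincomb_smult[OF X(2) a c])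
  finally show ?thesis .
qed

lemma in_spanI: "finite X \<Longrightarrow> a \<in> X \<rightarrow> carrier R \<Longrightarrow> lincomb a X \<in> span X" unfolding span_def by blast

end

section \<open>The module of congruences\<close>

locale congruence_ring = gorenstein_dim_1 R \<mm> I d \<epsilon> x + dvr_quotient R \<mm> S \<phi>
  for R (structure) and \<mm> and I and d and \<epsilon> and x and S (structure) and \<phi> +
  assumes x_p: "x \<notin> p" and reduced_at_p: "\<exists>s\<in>carrier R - p. \<forall>g\<in>p. s \<otimes> g = \<zero>"
begin

lemma ann_part_self: "ann_part (self_module R) J = ann J" unfolding ann_part_def ann_def by simp

lemma ann_p_torsion_free: "z \<in> ann p \<Longrightarrow> a \<in> carrier R \<Longrightarrow> a \<notin> p \<Longrightarrow> a \<otimes> z = \<zero> \<Longrightarrow> z = \<zero>"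
  using torsion_free[OF self_module, of x z a] x_m x_regular ann_part_self[of p] by simp

text \<open>Some element outside \<open>p\<close> annihilates \<open>p\<close> but acts injectively
  on \<open>ann p\<close>.\<close>

lemma ann_p_inter: "z \<in> ann p \<Longrightarrow> z \<in> p \<Longrightarrow> z = \<zero>" using reduced_at_p ann_p_torsion_free by blast

text \<open>Restricted to \<open>ann p\<close> the map to the valuation ring is injective by
  \<open>ann_p_inter\<close>, so \<open>ann p\<close> is isomorphic to an ideal there. An element of
  least valuation generates it: the difference of \<open>z\<close> and the expected multiple lies in
  \<open>p\<close> and in \<open>ann p\<close>. The valuation \<open>n\<close> of \<open>e\<close>
  will be the length of the congruence module of the ring.\<close>

lemma generator_exists:
  "\<exists>e n. e \<in> ann p \<and> e \<notin> p \<and> has_val e n \<and> (\<forall>z\<in>ann p. \<exists>a\<in>carrier R. z = a \<otimes> e)"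
proof -
  have annI: "ideal (ann p) R" by (rule ann_ideal[OF p_carrier])
  let ?P = "\<lambda>k. \<exists>e\<in>ann p. e \<notin> p \<and> has_val e k"
  obtain s where s: "s \<in> carrier R" "s \<notin> p" "\<And>g. g \<in> p \<Longrightarrow> s \<otimes> g = \<zero>" using reduced_at_p by blast
  have "s \<in> ann p" unfolding ann_def using s p_carrier by (auto simp: m_comm)
  moreover obtain k where "has_val s k" using val_exists[OF s(1,2)] by blast
  ultimately have Pk: "?P k" using s(2) by (intro bexI[of _ s]) auto
  define n where "n = (LEAST k. ?P k)"
  have "?P n" unfolding n_def by (rule LeastI[of ?P, OF Pk])
  then obtain e where e: "e \<in> ann p" "e \<notin> p" "has_val e n" by blast
  obtain v q where v: "v \<in> Units R" "q \<in> p" "e = v \<otimes> pi [^] n \<oplus> q" using e(3) unfolding has_val_def by blast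
  have vc: "v \<in> carrier R" "inv v \<in> carrier R" "q \<in> carrier R" "pi [^] n \<in> carrier R" "e \<in> carrier R"
    using v p_carrier pi_pow annD(1)[OF e(1)] by auto
  have "\<exists>a\<in>carrier R. z = a \<otimes> e" if z: "z \<in> ann p" for z
  proof (cases "z \<in> p")
    case True
    hence "z = \<zero> \<otimes> e" using ann_p_inter[OF z] vc by simp
    thus ?thesis by (intro bexI[of _ \<zero>] zero_closed)
  next
    case False
    have zc: "z \<in> carrier R" by (rule annD(1)[OF z])
    obtain k where k: "has_val z k" using val_exists[OF zc False] by blast
    have "n \<le> k" unfolding n_def by (rule Least_le) (use z False k in blast)
    then obtain i where i: "k = n + i" using le_Suc_ex by blast
    obtain w r where w: "w \<in> Units R" "r \<in> p" "z = w \<otimes> pi [^] k \<oplus> r" using k unfolding has_val_def by blast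
    have wc: "w \<in> carrier R" "r \<in> carrier R" "pi [^] i \<in> carrier R" using w p_carrier pi_pow by auto
    let ?a = "w \<otimes> inv v \<otimes> pi [^] i"
    have ac: "?a \<in> carrier R" using wc vc by simp
    have pk: "pi [^] k = pi [^] n \<otimes> pi [^] i" unfolding i by (rule nat_pow_mult[OF pi(3), symmetric])
    have iv: "v \<otimes> inv v = \<one>" using v(1) by simp
    have "?a \<otimes> e = w \<otimes> (v \<otimes> inv v) \<otimes> (pi [^] n \<otimes> pi [^] i) \<oplus> ?a \<otimes> q" unfolding v(3) using vc wc by algebra
    hence ae: "?a \<otimes> e = w \<otimes> pi [^] k \<oplus> ?a \<otimes> q" unfolding iv pk using wc vc by simp
    have wpc: "w \<otimes> pi [^] k \<in> carrier R" "?a \<otimes> q \<in> carrier R" using wc vc pk by auto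
    have "z \<ominus> ?a \<otimes> e = r \<ominus> ?a \<otimes> q"
    proof -
      have "(w \<otimes> pi [^] k \<oplus> r) \<ominus> (w \<otimes> pi [^] k \<oplus> ?a \<otimes> q) = r \<ominus> ?a \<otimes> q" using wpc wc(2) by algebra
      thus ?thesis unfolding ae using w(3) by simp
    qed
    moreover have "r \<ominus> ?a \<otimes> q \<in> p" using ideal_minus[OF p_ideal w(2) idealD(4)[OF p_ideal ac v(2)]] .
    moreover have "z \<ominus> ?a \<otimes> e \<in> ann p" using ideal_minus[OF annI z idealD(4)[OF annI ac e(1)]] .
    ultimately have "z \<ominus> ?a \<otimes> e = \<zero>" using ann_p_inter by simp
    hence "z = ?a \<otimes> e" using zc ac vc(5) by (simp add: r_right_minus_eq)
    thus ?thesis using ac by blast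
  qed
  thus ?thesis using e by blast
qed

end

locale congruence_gen = congruence_ring +
  fixes e and n :: nat
  assumes e_ann: "e \<in> ann p" and e_p: "e \<notin> p" and e_val: "has_val e n"
    and e_gen: "\<And>z. z \<in> ann p \<Longrightarrow> \<exists>a\<in>carrier R. z = a \<otimes> e"
begin

lemma e_carrier: "e \<in> carrier R" by (rule annD(1)[OF e_ann])

lemma e_kill: "a \<in> p \<Longrightarrow> a \<otimes> e = \<zero>" by (rule annD(2)[OF e_ann])

lemma e_zeroD: "a \<in> carrier R \<Longrightarrow> a \<otimes> e = \<zero> \<Longrightarrow> a \<in> p"
  using ann_p_torsion_free[OF e_ann] e_p idealD(2)[OF p_ideal] by metis

end

locale congruence_mod = congruence_gen + M: module R M for M +
  assumes x_regular_M: "\<And>z. z \<in> carrier M \<Longrightarrow> x \<odot>\<^sub>M z = \<zero>\<^sub>M \<Longrightarrow> z = \<zero>\<^sub>M"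
begin

lemma ann_part_p_submodule: "submodule R (ann_part M p) M"
  by (rule ann_part_submodule[OF M.module_axioms p_carrier])

lemma p_torsion_free: "z \<in> ann_part M p \<Longrightarrow> a \<in> carrier R \<Longrightarrow> a \<notin> p \<Longrightarrow> a \<odot>\<^sub>M z = \<zero>\<^sub>M \<Longrightarrow> z = \<zero>\<^sub>M"
  using torsion_free[OF M.module_axioms x_m] x_regular_M by blast

lemma e_p_smult: "a \<in> p \<Longrightarrow> z \<in> carrier M \<Longrightarrow> a \<odot>\<^sub>M (e \<odot>\<^sub>M z) = \<zero>\<^sub>M"
  using e_kill[of a] e_carrier p_carrier by (auto simp: M.smult_assoc1[symmetric])

lemma e_smult_ann: "z \<in> carrier M \<Longrightarrow> e \<odot>\<^sub>M z \<in> ann_part M p"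
  unfolding ann_part_def using e_p_smult e_carrier by auto

lemma ann_part_ann: "ann_part M (ann p) = {z \<in> carrier M. e \<odot>\<^sub>M z = \<zero>\<^sub>M}"
proof
  show "ann_part M (ann p) \<subseteq> {z \<in> carrier M. e \<odot>\<^sub>M z = \<zero>\<^sub>M}" unfolding ann_part_def using e_ann by auto
  show "{z \<in> carrier M. e \<odot>\<^sub>M z = \<zero>\<^sub>M} \<subseteq> ann_part M (ann p)"
  proof
    fix z assume z: "z \<in> {z \<in> carrier M. e \<odot>\<^sub>M z = \<zero>\<^sub>M}"
    have "b \<odot>\<^sub>M z = \<zero>\<^sub>M" if b: "b \<in> ann p" for b
    proof -
      obtain a where a: "a \<in> carrier R" "b = a \<otimes> e" using e_gen[OF b] by blast
      thus ?thesis using z e_carrier by (simp add: M.smult_assoc1)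
    qed
    thus "z \<in> ann_part M (ann p)" unfolding ann_part_def using z by simp
  qed
qed

lemma ann_part_ann_submodule: "submodule R (ann_part M (ann p)) M"
  by (rule ann_part_submodule[OF M.module_axioms]) (rule idealD(5)[OF ann_ideal[OF p_carrier]])

lemma ann_parts_inter: "z \<in> ann_part M p \<Longrightarrow> z \<in> ann_part M (ann p) \<Longrightarrow> z = \<zero>\<^sub>M"
  using p_torsion_free[OF _ e_carrier e_p] unfolding ann_part_ann by simp

text \<open>As \<open>e\<close> generates the annihilator of \<open>p\<close>, the condition says
  that \<open>M\<close> is the sum of the span of \<open>X\<close> and \<open>M[I_A]\<close>;
  multiplication by \<open>e\<close> identifies the quotient by \<open>M[I_A]\<close> with
  \<open>e M\<close>.\<close>

definition cgen where
  "cgen X \<longleftrightarrow> finite X \<and> X \<subseteq> carrier M \<and> (\<forall>m\<in>carrier M. \<exists>y\<in>M.span X. e \<odot>\<^sub>M m = e \<odot>\<^sub>M y)"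

text \<open>The elements \<open>e y\<close> form a basis of \<open>e M\<close> over the valuation
  ring: a coefficient in \<open>p\<close> is zero there.\<close>

definition cbasis where
  "cbasis X \<longleftrightarrow> cgen X \<and> inj_on (\<lambda>y. e \<odot>\<^sub>M y) X \<and>
     (\<forall>a y. a \<in> X \<rightarrow> carrier R \<longrightarrow> e \<odot>\<^sub>M M.lincomb a X = \<zero>\<^sub>M \<longrightarrow> y \<in> X \<longrightarrow> a y \<in> p)"

lemma cgenD:
  assumes "cgen X"
  shows "finite X" "X \<subseteq> carrier M" "m \<in> carrier M \<Longrightarrow> \<exists>b\<in>X \<rightarrow> carrier R. e \<odot>\<^sub>M m = e \<odot>\<^sub>M M.lincomb b X"
proof -
  show X: "finite X" "X \<subseteq> carrier M" using assms unfolding cgen_def by blast+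
  assume "m \<in> carrier M"
  then obtain y where y: "y \<in> M.span X" "e \<odot>\<^sub>M m = e \<odot>\<^sub>M y" using assms unfolding cgen_def by blast
  obtain b where "b \<in> X \<rightarrow> carrier R" "M.lincomb b X = y" using M.finite_in_span[OF X y(1)] by blast
  thus "\<exists>b\<in>X \<rightarrow> carrier R. e \<odot>\<^sub>M m = e \<odot>\<^sub>M M.lincomb b X" using y(2) by blast
qed

lemma cgen_remove:
  assumes X: "cgen X" and y: "y \<in> X" "y' \<in> M.span (X - {y})" "e \<odot>\<^sub>M y = e \<odot>\<^sub>M y'"
  shows "cgen (X - {y})"
  unfolding cgen_def
proof (intro conjI ballI)
  note Xd = cgenD[OF X]
  show "finite (X - {y})" "X - {y} \<subseteq> carrier M" using Xd by auto
  have sp: "submodule R (M.span (X - {y})) M" using Xd by (intro M.span_is_submodule) auto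
  have yc: "y \<in> carrier M" "y' \<in> carrier M" using Xd y(1) M.submoduleD(1)[OF sp y(2)] by auto
  fix m assume "m \<in> carrier M"
  then obtain b where b: "b \<in> X \<rightarrow> carrier R" "e \<odot>\<^sub>M m = e \<odot>\<^sub>M M.lincomb b X" using Xd(3) by blast
  have bc: "b y \<in> carrier R" "b \<in> X - {y} \<rightarrow> carrier R" using b(1) y(1) by auto
  let ?L = "M.lincomb b (X - {y})"
  have Ls: "?L \<in> M.span (X - {y})" using Xd bc(2) by (intro M.in_spanI) auto
  have Lc: "?L \<in> carrier M" using M.submoduleD(1)[OF sp Ls] .
  have "M.lincomb b X = b y \<odot>\<^sub>M y \<oplus>\<^sub>M ?L" by (rule M.lincomb_del2[OF Xd(1,2) b(1) y(1)])
  hence "e \<odot>\<^sub>M m = b y \<odot>\<^sub>M (e \<odot>\<^sub>M y) \<oplus>\<^sub>M e \<odot>\<^sub>M ?L"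
    unfolding b(2) using bc(1) yc Lc e_carrier by (simp add: M.smult_r_distr M.smult_assoc1[symmetric] m_comm)
  also have "\<dots> = e \<odot>\<^sub>M (b y \<odot>\<^sub>M y' \<oplus>\<^sub>M ?L)"
    unfolding y(3) using bc(1) yc Lc e_carrier by (simp add: M.smult_r_distr M.smult_assoc1[symmetric] m_comm)
  finally show "\<exists>z\<in>M.span (X - {y}). e \<odot>\<^sub>M m = e \<odot>\<^sub>M z"
    using M.submoduleD(3)[OF sp M.submoduleD(4)[OF sp bc(1) y(2)] Ls] by blast
qed

text \<open>A minimal generating set of \<open>eM\<close> is independent over the valuation ring \<open>S\<close>: a relation may be divided
  by a coefficient of least valuation.\<close>

lemma cbasis_exists:
  assumes "fin_gen_module R M"
  shows "\<exists>X. cbasis X"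
proof -
  obtain G where G: "finite G" "G \<subseteq> carrier M" "M.span G = carrier M" using assms unfolding fin_gen_module_def by blast
  have "cgen G" unfolding cgen_def using G by blast
  then obtain X where X: "cgen X" and min: "\<And>Y. cgen Y \<Longrightarrow> card X \<le> card Y"
    using ex_has_least_nat[of cgen G card] by blast
  note Xd = cgenD[OF X]
  have irr: False if y: "y \<in> X" "y' \<in> M.span (X - {y})" "e \<odot>\<^sub>M y = e \<odot>\<^sub>M y'" for y y'
    using min[OF cgen_remove[OF X y]] y(1) Xd(1) card_Diff1_less[of X y] by simp
  have "inj_on (\<lambda>y. e \<odot>\<^sub>M y) X"
  proof (rule inj_onI, rule ccontr)
    fix y y' assume y: "y \<in> X" "y' \<in> X" "e \<odot>\<^sub>M y = e \<odot>\<^sub>M y'" "y \<noteq> y'"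
    have "y' \<in> M.span (X - {y})" using y Xd(2) by (intro subsetD[OF M.in_own_span]) auto
    thus False using irr y by blast
  qed
  moreover have "a y1 \<in> p" if a: "a \<in> X \<rightarrow> carrier R" and z: "e \<odot>\<^sub>M M.lincomb a X = \<zero>\<^sub>M" and y1: "y1 \<in> X" for a y1
  proof (rule ccontr)
    assume n1: "a y1 \<notin> p"
    have ac: "a y \<in> carrier R" if "y \<in> X" for y using a that by auto
    let ?P = "\<lambda>k. \<exists>y\<in>X. a y \<notin> p \<and> has_val (a y) k"
    obtain k1 where "has_val (a y1) k1" using val_exists[OF ac[OF y1] n1] by blast
    hence P1: "?P k1" using y1 n1 by (intro bexI[of _ y1]) auto
    define k where "k = (LEAST k. ?P k)"
    have "?P k" unfolding k_def by (rule LeastI[of ?P, OF P1])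
    then obtain y0 where y0: "y0 \<in> X" "a y0 \<notin> p" "has_val (a y0) k" by blast
    have pc: "pi [^] k \<in> carrier R" by (rule pi_pow)
    have "\<exists>c\<in>carrier R. a y \<ominus> pi [^] k \<otimes> c \<in> p \<and> (y = y0 \<longrightarrow> c \<in> Units R)" if y: "y \<in> X" for y
    proof (cases "y = y0")
      case True
      obtain v q where v: "v \<in> Units R" "q \<in> p" "a y = v \<otimes> pi [^] k \<oplus> q"
        using y0(3) True unfolding has_val_def by blast
      have vc: "v \<in> carrier R" "q \<in> carrier R" using v p_carrier by auto
      have "(v \<otimes> pi [^] k \<oplus> q) \<ominus> pi [^] k \<otimes> v = q" using vc pc by algebra
      hence "a y \<ominus> pi [^] k \<otimes> v \<in> p" using v by simp
      thus ?thesis using v(1) vc by blast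
    next
      case F: False
      show ?thesis
      proof (cases "a y \<in> p")
        case True
        hence "a y \<ominus> pi [^] k \<otimes> \<zero> \<in> p" using pc ac[OF y] by (simp add: a_minus_def)
        thus ?thesis using F by blast
      next
        case False
        obtain k' where k': "has_val (a y) k'" using val_exists[OF ac[OF y] False] by blast
        have "k \<le> k'" unfolding k_def by (rule Least_le) (use y False k' in blast)
        then obtain i where i: "k' = k + i" using le_Suc_ex by blast
        obtain v q where v: "v \<in> Units R" "q \<in> p" "a y = v \<otimes> pi [^] k' \<oplus> q" using k' unfolding has_val_def by blast
        have vc: "v \<in> carrier R" "q \<in> carrier R" "pi [^] i \<in> carrier R" using v p_carrier pi_pow by auto
        have "pi [^] k' = pi [^] k \<otimes> pi [^] i" unfolding i by (rule nat_pow_mult[OF pi(3), symmetric])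
        moreover have "(v \<otimes> (pi [^] k \<otimes> pi [^] i) \<oplus> q) \<ominus> pi [^] k \<otimes> (v \<otimes> pi [^] i) = q" using vc pc by algebra
        ultimately have "a y \<ominus> pi [^] k \<otimes> (v \<otimes> pi [^] i) \<in> p" using v by simp
        moreover have "v \<otimes> pi [^] i \<in> carrier R" using vc by simp
        ultimately show ?thesis using F by blast
      qed
    qed
    hence "\<exists>b. \<forall>y\<in>X. b y \<in> carrier R \<and> a y \<ominus> pi [^] k \<otimes> b y \<in> p \<and> (y = y0 \<longrightarrow> b y \<in> Units R)"
      by (intro bchoice) blast
    then obtain b where b: "\<And>y. y \<in> X \<Longrightarrow> b y \<in> carrier R" "\<And>y. y \<in> X \<Longrightarrow> a y \<ominus> pi [^] k \<otimes> b y \<in> p" "b y0 \<in> Units R"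
      using y0(1) by blast
    have bX: "b \<in> X \<rightarrow> carrier R" using b(1) by blast
    have eb: "e \<otimes> a y = pi [^] k \<otimes> (e \<otimes> b y)" if y: "y \<in> X" for y
    proof -
      have "(a y \<ominus> pi [^] k \<otimes> b y) \<otimes> e = \<zero>" by (rule e_kill[OF b(2)[OF y]])
      moreover have "(a y \<ominus> pi [^] k \<otimes> b y) \<otimes> e = e \<otimes> a y \<ominus> pi [^] k \<otimes> (e \<otimes> b y)"
        using ac[OF y] b(1)[OF y] pc e_carrier by algebra
      ultimately show ?thesis using ac[OF y] b(1)[OF y] pc e_carrier by simp
    qed
    let ?B = "M.lincomb b X"
    have Bc: "?B \<in> carrier M" by (rule M.lincomb_closed[OF Xd(2) bX])
    have "\<zero>\<^sub>M = M.lincomb (\<lambda>y. e \<otimes> a y) X" using z M.lincomb_smult[OF Xd(2) a e_carrier] by simp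
    also have "\<dots> = M.lincomb (\<lambda>y. pi [^] k \<otimes> (e \<otimes> b y)) X"
      using eb b(1) pc e_carrier by (intro M.lincomb_cong[OF refl Xd(2)]) auto
    also have "\<dots> = pi [^] k \<odot>\<^sub>M M.lincomb (\<lambda>y. e \<otimes> b y) X"
      using b(1) e_carrier by (intro M.lincomb_smult[OF Xd(2) _ pc]) auto
    also have "M.lincomb (\<lambda>y. e \<otimes> b y) X = e \<odot>\<^sub>M ?B" by (rule M.lincomb_smult[OF Xd(2) bX e_carrier])
    finally have eB: "e \<odot>\<^sub>M ?B = \<zero>\<^sub>M" using p_torsion_free[OF e_smult_ann[OF Bc] pi_pow] by simp
    let ?L = "M.lincomb b (X - {y0})" and ?w = "inv (b y0)"
    have bX': "b \<in> X - {y0} \<rightarrow> carrier R" using bX by blast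
    have Lsp: "?L \<in> M.span (X - {y0})" using Xd bX' by (intro M.in_spanI) auto
    have sp: "submodule R (M.span (X - {y0})) M" using Xd by (intro M.span_is_submodule) auto
    have Lc: "?L \<in> carrier M" using M.submoduleD(1)[OF sp Lsp] .
    have wc: "?w \<in> carrier R" "b y0 \<in> carrier R" "?w \<otimes> b y0 = \<one>" using b(3) by auto
    have yc: "y0 \<in> carrier M" using y0 Xd by blast
    have Be: "?B = b y0 \<odot>\<^sub>M y0 \<oplus>\<^sub>M ?L" by (rule M.lincomb_del2[OF Xd(1,2) bX y0(1)])
    have "?w \<odot>\<^sub>M ?B \<oplus>\<^sub>M (\<ominus> ?w) \<odot>\<^sub>M ?L = (?w \<otimes> b y0) \<odot>\<^sub>M y0"
      unfolding Be using wc(1,2) yc Lc by (simp add: M.smult_r_distr M.smult_assoc1 M.smult_l_minus M.M.a_assoc M.M.r_neg)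
    hence y0e: "y0 = ?w \<odot>\<^sub>M ?B \<oplus>\<^sub>M (\<ominus> ?w) \<odot>\<^sub>M ?L" unfolding wc(3) using yc by simp
    have "e \<odot>\<^sub>M (?w \<odot>\<^sub>M ?B \<oplus>\<^sub>M (\<ominus> ?w) \<odot>\<^sub>M ?L) = ?w \<odot>\<^sub>M (e \<odot>\<^sub>M ?B) \<oplus>\<^sub>M e \<odot>\<^sub>M ((\<ominus> ?w) \<odot>\<^sub>M ?L)"
      using wc(1) e_carrier Bc Lc by (simp add: M.smult_r_distr M.smult_assoc1[symmetric] m_comm)
    hence "e \<odot>\<^sub>M y0 = e \<odot>\<^sub>M ((\<ominus> ?w) \<odot>\<^sub>M ?L)" unfolding y0e[symmetric] eB using wc(1) e_carrier Lc by simp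
    moreover have "(\<ominus> ?w) \<odot>\<^sub>M ?L \<in> M.span (X - {y0})" using M.submoduleD(4)[OF sp _ Lsp] wc(1) by simp
    ultimately show False using irr y0(1) by blast
  qed
  ultimately show ?thesis unfolding cbasis_def using X by blast
qed

lemma cbasisD:
  assumes "cbasis X"
  shows "cgen X" "inj_on (\<lambda>y. e \<odot>\<^sub>M y) X"
    "a \<in> X \<rightarrow> carrier R \<Longrightarrow> e \<odot>\<^sub>M M.lincomb a X = \<zero>\<^sub>M \<Longrightarrow> y \<in> X \<Longrightarrow> a y \<in> p" using assms unfolding cbasis_def by blast+

text \<open>\<open>e M\<close> lies in \<open>M[p]\<close> and contains \<open>\<phi> e\<close>
  times it, so both have the same rank over the fraction field; the basis of \<open>e M\<close>
  provides both bounds.\<close>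

lemma rank_ann_module:
  assumes B: "cbasis X"
  shows "domain_rank S (ann_module R S \<phi> M) = card X"
proof -
  let ?D = "ann_module R S \<phi> M" and ?Y = "(\<lambda>y. e \<odot>\<^sub>M y) ` X"
  note Xd = cgenD[OF cbasisD(1)[OF B]]
  interpret N: killed_module R S \<phi> "M\<lparr>carrier := ann_part M p\<rparr>" by (rule ann_module_killed[OF M.module_axioms])
  interpret S: domain S by (rule S_domain)
  have S0: "primeideal {\<zero>\<^sub>S} S" using S.domain_eq_zeroprimeideal S.domain_axioms by blast
  have Dm: "module S ?D" unfolding ann_module_eq by (rule N.D_module)
  have Dc: "carrier ?D = ann_part M p" "\<zero>\<^bsub>?D\<^esub> = \<zero>\<^sub>M" "y \<oplus>\<^bsub>?D\<^esub> z = y \<oplus>\<^sub>M z" for y z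
    unfolding ann_module_eq by (simp_all add: N.D_simps)
  have Ds: "\<phi> a \<odot>\<^bsub>?D\<^esub> z = a \<odot>\<^sub>M z" if "a \<in> carrier R" "z \<in> ann_part M p" for a z
    unfolding ann_module_eq using N.D_smult[of a z] that by simp
  interpret r: residue_hom "{\<zero>\<^sub>S}" S ?D "kappa S {\<zero>\<^sub>S}" "to_kappa S {\<zero>\<^sub>S}" by (rule residue_hom_kappa[OF S0 Dm])
  have e0: "\<phi> e \<in> carrier S - {\<zero>\<^sub>S}" using e_p e_carrier unfolding p_iff by simp
  have qM0: "z = \<zero>\<^sub>M" if "z \<in> r.qM" for z
  proof -
    have "r.qM \<subseteq> {\<zero>\<^bsub>?D\<^esub>}" unfolding r.qM_def ideal_smult_def by (rule r.M.span_least[OF r.M.submodule_zero]) auto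
    thus ?thesis using that unfolding Dc by blast
  qed
  \<comment> \<open>The relevant prime of the valuation ring is zero and \<open>M[p]\<close> is
    torsion free, so no nonzero element dies in the tensor product with the fraction field.\<close>
  have T0: "z = \<zero>\<^sub>M" if zT: "z \<in> r.T" for z
  proof -
    obtain s where s: "s \<in> carrier S" "s \<noteq> \<zero>\<^sub>S" "s \<odot>\<^bsub>?D\<^esub> z \<in> r.qM" and z: "z \<in> ann_part M p"
      using zT unfolding r.T_def Dc mem_Collect_eq by (elim conjE bexE DiffE) simp
    obtain a where a: "a \<in> carrier R" "\<phi> a = s" using phi_lift[OF s(1)] by blast
    have "a \<odot>\<^sub>M z = \<zero>\<^sub>M" using qM0[OF s(3)] unfolding a(2)[symmetric] Ds[OF a(1) z] .
    moreover have "a \<notin> p" unfolding p_iff using a s(2) by simp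
    ultimately show ?thesis using p_torsion_free[OF z a(1)] by blast
  qed
  have inj: "inj_on (\<lambda>y. e \<odot>\<^sub>M y) X" by (rule cbasisD(2)[OF B])
  have Yf: "finite ?Y" using Xd by simp
  have Ya: "?Y \<subseteq> ann_part M p" using Xd(2) e_smult_ann by auto
  have Yc: "?Y \<subseteq> carrier ?D" unfolding Dc by (rule Ya)
  have cY: "card ?Y = card X" by (rule card_image[OF inj])
  have lin: "r.M.lincomb c ?Y = e \<odot>\<^sub>M M.lincomb b X"
    if b: "b \<in> X \<rightarrow> carrier R" and c: "\<And>y. y \<in> X \<Longrightarrow> c (e \<odot>\<^sub>M y) = \<phi> (b y)" for b c
  proof -
    let ?b = "\<lambda>z. b (inv_into X (\<lambda>y. e \<odot>\<^sub>M y) z)"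
    have bi: "?b (e \<odot>\<^sub>M y) = b y" if "y \<in> X" for y using inv_into_f_f[OF inj that] by simp
    have "r.M.lincomb c ?Y = M.lincomb ?b ?Y"
    proof (rule ann_module_lincomb[OF M.module_axioms Yf Ya])
      fix z assume "z \<in> ?Y"
      then obtain y where y: "y \<in> X" "z = e \<odot>\<^sub>M y" by blast
      show "?b z \<in> carrier R \<and> c z = \<phi> (?b z)" unfolding y(2) bi[OF y(1)] using c y(1) b by blast
    qed
    also have "\<dots> = e \<odot>\<^sub>M M.lincomb b X" by (rule M.lincomb_smult_image[OF Xd(1,2) e_carrier b inj bi])
    finally show ?thesis .
  qed
  have gen: "\<exists>s\<in>carrier S - {\<zero>\<^sub>S}. \<exists>y\<in>r.M.span ?Y. \<exists>z\<in>r.qM. s \<odot>\<^bsub>?D\<^esub> m = y \<oplus>\<^bsub>?D\<^esub> z" if m: "m \<in> carrier ?D" for m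
  proof -
    have mp: "m \<in> ann_part M p" using m unfolding Dc .
    have mc: "m \<in> carrier M" using M.submoduleD(1)[OF ann_part_p_submodule mp] .
    obtain b where b: "b \<in> X \<rightarrow> carrier R" "e \<odot>\<^sub>M m = e \<odot>\<^sub>M M.lincomb b X" using Xd(3)[OF mc] by blast
    let ?c = "\<lambda>z. \<phi> (b (inv_into X (\<lambda>y. e \<odot>\<^sub>M y) z))"
    have c1: "?c (e \<odot>\<^sub>M y) = \<phi> (b y)" if "y \<in> X" for y using inv_into_f_f[OF inj that] by simp
    have c2: "?c \<in> ?Y \<rightarrow> carrier S"
    proof
      fix z assume "z \<in> ?Y"
      then obtain y where y: "y \<in> X" "z = e \<odot>\<^sub>M y" by blast
      show "?c z \<in> carrier S" unfolding y(2) c1[OF y(1)] using b(1) y(1) by auto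
    qed
    have "\<phi> e \<odot>\<^bsub>?D\<^esub> m = e \<odot>\<^sub>M m" by (rule Ds[OF e_carrier mp])
    also have "\<dots> = r.M.lincomb ?c ?Y" unfolding b(2) by (rule lin[OF b(1) c1, symmetric])
    finally have "\<phi> e \<odot>\<^bsub>?D\<^esub> m = r.M.lincomb ?c ?Y" .
    moreover have "r.M.lincomb ?c ?Y \<in> carrier ?D" by (rule r.M.lincomb_closed[OF Yc c2])
    ultimately have "\<phi> e \<odot>\<^bsub>?D\<^esub> m = r.M.lincomb ?c ?Y \<oplus>\<^bsub>?D\<^esub> \<zero>\<^bsub>?D\<^esub>" by simp
    moreover have "\<zero>\<^bsub>?D\<^esub> \<in> r.qM" by (rule r.M.submoduleD(2)[OF r.qM_submodule])
    ultimately show ?thesis using e0 r.M.in_spanI[OF Yf c2] by blast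
  qed
  have le: "r.V.dim \<le> card ?Y" "r.V.fin_dim" using r.dim_le[OF Yf Yc gen] by blast+
  have "card ?Y \<le> r.V.dim"
  proof (rule r.dim_ge(1)[OF le(2) Yf Yc])
    fix c z assume c: "\<And>y. y \<in> ?Y \<Longrightarrow> c y \<in> carrier S" "r.M.lincomb c ?Y \<in> r.T" and z: "z \<in> ?Y"
    have "\<exists>b. \<forall>y\<in>X. b y \<in> carrier R \<and> \<phi> (b y) = c (e \<odot>\<^sub>M y)"
    proof (intro bchoice ballI)
      fix y assume "y \<in> X"
      hence "c (e \<odot>\<^sub>M y) \<in> carrier S" using c(1) by blast
      thus "\<exists>b. b \<in> carrier R \<and> \<phi> b = c (e \<odot>\<^sub>M y)" using phi_lift by blast
    qed
    then obtain b where b: "\<And>y. y \<in> X \<Longrightarrow> b y \<in> carrier R" "\<And>y. y \<in> X \<Longrightarrow> c (e \<odot>\<^sub>M y) = \<phi> (b y)" by metis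
    have bX: "b \<in> X \<rightarrow> carrier R" using b(1) by blast
    have z0: "e \<odot>\<^sub>M M.lincomb b X = \<zero>\<^sub>M" by (rule trans[OF lin[OF bX b(2), symmetric] T0[OF c(2)]])
    obtain y where y: "y \<in> X" "z = e \<odot>\<^sub>M y" using z by blast
    have "b y \<in> p" by (rule cbasisD(3)[OF B bX z0 y(1)])
    thus "c z \<in> {\<zero>\<^sub>S}" unfolding y(2) b(2)[OF y(1)] p_iff by simp
  qed
  thus ?thesis unfolding domain_rank_def rank_at_eq[OF S0 Dm] using le(1) cY by simp
qed

end

lemma (in module) length_le_mono:
  assumes "length_le W W'' n" "W' \<subseteq> W''"
  shows "length_le W W' n"
  unfolding length_le_def
proof (intro allI impI)
  fix k N assume c: "chain_between W W' k N"
  have "N i \<subseteq> W''" if "i \<le> k" for i using c that assms(2) unfolding chain_between_def by (meson subset_trans)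
  hence "chain_between W W'' k N" using c unfolding chain_between_def by simp
  thus "k \<le> n" using assms(1) unfolding length_le_def by blast
qed

lemma (in module) length_le_trivial:
  assumes "W' \<subseteq> W"
  shows "length_le W W' n"
  unfolding length_le_def
proof (intro allI impI)
  fix k N assume c: "chain_between W W' k N"
  show "k \<le> n"
  proof (cases k)
    case (Suc j)
    have "N 0 \<subset> N (Suc 0)" "N (Suc 0) \<subseteq> W'" "W \<subseteq> N 0" using c Suc unfolding chain_between_def by simp_all
    thus ?thesis using assms by blast
  qed simp
qed

section \<open>The length of the congruence module of M\<close>

context congruence_mod
begin

abbreviation C where "C \<equiv> ann_part M p <+>\<^sub>M ann_part M (ann p)"

lemma C_submodule: "submodule R C M" "ann_part M p \<subseteq> C" "ann_part M (ann p) \<subseteq> C"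
  using M.submodule_set_add[OF ann_part_p_submodule ann_part_ann_submodule] by blast+

lemma p_smult_ann: "a \<in> p \<Longrightarrow> z \<in> carrier M \<Longrightarrow> a \<odot>\<^sub>M z \<in> ann_part M (ann p)"
  unfolding ann_part_ann using e_kill[of a] e_carrier p_carrier
  by (auto simp: M.smult_assoc1[symmetric] m_comm subset_iff)

lemma congruence_length:
  "module_length S (congruence_module R S \<phi> M) = module_length R (quot_module M C)"
proof -
  note C = C_submodule(1)
  have "killed_module R S \<phi> (quot_module M C)"
  proof (intro killed_module.intro killed_module_axioms.intro ring_surjection_axioms M.quot_module_is_module[OF C])
    fix a Z assume a: "a \<in> p" "Z \<in> carrier (quot_module M C)"
    obtain z where z: "z \<in> carrier M" "Z = C +>\<^sub>M z" using a(2) unfolding M.quot_module_simps(1)[OF C] by blast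
    have ac: "a \<in> carrier R" using a p_carrier by blast
    have "a \<odot>\<^sub>M z \<ominus>\<^sub>M \<zero>\<^sub>M \<in> C" 
      using M.submodule_minus[OF C subsetD[OF C_submodule(3) p_smult_ann[OF a(1) z(1)]] M.submoduleD(2)[OF C]] .
    hence "C +>\<^sub>M (a \<odot>\<^sub>M z) = C +>\<^sub>M \<zero>\<^sub>M" using M.coset_eq_iff[OF C, of "a \<odot>\<^sub>M z" "\<zero>\<^sub>M"] ac z(1) by simp
    thus "a \<odot>\<^bsub>quot_module M C\<^esub> Z = \<zero>\<^bsub>quot_module M C\<^esub>"
      unfolding z(2) M.quot_module_simps(2)[OF C] M.quot_module_simps(4)[OF C ac z(1)] .
  qed
  then interpret K: killed_module R S \<phi> "quot_module M C" .
  have "congruence_module R S \<phi> M = descend_scalars R \<phi> (quot_module M C)"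
    unfolding congruence_module_def Let_def p_def[symmetric] ann_part_self ..
  thus ?thesis using K.D_length by simp
qed

text \<open>Modulo \<open>eM\<close> the powers \<open>pi\<^sup>i\<close>, \<open>i \<le> n\<close>, fill a cyclic module in \<open>n\<close> simple steps.\<close>

lemma length_le_adjoin:
  assumes W: "submodule R W M" "ann_part M (ann p) \<subseteq> W" "\<And>z. z \<in> carrier M \<Longrightarrow> e \<odot>\<^sub>M z \<in> W" and y: "y \<in> carrier M"
  shows "M.length_le W (M.adjoin W y) n"
proof -
  let ?y = "\<lambda>i::nat. pi [^] i \<odot>\<^sub>M y"
  have yc: "?y i \<in> carrier M" for i using y pi_pow by simp
  obtain v q where v: "v \<in> Units R" "q \<in> p" "e = v \<otimes> pi [^] n \<oplus> q" using e_val unfolding has_val_def by blast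
  have vc: "v \<in> carrier R" "inv v \<in> carrier R" "q \<in> carrier R" "pi [^] n \<in> carrier R" "inv v \<otimes> v = \<one>"
    using v p_carrier pi_pow by auto
  have "v \<odot>\<^sub>M ?y n \<oplus>\<^sub>M q \<odot>\<^sub>M y \<in> W"
    using W(3)[OF y] vc y unfolding v(3) by (simp add: M.smult_l_distr M.smult_assoc1)
  moreover have "q \<odot>\<^sub>M y \<in> W" using p_smult_ann[OF v(2) y] W(2) by blast
  ultimately have "v \<odot>\<^sub>M ?y n \<in> W" using M.submodule_add_cancel[OF W(1)] vc yc by simp
  hence "inv v \<odot>\<^sub>M (v \<odot>\<^sub>M ?y n) \<in> W" by (rule M.submoduleD(4)[OF W(1) vc(2)])
  hence yn: "?y n \<in> W" using M.smult_assoc1[of "inv v" v "?y n", symmetric] vc yc by simp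
  have "M.length_le W (M.adjoin W (?y (n - j))) j" if "j \<le> n" for j using that
  proof (induction j)
    case 0
    have "M.adjoin W (?y n) \<subseteq> W" by (rule M.adjoin_least[OF W(1) subset_refl yn])
    thus ?case by (intro M.length_le_trivial) simp
  next
    case (Suc j)
    define i where "i = n - Suc j"
    have i: "n - j = Suc i" using Suc.prems unfolding i_def by simp
    let ?A = "M.adjoin W (?y (Suc i))"
    have A: "submodule R ?A M" by (rule M.submodule_adjoin[OF W(1) yc])
    have AW: "W \<subseteq> ?A" "?y (Suc i) \<in> ?A" using M.adjoin_superset[OF W(1) yc] by blast+
    have B: "submodule R (M.adjoin ?A (?y i)) M" by (rule M.submodule_adjoin[OF A yc])
    have piy: "?y (Suc i) = pi \<odot>\<^sub>M ?y i" using pi(3) pi_pow y by (simp add: M.smult_assoc1[symmetric] m_comm)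
    have "M.length_le ?A (M.adjoin ?A (?y i)) 1"
    proof (rule length_le_simple[OF M.module_axioms A yc])
      fix a assume "a \<in> \<mm>"
      then obtain b q where b: "b \<in> carrier R" "q \<in> p" "a = pi \<otimes> b \<oplus> q" using pi(4) by blast
      have qc: "q \<in> carrier R" using b p_carrier by blast
      have "a \<odot>\<^sub>M ?y i = b \<odot>\<^sub>M ?y (Suc i) \<oplus>\<^sub>M q \<odot>\<^sub>M ?y i"
        unfolding b(3) piy using b(1) qc pi(3) yc by (simp add: M.smult_l_distr M.smult_assoc1[symmetric] m_comm)
      moreover have "b \<odot>\<^sub>M ?y (Suc i) \<in> ?A" by (rule M.submoduleD(4)[OF A b(1) AW(2)])
      moreover have "q \<odot>\<^sub>M ?y i \<in> ?A" using p_smult_ann[OF b(2) yc] W(2) AW(1) by blast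
      ultimately show "a \<odot>\<^sub>M ?y i \<in> ?A" using M.submoduleD(3)[OF A] by simp
    qed
    moreover have "M.length_le W ?A j" using Suc.IH Suc.prems unfolding i by simp
    ultimately have "M.length_le W (M.adjoin ?A (?y i)) (j + 1)"
      using M.length_le_trans[OF A B AW(1) M.adjoin_superset(1)[OF A yc]] by blast
    moreover have "M.adjoin W (?y i) \<subseteq> M.adjoin ?A (?y i)"
    proof (rule M.adjoin_least[OF B])
      show "W \<subseteq> M.adjoin ?A (?y i)" using M.adjoin_superset(1)[OF A yc, of i] AW(1) by blast
      show "?y i \<in> M.adjoin ?A (?y i)" by (rule M.adjoin_superset(2)[OF A yc])
    qed
    ultimately have "M.length_le W (M.adjoin W (?y i)) (j + 1)" by (rule M.length_le_mono)
    thus ?case unfolding i_def by simp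
  qed
  from this[of n] show ?thesis using y by simp
qed

lemma length_le_finite:
  assumes W: "submodule R W M" "ann_part M (ann p) \<subseteq> W" "\<And>z. z \<in> carrier M \<Longrightarrow> e \<odot>\<^sub>M z \<in> W"
    and Z: "finite Z" "Z \<subseteq> carrier M"
  shows "\<exists>W'. submodule R W' M \<and> W \<subseteq> W' \<and> Z \<subseteq> W' \<and> M.length_le W W' (card Z * n)"
  using Z
proof (induction Z)
  case empty
  have "M.length_le W W 0" by (rule M.length_le_trivial[OF subset_refl])
  thus ?case using W(1) by (intro exI[of _ W]) simp
next
  case (insert y Z)
  then obtain W' where W': "submodule R W' M" "W \<subseteq> W'" "Z \<subseteq> W'" "M.length_le W W' (card Z * n)" by auto
  have y: "y \<in> carrier M" using insert by blast
  have le: "M.length_le W' (M.adjoin W' y) n" using W W'(2) by (intro length_le_adjoin[OF W'(1) _ _ y]) blast+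
  have A: "submodule R (M.adjoin W' y) M" "W' \<subseteq> M.adjoin W' y" "y \<in> M.adjoin W' y"
    using M.submodule_adjoin[OF W'(1) y] M.adjoin_superset[OF W'(1) y] by blast+
  have "M.length_le W (M.adjoin W' y) (card Z * n + n)" by (rule M.length_le_trans[OF W'(1) A(1) W'(2) A(2) W'(4) le])
  moreover have "card (insert y Z) * n = card Z * n + n" using insert.hyps by simp
  ultimately have "M.length_le W (M.adjoin W' y) (card (insert y Z) * n)" by (rule ssubst[rotated])
  moreover have "W \<subseteq> M.adjoin W' y" "insert y Z \<subseteq> M.adjoin W' y" using W' A by blast+
  ultimately show ?case using A(1) by (intro exI conjI)
qed

text \<open>\<open>M\<close> is generated by \<open>X\<close> together with \<open>M[I_A]\<close>,
  which \<open>W\<close> contains, and each element of \<open>X\<close> costs at most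
  \<open>n\<close> steps.\<close>

lemma length_le_carrier:
  assumes W: "submodule R W M" "ann_part M (ann p) \<subseteq> W" "\<And>z. z \<in> carrier M \<Longrightarrow> e \<odot>\<^sub>M z \<in> W" and X: "cgen X"
  shows "M.length_le W (carrier M) (card X * n)"
proof -
  note Xd = cgenD[OF X]
  obtain W' where W': "submodule R W' M" "W \<subseteq> W'" "X \<subseteq> W'" "M.length_le W W' (card X * n)"
    using length_le_finite[OF W Xd(1,2)] by blast
  have "carrier M \<subseteq> W'"
  proof
    fix m assume m: "m \<in> carrier M"
    then obtain b where b: "b \<in> X \<rightarrow> carrier R" "e \<odot>\<^sub>M m = e \<odot>\<^sub>M M.lincomb b X" using Xd(3) by blast
    let ?y = "M.lincomb b X"
    have yc: "?y \<in> carrier M" by (rule M.lincomb_closed[OF Xd(2) b(1)])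
    have yW: "?y \<in> W'" using M.span_least[OF W'(1,3)] M.in_spanI[OF Xd(1) b(1)] by blast
    have "e \<odot>\<^sub>M (m \<ominus>\<^sub>M ?y) = \<zero>\<^sub>M" using m yc e_carrier b(2) by (simp add: a_minus_def M.smult_r_distr M.smult_r_minus M.M.r_neg)
    hence "m \<ominus>\<^sub>M ?y \<in> ann_part M (ann p)" unfolding ann_part_ann using m yc by simp
    hence "m \<ominus>\<^sub>M ?y \<in> W'" using W(2) W'(2) by blast
    hence "(m \<ominus>\<^sub>M ?y) \<oplus>\<^sub>M ?y \<in> W'" using M.submoduleD(3)[OF W'(1) _ yW] by blast
    thus "m \<in> W'" using m yc by (simp add: a_minus_def M.M.a_assoc M.M.l_neg)
  qed
  hence "W' = carrier M" using M.submoduleD(1)[OF W'(1)] by blast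
  thus ?thesis using W'(4) by simp
qed

lemma congruence_length_le:
  assumes "cgen X"
  shows "module_length S (congruence_module R S \<phi> M) \<le> enat (card X * n)"
  unfolding congruence_length
  by (intro M.quot_module_length_le C_submodule length_le_carrier assms) (use C_submodule(2) e_smult_ann in blast)

text \<open>The bound \<open>card X * n\<close> holds already for the quotient by the smaller
  submodule \<open>e M + M[I_A]\<close>. If the quotient by \<open>M[p] + M[I_A]\<close> has this
  length, both submodules agree; since \<open>M[p]\<close> and \<open>M[I_A]\<close> meet in zero,
  \<open>M[p] = e M\<close>.\<close>

lemma ann_part_p_eq:
  assumes X: "cgen X" and len: "module_length S (congruence_module R S \<phi> M) = enat (card X * n)" and z: "z \<in> ann_part M p"
  shows "\<exists>m\<in>carrier M. z = e \<odot>\<^sub>M m"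
proof -
  let ?eM = "{e \<odot>\<^sub>M m | m. m \<in> carrier M}"
  have eM: "submodule R ?eM M" unfolding M.submodule_iff
  proof (intro conjI ballI)
    show "?eM \<subseteq> carrier M" using e_carrier by auto
    show "\<zero>\<^sub>M \<in> ?eM" using e_carrier by (intro CollectI exI[of _ "\<zero>\<^sub>M"]) simp
  next
    fix y z assume "y \<in> ?eM" "z \<in> ?eM"
    then obtain m m' where m: "m \<in> carrier M" "y = e \<odot>\<^sub>M m" "m' \<in> carrier M" "z = e \<odot>\<^sub>M m'" by blast
    thus "y \<oplus>\<^sub>M z \<in> ?eM" using e_carrier by (intro CollectI exI[of _ "m \<oplus>\<^sub>M m'"]) (simp add: M.smult_r_distr)
  next
    fix a y assume a: "a \<in> carrier R" "y \<in> ?eM"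
    then obtain m where m: "m \<in> carrier M" "y = e \<odot>\<^sub>M m" by blast
    thus "a \<odot>\<^sub>M y \<in> ?eM" using e_carrier a(1)
      by (intro CollectI exI[of _ "a \<odot>\<^sub>M m"]) (simp add: M.smult_assoc1[symmetric] m_comm)
  qed
  let ?E = "?eM <+>\<^sub>M ann_part M (ann p)"
  note E = M.submodule_set_add[OF eM ann_part_ann_submodule]
  have EC: "?E \<subseteq> C"
  proof (rule M.set_add_least[OF C_submodule(1) _ C_submodule(3)])
    show "?eM \<subseteq> C" using e_smult_ann C_submodule(2) by auto
  qed
  have leE: "M.length_le ?E (carrier M) (card X * n)"
  proof (rule length_le_carrier[OF E(1) E(3) _ X])
    fix y assume "y \<in> carrier M"
    hence "e \<odot>\<^sub>M y \<in> ?eM" by blast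
    thus "e \<odot>\<^sub>M y \<in> ?E" by (rule subsetD[OF E(2)])
  qed
  have "z \<in> ?E"
  proof (rule ccontr)
    assume "z \<notin> ?E"
    hence sub: "?E \<subset> C" using EC C_submodule(2) z by blast
    \<comment> \<open>Every chain above \<open>C\<close> can be prolonged by \<open>?E\<close> at
      the bottom.\<close>
    have ext: "Suc k \<le> card X * n" if c: "M.chain_between C (carrier M) k N" for k N
    proof -
      let ?N = "case_nat ?E N"
      have "M.chain_between ?E (carrier M) (Suc k) ?N" unfolding M.chain_between_def
      proof (intro conjI allI impI)
        fix i assume i: "i \<le> Suc k"
        have N: "submodule R (N j) M" "C \<subseteq> N j" "N j \<subseteq> carrier M" if "j \<le> k" for j
          using c that unfolding M.chain_between_def by blast+
        show "submodule R (?N i) M" using i N E(1) by (cases i) auto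
        show "?E \<subseteq> ?N i" 
        proof (cases i)
          case (Suc j)
          thus ?thesis using subset_trans[OF EC N(2)[of j]] i by simp
        qed simp
        show "?N i \<subseteq> carrier M" using M.submoduleD(1)[OF E(1)] i N by (cases i) auto
      next
        fix i assume i: "i < Suc k"
        show "?N i \<subset> ?N (Suc i)"
        proof (cases i)
          case 0
          have "C \<subseteq> N 0" using c unfolding M.chain_between_def by blast
          thus ?thesis using sub 0 by auto
        next
          case (Suc j)
          thus ?thesis using c i unfolding M.chain_between_def by simp
        qed
      qed
      thus ?thesis using leE unfolding M.length_le_def by blast
    qed
    have "M.chain_between C (carrier M) 0 (\<lambda>_. C)"
      unfolding M.chain_between_def using C_submodule(1) M.submoduleD(1)[OF C_submodule(1)] by auto
    \<comment> \<open>Ensures that the truncated subtraction of one below is a true one.\<close>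
    hence pos: "Suc 0 \<le> card X * n" by (rule ext)
    have "M.length_le C (carrier M) (card X * n - 1)" unfolding M.length_le_def using ext by fastforce
    hence "module_length R (quot_module M C) \<le> enat (card X * n - 1)" by (rule M.quot_module_length_le[OF C_submodule(1)])
    hence "card X * n \<le> card X * n - 1" using len unfolding congruence_length by (simp only: enat_ord_simps)
    thus False using pos by linarith
  qed
  then obtain m w where m: "m \<in> carrier M" "w \<in> ann_part M (ann p)" "z = e \<odot>\<^sub>M m \<oplus>\<^sub>M w" unfolding M.set_add_iff by blast
  have wc: "w \<in> carrier M" using M.submoduleD(1)[OF ann_part_ann_submodule m(2)] .
  have "z \<ominus>\<^sub>M e \<odot>\<^sub>M m \<in> ann_part M p" using M.submodule_minus[OF ann_part_p_submodule z e_smult_ann[OF m(1)]] .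
  moreover have "z \<ominus>\<^sub>M e \<odot>\<^sub>M m = w" unfolding m(3) using m(1) wc e_carrier by (simp add: M.msimps)
  ultimately have "w = \<zero>\<^sub>M" using ann_parts_inter m(2) by simp
  thus ?thesis using m e_carrier by auto
qed

end

section \<open>The congruence module of the ring itself\<close>

context congruence_gen
begin

lemma congruence_mod_self: "congruence_mod R \<mm> I d \<epsilon> x S \<phi> e n (self_module R)"
  using x_regular by (intro congruence_mod.intro congruence_mod_axioms.intro congruence_gen_axioms self_module) simp

sublocale A: congruence_mod R \<mm> I d \<epsilon> x S \<phi> e n "self_module R" by (rule congruence_mod_self)

lemma cbasis_one: "A.cbasis {\<one>}"
proof -
  have l: "self.lincomb a {\<one>} = a \<one>" if "a \<one> \<in> carrier R" for a using that by (simp add: self.lincomb_def)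
  have "A.cgen {\<one>}" unfolding A.cgen_def
  proof (intro conjI ballI)
    fix m assume m: "m \<in> carrier (self_module R)"
    have "self.lincomb (\<lambda>_. m) {\<one>} \<in> self.span {\<one>}" using m by (intro self.in_spanI) auto
    thus "\<exists>y\<in>self.span {\<one>}. e \<odot>\<^bsub>self_module R\<^esub> m = e \<odot>\<^bsub>self_module R\<^esub> y" using l[of "\<lambda>_. m"] m by auto
  qed auto
  moreover have "a y \<in> p" if a: "a \<in> {\<one>} \<rightarrow> carrier R" "e \<odot>\<^bsub>self_module R\<^esub> self.lincomb a {\<one>} = \<zero>\<^bsub>self_module R\<^esub>" "y \<in> {\<one>}" for a y
  proof -
    have ac: "a \<one> \<in> carrier R" using a(1) by blast
    hence "a \<one> \<otimes> e = \<zero>" using a(2) l[of a, OF ac] e_carrier by (simp add: m_comm)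
    thus ?thesis using e_zeroD[OF ac] a(3) by simp
  qed
  ultimately show ?thesis unfolding A.cbasis_def by simp
qed

lemma rank_self: "domain_rank S (ann_module R S \<phi> (self_module R)) = 1"
  using A.rank_ann_module[OF cbasis_one] by simp

text \<open>For the ring, \<open>M[I_A]\<close> is \<open>p\<close>; modulo \<open>ann p + p\<close>
  the ring becomes the valuation ring modulo \<open>\<phi> e\<close>, whose length is the valuation
  \<open>n\<close>. The powers of \<open>pi\<close> give a chain of this length.\<close>

lemma congruence_length_self: "module_length S (congruence_module R S \<phi> (self_module R)) = enat n"
proof (rule antisym)
  show "module_length S (congruence_module R S \<phi> (self_module R)) \<le> enat n"
    using A.congruence_length_le[OF A.cbasisD(1)[OF cbasis_one]] by simp
  have annp: "z \<in> p" if "z \<in> ann_part (self_module R) (ann p)" for z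
    using that e_zeroD[of z] e_carrier unfolding A.ann_part_ann by (auto simp: m_comm)
  obtain v q where v: "v \<in> Units R" "q \<in> p" "e = v \<otimes> pi [^] n \<oplus> q" using e_val unfolding has_val_def by blast
  have vc: "v \<in> carrier R" "q \<in> carrier R" using v p_carrier by auto
  let ?A = "\<lambda>k::nat. self.adjoin A.C (pi [^] k)"
  note C = A.C_submodule(1)
  have pk: "pi [^] k \<in> carrier (self_module R)" for k :: nat using pi_pow by simp
  have A: "submodule R (?A k) (self_module R)" "A.C \<subseteq> ?A k" "pi [^] k \<in> ?A k" for k :: nat
    using self.submodule_adjoin[OF C pk] self.adjoin_superset[OF C pk] by auto
  have sub: "?A (Suc k) \<subset> ?A k" if k: "k < n" for k
  proof
    have "pi \<odot>\<^bsub>self_module R\<^esub> pi [^] k \<in> ?A k" by (rule self.submoduleD(4)[OF A(1) pi(3) A(3)])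
    hence "pi [^] Suc k \<in> ?A k" using pi(3) pi_pow by (simp add: m_comm)
    thus "?A (Suc k) \<subseteq> ?A k" by (rule self.adjoin_least[OF A(1,2)])
    have "pi [^] k \<notin> ?A (Suc k)"
    proof
      assume "pi [^] k \<in> ?A (Suc k)"
      then obtain c0 c where c: "c0 \<in> A.C" "c \<in> carrier R" "pi [^] k = c0 \<oplus> c \<otimes> (pi [^] k \<otimes> pi)"
        unfolding adjoin_eq_self nat_pow_Suc by blast
      obtain h g where h: "h \<in> ann p" "g \<in> ann_part (self_module R) (ann p)" "c0 = h \<oplus> g"
        using c(1) unfolding self.set_add_iff ann_part_self[of p] by auto
      have g: "g \<in> p" by (rule annp[OF h(2)])
      obtain a where a: "a \<in> carrier R" "h = a \<otimes> e" using e_gen[OF h(1)] by blast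
      obtain i where i: "n = Suc k + i" using k less_iff_Suc_add by auto
      have ic: "pi [^] i \<in> carrier R" "pi [^] k \<in> carrier R" "g \<in> carrier R" "c0 \<in> carrier R"
        using pi_pow g p_carrier self.submoduleD(1)[OF C c(1)] by auto
      have pn: "pi [^] n = pi [^] k \<otimes> pi \<otimes> pi [^] i" unfolding i nat_pow_mult[OF pi(3), symmetric] by simp
      \<comment> \<open>Modulo \<open>p\<close> all terms on the right of the equation for
        \<open>pi [^] k\<close> contain a further factor \<open>pi\<close>, the one from
        \<open>e\<close> because \<open>k < n\<close>. Collecting them leaves
        \<open>pi [^] k\<close> times a unit in \<open>p\<close>.\<close>
      let ?u = "\<one> \<ominus> pi \<otimes> (c \<oplus> a \<otimes> v \<otimes> pi [^] i)"
      have c0: "c0 = a \<otimes> (v \<otimes> (pi [^] k \<otimes> pi \<otimes> pi [^] i) \<oplus> q) \<oplus> g" unfolding h(3) a(2) v(3) pn ..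
      have "pi [^] k \<otimes> ?u = pi [^] k \<ominus> (c \<otimes> (pi [^] k \<otimes> pi) \<oplus> a \<otimes> v \<otimes> (pi [^] k \<otimes> pi \<otimes> pi [^] i))"
        using ic c(2) a(1) vc pi(3) by algebra
      also have "\<dots> = (c0 \<oplus> c \<otimes> (pi [^] k \<otimes> pi)) \<ominus> (c \<otimes> (pi [^] k \<otimes> pi) \<oplus> a \<otimes> v \<otimes> (pi [^] k \<otimes> pi \<otimes> pi [^] i))"
        by (rule arg_cong[OF c(3)])
      also have "\<dots> = a \<otimes> q \<oplus> g" unfolding c0 using ic c(2) a(1) vc pi(3) by algebra
      finally have "pi [^] k \<otimes> ?u \<in> p" using idealD(3)[OF p_ideal idealD(4)[OF p_ideal a(1) v(2)] g] by simp
      moreover have acc: "c \<oplus> a \<otimes> v \<otimes> pi [^] i \<in> carrier R" using c(2) a(1) vc ic by simp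
      have "pi \<otimes> (c \<oplus> a \<otimes> v \<otimes> pi [^] i) \<in> \<mm>" using idealD(4)[OF m_ideal acc pi(1)] m_comm[OF acc pi(3)] by simp
      hence "?u \<notin> p" using one_minus_m p_le_m by blast
      moreover have "?u \<in> carrier R" using acc pi(3) by simp
      ultimately show False using p.I_prime[OF ic(2)] pi_pow(2) by blast
    qed
    thus "?A (Suc k) \<noteq> ?A k" using A(3) by blast
  qed
  show "enat n \<le> module_length S (congruence_module R S \<phi> (self_module R))" unfolding A.congruence_length
  proof (rule self.quot_module_length_ge[OF C])
    show "self.chain_between A.C (carrier (self_module R)) n (\<lambda>i. ?A (n - i))" unfolding self.chain_between_def
    proof (intro conjI allI impI)
      fix i
      show "submodule R (?A (n - i)) (self_module R)" "A.C \<subseteq> ?A (n - i)" by (rule A)+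
      show "?A (n - i) \<subseteq> carrier (self_module R)" using self.submoduleD(1)[OF A(1)] by blast
      assume "i < n"
      hence "n - i = Suc (n - Suc i)" by simp
      thus "?A (n - i) \<subset> ?A (n - Suc i)" using sub[of "n - Suc i"] \<open>i < n\<close> by simp
    qed
  qed
qed

end

section \<open>Freeness from \<open>M[p] = e M\<close>\<close>

context module
begin

lemma ideal_smult_lincomb:
  assumes G: "finite G" "G \<subseteq> carrier M" "span G = carrier M" and J: "ideal J R" and z: "z \<in> ideal_smult R J M"
  shows "\<exists>a\<in>G \<rightarrow> J. z = lincomb a G"
proof -
  have "ideal_smult R J M \<subseteq> {lincomb a G | a. a \<in> G \<rightarrow> J}" unfolding ideal_smult_def
  proof (rule span_least[OF submodule_lincomb_ideal[OF G(1,2) J]])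
    show "{a \<odot>\<^sub>M y | a y. a \<in> J \<and> y \<in> carrier M} \<subseteq> {lincomb a G | a. a \<in> G \<rightarrow> J}"
    proof
      fix v assume "v \<in> {a \<odot>\<^sub>M y | a y. a \<in> J \<and> y \<in> carrier M}"
      then obtain a y where a: "a \<in> J" "y \<in> carrier M" "v = a \<odot>\<^sub>M y" by blast
      have ac: "a \<in> carrier R" by (rule R.idealD(1)[OF J a(1)])
      have "y \<in> span G" using a(2) G(3) by simp
      then obtain b where b: "b \<in> G \<rightarrow> carrier R" "lincomb b G = y" using finite_in_span[OF G(1,2)] by blast
      have "lincomb (\<lambda>g. a \<otimes> b g) G = v" unfolding a(3) b(2)[symmetric] by (rule lincomb_smult[OF G(2) b(1) ac])
      moreover have "(\<lambda>g. a \<otimes> b g) \<in> G \<rightarrow> J"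
      proof
        fix g assume "g \<in> G"
        hence "b g \<in> carrier R" using b(1) by blast
        thus "a \<otimes> b g \<in> J" using R.idealD(4)[OF J _ a(1)] R.m_comm[OF ac] by simp
      qed
      ultimately show "v \<in> {lincomb a G | a. a \<in> G \<rightarrow> J}" by blast
    qed
  qed
  thus ?thesis using z by blast
qed

end

text \<open>Multipliers are accumulated over the index set: a further multiplier moves the new entry
  into the socle modulo \<open>x\<close> without making it zero, and keeps the earlier entries
  there.\<close>

lemma (in gorenstein_dim_1) socle_multiple:
  assumes "finite X" "\<And>y. y \<in> X \<Longrightarrow> a y \<in> carrier R" "\<exists>y\<in>X. a y \<notin> PIdl x"
  shows "\<exists>c\<in>carrier R. (\<exists>y\<in>X. c \<otimes> a y \<notin> PIdl x) \<and> (\<forall>y\<in>X. \<forall>b\<in>\<mm>. b \<otimes> (c \<otimes> a y) \<in> PIdl x)"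
  using assms
proof (induction X)
  case (insert y X)
  have yc: "a y \<in> carrier R" using insert.prems by blast
  have ac: "a z \<in> carrier R" if "z \<in> X" for z using insert.prems that by blast
  show ?case
  proof (cases "\<exists>z\<in>X. a z \<notin> PIdl x")
    case True
    then obtain c where c: "c \<in> carrier R" "\<exists>z\<in>X. c \<otimes> a z \<notin> PIdl x" "\<And>z b. z \<in> X \<Longrightarrow> b \<in> \<mm> \<Longrightarrow> b \<otimes> (c \<otimes> a z) \<in> PIdl x"
      using insert.IH insert.prems(1) by blast
    show ?thesis
    proof (cases "c \<otimes> a y \<in> PIdl x")
      case True
      have "b \<otimes> (c \<otimes> a y) \<in> PIdl x" if "b \<in> \<mm>" for b using idealD(4)[OF x_ideal m_carrier[OF that] True] .
      thus ?thesis using c by (intro bexI[of _ c]) auto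
    next
      case False
      have cy: "c \<otimes> a y \<in> carrier R" using c(1) yc by simp
      obtain b where b: "b \<in> carrier R" "b \<otimes> (c \<otimes> a y) \<notin> PIdl x" "\<And>g. g \<in> \<mm> \<Longrightarrow> g \<otimes> (b \<otimes> (c \<otimes> a y)) \<in> PIdl x"
        using socle_element_exists[OF cy False] by blast
      have bc: "b \<otimes> c \<in> carrier R" "\<And>z. z \<in> insert y X \<Longrightarrow> b \<otimes> c \<otimes> a z = b \<otimes> (c \<otimes> a z)"
        using b(1) c(1) yc ac by (auto simp: m_assoc)
      have "g \<otimes> (b \<otimes> (c \<otimes> a z)) \<in> PIdl x" if z: "z \<in> X" and g: "g \<in> \<mm>" for z g
      proof -
        have "g \<otimes> (b \<otimes> (c \<otimes> a z)) = b \<otimes> (g \<otimes> (c \<otimes> a z))" using m_carrier[OF g] b(1) c(1) ac[OF z] by algebra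
        thus ?thesis using idealD(4)[OF x_ideal b(1) c(3)[OF z g]] by simp
      qed
      hence "\<forall>z\<in>insert y X. \<forall>g\<in>\<mm>. g \<otimes> (b \<otimes> c \<otimes> a z) \<in> PIdl x" using bc(2) b(3) by auto
      moreover have "b \<otimes> c \<otimes> a y \<notin> PIdl x" using bc(2) b(2) by simp
      ultimately show ?thesis using bc(1) by blast
    qed
  next
    case False
    hence "a y \<notin> PIdl x" using insert.prems by blast
    then obtain b where b: "b \<in> carrier R" "b \<otimes> a y \<notin> PIdl x" "\<And>g. g \<in> \<mm> \<Longrightarrow> g \<otimes> (b \<otimes> a y) \<in> PIdl x"
      using socle_element_exists[OF yc] by blast
    have "g \<otimes> (b \<otimes> a z) \<in> PIdl x" if z: "z \<in> X" and g: "g \<in> \<mm>" for z g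
    proof -
      have "a z \<in> PIdl x" using False z by blast
      thus ?thesis using idealD(4)[OF x_ideal m_carrier[OF g] idealD(4)[OF x_ideal b(1)]] by blast
    qed
    thus ?thesis using b by (intro bexI[of _ b]) auto
  qed
qed simp

text \<open>Dividing \<open>x\<close> by \<open>pi\<close> in the valuation ring gives
  \<open>t\<close>. Then \<open>pi t e = x e\<close>, so \<open>t e\<close> is killed by
  \<open>pi\<close> modulo \<open>x\<close>, and by \<open>p\<close> outright. If \<open>t e\<close>
  were \<open>x b\<close>, then \<open>b\<close> would lie in \<open>ann p\<close>, say
  \<open>b = c e\<close>, and \<open>t (1 - c pi) e = 0\<close>; this is impossible as the
  annihilator of \<open>e\<close> is \<open>p\<close>.\<close>

lemma (in congruence_gen) socle_generator:
  obtains t where "t \<in> carrier R" "t \<notin> p" "x \<ominus> t \<otimes> pi \<in> p" "t \<otimes> e \<notin> PIdl x"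
    "\<And>a. a \<in> \<mm> \<Longrightarrow> a \<otimes> (t \<otimes> e) \<in> PIdl x"
proof -
  obtain j where "has_val x j" using val_exists[OF x_carrier x_p] by blast
  then obtain w q where w: "w \<in> Units R" "q \<in> p" "x = w \<otimes> pi [^] (j::nat) \<oplus> q" unfolding has_val_def by blast
  have wc: "w \<in> carrier R" "q \<in> carrier R" using w p_carrier by auto
  have "j \<noteq> 0"
  proof
    assume "j = 0"
    hence "w \<oplus> q \<in> \<mm>" using w(3) wc x_m by simp
    moreover have "q \<in> \<mm>" using w(2) p_le_m by blast
    ultimately have "w \<in> \<mm>" using ideal_add_cancel[OF m_ideal] wc by blast
    thus False using m_nonunit w(1) by blast
  qed
  then obtain i where i: "j = Suc i" using not0_implies_Suc by blast
  let ?t = "w \<otimes> pi [^] i"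
  have pc: "pi [^] i \<in> carrier R" "?t \<in> carrier R" using pi_pow wc by auto
  have "w \<notin> p" using m_nonunit p_le_m w(1) by blast
  hence tp: "?t \<notin> p" using p.I_prime[OF wc(1) pc(1)] pi_pow by blast
  have "(w \<otimes> (pi [^] i \<otimes> pi) \<oplus> q) \<ominus> w \<otimes> pi [^] i \<otimes> pi = q" using wc pc(1) pi(3) by algebra
  hence xt: "x \<ominus> ?t \<otimes> pi = q" unfolding w(3) i by simp
  have qe: "q \<otimes> e = \<zero>" by (rule e_kill[OF w(2)])
  have xe: "x \<otimes> e = ?t \<otimes> pi \<otimes> e"
  proof -
    have "(x \<ominus> ?t \<otimes> pi) \<otimes> e = \<zero>" unfolding xt by (rule qe)
    moreover have "(x \<ominus> ?t \<otimes> pi) \<otimes> e = x \<otimes> e \<ominus> ?t \<otimes> pi \<otimes> e" using x_carrier pc(2) pi(3) e_carrier by algebra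
    ultimately show ?thesis using x_carrier pc(2) pi(3) e_carrier by simp
  qed
  have ti: "b \<otimes> (?t \<otimes> e) \<in> PIdl x" if bm: "b \<in> \<mm>" for b
  proof -
    obtain c r where c: "c \<in> carrier R" "r \<in> p" "b = pi \<otimes> c \<oplus> r" using pi(4)[OF bm] by blast
    have rc: "r \<in> carrier R" using c p_carrier by blast
    have re: "r \<otimes> e = \<zero>" by (rule e_kill[OF c(2)])
    have "b \<otimes> (?t \<otimes> e) = c \<otimes> (?t \<otimes> pi \<otimes> e) \<oplus> ?t \<otimes> (r \<otimes> e)"
      unfolding c(3) using c(1) rc pc(2) pi(3) e_carrier by algebra
    also have "\<dots> = x \<otimes> (c \<otimes> e)" unfolding re xe[symmetric] using c(1) pc(2) x_carrier e_carrier by (simp add: m_lcomm)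
    finally show ?thesis using xI c(1) e_carrier by simp
  qed
  have "?t \<otimes> e \<notin> PIdl x"
  proof
    assume "?t \<otimes> e \<in> PIdl x"
    then obtain b where b: "b \<in> carrier R" "?t \<otimes> e = x \<otimes> b" using xE by blast
    have "a \<otimes> b = \<zero>" if a: "a \<in> p" for a
    proof (rule x_regular)
      have ac: "a \<in> carrier R" using a p_carrier by blast
      show "a \<otimes> b \<in> carrier R" using ac b by simp
      have "x \<otimes> (a \<otimes> b) = a \<otimes> (x \<otimes> b)" using ac b(1) x_carrier by (simp add: m_lcomm)
      also have "\<dots> = ?t \<otimes> (a \<otimes> e)" unfolding b(2)[symmetric] using ac pc(2) e_carrier by (simp add: m_lcomm)
      finally show "x \<otimes> (a \<otimes> b) = \<zero>" using e_kill[OF a] pc(2) by simp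
    qed
    hence "b \<in> ann p" unfolding ann_def using b(1) by blast
    then obtain c where c: "c \<in> carrier R" "b = c \<otimes> e" using e_gen by blast
    have "?t \<otimes> e = c \<otimes> (x \<otimes> e)" unfolding b(2) c(2) using c(1) x_carrier e_carrier by (simp add: m_lcomm)
    hence te: "?t \<otimes> e = c \<otimes> (?t \<otimes> pi \<otimes> e)" unfolding xe .
    have "?t \<otimes> (\<one> \<ominus> c \<otimes> pi) \<otimes> e = ?t \<otimes> e \<ominus> c \<otimes> (?t \<otimes> pi \<otimes> e)" using pc(2) c(1) pi(3) e_carrier by algebra
    also have "\<dots> = \<zero>" unfolding te using pc(2) c(1) pi(3) e_carrier by simp
    finally have "?t \<otimes> (\<one> \<ominus> c \<otimes> pi) \<in> p" using e_zeroD pc(2) c(1) pi(3) by simp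
    moreover have "\<one> \<ominus> c \<otimes> pi \<notin> p" using one_minus_m[OF idealD(4)[OF m_ideal c(1) pi(1)]] p_le_m by (rule contra_subsetD[rotated])
    moreover have "\<one> \<ominus> c \<otimes> pi \<in> carrier R" using c(1) pi(3) by simp
    ultimately show False using p.I_prime[OF pc(2)] tp by blast
  qed
  thus thesis using that[OF pc(2) tp _ _ ti] xt w(2) by simp
qed

locale congruence_basis = congruence_mod +
  fixes X
  assumes X: "cbasis X" and ann_part_p: "\<And>z. z \<in> ann_part M p \<Longrightarrow> \<exists>m\<in>carrier M. z = e \<odot>\<^sub>M m"
begin

lemma X_finite: "finite X" and X_carrier: "X \<subseteq> carrier M" using cgenD(1,2)[OF cbasisD(1)[OF X]] by blast+

text \<open>The socle of \<open>R/x\<close> is generated by \<open>t e\<close> with \<open>x \<equiv> t pi\<close> modulo \<open>p\<close>, so a nontrivial relation modulo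
  \<open>xM\<close> would give \<open>t e \<cdot> B \<in> x M[p] = xeM\<close> for some combination \<open>B\<close> with a unit coefficient.\<close>

lemma lincomb_mod_x:
  assumes a: "a \<in> X \<rightarrow> carrier R" and m: "m \<in> carrier M" "M.lincomb a X = x \<odot>\<^sub>M m" and y: "y \<in> X"
  shows "a y \<in> PIdl x"
proof (rule ccontr)
  assume "a y \<notin> PIdl x"
  have ac: "a z \<in> carrier R" if "z \<in> X" for z using a that by blast
  have ex: "\<exists>z\<in>X. a z \<notin> PIdl x" using y \<open>a y \<notin> PIdl x\<close> by blast
  \<comment> \<open>A multiple of the relation has all coefficients in the socle modulo
    \<open>x\<close>, not all of them zero there.\<close>
  from socle_multiple[OF X_finite ac ex]
  obtain c where c: "c \<in> carrier R" "\<exists>z\<in>X. c \<otimes> a z \<notin> PIdl x" "\<forall>z\<in>X. \<forall>b\<in>\<mm>. b \<otimes> (c \<otimes> a z) \<in> PIdl x" by blast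
  obtain t where t: "t \<in> carrier R" "t \<notin> p" "x \<ominus> t \<otimes> pi \<in> p" "t \<otimes> e \<notin> PIdl x" "\<And>a. a \<in> \<mm> \<Longrightarrow> a \<otimes> (t \<otimes> e) \<in> PIdl x"
    using socle_generator by blast
  have te: "t \<otimes> e \<in> carrier R" using t(1) e_carrier by simp
  have "\<exists>b g. b \<in> carrier R \<and> g \<in> carrier R \<and> c \<otimes> a z = t \<otimes> e \<otimes> b \<oplus> x \<otimes> g" if z: "z \<in> X" for z
  proof -
    have cz: "c \<otimes> a z \<in> carrier R" using c(1) ac[OF z] by simp
    obtain b where b: "b \<in> carrier R" "c \<otimes> a z \<ominus> b \<otimes> (t \<otimes> e) \<in> PIdl x"
      using socle_unique[OF te t(4,5) cz bspec[OF bspec[OF c(3) z]]] by blast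
    obtain g where g: "g \<in> carrier R" "c \<otimes> a z \<ominus> b \<otimes> (t \<otimes> e) = x \<otimes> g" using xE[OF b(2)] by blast
    have "c \<otimes> a z = t \<otimes> e \<otimes> b \<oplus> (c \<otimes> a z \<ominus> b \<otimes> (t \<otimes> e))" using cz te b(1) by algebra
    thus ?thesis unfolding g(2) using b(1) g(1) by blast
  qed
  then obtain b g where bg: "\<And>z. z \<in> X \<Longrightarrow> b z \<in> carrier R" "\<And>z. z \<in> X \<Longrightarrow> g z \<in> carrier R"
    "\<And>z. z \<in> X \<Longrightarrow> c \<otimes> a z = t \<otimes> e \<otimes> b z \<oplus> x \<otimes> g z" by metis
  have bX: "b \<in> X \<rightarrow> carrier R" "g \<in> X \<rightarrow> carrier R" using bg by blast+
  let ?B = "M.lincomb b X" and ?G = "M.lincomb g X"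
  have BG: "?B \<in> carrier M" "?G \<in> carrier M" using M.lincomb_closed[OF X_carrier] bX by blast+
  let ?m = "c \<odot>\<^sub>M m \<ominus>\<^sub>M ?G"
  have mc: "?m \<in> carrier M" using c(1) m(1) BG by simp
  have "x \<odot>\<^sub>M (c \<odot>\<^sub>M m) = M.lincomb (\<lambda>z. c \<otimes> a z) X"
    using M.lincomb_smult[OF X_carrier a c(1)] m c(1) x_carrier by (simp add: M.smult_assoc1[symmetric] m_comm)
  also have "\<dots> = M.lincomb (\<lambda>z. t \<otimes> e \<otimes> b z \<oplus> x \<otimes> g z) X"
    using bg te x_carrier by (intro M.lincomb_cong[OF refl X_carrier]) auto
  also have "\<dots> = (t \<otimes> e) \<odot>\<^sub>M ?B \<oplus>\<^sub>M x \<odot>\<^sub>M ?G" by (rule M.lincomb_linear[OF X_finite X_carrier bX x_carrier te])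
  finally have xm: "x \<odot>\<^sub>M (c \<odot>\<^sub>M m) = (t \<otimes> e) \<odot>\<^sub>M ?B \<oplus>\<^sub>M x \<odot>\<^sub>M ?G" .
  have xm': "x \<odot>\<^sub>M ?m = t \<odot>\<^sub>M (e \<odot>\<^sub>M ?B)"
  proof -
    have "x \<odot>\<^sub>M ?m = x \<odot>\<^sub>M (c \<odot>\<^sub>M m) \<ominus>\<^sub>M x \<odot>\<^sub>M ?G"
      using c(1) m(1) BG x_carrier by (simp add: a_minus_def M.smult_r_distr M.smult_r_minus)
    also have "\<dots> = (t \<otimes> e) \<odot>\<^sub>M ?B"
      unfolding xm using te BG x_carrier by (simp add: a_minus_def M.M.a_assoc M.M.r_neg)
    finally show ?thesis using t(1) e_carrier BG by (simp add: M.smult_assoc1)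
  qed
  \<comment> \<open>Since \<open>x ?m\<close> equals \<open>t e ?B\<close>, which \<open>p\<close>
    kills, regularity of \<open>x\<close> puts \<open>?m\<close> in \<open>M[p]\<close>, that is in
    \<open>e M\<close>.\<close>
  have "?m \<in> ann_part M p" unfolding ann_part_def
  proof (intro CollectI conjI ballI mc)
    fix q assume q: "q \<in> p"
    have qc: "q \<in> carrier R" using q p_carrier by blast
    show "q \<odot>\<^sub>M ?m = \<zero>\<^sub>M"
    proof (rule x_regular_M)
      show "q \<odot>\<^sub>M ?m \<in> carrier M" using qc mc by simp
      have "x \<odot>\<^sub>M (q \<odot>\<^sub>M ?m) = q \<odot>\<^sub>M (x \<odot>\<^sub>M ?m)"
        using M.smult_assoc1[OF x_carrier qc mc] M.smult_assoc1[OF qc x_carrier mc] qc x_carrier by (simp add: m_comm)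
      also have "\<dots> = t \<odot>\<^sub>M (q \<odot>\<^sub>M (e \<odot>\<^sub>M ?B))"
        unfolding xm' using qc t(1) e_carrier BG by (simp add: M.smult_assoc1[symmetric] m_ac)
      finally show "x \<odot>\<^sub>M (q \<odot>\<^sub>M ?m) = \<zero>\<^sub>M" using e_p_smult[OF q BG(1)] t(1) by simp
    qed
  qed
  then obtain m' where m': "m' \<in> carrier M" "?m = e \<odot>\<^sub>M m'" using ann_part_p by blast
  obtain h where h: "h \<in> X \<rightarrow> carrier R" "e \<odot>\<^sub>M m' = e \<odot>\<^sub>M M.lincomb h X"
    using cgenD(3)[OF cbasisD(1)[OF X] m'(1)] by blast
  let ?D = "M.lincomb h X"
  have Dc: "?D \<in> carrier M" by (rule M.lincomb_closed[OF X_carrier h(1)])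
  have eD: "e \<odot>\<^sub>M ?D \<in> carrier M" using Dc e_carrier by simp
  have qc: "x \<ominus> t \<otimes> pi \<in> carrier R" using x_carrier t(1) pi(3) by simp
  have "x = t \<otimes> pi \<oplus> (x \<ominus> t \<otimes> pi)" using x_carrier t(1) pi(3) by algebra
  hence "x \<odot>\<^sub>M (e \<odot>\<^sub>M ?D) = (t \<otimes> pi) \<odot>\<^sub>M (e \<odot>\<^sub>M ?D) \<oplus>\<^sub>M (x \<ominus> t \<otimes> pi) \<odot>\<^sub>M (e \<odot>\<^sub>M ?D)"
    using M.smult_l_distr[OF _ qc eD, of "t \<otimes> pi"] t(1) pi(3) by simp
  hence "t \<odot>\<^sub>M (e \<odot>\<^sub>M ?B) = t \<odot>\<^sub>M (pi \<odot>\<^sub>M (e \<odot>\<^sub>M ?D))"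
    unfolding e_p_smult[OF t(3) Dc] xm'[symmetric] m'(2) h(2) using t(1) pi(3) eD by (simp add: M.smult_assoc1)
  \<comment> \<open>On \<open>e M\<close> the element \<open>x\<close> acts as \<open>t pi\<close>,
    so \<open>t\<close> is a common factor; cancelling it in the torsion-free \<open>M[p]\<close>
    will leave \<open>e (?B - pi ?D) = 0\<close>.\<close>
  hence tz: "t \<odot>\<^sub>M (e \<odot>\<^sub>M (?B \<ominus>\<^sub>M pi \<odot>\<^sub>M ?D)) = \<zero>\<^sub>M" using t(1) pi(3) e_carrier BG Dc
    by (simp add: a_minus_def M.smult_r_distr M.smult_r_minus M.smult_assoc1[symmetric] m_ac M.M.r_neg)
  let ?f = "\<lambda>z. b z \<ominus> pi \<otimes> h z"
  have hc: "pi \<otimes> h z \<in> carrier R" if "z \<in> X" for z using h(1) pi(3) that by auto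
  have "M.lincomb ?f X = ?B \<ominus>\<^sub>M M.lincomb (\<lambda>z. pi \<otimes> h z) X"
    using hc by (intro M.lincomb_minus[OF X_finite X_carrier bX(1)]) auto
  also have "M.lincomb (\<lambda>z. pi \<otimes> h z) X = pi \<odot>\<^sub>M ?D" by (rule M.lincomb_smult[OF X_carrier h(1) pi(3)])
  finally have fl: "M.lincomb ?f X = ?B \<ominus>\<^sub>M pi \<odot>\<^sub>M ?D" .
  have BDc: "?B \<ominus>\<^sub>M pi \<odot>\<^sub>M ?D \<in> carrier M" using BG Dc pi(3) by simp
  have "e \<odot>\<^sub>M M.lincomb ?f X = \<zero>\<^sub>M" unfolding fl by (rule p_torsion_free[OF e_smult_ann[OF BDc] t(1,2) tz])
  moreover have fc: "?f \<in> X \<rightarrow> carrier R" using bg(1) hc by auto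
  ultimately have fp: "?f z \<in> p" if "z \<in> X" for z using cbasisD(3)[OF X _ _ that, of ?f] by blast
  obtain z where z: "z \<in> X" "c \<otimes> a z \<notin> PIdl x" using c(2) by blast
  have hz: "h z \<in> carrier R" using h(1) z(1) by blast
  have be: "b z = h z \<otimes> pi \<oplus> ?f z" using bg(1)[OF z(1)] hz pi(3) by algebra
  \<comment> \<open>As \<open>b z\<close> is \<open>pi h z\<close> modulo \<open>p\<close>, it lies
    in \<open>\<mm>\<close> and kills the socle generator \<open>t e\<close> modulo
    \<open>x\<close>; so the chosen coefficient was zero modulo \<open>x\<close> after all.\<close>
  have "b z \<in> \<mm>"
    by (subst be) (rule idealD(3)[OF m_ideal idealD(4)[OF m_ideal hz pi(1)] subsetD[OF p_le_m fp[OF z(1)]]])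
  hence "b z \<otimes> (t \<otimes> e) \<in> PIdl x" by (rule t(5))
  hence "t \<otimes> e \<otimes> b z \<in> PIdl x" using te bg(1)[OF z(1)] by (simp add: m_comm)
  hence "t \<otimes> e \<otimes> b z \<oplus> x \<otimes> g z \<in> PIdl x" using idealD(3)[OF x_ideal] xI[OF bg(2)[OF z(1)]] by blast
  thus False using z bg(3) by simp
qed

text \<open>All coefficients are divisible by \<open>x\<close>, and \<open>x\<close> cancels on
  \<open>M\<close>.\<close>

lemma lincomb_divide_x:
  assumes a: "a \<in> X \<rightarrow> carrier R" and m: "m \<in> carrier M" "M.lincomb a X = x \<odot>\<^sub>M m"
  shows "\<exists>b\<in>X \<rightarrow> carrier R. m = M.lincomb b X \<and> (\<forall>y\<in>X. a y = x \<otimes> b y)"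
proof -
  have "\<exists>b. b \<in> carrier R \<and> a y = x \<otimes> b" if "y \<in> X" for y using xE[OF lincomb_mod_x[OF a m that]] by blast
  then obtain b where b: "\<And>y. y \<in> X \<Longrightarrow> b y \<in> carrier R" "\<And>y. y \<in> X \<Longrightarrow> a y = x \<otimes> b y" by metis
  have bX: "b \<in> X \<rightarrow> carrier R" using b(1) by blast
  have Bc: "M.lincomb b X \<in> carrier M" by (rule M.lincomb_closed[OF X_carrier bX])
  have "M.lincomb a X = M.lincomb (\<lambda>y. x \<otimes> b y) X"
    using b x_carrier by (intro M.lincomb_cong[OF refl X_carrier]) auto
  also have "\<dots> = x \<odot>\<^sub>M M.lincomb b X" by (rule M.lincomb_smult[OF X_carrier bX x_carrier])
  finally have "x \<odot>\<^sub>M m = x \<odot>\<^sub>M M.lincomb b X" using m(2) by simp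
  hence "x \<odot>\<^sub>M (m \<ominus>\<^sub>M M.lincomb b X) = \<zero>\<^sub>M"
    using m(1) Bc x_carrier by (simp add: a_minus_def M.smult_r_distr M.smult_r_minus M.M.r_neg)
  hence "m \<ominus>\<^sub>M M.lincomb b X = \<zero>\<^sub>M" using x_regular_M m(1) Bc by simp
  hence "m = M.lincomb b X" using m(1) Bc by simp
  thus ?thesis using bX b(2) by blast
qed

lemma span_saturated:
  assumes m: "m \<in> carrier M" "x \<odot>\<^sub>M m \<in> M.span X"
  shows "m \<in> M.span X"
proof -
  obtain a where a: "a \<in> X \<rightarrow> carrier R" "M.lincomb a X = x \<odot>\<^sub>M m"
    using M.finite_in_span[OF X_finite X_carrier m(2)] by blast
  then obtain b where "b \<in> X \<rightarrow> carrier R" "m = M.lincomb b X" using lincomb_divide_x[OF a(1) m(1) a(2)] by blast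
  thus ?thesis using M.in_spanI[OF X_finite] by simp
qed

text \<open>The \<open>y\<close>-coefficients of all relations form an ideal. Dividing a relation by
  \<open>x\<close> yields another relation, so this ideal is \<open>x\<close> times itself and
  vanishes.\<close>

lemma independent:
  assumes a: "a \<in> X \<rightarrow> carrier R" "M.lincomb a X = \<zero>\<^sub>M" and y: "y \<in> X"
  shows "a y = \<zero>"
proof -
  let ?H = "{a y | a. a \<in> X \<rightarrow> carrier R \<and> M.lincomb a X = \<zero>\<^sub>M}"
  have H: "ideal ?H R" unfolding ideal_iff
  proof (intro conjI ballI)
    show "?H \<subseteq> carrier R" using y by auto
    show "\<zero> \<in> ?H" using M.lincomb_zero_fun[OF X_carrier] by (intro CollectI exI[of _ "\<lambda>_. \<zero>"]) auto
  next
    fix u v assume "u \<in> ?H" "v \<in> ?H"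
    then obtain a b where ab: "a \<in> X \<rightarrow> carrier R" "M.lincomb a X = \<zero>\<^sub>M" "u = a y"
      "b \<in> X \<rightarrow> carrier R" "M.lincomb b X = \<zero>\<^sub>M" "v = b y" by blast
    thus "u \<oplus> v \<in> ?H" using M.lincomb_sum[OF X_finite X_carrier ab(1,4)]
      by (intro CollectI exI[of _ "\<lambda>z. a z \<oplus> b z"]) auto
  next
    fix c u assume c: "c \<in> carrier R" "u \<in> ?H"
    then obtain a where a: "a \<in> X \<rightarrow> carrier R" "M.lincomb a X = \<zero>\<^sub>M" "u = a y" by blast
    thus "c \<otimes> u \<in> ?H" using M.lincomb_smult[OF X_carrier a(1) c(1)] c(1)
      by (intro CollectI exI[of _ "\<lambda>z. c \<otimes> a z"]) auto
  qed
  have "?H \<subseteq> {\<zero>}"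
  proof (rule nakayama_ideal_local[OF ideal_zero H x_m])
    fix h assume "h \<in> ?H"
    then obtain a where a: "a \<in> X \<rightarrow> carrier R" "M.lincomb a X = \<zero>\<^sub>M" "h = a y" by blast
    have "M.lincomb a X = x \<odot>\<^sub>M \<zero>\<^sub>M" using a(2) x_carrier by simp
    then obtain b where b: "b \<in> X \<rightarrow> carrier R" "\<zero>\<^sub>M = M.lincomb b X" "\<forall>y\<in>X. a y = x \<otimes> b y"
      using lincomb_divide_x[OF a(1) M.M.zero_closed] by blast
    have "b y \<in> ?H" using b(1,2) by (intro CollectI exI[of _ b]) simp
    moreover have "b y \<in> carrier R" using b(1) y by blast
    hence "h = \<zero> \<oplus> x \<otimes> b y" using a(3) b(3) y x_carrier by simp
    ultimately show "\<exists>n\<in>{\<zero>}. \<exists>h'\<in>?H. h = n \<oplus> x \<otimes> h'" by blast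
  qed
  moreover have "a y \<in> ?H" using a by blast
  ultimately show ?thesis by blast
qed

lemma lin_indpt: "\<not> M.lin_dep X"
proof
  assume "M.lin_dep X"
  then obtain A a v where A: "A \<subseteq> X" "a \<in> A \<rightarrow> carrier R" "M.lincomb a A = \<zero>\<^sub>M" "v \<in> A" "a v \<noteq> \<zero>"
    unfolding M.lin_dep_def by blast
  let ?a = "\<lambda>y. if y \<in> A then a y else \<zero>"
  have aX: "?a \<in> X \<rightarrow> carrier R" using A(2) by auto
  have "M.lincomb ?a X = M.lincomb ?a A" using A(1) by (intro M.lincomb_extend[OF X_finite A(1) X_carrier aX]) auto
  also have "\<dots> = M.lincomb a A" using A(1,2) X_carrier by (intro M.lincomb_cong) auto
  finally have "?a v = \<zero>" using independent[OF aX _ subsetD[OF A(1,4)]] A(3) by simp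
  thus False using A by simp
qed

lemma span_eq:
  assumes fg: "fin_gen_module R M" and rank: "\<And>Q. minimal_prime R Q \<Longrightarrow> rank_at R M Q \<le> card X"
  shows "M.span X = carrier M"
proof (rule ccontr)
  assume ne: "M.span X \<noteq> carrier M"
  have F: "submodule R (M.span X) M" by (rule M.span_is_submodule[OF X_carrier])
  obtain v where v: "v \<in> carrier M" "v \<notin> M.span X" using ne M.submoduleD(1)[OF F] by blast
  obtain c Q where c: "c \<in> carrier R" "c \<odot>\<^sub>M v \<notin> M.span X" and Qe: "Q = {a \<in> carrier R. a \<odot>\<^sub>M (c \<odot>\<^sub>M v) \<in> M.span X}"
    and Q: "primeideal Q R"
    by (rule associated_prime[OF M.module_axioms F v])
  have cv: "c \<odot>\<^sub>M v \<in> carrier M" using c(1) v(1) by simp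
  have xQ: "x \<notin> Q" unfolding Qe using span_saturated[OF cv] c(2) by blast
  obtain w where w: "w \<in> carrier R" "Q = {a \<in> carrier R. a \<otimes> w = \<zero>}"
    by (rule prime_not_containing_x_associated[OF Q xQ])
  have Qw: "a \<otimes> w = \<zero>" if "a \<in> Q" for a using that unfolding w(2) by blast
  have wQ: "a \<in> Q" if "a \<in> carrier R" "a \<otimes> w = \<zero>" for a using that unfolding w(2) by blast
  interpret r: residue_hom Q R M "kappa R Q" "to_kappa R Q" by (rule residue_hom_kappa[OF Q M.module_axioms])
  have rk: "r.V.dim \<le> card X"
    using rank[OF prime_not_containing_x_minimal_prime[OF Q xQ]] unfolding rank_at_eq[OF Q M.module_axioms] .
  have wq: "w \<odot>\<^sub>M z = \<zero>\<^sub>M" if z: "z \<in> r.qM" for z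
  proof -
    let ?W = "{z \<in> carrier M. \<forall>a\<in>{w}. a \<odot>\<^sub>M z \<in> {\<zero>\<^sub>M}}"
    have "submodule R ?W M" using M.submodule_torsion[OF _ M.submodule_zero, of "{w}"] w(1) by blast
    hence "r.qM \<subseteq> ?W" unfolding r.qM_def ideal_smult_def
    proof (rule M.span_least)
      show "{a \<odot>\<^sub>M z | a z. a \<in> Q \<and> z \<in> carrier M} \<subseteq> ?W"
      proof
        fix u assume "u \<in> {a \<odot>\<^sub>M z | a z. a \<in> Q \<and> z \<in> carrier M}"
        then obtain a z where a: "a \<in> Q" "z \<in> carrier M" "u = a \<odot>\<^sub>M z" by blast
        have ac: "a \<in> carrier R" using r.Icarr a(1) .
        have "w \<odot>\<^sub>M u = (a \<otimes> w) \<odot>\<^sub>M z" unfolding a(3) using ac w(1) a(2) by (simp add: M.smult_assoc1[symmetric] m_comm)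
        thus "u \<in> ?W" using Qw[OF a(1)] a ac by simp
      qed
    qed
    thus ?thesis using z by blast
  qed
  \<comment> \<open>Multiplying by \<open>w s\<close> turns a relation that holds modulo
    \<open>Q M\<close> after localization into a true relation, so \<open>w s (a y) = 0\<close> by
    \<open>independent\<close>. As \<open>Q\<close> is exactly the annihilator of \<open>w\<close>,
    the coefficient lies in \<open>Q\<close>.\<close>
  have ind: "a y \<in> Q" if a: "\<And>y. y \<in> X \<Longrightarrow> a y \<in> carrier R" "M.lincomb a X \<in> r.T" and y: "y \<in> X" for a y
  proof -
    have aX: "a \<in> X \<rightarrow> carrier R" using a(1) by blast
    obtain s where s: "s \<in> carrier R" "s \<notin> Q" "s \<odot>\<^sub>M M.lincomb a X \<in> r.qM" using a(2) unfolding r.T_def by blast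
    have ws: "w \<otimes> s \<in> carrier R" using w(1) s(1) by simp
    have Lc: "M.lincomb a X \<in> carrier M" by (rule M.lincomb_closed[OF X_carrier aX])
    have "M.lincomb (\<lambda>y. w \<otimes> s \<otimes> a y) X = w \<odot>\<^sub>M (s \<odot>\<^sub>M M.lincomb a X)"
      using M.lincomb_smult[OF X_carrier aX ws] w(1) s(1) Lc by (simp add: M.smult_assoc1)
    also have "\<dots> = \<zero>\<^sub>M" by (rule wq[OF s(3)])
    finally have "w \<otimes> s \<otimes> a y = \<zero>" using a(1) ws by (intro independent[OF _ _ y]) auto
    hence "(s \<otimes> a y) \<otimes> w = \<zero>" using w(1) s(1) a(1)[OF y] by (simp add: m_ac)
    hence "s \<otimes> a y \<in> Q" using wQ s(1) a(1)[OF y] by simp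
    thus ?thesis using r.I_prime[OF s(1) a(1)[OF y]] s(2) by blast
  qed
  have near: "\<exists>s\<in>carrier R - Q. \<exists>y\<in>M.span X. s \<odot>\<^sub>M m \<ominus>\<^sub>M y \<in> r.T" if "m \<in> carrier M" for m
    by (rule r.dim_ge(2)[OF r.fin_gen_fin_dim[OF fg] X_finite X_carrier _ rk that]) (rule ind)
  obtain G where G: "finite G" "G \<subseteq> carrier M" "M.span G = carrier M" using fg unfolding fin_gen_module_def by blast
  \<comment> \<open>At \<open>Q\<close> the set \<open>X\<close> spans \<open>M\<close> modulo
    \<open>Q M\<close>; Nakayama's lemma there removes \<open>Q M\<close>.\<close>
  have "\<forall>g\<in>G. \<exists>s\<in>carrier R - Q. s \<odot>\<^sub>M g \<in> M.span X"
  proof (rule M.nakayama_at_prime[OF G(1,2) F Q], rule ballI)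
    fix g assume "g \<in> G"
    hence gc: "g \<in> carrier M" using G by blast
    obtain s y where s: "s \<in> carrier R - Q" "y \<in> M.span X" "s \<odot>\<^sub>M g \<ominus>\<^sub>M y \<in> r.T" using near[OF gc] by blast
    obtain s' where s': "s' \<in> carrier R - Q" "s' \<odot>\<^sub>M (s \<odot>\<^sub>M g \<ominus>\<^sub>M y) \<in> r.qM" using s(3) unfolding r.T_def by blast
    obtain a where a: "a \<in> G \<rightarrow> Q" "s' \<odot>\<^sub>M (s \<odot>\<^sub>M g \<ominus>\<^sub>M y) = M.lincomb a G"
      using M.ideal_smult_lincomb[OF G r.ideal_axioms] s'(2) unfolding r.qM_def by blast
    have yc: "y \<in> carrier M" by (rule M.submoduleD(1)[OF F s(2)])
    have sc: "s \<in> carrier R" "s' \<in> carrier R" using s s' by blast+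
    have "(s' \<otimes> s) \<odot>\<^sub>M g = s' \<odot>\<^sub>M y \<oplus>\<^sub>M s' \<odot>\<^sub>M (s \<odot>\<^sub>M g \<ominus>\<^sub>M y)" using sc yc gc by (simp add: M.msimps)
    hence "(s' \<otimes> s) \<odot>\<^sub>M g = s' \<odot>\<^sub>M y \<oplus>\<^sub>M M.lincomb a G" unfolding a(2) .
    moreover have "s' \<odot>\<^sub>M y \<in> M.span X" by (rule M.submoduleD(4)[OF F sc(2) s(2)])
    moreover have "s' \<otimes> s \<in> carrier R - Q" by (rule r.S_mult[OF s'(1) s(1)])
    ultimately show "\<exists>s\<in>carrier R - Q. \<exists>f\<in>M.span X. \<exists>a\<in>G \<rightarrow> Q. s \<odot>\<^sub>M g = f \<oplus>\<^sub>M M.lincomb a G" using a(1) by blast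
  qed
  then obtain s where s: "s \<in> carrier R" "s \<notin> Q" "\<And>g. g \<in> G \<Longrightarrow> s \<odot>\<^sub>M g \<in> M.span X"
    using M.prime_common_multiplier[OF Q F G(1,2)] by blast
  let ?W = "{z \<in> carrier M. \<forall>a\<in>{s}. a \<odot>\<^sub>M z \<in> M.span X}"
  have "M.span G \<subseteq> ?W"
  proof (rule M.span_least)
    show "submodule R ?W M" using M.submodule_torsion[OF _ F, of "{s}"] s(1) by blast
    show "G \<subseteq> ?W" using G(2) s(3) by auto
  qed
  \<comment> \<open>An element outside \<open>Q\<close> moves all of \<open>M\<close>, in particular
    \<open>c v\<close>, into the span, whereas the elements that do so for \<open>c v\<close> make
    up \<open>Q\<close>.\<close>
  hence "s \<odot>\<^sub>M (c \<odot>\<^sub>M v) \<in> M.span X" using cv G(3) by blast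
  hence "s \<in> Q" unfolding Qe using s(1) by blast
  thus False using s(2) by blast
qed

end

section \<open>The freeness criterion\<close>

text \<open>An associated prime arising from an element killed by \<open>x\<close> contains
  \<open>x\<close>, so it is \<open>\<mm>\<close>, and a nonzero multiple of the element would be
  killed by \<open>\<mm>\<close>.\<close>

lemma (in gorenstein_dim_1) x_regular_on_module:
  assumes M: "module R M" and socle: "\<And>z. z \<in> carrier M \<Longrightarrow> (\<And>a. a \<in> \<mm> \<Longrightarrow> a \<odot>\<^sub>M z = \<zero>\<^sub>M) \<Longrightarrow> z = \<zero>\<^sub>M"
    and z: "z \<in> carrier M" "x \<odot>\<^sub>M z = \<zero>\<^sub>M"
  shows "z = \<zero>\<^sub>M"
proof (rule ccontr)
  interpret M: module R M by (rule M)
  assume "z \<noteq> \<zero>\<^sub>M"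
  hence "z \<notin> {\<zero>\<^sub>M}" by simp
  obtain c Q where c: "c \<in> carrier R" "c \<odot>\<^sub>M z \<notin> {\<zero>\<^sub>M}" and Qe: "Q = {a \<in> carrier R. a \<odot>\<^sub>M (c \<odot>\<^sub>M z) \<in> {\<zero>\<^sub>M}}"
    and Q: "primeideal Q R"
    by (rule associated_prime[OF M M.submodule_zero z(1) \<open>z \<notin> {\<zero>\<^sub>M}\<close>])
  have "x \<odot>\<^sub>M (c \<odot>\<^sub>M z) = c \<odot>\<^sub>M (x \<odot>\<^sub>M z)" using c(1) x_carrier z(1) by (simp add: M.smult_assoc1[symmetric] m_comm)
  hence "x \<in> Q" unfolding Qe using z(2) c(1) x_carrier by simp
  hence "Q = \<mm>" by (rule prime_containing_x[OF Q])
  hence "a \<odot>\<^sub>M (c \<odot>\<^sub>M z) = \<zero>\<^sub>M" if "a \<in> \<mm>" for a using that unfolding Qe by blast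
  hence "c \<odot>\<^sub>M z = \<zero>\<^sub>M" using socle c(1) z(1) by simp
  thus False using c(2) by simp
qed

text \<open>The first term of a regular sequence lies in the maximal ideal and is injective on
  \<open>M\<close>.\<close>

lemma depth_ge_1_socle:
  fixes R (structure)
  assumes M: "module R M" and depth: "depth R M \<ge> 1" and z: "z \<in> carrier M" "\<And>a. a \<in> max_ideal R \<Longrightarrow> a \<odot>\<^sub>M z = \<zero>\<^sub>M"
  shows "z = \<zero>\<^sub>M"
proof (cases "carrier M = {\<zero>\<^sub>M}")
  case True
  thus ?thesis using z by blast
next
  case False
  interpret M: module R M by (rule M)
  have "0 < depth R M" by (rule order.strict_trans2[OF _ depth]) (simp add: one_enat_def zero_enat_def)
  hence "0 < Sup {enat (length xs) | xs. set xs \<subseteq> max_ideal R \<and> regular_sequence R M xs}"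
    unfolding depth_def using False by simp
  then obtain xs where xs: "0 < enat (length xs)" "set xs \<subseteq> max_ideal R" "regular_sequence R M xs"
    unfolding less_Sup_iff by blast
  have l: "0 < length xs" using xs(1) by (simp add: zero_enat_def)
  \<comment> \<open>The first term is tested modulo the submodule that comes from the empty list,
    which is zero.\<close>
  let ?N = "ideal_smult R (Idl (set (take 0 xs))) M"
  have "Idl {} \<subseteq> {\<zero>}" by (rule M.R.genideal_minimal[OF M.R.zeroideal]) simp
  hence gen: "{a \<odot>\<^sub>M y | a y. a \<in> Idl (set (take 0 xs)) \<and> y \<in> carrier M} \<subseteq> {\<zero>\<^sub>M}" by auto
  have sub: "?N \<subseteq> {\<zero>\<^sub>M}" unfolding ideal_smult_def by (rule M.span_least[OF M.submodule_zero gen])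
  have "submodule R ?N M" unfolding ideal_smult_def using gen by (intro M.span_is_submodule) (rule subset_trans, assumption, simp)
  hence N0: "\<zero>\<^sub>M \<in> ?N" by (rule M.submoduleD(2))
  have "xs ! 0 \<in> max_ideal R" using xs(2) l nth_mem by blast
  hence "xs ! 0 \<odot>\<^sub>M z \<in> ?N" using z(2) N0 by simp
  hence "z \<in> ?N" using xs(3) l z(1) unfolding regular_sequence_def by blast
  thus ?thesis using sub by blast
qed

theorem theorem1p3:
  fixes A :: "('a, 'k) ring_scheme"
    and \<O> :: "('o, 'l) ring_scheme"
    and \<phi> :: "'a \<Rightarrow> 'o"
    and M :: "('a, 'm, 'n) module_scheme"
  assumes "discrete_valuation_ring \<O>"
    and "cring A" and "noetherian_ring A" and "local_ring A"
    and "\<phi> \<in> ring_hom A \<O>" and "\<phi> ` carrier A = carrier \<O>"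
    and "module_length \<O> (cotangent_module A \<O> \<phi>) < \<infinity>"
    and "gorenstein_local_ring A"
    and "module A M" and "fin_gen_module A M"
    and "depth A M \<ge> 1"
    and "wiles_defect A \<O> \<phi> M =
           int (domain_rank \<O> (ann_module A \<O> \<phi> M)) * wiles_defect A \<O> \<phi> (self_module A)"
    and "\<And>\<qq>. minimal_prime A \<qq> \<Longrightarrow> rank_at A M \<qq> \<le> domain_rank \<O> (ann_module A \<O> \<phi> M)"
  shows "free_module A M"
proof -
  let ?m = "max_ideal A"
  have local: "noeth_local A ?m" by (rule noeth_localI[OF assms(2-4)])
  interpret O: principal_domain \<O> using assms(1) unfolding discrete_valuation_ring_def by blast
  interpret D: dvr_quotient A ?m \<O> \<phi>
    by (intro dvr_quotient.intro local ring_surjection.intro ring_surjection_axioms.intro dvr_quotient_axioms.intro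
        O.is_cring assms)
  have pm: "D.p \<subset> ?m" using D.p_le_m D.pi by blast
  obtain s where s: "s \<in> carrier A - D.p" "\<forall>g\<in>D.p. s \<otimes>\<^sub>A g = \<zero>\<^sub>A" using D.generically_reduced[OF assms(7)] by blast
  have s0: "s \<noteq> \<zero>\<^sub>A" using s(1) D.idealD(2)[OF D.p_ideal] by blast
  have idim: "injective_dimension A (self_module A) < \<infinity>" using assms(8) unfolding gorenstein_local_ring_def by blast
  obtain N I d and \<epsilon> :: "'a \<Rightarrow> (nat \<times> 'a) set" where res: "ring_injective_resolution A ?m I d \<epsilon>"
    and fin: "\<And>i. N < i \<Longrightarrow> carrier (I i) = {\<zero>\<^bsub>I i\<^esub>}"
    by (rule injective_dimension_finite[OF local idim]) (rule that)
  have "\<exists>x. gorenstein_dim_1 A ?m I d \<epsilon> x \<and> x \<notin> D.p"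
    by (rule ring_injective_resolution.gorenstein_dim_1_exists[OF res fin D.p_prime pm])
      (use D.dimension_one s s0 in auto)
  then obtain x where x: "gorenstein_dim_1 A ?m I d \<epsilon> x" "x \<notin> D.p" by blast
  have ring: "congruence_ring A ?m I d \<epsilon> x \<O> \<phi>"
    using s by (intro congruence_ring.intro congruence_ring_axioms.intro x D.dvr_quotient_axioms) blast
  from congruence_ring.generator_exists[OF ring] obtain e n where e: "e \<in> D.ann D.p" "e \<notin> D.p" "D.has_val e n" "\<forall>z\<in>D.ann D.p. \<exists>a\<in>carrier A. z = a \<otimes>\<^sub>A e" by blast
  have gen: "congruence_gen A ?m I d \<epsilon> x \<O> \<phi> e n"
    using e by (intro congruence_gen.intro congruence_gen_axioms.intro ring) blast+
  interpret G: congruence_gen A ?m I d \<epsilon> x \<O> \<phi> e n by (rule gen)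
  \<comment> \<open>Depth at least one excludes nonzero elements killed by the maximal ideal; this
    makes the \<open>x\<close> that was found for the ring regular on \<open>M\<close> too.\<close>
  have socle: "z = \<zero>\<^sub>M" if "z \<in> carrier M" "\<And>a. a \<in> ?m \<Longrightarrow> a \<odot>\<^sub>M z = \<zero>\<^sub>M" for z
    by (rule depth_ge_1_socle[OF assms(9,11) that])
  have "congruence_mod A ?m I d \<epsilon> x \<O> \<phi> e n M" using G.x_regular_on_module[OF assms(9) socle]
    by (intro congruence_mod.intro congruence_mod_axioms.intro gen assms(9)) blast+
  then interpret C: congruence_mod A ?m I d \<epsilon> x \<O> \<phi> e n M .
  obtain X where X: "C.cbasis X" using C.cbasis_exists[OF assms(10)] by blast
  note cX = C.cbasisD(1)[OF X]
  have rank: "domain_rank \<O> (ann_module A \<O> \<phi> M) = card X" by (rule C.rank_ann_module[OF X])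
  \<comment> \<open>The rank of \<open>A[p]\<close> is one and the congruence module of the ring has
    length \<open>n\<close>, so the contributions of the cotangent module cancel from the equality
    of defects.\<close>
  have "int (the_enat (module_length \<O> (congruence_module A \<O> \<phi> M))) = int (card X * n)"
    using assms(12) unfolding wiles_defect_def rank G.rank_self G.congruence_length_self by (simp add: algebra_simps)
  hence "the_enat (module_length \<O> (congruence_module A \<O> \<phi> M)) = card X * n" by (simp only: of_nat_eq_iff)
  \<comment> \<open>\<open>the_enat\<close> is unspecified at infinity, so finiteness of the length
    is taken from the upper bound.\<close>
  moreover obtain l where "module_length \<O> (congruence_module A \<O> \<phi> M) = enat l"
    using C.congruence_length_le[OF cX] enat_ile by blast
  ultimately have len: "module_length \<O> (congruence_module A \<O> \<phi> M) = enat (card X * n)" by simp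
  interpret B: congruence_basis A ?m I d \<epsilon> x \<O> \<phi> e n M X using C.ann_part_p_eq[OF cX len]
    by (intro congruence_basis.intro congruence_basis_axioms.intro C.congruence_mod_axioms X) blast
  have "C.M.span X = carrier M" by (rule B.span_eq[OF assms(10)]) (use assms(13) rank in simp)
  thus ?thesis unfolding free_module_def using B.X_carrier B.lin_indpt by blast
qed

end
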